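(* Let $\mathcal C$ be a $BTC^*$ and $\mathcal S\subset\mathcal C$ an even symmetric subcategory. Then $\mathcal C\rtimes\mathcal S$ is a $C^*$-tensor category with conjugates, direct sums and subobjects. If $\mathcal S\subset\mathcal D(\mathcal C)$ then $\mathcal C\rtimes\mathcal S$ is braided. If $\mathcal C$ is rational then so is $\mathcal C\rtimes\mathcal S$.
   Context: Tensor categories. All are small and strict; $\rho\sigma$ is the tensor product of objects, $\times$ that of arrows, $\circ$ is composition, $\iota$ the unit. A tensor $*$-category has complex vector spaces as Hom-sets, bilinear $\circ,\times$, and a positive $*$-operation (antilinear, involutive, contravariant, monoidal, and $X^*\circ X=0\Rightarrow X=0$). $\rho$ is irreducible if $\mathrm{Hom}(\rho,\rho)=\mathbb C\,\mathrm{id}_\rho$. Subobjects (for every projection $E=E^*=E^2\in\mathrm{Hom}(\rho,\rho)$ an isometry $V$ with $VV^*=E$), direct sums (isometries $V_i\in\mathrm{Hom}(\rho_i,\tau)$ with $V_1V_1^*+V_2V_2^*=\mathrm{id}_\tau$) and conjugates ($R\in\mathrm{Hom}(\iota,\bar\rho\rho)$, $\bar R\in\mathrm{Hom}(\iota,\rho\bar\rho)$ with $(\bar R^*\times\mathrm{id}_\rho)\circ(\mathrm{id}_\rho\times R)=\mathrm{id}_\rho$, $(R^*\times\mathrm{id}_{\bar\rho})\circ(\mathrm{id}_{\bar\rho}\times\bar R)=\mathrm{id}_{\bar\rho}$, normalized by $R^*R=\bar R^*\bar R=d(\rho)\mathrm{id}_\iota$ for $\rho$ irreducible) are meant in the $*$-sense.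 For reducible $\rho$ only standard solutions $R_\rho=\sum_i(\bar W_i\times W_i)\circ R_i$, built from a decomposition into irreducibles, are used. A $TC^*$ is a tensor $*$-category with conjugates, direct sums, subobjects, finite dimensional Hom-spaces and irreducible unit; a $BTC^*$ is a $TC^*$ with unitary braiding $\varepsilon$. A category is rational if it has finitely many isomorphism classes of irreducible objects. A $C^*$-tensor category is a complex tensor category with $*$-operation whose Hom-spaces are Banach spaces with $\|Y\circ X\|\le\|X\|\,\|Y\|$ and $\|X^*\circ X\|=\|X\|^2$. Degenerate objects: $\rho\in\mathcal C$ is degenerate if $\varepsilon(\eta,\rho)\circ\varepsilon(\rho,\eta)=\mathrm{id}_{\rho\eta}$ for all $\eta\in\mathcal C$; $\mathcal D(\mathcal C)$ is the full subcategory of degenerate objects. The twist is $\kappa(\rho)=(R_\rho^*\times\mathrm{id}_\rho)\circ(\mathrm{id}_{\bar\rho}\times\varepsilon(\rho,\rho))\circ(R_\rho\times\mathrm{id}_\rho)$. Even symmetric subcategory $\mathcal S\subset\mathcal C$: a replete full tensor subcategory on which $\varepsilon$ is symmetric, closed under conjugates, direct sums and subobjects, with all twists $\kappa(\rho)=\mathrm{id}_\rho$, $\rho\in\mathcal S$. By Doplicher–Roberts there are a compact group $G=\mathrm{Gal}(\mathcal S)$, unique up to isomorphism, and an isomorphism $F:\mathcal S\to U(G)$ of symmetric tensor $*$-categories onto a category $U(G)$ of finite dimensional continuous unitary representations of $G$ closed under direct sums and subrepresentations and containing members of all classes of irreducibles. Tensor product in $U(G)$ is $\boxtimes$; $F(\iota)=\mathbb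 C$ contains a unit vector $\Omega$ with $\Omega\boxtimes\psi=\psi\boxtimes\Omega=\psi$. Crossed product: let $\hat G$ be the set of isomorphism classes of irreducible objects of $\mathcal S$, $\gamma_k$ ($k\in\hat G$) representatives with $\gamma_0=\iota$, $\mathcal H_k=F(\gamma_k)$; choose orthonormal bases $\{V_{k,l}^{m,\alpha}\}_{\alpha=1}^{N_{k,l}^m}$ of $\mathrm{Hom}(\gamma_m,\gamma_k\gamma_l)$ ($V^*\circ W=\langle V,W\rangle\mathrm{id}$), and normalized solutions $R_k\in\mathrm{Hom}(\iota,\gamma_{\bar k}\gamma_k)$, $\bar R_k\in\mathrm{Hom}(\iota,\gamma_k\gamma_{\bar k})$ of the conjugate equations with $R_{\bar k}=\bar R_k$, $\bar R_{\bar k}=R_k$ if $\bar k\neq k$ and $\bar R_k=\pm R_k$ if $\bar k=k$. $\mathcal C\rtimes_0\mathcal S$ has the objects and tensor product of objects of $\mathcal C$, and $\mathrm{Hom}_{\mathcal C\rtimes_0\mathcal S}(\rho,\sigma)=\bigoplus_{k\in\hat G}\mathrm{Hom}_{\mathcal C}(\gamma_k\rho,\sigma)\otimes\mathcal H_k$. For $S\in\mathrm{Hom}(\gamma_k\sigma,\delta)$, $T\in\mathrm{Hom}(\gamma_l\rho,\sigma)$, $\psi_k\in\mathcal H_k,\psi_l\in\mathcal H_l$, $$(S\otimes\psi_k)\circ(T\otimes\psi_l)=\bigoplus_{m}\sum_\alpha\big[S\circ(\mathrm{id}_{\gamma_k}\times T)\circ(V_{k,l}^{m,\alpha}\times\mathrm{id}_\rho)\big]\otimes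 F(V_{k,l}^{m,\alpha})^*(\psi_k\boxtimes\psi_l);$$ for $S\in\mathrm{Hom}(\gamma_k\rho_1,\sigma_1)$, $T\in\mathrm{Hom}(\gamma_l\rho_2,\sigma_2)$, $$(S\otimes\psi_k)\times(T\otimes\psi_l)=\bigoplus_{m}\sum_\alpha\big[(S\times T)\circ(\mathrm{id}_{\gamma_k}\times\varepsilon(\gamma_l,\rho_1)\times\mathrm{id}_{\rho_2})\circ(V_{k,l}^{m,\alpha}\times\mathrm{id}_{\rho_1\rho_2})\big]\otimes F(V_{k,l}^{m,\alpha})^*(\psi_k\boxtimes\psi_l);$$ for $S\in\mathrm{Hom}(\gamma_k\rho,\sigma)$, $(S\otimes\psi_k)^*=\big[(R_k^*\times\mathrm{id}_\rho)\circ(\mathrm{id}_{\gamma_{\bar k}}\times S^* )\big]\otimes\bar\psi$, where $\bar\psi\in\mathcal H_{\bar k}$ is defined by $\langle a,\bar\psi\rangle=\langle\psi_k\boxtimes a,F(\bar R_k)\Omega\rangle$ for all $a\in\mathcal H_{\bar k}$ (inner products antilinear in the first variable). $\mathcal C$ is a subcategory of $\mathcal C\rtimes_0\mathcal S$ via $S\mapsto S\otimes\Omega$. $\mathcal C\rtimes\mathcal S$ is the closure of $\mathcal C\rtimes_0\mathcal S$ under subobjects: objects are pairs $(\rho,E)$ with $E=E^2=E^*\in\mathrm{Hom}_{\mathcal C\rtimes_0\mathcal S}(\rho,\rho)$, $\mathrm{Hom}((\rho,E),(\sigma,E'))=E'\circ\mathrm{Hom}_{\mathcal C\rtimes_0\mathcal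 S}(\rho,\sigma)\circ E$, $\mathrm{id}_{(\rho,E)}=E$, $(\rho,E)(\sigma,E')=(\rho\sigma,E\times E')$, with $\circ,\times,*$ of arrows as in $\mathcal C\rtimes_0\mathcal S$; $\rho$ is identified with $(\rho,\mathrm{id}_\rho)$. If $\mathcal S\subset\mathcal D(\mathcal C)$ the braiding of $\mathcal C\rtimes\mathcal S$ is $\varepsilon((\rho,E),(\sigma,E'))=(E'\times E)\circ(\varepsilon(\rho,\sigma)\otimes\Omega)\circ(E\times E')$. *)

theory Defs
  imports "HOL-Algebra.Module" "HOL-Analysis.Abstract_Metric_Spaces"
begin

section \<open>Complex vector spaces and finite-dimensional Hilbert spaces\<close>

definition complex_field :: "complex ring" where
  "complex_field = \<lparr>carrier = UNIV, mult = (*), one = 1, zero = 0, add = (+)\<rparr>"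

definition spans :: "(complex, 'a, 'z) module_scheme \<Rightarrow> 'a set \<Rightarrow> bool" where
  "spans M B \<longleftrightarrow> finite B \<and> B \<subseteq> carrier M \<and>
     (\<forall>x\<in>carrier M. \<exists>c. x = (\<Oplus>\<^bsub>M\<^esub>b\<in>B. c b \<odot>\<^bsub>M\<^esub> b))"

definition finite_dimensional :: "(complex, 'a, 'z) module_scheme \<Rightarrow> bool" where
  "finite_dimensional M \<longleftrightarrow> (\<exists>B. spans M B)"

text \<open>Maps are extensional: they take the value \<open>undefined\<close> outside the carrier of their domain,
  so that linear maps are equal as soon as they agree on that carrier.\<close>

definition linear_maps ::
  "(complex, 'a, 'y) module_scheme \<Rightarrow> (complex, 'b, 'z) module_scheme \<Rightarrow> ('a \<Rightarrow> 'b) set" where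
  "linear_maps M N = {f \<in> carrier M \<rightarrow>\<^sub>E carrier N.
     (\<forall>x\<in>carrier M. \<forall>y\<in>carrier M. f (x \<oplus>\<^bsub>M\<^esub> y) = f x \<oplus>\<^bsub>N\<^esub> f y) \<and>
     (\<forall>c. \<forall>x\<in>carrier M. f (c \<odot>\<^bsub>M\<^esub> x) = c \<odot>\<^bsub>N\<^esub> f x)}"

definition antilinear_maps ::
  "(complex, 'a, 'y) module_scheme \<Rightarrow> (complex, 'b, 'z) module_scheme \<Rightarrow> ('a \<Rightarrow> 'b) set" where
  "antilinear_maps M N = {f \<in> carrier M \<rightarrow>\<^sub>E carrier N.
     (\<forall>x\<in>carrier M. \<forall>y\<in>carrier M. f (x \<oplus>\<^bsub>M\<^esub> y) = f x \<oplus>\<^bsub>N\<^esub> f y) \<and>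
     (\<forall>c. \<forall>x\<in>carrier M. f (c \<odot>\<^bsub>M\<^esub> x) = cnj c \<odot>\<^bsub>N\<^esub> f x)}"

record 'v hilbert = "(complex, 'v) module" +
  ip :: "'v \<Rightarrow> 'v \<Rightarrow> complex"

text \<open>Inner products are antilinear in the first variable.\<close>

locale fd_hilbert =
  fixes H :: "'v hilbert"
  assumes vector_space: "Module.module complex_field H"
    and fin_dim: "finite_dimensional H"
    and ip_add: "\<lbrakk>x \<in> carrier H; y \<in> carrier H; z \<in> carrier H\<rbrakk>
      \<Longrightarrow> ip H x (y \<oplus>\<^bsub>H\<^esub> z) = ip H x y + ip H x z"
    and ip_scale: "\<lbrakk>x \<in> carrier H; y \<in> carrier H\<rbrakk> \<Longrightarrow> ip H x (c \<odot>\<^bsub>H\<^esub> y) = c * ip H x y"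
    and ip_cnj: "\<lbrakk>x \<in> carrier H; y \<in> carrier H\<rbrakk> \<Longrightarrow> ip H y x = cnj (ip H x y)"
    and ip_pos: "\<lbrakk>x \<in> carrier H; x \<noteq> \<zero>\<^bsub>H\<^esub>\<rbrakk> \<Longrightarrow> Re (ip H x x) > 0"

definition orthonormal_basis :: "'v hilbert \<Rightarrow> 'v set \<Rightarrow> bool" where
  "orthonormal_basis H B \<longleftrightarrow> spans H B \<and>
     (\<forall>a\<in>B. \<forall>b\<in>B. ip H a b = (if a = b then 1 else 0))"

definition hilbert_adjoint :: "'v hilbert \<Rightarrow> 'v hilbert \<Rightarrow> ('v \<Rightarrow> 'v) \<Rightarrow> 'v \<Rightarrow> 'v" where
  "hilbert_adjoint H K T =
     (\<lambda>b\<in>carrier K. THE a. a \<in> carrier H \<and> (\<forall>c\<in>carrier H. ip K (T c) b = ip H c a))"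


section \<open>Strict tensor categories over the complex numbers\<close>

text \<open>\<open>R \<cdot> S\<close> is the composition ``\<open>R\<close> after \<open>S\<close>'', \<open>\<rho> \<boxdot> \<sigma>\<close> the tensor product
  of objects and \<open>S \<boxtimes> T\<close> that of arrows. The linear operations on arrows are only meaningful
  for parallel arrows.\<close>

record ('o, 'm) tensor_cat =
  Obj :: "'o set"
  Arr :: "'m set"
  Dom :: "'m \<Rightarrow> 'o"
  Cod :: "'m \<Rightarrow> 'o"
  idn :: "'o \<Rightarrow> 'm"
  cmp :: "'m \<Rightarrow> 'm \<Rightarrow> 'm" (infixr \<open>\<cdot>\<index>\<close> 70)
  unt :: "'o"
  tob :: "'o \<Rightarrow> 'o \<Rightarrow> 'o" (infixr \<open>\<boxdot>\<index>\<close> 80)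
  tar :: "'m \<Rightarrow> 'm \<Rightarrow> 'm" (infixr \<open>\<boxtimes>\<index>\<close> 75)
  star :: "'m \<Rightarrow> 'm" (\<open>_\<dagger>\<index>\<close> [1000] 999)
  hadd :: "'m \<Rightarrow> 'm \<Rightarrow> 'm"
  hzero :: "'o \<Rightarrow> 'o \<Rightarrow> 'm"
  hscale :: "complex \<Rightarrow> 'm \<Rightarrow> 'm"

record ('o, 'm) braided_cat = "('o, 'm) tensor_cat" +
  braid :: "'o \<Rightarrow> 'o \<Rightarrow> 'm"

definition Hom :: "('o, 'm, 'z) tensor_cat_scheme \<Rightarrow> 'o \<Rightarrow> 'o \<Rightarrow> 'm set" where
  "Hom C \<rho> \<sigma> = {f \<in> Arr C. Dom C f = \<rho> \<and> Cod C f = \<sigma>}"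

text \<open>The ring multiplication and unit that a module record also carries are irrelevant here.\<close>

definition hom_space ::
  "('o, 'm, 'z) tensor_cat_scheme \<Rightarrow> 'o \<Rightarrow> 'o \<Rightarrow> (complex, 'm) module" where
  "hom_space C \<rho> \<sigma> = \<lparr>carrier = Hom C \<rho> \<sigma>, mult = undefined, one = undefined,
     zero = hzero C \<rho> \<sigma>, add = hadd C, smult = hscale C\<rparr>"

locale complex_tensor_category =
  fixes C :: "('o, 'm, 'z) tensor_cat_scheme" (structure)
  assumes Dom_Cod: "f \<in> Arr C \<Longrightarrow> Dom C f \<in> Obj C \<and> Cod C f \<in> Obj C"
    and idn_hom: "\<rho> \<in> Obj C \<Longrightarrow> idn C \<rho> \<in> Hom C \<rho> \<rho>"
    and cmp_hom: "\<lbrakk>g \<in> Hom C \<sigma> \<tau>; f \<in> Hom C \<rho> \<sigma>\<rbrakk> \<Longrightarrow> g \<cdot> f \<in> Hom C \<rho> \<tau>"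
    and cmp_assoc: "\<lbrakk>h \<in> Hom C \<tau> \<upsilon>; g \<in> Hom C \<sigma> \<tau>; f \<in> Hom C \<rho> \<sigma>\<rbrakk>
      \<Longrightarrow> (h \<cdot> g) \<cdot> f = h \<cdot> (g \<cdot> f)"
    and cmp_idn: "f \<in> Hom C \<rho> \<sigma> \<Longrightarrow> idn C \<sigma> \<cdot> f = f \<and> f \<cdot> idn C \<rho> = f"
    and vector_space: "\<lbrakk>\<rho> \<in> Obj C; \<sigma> \<in> Obj C\<rbrakk> \<Longrightarrow> Module.module complex_field (hom_space C \<rho> \<sigma>)"
    and cmp_add_left: "\<lbrakk>g \<in> Hom C \<sigma> \<tau>; g' \<in> Hom C \<sigma> \<tau>; f \<in> Hom C \<rho> \<sigma>\<rbrakk>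
      \<Longrightarrow> hadd C g g' \<cdot> f = hadd C (g \<cdot> f) (g' \<cdot> f)"
    and cmp_add_right: "\<lbrakk>g \<in> Hom C \<sigma> \<tau>; f \<in> Hom C \<rho> \<sigma>; f' \<in> Hom C \<rho> \<sigma>\<rbrakk>
      \<Longrightarrow> g \<cdot> hadd C f f' = hadd C (g \<cdot> f) (g \<cdot> f')"
    and cmp_scale: "\<lbrakk>g \<in> Hom C \<sigma> \<tau>; f \<in> Hom C \<rho> \<sigma>\<rbrakk>
      \<Longrightarrow> hscale C c g \<cdot> f = hscale C c (g \<cdot> f) \<and> g \<cdot> hscale C c f = hscale C c (g \<cdot> f)"
    and unt_obj: "unt C \<in> Obj C"
    and tob_obj: "\<lbrakk>\<rho> \<in> Obj C; \<sigma> \<in> Obj C\<rbrakk> \<Longrightarrow> \<rho> \<boxdot> \<sigma> \<in> Obj C"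
    and tob_assoc: "\<lbrakk>\<rho> \<in> Obj C; \<sigma> \<in> Obj C; \<tau> \<in> Obj C\<rbrakk> \<Longrightarrow> (\<rho> \<boxdot> \<sigma>) \<boxdot> \<tau> = \<rho> \<boxdot> (\<sigma> \<boxdot> \<tau>)"
    and tob_unt: "\<rho> \<in> Obj C \<Longrightarrow> unt C \<boxdot> \<rho> = \<rho> \<and> \<rho> \<boxdot> unt C = \<rho>"
    and tar_hom: "\<lbrakk>f \<in> Hom C \<rho> \<sigma>; f' \<in> Hom C \<rho>' \<sigma>'\<rbrakk> \<Longrightarrow> f \<boxtimes> f' \<in> Hom C (\<rho> \<boxdot> \<rho>') (\<sigma> \<boxdot> \<sigma>')"
    and tar_idn: "\<lbrakk>\<rho> \<in> Obj C; \<sigma> \<in> Obj C\<rbrakk> \<Longrightarrow> idn C \<rho> \<boxtimes> idn C \<sigma> = idn C (\<rho> \<boxdot> \<sigma>)"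
    and interchange: "\<lbrakk>g \<in> Hom C \<sigma> \<tau>; f \<in> Hom C \<rho> \<sigma>; g' \<in> Hom C \<sigma>' \<tau>'; f' \<in> Hom C \<rho>' \<sigma>'\<rbrakk>
      \<Longrightarrow> (g \<cdot> f) \<boxtimes> (g' \<cdot> f') = (g \<boxtimes> g') \<cdot> (f \<boxtimes> f')"
    and tar_assoc: "\<lbrakk>f \<in> Arr C; g \<in> Arr C; h \<in> Arr C\<rbrakk> \<Longrightarrow> (f \<boxtimes> g) \<boxtimes> h = f \<boxtimes> (g \<boxtimes> h)"
    and tar_unt: "f \<in> Arr C \<Longrightarrow> idn C (unt C) \<boxtimes> f = f \<and> f \<boxtimes> idn C (unt C) = f"
    and tar_add_left: "\<lbrakk>f \<in> Hom C \<rho> \<sigma>; f' \<in> Hom C \<rho> \<sigma>; g \<in> Arr C\<rbrakk>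
      \<Longrightarrow> hadd C f f' \<boxtimes> g = hadd C (f \<boxtimes> g) (f' \<boxtimes> g)"
    and tar_add_right: "\<lbrakk>f \<in> Arr C; g \<in> Hom C \<rho> \<sigma>; g' \<in> Hom C \<rho> \<sigma>\<rbrakk>
      \<Longrightarrow> f \<boxtimes> hadd C g g' = hadd C (f \<boxtimes> g) (f \<boxtimes> g')"
    and tar_scale: "\<lbrakk>f \<in> Arr C; g \<in> Arr C\<rbrakk>
      \<Longrightarrow> hscale C c f \<boxtimes> g = hscale C c (f \<boxtimes> g) \<and> f \<boxtimes> hscale C c g = hscale C c (f \<boxtimes> g)"

locale tensor_category_with_star = complex_tensor_category +
  assumes star_hom: "f \<in> Hom C \<rho> \<sigma> \<Longrightarrow> f\<dagger> \<in> Hom C \<sigma> \<rho>"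
    and star_star: "f \<in> Arr C \<Longrightarrow> (f\<dagger>)\<dagger> = f"
    and star_add: "\<lbrakk>f \<in> Hom C \<rho> \<sigma>; g \<in> Hom C \<rho> \<sigma>\<rbrakk> \<Longrightarrow> (hadd C f g)\<dagger> = hadd C (f\<dagger>) (g\<dagger>)"
    and star_scale: "f \<in> Arr C \<Longrightarrow> (hscale C c f)\<dagger> = hscale C (cnj c) (f\<dagger>)"
    and star_cmp: "\<lbrakk>g \<in> Hom C \<sigma> \<tau>; f \<in> Hom C \<rho> \<sigma>\<rbrakk> \<Longrightarrow> (g \<cdot> f)\<dagger> = f\<dagger> \<cdot> g\<dagger>"
    and star_tar: "\<lbrakk>f \<in> Arr C; g \<in> Arr C\<rbrakk> \<Longrightarrow> (f \<boxtimes> g)\<dagger> = f\<dagger> \<boxtimes> g\<dagger>"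

locale tensor_star_category = tensor_category_with_star +
  assumes star_positive: "\<lbrakk>f \<in> Hom C \<rho> \<sigma>; f\<dagger> \<cdot> f = hzero C \<rho> \<rho>\<rbrakk> \<Longrightarrow> f = hzero C \<rho> \<sigma>"

text \<open>A \<open>Metric_space\<close> needs a distance that is nonnegative and symmetric on the whole type, hence
  the case distinction in \<open>nrm_complete\<close>.\<close>

locale Cstar_tensor_category = tensor_category_with_star +
  fixes nrm :: "'b \<Rightarrow> real"
  assumes nrm_nonneg: "f \<in> Arr C \<Longrightarrow> 0 \<le> nrm f"
    and nrm_eq_0: "f \<in> Hom C \<rho> \<sigma> \<Longrightarrow> nrm f = 0 \<longleftrightarrow> f = hzero C \<rho> \<sigma>"
    and nrm_triangle: "\<lbrakk>f \<in> Hom C \<rho> \<sigma>; g \<in> Hom C \<rho> \<sigma>\<rbrakk> \<Longrightarrow> nrm (hadd C f g) \<le> nrm f + nrm g"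
    and nrm_scale: "f \<in> Arr C \<Longrightarrow> nrm (hscale C c f) = cmod c * nrm f"
    and nrm_complete: "\<lbrakk>\<rho> \<in> Obj C; \<sigma> \<in> Obj C\<rbrakk> \<Longrightarrow>
      Metric_space.mcomplete (Hom C \<rho> \<sigma>)
        (\<lambda>f g. if f \<in> Hom C \<rho> \<sigma> \<and> g \<in> Hom C \<rho> \<sigma> then nrm (f \<ominus>\<^bsub>hom_space C \<rho> \<sigma>\<^esub> g) else 0)"
    and nrm_cmp: "\<lbrakk>g \<in> Hom C \<sigma> \<tau>; f \<in> Hom C \<rho> \<sigma>\<rbrakk> \<Longrightarrow> nrm (g \<cdot> f) \<le> nrm f * nrm g"
    and nrm_Cstar: "f \<in> Arr C \<Longrightarrow> nrm (f\<dagger> \<cdot> f) = (nrm f)\<^sup>2"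


subsection \<open>Irreducibility, subobjects, direct sums, conjugates\<close>

definition isomorphic :: "('o, 'm, 'z) tensor_cat_scheme \<Rightarrow> 'o \<Rightarrow> 'o \<Rightarrow> bool" where
  "isomorphic C \<rho> \<sigma> \<longleftrightarrow> (\<exists>f\<in>Hom C \<rho> \<sigma>. \<exists>g\<in>Hom C \<sigma> \<rho>. g \<cdot>\<^bsub>C\<^esub> f = idn C \<rho> \<and> f \<cdot>\<^bsub>C\<^esub> g = idn C \<sigma>)"

definition iso_class :: "('o, 'm, 'z) tensor_cat_scheme \<Rightarrow> 'o \<Rightarrow> 'o set" where
  "iso_class C \<rho> = {\<sigma> \<in> Obj C. isomorphic C \<rho> \<sigma>}"

text \<open>A zero object, which exists because the projection \<open>0\<close> has a corresponding subobject,
  is not irreducible.\<close>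

definition irreducible_obj :: "('o, 'm, 'z) tensor_cat_scheme \<Rightarrow> 'o \<Rightarrow> bool" where
  "irreducible_obj C \<rho> \<longleftrightarrow> \<rho> \<in> Obj C \<and> Hom C \<rho> \<rho> = range (\<lambda>c. hscale C c (idn C \<rho>)) \<and>
     idn C \<rho> \<noteq> hzero C \<rho> \<rho>"

text \<open>Isomorphism classes of irreducible objects lying in a replete set \<open>S\<close> of objects.\<close>

definition irr_classes :: "('o, 'm, 'z) tensor_cat_scheme \<Rightarrow> 'o set \<Rightarrow> 'o set set" where
  "irr_classes C S = iso_class C ` {\<rho> \<in> S. irreducible_obj C \<rho>}"

definition rational :: "('o, 'm, 'z) tensor_cat_scheme \<Rightarrow> bool" where
  "rational C \<longleftrightarrow> finite (irr_classes C (Obj C))"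

definition isometry :: "('o, 'm, 'z) tensor_cat_scheme \<Rightarrow> 'o \<Rightarrow> 'o \<Rightarrow> 'm \<Rightarrow> bool" where
  "isometry C \<rho> \<sigma> V \<longleftrightarrow> V \<in> Hom C \<rho> \<sigma> \<and> V\<dagger>\<^bsub>C\<^esub> \<cdot>\<^bsub>C\<^esub> V = idn C \<rho>"

definition projection :: "('o, 'm, 'z) tensor_cat_scheme \<Rightarrow> 'o \<Rightarrow> 'm \<Rightarrow> bool" where
  "projection C \<rho> E \<longleftrightarrow> E \<in> Hom C \<rho> \<rho> \<and> E\<dagger>\<^bsub>C\<^esub> = E \<and> E \<cdot>\<^bsub>C\<^esub> E = E"

definition has_subobjects :: "('o, 'm, 'z) tensor_cat_scheme \<Rightarrow> bool" where
  "has_subobjects C \<longleftrightarrow> (\<forall>\<rho>\<in>Obj C. \<forall>E. projection C \<rho> E \<longrightarrow>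
     (\<exists>\<sigma>\<in>Obj C. \<exists>V. isometry C \<sigma> \<rho> V \<and> V \<cdot>\<^bsub>C\<^esub> V\<dagger>\<^bsub>C\<^esub> = E))"

definition direct_sum ::
  "('o, 'm, 'z) tensor_cat_scheme \<Rightarrow> 'o \<Rightarrow> 'o \<Rightarrow> 'o \<Rightarrow> bool" where
  "direct_sum C \<rho> \<sigma> \<tau> \<longleftrightarrow> (\<exists>V W. isometry C \<rho> \<tau> V \<and> isometry C \<sigma> \<tau> W \<and>
     hadd C (V \<cdot>\<^bsub>C\<^esub> V\<dagger>\<^bsub>C\<^esub>) (W \<cdot>\<^bsub>C\<^esub> W\<dagger>\<^bsub>C\<^esub>) = idn C \<tau>)"

definition has_direct_sums :: "('o, 'm, 'z) tensor_cat_scheme \<Rightarrow> bool" where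
  "has_direct_sums C \<longleftrightarrow> (\<forall>\<rho>\<in>Obj C. \<forall>\<sigma>\<in>Obj C. \<exists>\<tau>\<in>Obj C. direct_sum C \<rho> \<sigma> \<tau>)"

definition conjugate_solution ::
  "('o, 'm, 'z) tensor_cat_scheme \<Rightarrow> 'o \<Rightarrow> 'o \<Rightarrow> 'm \<Rightarrow> 'm \<Rightarrow> bool" where
  "conjugate_solution C \<rho> \<rho>b R Rb \<longleftrightarrow> \<rho> \<in> Obj C \<and> \<rho>b \<in> Obj C \<and>
     R \<in> Hom C (unt C) (\<rho>b \<boxdot>\<^bsub>C\<^esub> \<rho>) \<and> Rb \<in> Hom C (unt C) (\<rho> \<boxdot>\<^bsub>C\<^esub> \<rho>b) \<and>
     (Rb\<dagger>\<^bsub>C\<^esub> \<boxtimes>\<^bsub>C\<^esub> idn C \<rho>) \<cdot>\<^bsub>C\<^esub> (idn C \<rho> \<boxtimes>\<^bsub>C\<^esub> R) = idn C \<rho> \<and>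
     (R\<dagger>\<^bsub>C\<^esub> \<boxtimes>\<^bsub>C\<^esub> idn C \<rho>b) \<cdot>\<^bsub>C\<^esub> (idn C \<rho>b \<boxtimes>\<^bsub>C\<^esub> Rb) = idn C \<rho>b"

definition normalized_solution ::
  "('o, 'm, 'z) tensor_cat_scheme \<Rightarrow> 'o \<Rightarrow> 'o \<Rightarrow> 'm \<Rightarrow> 'm \<Rightarrow> bool" where
  "normalized_solution C \<rho> \<rho>b R Rb \<longleftrightarrow> conjugate_solution C \<rho> \<rho>b R Rb \<and>
     (\<exists>d::real. R\<dagger>\<^bsub>C\<^esub> \<cdot>\<^bsub>C\<^esub> R = hscale C (of_real d) (idn C (unt C)) \<and>
                Rb\<dagger>\<^bsub>C\<^esub> \<cdot>\<^bsub>C\<^esub> Rb = hscale C (of_real d) (idn C (unt C)))"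

definition has_conjugates :: "('o, 'm, 'z) tensor_cat_scheme \<Rightarrow> bool" where
  "has_conjugates C \<longleftrightarrow> (\<forall>\<rho>\<in>Obj C. \<exists>\<rho>b R Rb. conjugate_solution C \<rho> \<rho>b R Rb \<and>
     (irreducible_obj C \<rho> \<longrightarrow> normalized_solution C \<rho> \<rho>b R Rb))"

definition standard_solution ::
  "('o, 'm, 'z) tensor_cat_scheme \<Rightarrow> 'o \<Rightarrow> 'o \<Rightarrow> 'm \<Rightarrow> 'm \<Rightarrow> bool" where
  "standard_solution C \<rho> \<rho>b R Rb \<longleftrightarrow> \<rho> \<in> Obj C \<and> \<rho>b \<in> Obj C \<and>
     (\<exists>(n::nat) r rb Ri Rbi W Wb.
        (\<forall>i<n. irreducible_obj C (r i) \<and> normalized_solution C (r i) (rb i) (Ri i) (Rbi i) \<and>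
               isometry C (r i) \<rho> (W i) \<and> isometry C (rb i) \<rho>b (Wb i)) \<and>
        (\<Oplus>\<^bsub>hom_space C \<rho> \<rho>\<^esub>i\<in>{..<n}. W i \<cdot>\<^bsub>C\<^esub> (W i)\<dagger>\<^bsub>C\<^esub>) = idn C \<rho> \<and>
        (\<Oplus>\<^bsub>hom_space C \<rho>b \<rho>b\<^esub>i\<in>{..<n}. Wb i \<cdot>\<^bsub>C\<^esub> (Wb i)\<dagger>\<^bsub>C\<^esub>) = idn C \<rho>b \<and>
        R = (\<Oplus>\<^bsub>hom_space C (unt C) (\<rho>b \<boxdot>\<^bsub>C\<^esub> \<rho>)\<^esub>i\<in>{..<n}. (Wb i \<boxtimes>\<^bsub>C\<^esub> W i) \<cdot>\<^bsub>C\<^esub> Ri i) \<and>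
        Rb = (\<Oplus>\<^bsub>hom_space C (unt C) (\<rho> \<boxdot>\<^bsub>C\<^esub> \<rho>b)\<^esub>i\<in>{..<n}. (W i \<boxtimes>\<^bsub>C\<^esub> Wb i) \<cdot>\<^bsub>C\<^esub> Rbi i))"

locale TC_star = tensor_star_category +
  assumes conjugates: "has_conjugates C"
    and direct_sums: "has_direct_sums C"
    and subobjects: "has_subobjects C"
    and fin_dim: "\<lbrakk>\<rho> \<in> Obj C; \<sigma> \<in> Obj C\<rbrakk> \<Longrightarrow> finite_dimensional (hom_space C \<rho> \<sigma>)"
    and irreducible_unt: "irreducible_obj C (unt C)"


subsection \<open>Braidings and even symmetric subcategories\<close>

locale unitary_braiding =
  fixes C :: "('o, 'm, 'z) braided_cat_scheme" (structure)
  assumes braid_hom: "\<lbrakk>\<rho> \<in> Obj C; \<sigma> \<in> Obj C\<rbrakk> \<Longrightarrow> braid C \<rho> \<sigma> \<in> Hom C (\<rho> \<boxdot> \<sigma>) (\<sigma> \<boxdot> \<rho>)"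
    and braid_unitary: "\<lbrakk>\<rho> \<in> Obj C; \<sigma> \<in> Obj C\<rbrakk>
      \<Longrightarrow> (braid C \<rho> \<sigma>)\<dagger> \<cdot> braid C \<rho> \<sigma> = idn C (\<rho> \<boxdot> \<sigma>) \<and>
          braid C \<rho> \<sigma> \<cdot> (braid C \<rho> \<sigma>)\<dagger> = idn C (\<sigma> \<boxdot> \<rho>)"
    and braid_natural: "\<lbrakk>f \<in> Hom C \<rho> \<rho>'; g \<in> Hom C \<sigma> \<sigma>'\<rbrakk>
      \<Longrightarrow> braid C \<rho>' \<sigma>' \<cdot> (f \<boxtimes> g) = (g \<boxtimes> f) \<cdot> braid C \<rho> \<sigma>"
    and braid_tob_right: "\<lbrakk>\<rho> \<in> Obj C; \<sigma> \<in> Obj C; \<tau> \<in> Obj C\<rbrakk>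
      \<Longrightarrow> braid C \<rho> (\<sigma> \<boxdot> \<tau>) = (idn C \<sigma> \<boxtimes> braid C \<rho> \<tau>) \<cdot> (braid C \<rho> \<sigma> \<boxtimes> idn C \<tau>)"
    and braid_tob_left: "\<lbrakk>\<rho> \<in> Obj C; \<sigma> \<in> Obj C; \<tau> \<in> Obj C\<rbrakk>
      \<Longrightarrow> braid C (\<rho> \<boxdot> \<sigma>) \<tau> = (braid C \<rho> \<tau> \<boxtimes> idn C \<sigma>) \<cdot> (idn C \<rho> \<boxtimes> braid C \<sigma> \<tau>)"

locale BTC_star = TC_star C + unitary_braiding C
  for C :: "('o, 'm, 'z) braided_cat_scheme" (structure)

definition degenerate_objects :: "('o, 'm, 'z) braided_cat_scheme \<Rightarrow> 'o set" where
  "degenerate_objects C =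
     {\<rho> \<in> Obj C. \<forall>\<eta>\<in>Obj C. braid C \<eta> \<rho> \<cdot>\<^bsub>C\<^esub> braid C \<rho> \<eta> = idn C (\<rho> \<boxdot>\<^bsub>C\<^esub> \<eta>)}"

text \<open>The twist of \<open>\<rho>\<close>, computed from a standard solution \<open>R\<close> for \<open>\<rho>\<close> and \<open>\<rho>b\<close>;
  it does not depend on the choice of the latter.\<close>

definition twist :: "('o, 'm, 'z) braided_cat_scheme \<Rightarrow> 'o \<Rightarrow> 'o \<Rightarrow> 'm \<Rightarrow> 'm" where
  "twist C \<rho> \<rho>b R = (R\<dagger>\<^bsub>C\<^esub> \<boxtimes>\<^bsub>C\<^esub> idn C \<rho>) \<cdot>\<^bsub>C\<^esub> (idn C \<rho>b \<boxtimes>\<^bsub>C\<^esub> braid C \<rho> \<rho>) \<cdot>\<^bsub>C\<^esub> (R \<boxtimes>\<^bsub>C\<^esub> idn C \<rho>)"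

text \<open>A full subcategory is given by its set \<open>S\<close> of objects.\<close>

locale even_symmetric_subcategory =
  fixes C :: "('o, 'm, 'z) braided_cat_scheme" (structure) and S :: "'o set"
  assumes sub_obj: "S \<subseteq> Obj C"
    and replete: "\<lbrakk>\<rho> \<in> S; \<sigma> \<in> Obj C; isomorphic C \<rho> \<sigma>\<rbrakk> \<Longrightarrow> \<sigma> \<in> S"
    and unt_mem: "unt C \<in> S"
    and tob_mem: "\<lbrakk>\<rho> \<in> S; \<sigma> \<in> S\<rbrakk> \<Longrightarrow> \<rho> \<boxdot> \<sigma> \<in> S"
    and symmetric: "\<lbrakk>\<rho> \<in> S; \<sigma> \<in> S\<rbrakk> \<Longrightarrow> braid C \<sigma> \<rho> \<cdot> braid C \<rho> \<sigma> = idn C (\<rho> \<boxdot> \<sigma>)"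
    and conj_mem: "\<lbrakk>\<rho> \<in> S; conjugate_solution C \<rho> \<rho>b R Rb\<rbrakk> \<Longrightarrow> \<rho>b \<in> S"
    and direct_sum_mem: "\<lbrakk>\<rho> \<in> S; \<sigma> \<in> S; \<tau> \<in> Obj C; direct_sum C \<rho> \<sigma> \<tau>\<rbrakk> \<Longrightarrow> \<tau> \<in> S"
    and subobject_mem: "\<lbrakk>\<rho> \<in> S; \<sigma> \<in> Obj C; isometry C \<sigma> \<rho> V\<rbrakk> \<Longrightarrow> \<sigma> \<in> S"
    and even: "\<lbrakk>\<rho> \<in> S; standard_solution C \<rho> \<rho>b R Rb\<rbrakk> \<Longrightarrow> twist C \<rho> \<rho>b R = idn C \<rho>"


section \<open>Compact groups and categories of their representations\<close>

record 'g top_group = "'g monoid" +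
  gtop :: "'g topology"

locale compact_group = group G for G :: "'g top_group" (structure) +
  assumes topspace_gtop: "topspace (gtop G) = carrier G"
    and compact: "compact_space (gtop G)"
    and hausdorff: "Hausdorff_space (gtop G)"
    and continuous_mult:
      "continuous_map (prod_topology (gtop G) (gtop G)) (gtop G) (\<lambda>(g, h). g \<otimes> h)"
    and continuous_inv: "continuous_map (gtop G) (gtop G) (\<lambda>g. inv g)"

locale unitary_rep =
  fixes G :: "'g top_group" and H :: "'v hilbert" and \<pi> :: "'g \<Rightarrow> 'v \<Rightarrow> 'v"
  assumes hilbert: "fd_hilbert H"
    and act_linear: "g \<in> carrier G \<Longrightarrow> \<pi> g \<in> linear_maps H H"
    and act_mult: "\<lbrakk>g \<in> carrier G; h \<in> carrier G; x \<in> carrier H\<rbrakk>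
      \<Longrightarrow> \<pi> (g \<otimes>\<^bsub>G\<^esub> h) x = \<pi> g (\<pi> h x)"
    and act_one: "x \<in> carrier H \<Longrightarrow> \<pi> \<one>\<^bsub>G\<^esub> x = x"
    and act_unitary: "\<lbrakk>g \<in> carrier G; x \<in> carrier H; y \<in> carrier H\<rbrakk>
      \<Longrightarrow> ip H (\<pi> g x) (\<pi> g y) = ip H x y"
    and act_continuous: "\<lbrakk>x \<in> carrier H; y \<in> carrier H\<rbrakk>
      \<Longrightarrow> continuous_map (gtop G) euclidean (\<lambda>g. ip H x (\<pi> g y))"

definition intertwiners :: "'g top_group \<Rightarrow> 'v hilbert \<Rightarrow> ('g \<Rightarrow> 'v \<Rightarrow> 'v) \<Rightarrow>
    'v hilbert \<Rightarrow> ('g \<Rightarrow> 'v \<Rightarrow> 'v) \<Rightarrow> ('v \<Rightarrow> 'v) set" where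
  "intertwiners G H \<pi> K \<pi>' =
     {T \<in> linear_maps H K. \<forall>g\<in>carrier G. \<forall>x\<in>carrier H. T (\<pi> g x) = \<pi>' g (T x)}"

definition isometric_on :: "'v hilbert \<Rightarrow> 'v hilbert \<Rightarrow> ('v \<Rightarrow> 'v) \<Rightarrow> bool" where
  "isometric_on H K T \<longleftrightarrow> (\<forall>x\<in>carrier H. \<forall>y\<in>carrier H. ip K (T x) (T y) = ip H x y)"

definition irreducible_rep :: "'g top_group \<Rightarrow> 'v hilbert \<Rightarrow> ('g \<Rightarrow> 'v \<Rightarrow> 'v) \<Rightarrow> bool" where
  "irreducible_rep G H \<pi> \<longleftrightarrow> carrier H \<noteq> {\<zero>\<^bsub>H\<^esub>} \<and>
     (\<forall>W. Module.submodule W complex_field H \<and> (\<forall>g\<in>carrier G. \<pi> g ` W \<subseteq> W)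
        \<longrightarrow> W = {\<zero>\<^bsub>H\<^esub>} \<or> W = carrier H)"

text \<open>A category of representations is given by a set of objects, a representation for each object,
  and a tensor product; its arrows are all intertwiners. \<open>rtvec U u w\<close> is the bilinear map
  from the spaces of \<open>u\<close> and \<open>w\<close> into that of their tensor product.\<close>

record ('u, 'g, 'v) rep_cat =
  robj :: "'u set"
  rspace :: "'u \<Rightarrow> 'v hilbert"
  ract :: "'u \<Rightarrow> 'g \<Rightarrow> 'v \<Rightarrow> 'v"
  runt :: "'u"
  rtob :: "'u \<Rightarrow> 'u \<Rightarrow> 'u"
  rtvec :: "'u \<Rightarrow> 'u \<Rightarrow> 'v \<Rightarrow> 'v \<Rightarrow> 'v"
  romega :: "'v"

definition rhom :: "'g top_group \<Rightarrow> ('u, 'g, 'v) rep_cat \<Rightarrow> 'u \<Rightarrow> 'u \<Rightarrow> ('v \<Rightarrow> 'v) set" where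
  "rhom G U u w = intertwiners G (rspace U u) (ract U u) (rspace U w) (ract U w)"

text \<open>In \<open>all_irreducibles\<close> it suffices to consider Hilbert spaces on subsets of \<open>'v\<close>: this type
  carries a one-dimensional complex vector space, hence a copy of every finite-dimensional one.\<close>

locale rep_category =
  fixes G :: "'g top_group" and U :: "('u, 'g, 'v) rep_cat"
  assumes rep: "u \<in> robj U \<Longrightarrow> unitary_rep G (rspace U u) (ract U u)"
    and runt_obj: "runt U \<in> robj U"
    and runt_space: "romega U \<in> carrier (rspace U (runt U))"
      "ip (rspace U (runt U)) (romega U) (romega U) = 1"
      "spans (rspace U (runt U)) {romega U}"
    and runt_act: "g \<in> carrier G \<Longrightarrow> ract U (runt U) g (romega U) = romega U"
    and rtob_obj: "\<lbrakk>u \<in> robj U; w \<in> robj U\<rbrakk> \<Longrightarrow> rtob U u w \<in> robj U"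
    and rtvec_left: "\<lbrakk>u \<in> robj U; w \<in> robj U; y \<in> carrier (rspace U w)\<rbrakk> \<Longrightarrow>
      (\<lambda>x\<in>carrier (rspace U u). rtvec U u w x y) \<in> linear_maps (rspace U u) (rspace U (rtob U u w))"
    and rtvec_right: "\<lbrakk>u \<in> robj U; w \<in> robj U; x \<in> carrier (rspace U u)\<rbrakk> \<Longrightarrow>
      (\<lambda>y\<in>carrier (rspace U w). rtvec U u w x y) \<in> linear_maps (rspace U w) (rspace U (rtob U u w))"
    and rtvec_ip: "\<lbrakk>u \<in> robj U; w \<in> robj U; x \<in> carrier (rspace U u); x' \<in> carrier (rspace U u);
        y \<in> carrier (rspace U w); y' \<in> carrier (rspace U w)\<rbrakk> \<Longrightarrow>
      ip (rspace U (rtob U u w)) (rtvec U u w x y) (rtvec U u w x' y') =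
      ip (rspace U u) x x' * ip (rspace U w) y y'"
    and rtvec_total: "\<lbrakk>u \<in> robj U; w \<in> robj U\<rbrakk> \<Longrightarrow>
      \<exists>A\<subseteq>carrier (rspace U u). \<exists>B\<subseteq>carrier (rspace U w).
        spans (rspace U (rtob U u w)) ((\<lambda>(x, y). rtvec U u w x y) ` (A \<times> B))"
    and rtvec_act: "\<lbrakk>u \<in> robj U; w \<in> robj U; g \<in> carrier G;
        x \<in> carrier (rspace U u); y \<in> carrier (rspace U w)\<rbrakk> \<Longrightarrow>
      ract U (rtob U u w) g (rtvec U u w x y) = rtvec U u w (ract U u g x) (ract U w g y)"
    and rtob_assoc: "\<lbrakk>u \<in> robj U; w \<in> robj U; z \<in> robj U\<rbrakk> \<Longrightarrow>
      rtob U (rtob U u w) z = rtob U u (rtob U w z)"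
    and rtvec_assoc: "\<lbrakk>u \<in> robj U; w \<in> robj U; z \<in> robj U;
        x \<in> carrier (rspace U u); y \<in> carrier (rspace U w); t \<in> carrier (rspace U z)\<rbrakk> \<Longrightarrow>
      rtvec U (rtob U u w) z (rtvec U u w x y) t = rtvec U u (rtob U w z) x (rtvec U w z y t)"
    and rtob_unt: "u \<in> robj U \<Longrightarrow> rtob U (runt U) u = u \<and> rtob U u (runt U) = u"
    and rtvec_unt: "\<lbrakk>u \<in> robj U; x \<in> carrier (rspace U u)\<rbrakk> \<Longrightarrow>
      rtvec U (runt U) u (romega U) x = x \<and> rtvec U u (runt U) x (romega U) = x"
    and direct_sums: "\<lbrakk>u \<in> robj U; w \<in> robj U\<rbrakk> \<Longrightarrow>
      \<exists>z\<in>robj U. \<exists>V\<in>rhom G U u z. \<exists>W\<in>rhom G U w z.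
        isometric_on (rspace U u) (rspace U z) V \<and> isometric_on (rspace U w) (rspace U z) W \<and>
        (\<forall>x\<in>carrier (rspace U u). \<forall>y\<in>carrier (rspace U w). ip (rspace U z) (V x) (W y) = 0) \<and>
        (\<forall>t\<in>carrier (rspace U z). \<exists>x\<in>carrier (rspace U u). \<exists>y\<in>carrier (rspace U w).
           t = V x \<oplus>\<^bsub>rspace U z\<^esub> W y)"
    and subreps: "\<lbrakk>u \<in> robj U; Module.submodule L complex_field (rspace U u);
        \<And>g. g \<in> carrier G \<Longrightarrow> ract U u g ` L \<subseteq> L\<rbrakk> \<Longrightarrow>
      \<exists>w\<in>robj U. \<exists>V\<in>rhom G U w u.
        isometric_on (rspace U w) (rspace U u) V \<and> V ` carrier (rspace U w) = L"
    and all_irreducibles: "\<lbrakk>unitary_rep G (H :: 'v hilbert) \<pi>; irreducible_rep G H \<pi>\<rbrakk> \<Longrightarrow>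
      \<exists>u\<in>robj U. \<exists>V\<in>intertwiners G H \<pi> (rspace U u) (ract U u).
        isometric_on H (rspace U u) V \<and> V ` carrier H = carrier (rspace U u)"

text \<open>An isomorphism \<open>(Fo, Fa)\<close> of symmetric tensor \<open>*\<close>-categories from the full subcategory on \<open>S\<close>
  onto \<open>U\<close>, whose symmetry is the flip.\<close>

locale symmetric_tensor_isomorphism =
  fixes C :: "('o, 'm, 'z) braided_cat_scheme" (structure) and S :: "'o set"
    and G :: "'g top_group" and U :: "('u, 'g, 'v) rep_cat"
    and Fo :: "'o \<Rightarrow> 'u" and Fa :: "'m \<Rightarrow> 'v \<Rightarrow> 'v"
  assumes Fo_bij: "bij_betw Fo S (robj U)"
    and Fa_bij: "\<lbrakk>\<rho> \<in> S; \<sigma> \<in> S\<rbrakk> \<Longrightarrow> bij_betw Fa (Hom C \<rho> \<sigma>) (rhom G U (Fo \<rho>) (Fo \<sigma>))"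
    and Fa_idn: "\<lbrakk>\<rho> \<in> S; x \<in> carrier (rspace U (Fo \<rho>))\<rbrakk> \<Longrightarrow> Fa (idn C \<rho>) x = x"
    and Fa_cmp: "\<lbrakk>\<rho> \<in> S; \<sigma> \<in> S; \<tau> \<in> S; g \<in> Hom C \<sigma> \<tau>; f \<in> Hom C \<rho> \<sigma>;
        x \<in> carrier (rspace U (Fo \<rho>))\<rbrakk> \<Longrightarrow> Fa (g \<cdot> f) x = Fa g (Fa f x)"
    and Fa_add: "\<lbrakk>\<rho> \<in> S; \<sigma> \<in> S; f \<in> Hom C \<rho> \<sigma>; g \<in> Hom C \<rho> \<sigma>;
        x \<in> carrier (rspace U (Fo \<rho>))\<rbrakk> \<Longrightarrow> Fa (hadd C f g) x = Fa f x \<oplus>\<^bsub>rspace U (Fo \<sigma>)\<^esub> Fa g x"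
    and Fa_scale: "\<lbrakk>\<rho> \<in> S; \<sigma> \<in> S; f \<in> Hom C \<rho> \<sigma>; x \<in> carrier (rspace U (Fo \<rho>))\<rbrakk>
      \<Longrightarrow> Fa (hscale C c f) x = c \<odot>\<^bsub>rspace U (Fo \<sigma>)\<^esub> Fa f x"
    and Fa_star: "\<lbrakk>\<rho> \<in> S; \<sigma> \<in> S; f \<in> Hom C \<rho> \<sigma>\<rbrakk>
      \<Longrightarrow> Fa (f\<dagger>) = hilbert_adjoint (rspace U (Fo \<rho>)) (rspace U (Fo \<sigma>)) (Fa f)"
    and Fo_unt: "Fo (unt C) = runt U"
    and Fo_tob: "\<lbrakk>\<rho> \<in> S; \<sigma> \<in> S\<rbrakk> \<Longrightarrow> Fo (\<rho> \<boxdot> \<sigma>) = rtob U (Fo \<rho>) (Fo \<sigma>)"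
    and Fa_tar: "\<lbrakk>\<rho> \<in> S; \<sigma> \<in> S; \<rho>' \<in> S; \<sigma>' \<in> S; f \<in> Hom C \<rho> \<sigma>; f' \<in> Hom C \<rho>' \<sigma>';
        x \<in> carrier (rspace U (Fo \<rho>)); y \<in> carrier (rspace U (Fo \<rho>'))\<rbrakk> \<Longrightarrow>
      Fa (f \<boxtimes> f') (rtvec U (Fo \<rho>) (Fo \<rho>') x y) = rtvec U (Fo \<sigma>) (Fo \<sigma>') (Fa f x) (Fa f' y)"
    and Fa_braid: "\<lbrakk>\<rho> \<in> S; \<sigma> \<in> S; x \<in> carrier (rspace U (Fo \<rho>)); y \<in> carrier (rspace U (Fo \<sigma>))\<rbrakk>
      \<Longrightarrow> Fa (braid C \<rho> \<sigma>) (rtvec U (Fo \<rho>) (Fo \<sigma>) x y) = rtvec U (Fo \<sigma>) (Fo \<rho>) y x"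


section \<open>The crossed product\<close>

definition conj_class :: "('o, 'm, 'z) tensor_cat_scheme \<Rightarrow> 'o set \<Rightarrow> 'o set" where
  "conj_class C k = {\<sigma>. \<exists>\<rho>\<in>k. \<exists>R Rb. conjugate_solution C \<rho> \<sigma> R Rb}"

text \<open>The auxiliary choices: representatives \<open>\<gamma> k\<close>, orthonormal bases \<open>V k l m\<close> of
  \<open>Hom(\<gamma>\<^sub>m, \<gamma>\<^sub>k\<gamma>\<^sub>l)\<close>, given as sets, and solutions \<open>R k\<close>, \<open>Rb k\<close> of the conjugate equations.\<close>

locale crossed_product_choices =
  fixes C :: "('o, 'm, 'z) tensor_cat_scheme" (structure) and S :: "'o set"
    and \<gamma> :: "'o set \<Rightarrow> 'o" and V :: "'o set \<Rightarrow> 'o set \<Rightarrow> 'o set \<Rightarrow> 'm set"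
    and R :: "'o set \<Rightarrow> 'm" and Rb :: "'o set \<Rightarrow> 'm"
  assumes rep_mem: "k \<in> irr_classes C S \<Longrightarrow> \<gamma> k \<in> k"
    and rep_unt: "\<gamma> (iso_class C (unt C)) = unt C"
    and basis: "\<lbrakk>k \<in> irr_classes C S; l \<in> irr_classes C S; m \<in> irr_classes C S\<rbrakk> \<Longrightarrow>
      spans (hom_space C (\<gamma> m) (\<gamma> k \<boxdot> \<gamma> l)) (V k l m) \<and>
      (\<forall>v\<in>V k l m. \<forall>w\<in>V k l m. v\<dagger> \<cdot> w = (if v = w then idn C (\<gamma> m) else hzero C (\<gamma> m) (\<gamma> m)))"
    and solution: "k \<in> irr_classes C S \<Longrightarrow>
      normalized_solution C (\<gamma> k) (\<gamma> (conj_class C k)) (R k) (Rb k)"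
    and solution_conj: "\<lbrakk>k \<in> irr_classes C S; conj_class C k \<noteq> k\<rbrakk> \<Longrightarrow>
      R (conj_class C k) = Rb k \<and> Rb (conj_class C k) = R k"
    and solution_self_conj: "\<lbrakk>k \<in> irr_classes C S; conj_class C k = k\<rbrakk> \<Longrightarrow>
      Rb k = R k \<or> Rb k = hscale C (-1) (R k)"

text \<open>Arrows tagged with their source and target objects.\<close>

datatype ('o, 'x) arrow = Arrow (src: 'o) (trg: 'o) (val: 'x)

text \<open>For a finite-dimensional Hilbert space \<open>H\<close> the tensor product \<open>A \<otimes> H\<close> is realized as the space
  of antilinear maps from \<open>H\<close> to \<open>A\<close>, the elementary tensor \<open>T \<otimes> \<psi>\<close> being the map
  \<open>\<phi> \<mapsto> \<langle>\<phi>, \<psi>\<rangle> T\<close>. An element \<open>c\<close> is the sum of the \<open>c b \<otimes> b\<close> over any orthonormal basis of \<open>H\<close>;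
  operations prescribed on elementary tensors are extended (anti)linearly by means of
  this decomposition.\<close>

locale crossed_product_data =
  fixes C :: "('o, 'm) braided_cat" (structure) and S :: "'o set"
    and U :: "('u, 'g, 'v) rep_cat" and Fo :: "'o \<Rightarrow> 'u" and Fa :: "'m \<Rightarrow> 'v \<Rightarrow> 'v"
    and \<gamma> :: "'o set \<Rightarrow> 'o" and V :: "'o set \<Rightarrow> 'o set \<Rightarrow> 'o set \<Rightarrow> 'm set"
    and R :: "'o set \<Rightarrow> 'm" and Rb :: "'o set \<Rightarrow> 'm"
begin

abbreviation (input) Ghat :: "'o set set" where "Ghat \<equiv> irr_classes C S"

definition H :: "'o set \<Rightarrow> 'v hilbert" where
  "H k = rspace U (Fo (\<gamma> k))"

text \<open>\<open>\<psi>\<^sub>k \<boxtimes> \<psi>\<^sub>l\<close>, a vector in the space of \<open>F(\<gamma>\<^sub>k\<gamma>\<^sub>l)\<close>.\<close>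

definition vec_tensor :: "'o set \<Rightarrow> 'o set \<Rightarrow> 'v \<Rightarrow> 'v \<Rightarrow> 'v" where
  "vec_tensor k l x y = rtvec U (Fo (\<gamma> k)) (Fo (\<gamma> l)) x y"

text \<open>\<open>F(v)\<^sup>*\<close> for \<open>v\<close> in \<open>Hom(\<gamma>\<^sub>m, \<gamma>\<^sub>k\<gamma>\<^sub>l)\<close>.\<close>

definition F_adj :: "'o set \<Rightarrow> 'o set \<Rightarrow> 'o set \<Rightarrow> 'm \<Rightarrow> 'v \<Rightarrow> 'v" where
  "F_adj k l m v = hilbert_adjoint (H m) (rspace U (Fo (\<gamma> k \<boxdot> \<gamma> l))) (Fa v)"

definition conj_vec :: "'o set \<Rightarrow> 'v \<Rightarrow> 'v" where
  "conj_vec k \<psi> = (THE \<xi>. \<xi> \<in> carrier (H (conj_class C k)) \<and>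
     (\<forall>a\<in>carrier (H (conj_class C k)).
        ip (H (conj_class C k)) a \<xi> =
        ip (rspace U (Fo (\<gamma> k \<boxdot> \<gamma> (conj_class C k))))
           (vec_tensor k (conj_class C k) \<psi> a) (Fa (Rb k) (romega U))))"

definition coeff_space :: "'o \<Rightarrow> 'o \<Rightarrow> 'o set \<Rightarrow> ('v \<Rightarrow> 'm) set" where
  "coeff_space \<rho> \<sigma> k = antilinear_maps (H k) (hom_space C (\<gamma> k \<boxdot> \<rho>) \<sigma>)"

definition supp :: "('o, 'o set \<Rightarrow> 'v \<Rightarrow> 'm) arrow \<Rightarrow> 'o set set" where
  "supp x = {k \<in> Ghat. \<exists>\<phi>\<in>carrier (H k). val x k \<phi> \<noteq> hzero C (\<gamma> k \<boxdot> src x) (trg x)}"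

definition cr_hom :: "'o \<Rightarrow> 'o \<Rightarrow> ('o, 'o set \<Rightarrow> 'v \<Rightarrow> 'm) arrow set" where
  "cr_hom \<rho> \<sigma> = {x. src x = \<rho> \<and> trg x = \<sigma> \<and> val x \<in> (\<Pi>\<^sub>E k\<in>Ghat. coeff_space \<rho> \<sigma> k) \<and> finite (supp x)}"

definition cr_zero :: "'o \<Rightarrow> 'o \<Rightarrow> ('o, 'o set \<Rightarrow> 'v \<Rightarrow> 'm) arrow" where
  "cr_zero \<rho> \<sigma> = Arrow \<rho> \<sigma> (\<lambda>k\<in>Ghat. \<lambda>\<phi>\<in>carrier (H k). hzero C (\<gamma> k \<boxdot> \<rho>) \<sigma>)"

definition cr_add :: "('o, 'o set \<Rightarrow> 'v \<Rightarrow> 'm) arrow \<Rightarrow> ('o, 'o set \<Rightarrow> 'v \<Rightarrow> 'm) arrow \<Rightarrow>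
    ('o, 'o set \<Rightarrow> 'v \<Rightarrow> 'm) arrow" where
  "cr_add x y = Arrow (src x) (trg x)
     (\<lambda>k\<in>Ghat. \<lambda>\<phi>\<in>carrier (H k). hadd C (val x k \<phi>) (val y k \<phi>))"

definition cr_scale :: "complex \<Rightarrow> ('o, 'o set \<Rightarrow> 'v \<Rightarrow> 'm) arrow \<Rightarrow>
    ('o, 'o set \<Rightarrow> 'v \<Rightarrow> 'm) arrow" where
  "cr_scale c x = Arrow (src x) (trg x) (\<lambda>k\<in>Ghat. \<lambda>\<phi>\<in>carrier (H k). hscale C c (val x k \<phi>))"

definition cr_space :: "'o \<Rightarrow> 'o \<Rightarrow> (complex, ('o, 'o set \<Rightarrow> 'v \<Rightarrow> 'm) arrow) module" where
  "cr_space \<rho> \<sigma> = \<lparr>carrier = cr_hom \<rho> \<sigma>, mult = undefined, one = undefined,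
     zero = cr_zero \<rho> \<sigma>, add = cr_add, smult = cr_scale\<rparr>"

text \<open>The elementary tensor \<open>T \<otimes> \<psi>\<close> with \<open>T\<close> in \<open>Hom(\<gamma>\<^sub>k\<rho>, \<sigma>)\<close> and \<open>\<psi>\<close> in \<open>H k\<close>.\<close>

definition elem :: "'o \<Rightarrow> 'o \<Rightarrow> 'o set \<Rightarrow> 'm \<Rightarrow> 'v \<Rightarrow> ('o, 'o set \<Rightarrow> 'v \<Rightarrow> 'm) arrow" where
  "elem \<rho> \<sigma> k T \<psi> = Arrow \<rho> \<sigma> (\<lambda>k'\<in>Ghat. \<lambda>\<phi>\<in>carrier (H k').
     if k' = k then hscale C (ip (H k) \<phi> \<psi>) T else hzero C (\<gamma> k' \<boxdot> \<rho>) \<sigma>)"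

definition onb :: "'o set \<Rightarrow> 'v set" where
  "onb k = (SOME B. orthonormal_basis (H k) B)"

text \<open>Indices \<open>(k, b)\<close> of the decomposition of \<open>x\<close> into the elementary tensors \<open>val x k b \<otimes> b\<close>.\<close>

definition terms :: "('o, 'o set \<Rightarrow> 'v \<Rightarrow> 'm) arrow \<Rightarrow> ('o set \<times> 'v) set" where
  "terms x = Sigma (supp x) onb"

text \<open>Composition \<open>(T \<otimes> \<psi>) \<circ> (T' \<otimes> \<psi>')\<close> for \<open>T\<close> in \<open>Hom(\<gamma>\<^sub>k\<sigma>, \<delta>)\<close> and \<open>T'\<close> in \<open>Hom(\<gamma>\<^sub>l\<rho>, \<sigma>)\<close>.\<close>

definition elem_cmp :: "'o \<Rightarrow> 'o \<Rightarrow> 'o set \<Rightarrow> 'm \<Rightarrow> 'v \<Rightarrow> 'o set \<Rightarrow> 'm \<Rightarrow> 'v \<Rightarrow>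
    ('o, 'o set \<Rightarrow> 'v \<Rightarrow> 'm) arrow" where
  "elem_cmp \<rho> \<delta> k T \<psi> l T' \<psi>' =
     finsum (cr_space \<rho> \<delta>)
       (\<lambda>(m, v).
        elem \<rho> \<delta> m (T \<cdot> (idn C (\<gamma> k) \<boxtimes> T') \<cdot> (v \<boxtimes> idn C \<rho>))
          (F_adj k l m v (vec_tensor k l \<psi> \<psi>')))
       (Sigma Ghat (V k l))"

definition cr_cmp :: "('o, 'o set \<Rightarrow> 'v \<Rightarrow> 'm) arrow \<Rightarrow> ('o, 'o set \<Rightarrow> 'v \<Rightarrow> 'm) arrow \<Rightarrow>
    ('o, 'o set \<Rightarrow> 'v \<Rightarrow> 'm) arrow" where
  "cr_cmp x y = finsum (cr_space (src y) (trg x))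
       (\<lambda>((k, b), (l, c)).
          elem_cmp (src y) (trg x) k (val x k b) b l (val y l c) c)
       (terms x \<times> terms y)"

text \<open>Tensor product \<open>(T \<otimes> \<psi>) \<times> (T' \<otimes> \<psi>')\<close> for \<open>T\<close> in \<open>Hom(\<gamma>\<^sub>k\<rho>, \<sigma>)\<close> and \<open>T'\<close> in \<open>Hom(\<gamma>\<^sub>l\<rho>', \<sigma>')\<close>.\<close>

definition elem_tar :: "'o \<Rightarrow> 'o \<Rightarrow> 'o \<Rightarrow> 'o \<Rightarrow> 'o set \<Rightarrow> 'm \<Rightarrow> 'v \<Rightarrow> 'o set \<Rightarrow> 'm \<Rightarrow> 'v \<Rightarrow>
    ('o, 'o set \<Rightarrow> 'v \<Rightarrow> 'm) arrow" where
  "elem_tar \<rho> \<sigma> \<rho>' \<sigma>' k T \<psi> l T' \<psi>' =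
     finsum (cr_space (\<rho> \<boxdot> \<rho>') (\<sigma> \<boxdot> \<sigma>'))
       (\<lambda>(m, v).
        elem (\<rho> \<boxdot> \<rho>') (\<sigma> \<boxdot> \<sigma>') m
          ((T \<boxtimes> T') \<cdot> (idn C (\<gamma> k) \<boxtimes> braid C (\<gamma> l) \<rho> \<boxtimes> idn C \<rho>') \<cdot> (v \<boxtimes> idn C (\<rho> \<boxdot> \<rho>')))
          (F_adj k l m v (vec_tensor k l \<psi> \<psi>')))
       (Sigma Ghat (V k l))"

definition cr_tar :: "('o, 'o set \<Rightarrow> 'v \<Rightarrow> 'm) arrow \<Rightarrow> ('o, 'o set \<Rightarrow> 'v \<Rightarrow> 'm) arrow \<Rightarrow>
    ('o, 'o set \<Rightarrow> 'v \<Rightarrow> 'm) arrow" where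
  "cr_tar x y = finsum (cr_space (src x \<boxdot> src y) (trg x \<boxdot> trg y))
       (\<lambda>((k, b), (l, c)).
          elem_tar (src x) (trg x) (src y) (trg y) k (val x k b) b l (val y l c) c)
       (terms x \<times> terms y)"

definition elem_star :: "'o \<Rightarrow> 'o \<Rightarrow> 'o set \<Rightarrow> 'm \<Rightarrow> 'v \<Rightarrow> ('o, 'o set \<Rightarrow> 'v \<Rightarrow> 'm) arrow" where
  "elem_star \<rho> \<sigma> k T \<psi> = elem \<sigma> \<rho> (conj_class C k)
     (((R k)\<dagger> \<boxtimes> idn C \<rho>) \<cdot> (idn C (\<gamma> (conj_class C k)) \<boxtimes> T\<dagger>)) (conj_vec k \<psi>)"

definition cr_star :: "('o, 'o set \<Rightarrow> 'v \<Rightarrow> 'm) arrow \<Rightarrow> ('o, 'o set \<Rightarrow> 'v \<Rightarrow> 'm) arrow" where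
  "cr_star x = finsum (cr_space (trg x) (src x))
       (\<lambda>(k, b). elem_star (src x) (trg x) k (val x k b) b)
       (terms x)"

text \<open>The inclusion \<open>T \<mapsto> T \<otimes> \<Omega>\<close> of \<open>C\<close>; note that \<open>\<gamma>\<^sub>0\<rho> = \<rho>\<close>.\<close>

definition incl :: "'m \<Rightarrow> ('o, 'o set \<Rightarrow> 'v \<Rightarrow> 'm) arrow" where
  "incl T = elem (Dom C T) (Cod C T) (iso_class C (unt C)) T (romega U)"

text \<open>The family \<open>braid\<close> below is a braiding only if \<open>S\<close> consists of degenerate objects.\<close>

definition crossed0 :: "('o, ('o, 'o set \<Rightarrow> 'v \<Rightarrow> 'm) arrow) braided_cat" where
  "crossed0 = \<lparr>Obj = Obj C, Arr = (\<Union>\<rho>\<in>Obj C. \<Union>\<sigma>\<in>Obj C. cr_hom \<rho> \<sigma>), Dom = src, Cod = trg,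
     idn = (\<lambda>\<rho>. incl (idn C \<rho>)), cmp = cr_cmp, unt = unt C, tob = tob C, tar = cr_tar,
     star = cr_star, hadd = cr_add, hzero = cr_zero, hscale = cr_scale,
     braid = (\<lambda>\<rho> \<sigma>. incl (braid C \<rho> \<sigma>))\<rparr>"

end

text \<open>The closure under subobjects. An arrow from \<open>(\<rho>, E)\<close> to \<open>(\<sigma>, E')\<close> is an arrow \<open>E' \<circ> x \<circ> E\<close> of
  the given category, tagged with these two objects.\<close>

definition subobject_closure ::
  "('o, 'x) braided_cat \<Rightarrow> ('o \<times> 'x, ('o \<times> 'x, 'x) arrow) braided_cat" where
  "subobject_closure A = \<lparr>
     Obj = {(\<rho>, E). \<rho> \<in> Obj A \<and> projection A \<rho> E},
     Arr = {Arrow (\<rho>, E) (\<sigma>, E') (E' \<cdot>\<^bsub>A\<^esub> x \<cdot>\<^bsub>A\<^esub> E) |\<rho> E \<sigma> E' x.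
       \<rho> \<in> Obj A \<and> \<sigma> \<in> Obj A \<and> projection A \<rho> E \<and> projection A \<sigma> E' \<and> x \<in> Hom A \<rho> \<sigma>},
     Dom = src, Cod = trg,
     idn = (\<lambda>(\<rho>, E). Arrow (\<rho>, E) (\<rho>, E) E),
     cmp = (\<lambda>g f. Arrow (src f) (trg g) (val g \<cdot>\<^bsub>A\<^esub> val f)),
     unt = (unt A, idn A (unt A)),
     tob = (\<lambda>(\<rho>, E) (\<sigma>, E'). (\<rho> \<boxdot>\<^bsub>A\<^esub> \<sigma>, E \<boxtimes>\<^bsub>A\<^esub> E')),
     tar = (\<lambda>f g. Arrow
       (fst (src f) \<boxdot>\<^bsub>A\<^esub> fst (src g), snd (src f) \<boxtimes>\<^bsub>A\<^esub> snd (src g))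
       (fst (trg f) \<boxdot>\<^bsub>A\<^esub> fst (trg g), snd (trg f) \<boxtimes>\<^bsub>A\<^esub> snd (trg g))
       (val f \<boxtimes>\<^bsub>A\<^esub> val g)),
     star = (\<lambda>f. Arrow (trg f) (src f) ((val f)\<dagger>\<^bsub>A\<^esub>)),
     hadd = (\<lambda>f g. Arrow (src f) (trg f) (hadd A (val f) (val g))),
     hzero = (\<lambda>X Y. Arrow X Y (hzero A (fst X) (fst Y))),
     hscale = (\<lambda>c f. Arrow (src f) (trg f) (hscale A c (val f))),
     braid = (\<lambda>(\<rho>, E) (\<sigma>, E'). Arrow (\<rho> \<boxdot>\<^bsub>A\<^esub> \<sigma>, E \<boxtimes>\<^bsub>A\<^esub> E') (\<sigma> \<boxdot>\<^bsub>A\<^esub> \<rho>, E' \<boxtimes>\<^bsub>A\<^esub> E)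
       ((E' \<boxtimes>\<^bsub>A\<^esub> E) \<cdot>\<^bsub>A\<^esub> braid A \<rho> \<sigma> \<cdot>\<^bsub>A\<^esub> (E \<boxtimes>\<^bsub>A\<^esub> E')))\<rparr>"

definition (in crossed_product_data) crossed_product ::
  "('o \<times> ('o, 'o set \<Rightarrow> 'v \<Rightarrow> 'm) arrow,
    ('o \<times> ('o, 'o set \<Rightarrow> 'v \<Rightarrow> 'm) arrow, ('o, 'o set \<Rightarrow> 'v \<Rightarrow> 'm) arrow) arrow) braided_cat" where
  "crossed_product = subobject_closure crossed0"

end

theory Submission
 imports Defs "HOL-Computational_Algebra.Fundamental_Theorem_Algebra"
begin

text \<open>
 The operations of the crossed product are defined on elementary tensors over the chosen
 representatives \<open>\<gamma> k\<close> by sums over orthonormal bases. The key to all axioms is a description free of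
 these choices. For any object \<open>g\<close> of the symmetric subcategory, \<open>T\<close> in \<open>Hom(g \<rho>, \<sigma>)\<close> and \<open>\<psi>\<close> in \<open>F(g)\<close> there
 is an arrow \<open>T \<otimes> \<psi>\<close> (\<open>gen\<close>), every arrow has this form (\<open>cr_hom_gen\<close>), and the arrows satisfy the single
 relation \<open>T(v \<times> id) \<otimes> \<psi> = T \<otimes> F(v)\<psi>\<close> (\<open>gen_natural\<close>). The definition of \<open>T \<otimes> \<psi>\<close> uses the dyads of \<open>\<psi>\<close>, the
 parts of the operators \<open>\<bar>\<psi>\<rangle>\<langle>\<phi>\<bar>\<close> that come from arrows \<open>\<gamma> k \<rightarrow> g\<close>. Since the dyads of \<open>\<psi>\<close> add up to \<open>\<psi>\<close>
 (\<open>dyad_complete\<close>), the sums collapse: \<open>(T \<otimes> \<psi>) \<circ> (T' \<otimes> \<psi>') = T(id \<times> T') \<otimes> (\<psi> \<boxtimes> \<psi>')\<close> over \<open>g g'\<close>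
 (\<open>cr_cmp_gen\<close>), the tensor product inserts one braiding (\<open>cr_tar_gen\<close>), and the star can be computed with
 any solution of the conjugate equations for \<open>g\<close> (\<open>cr_star_gen\<close>). The axioms of a tensor category with star
 thereby become identities in the original category; the interchange law and the star of a tensor product
 use that the braiding is symmetric on the subcategory and that \<open>F\<close> maps it to the flip.

 Positivity follows from Frobenius reciprocity, which reduces it to arrows \<open>f = T \<otimes> \<psi>\<close> out of the unit, for
 which \<open>f\<^sup>* \<circ> f = \<langle>\<psi>, F(T\<^sup>*T)\<psi>\<rangle>\<close>; decomposing the target turns this into a sum of squares, because only its
 components in the subcategory contribute. The same expansion shows that the \<open>Hom\<close>-spaces are
 finite-dimensional and that the unit is irreducible.

 The closure under subobjects is then a semisimple tensor category: a maximal orthogonal family of projections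
 decomposes every object (\<open>decomposition_exists\<close>). The arrows from an irreducible object into any other object form
 a Hilbert space, and the operator norm on all of these is a \<open>C\<^sup>*\<close>-norm (\<open>Cstar_norm\<close>). Every object is a subobject of
 one of the original category, which has a conjugate there, and conjugates pass to subobjects
 (\<open>conjugates_of_subobjects\<close>). The braiding is natural once the subcategory consists of degenerate objects, since
 its naturality on \<open>T \<otimes> \<psi>\<close> amounts to a trivial monodromy with \<open>g\<close> (\<open>unitary_braiding_CR\<close>). Finally, every
 irreducible object of the closure is a component of an irreducible object of the original category, and each of
 these has finitely many components (\<open>rational_CS\<close>).
\<close>

section \<open>Linear algebra over the complex numbers\<close>

lemma complex_field_simps [simp]:
 "carrier complex_field = UNIV"
 "x \<otimes>\<^bsub>complex_field\<^esub> y = x * y" "x \<oplus>\<^bsub>complex_field\<^esub> y = x + y"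
 "\<one>\<^bsub>complex_field\<^esub> = 1" "\<zero>\<^bsub>complex_field\<^esub> = 0"
 by (simp_all add: complex_field_def)

lemma cring_complex_field: "cring complex_field"
proof (rule cringI)
 show "abelian_group complex_field"
  by (rule abelian_groupI) (auto simp: algebra_simps intro: exI[of _ "- x" for x])
 show "Group.comm_monoid complex_field"
  by (rule Group.comm_monoidI) auto
qed (auto simp: algebra_simps)

lemma complex_moduleI:
 fixes M (structure)
 assumes "\<zero> \<in> carrier M"
  and "!!x y. [|x \<in> carrier M; y \<in> carrier M|] ==> x \<oplus> y \<in> carrier M"
  and smc: "!!c x. x \<in> carrier M ==> c \<odot> x \<in> carrier M"
  and "!!x y z. [|x \<in> carrier M; y \<in> carrier M; z \<in> carrier M|] ==> (x \<oplus> y) \<oplus> z = x \<oplus> (y \<oplus> z)"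
  and "!!x y. [|x \<in> carrier M; y \<in> carrier M|] ==> x \<oplus> y = y \<oplus> x"
  and "!!x. x \<in> carrier M ==> \<zero> \<oplus> x = x"
  and z: "!!x. x \<in> carrier M ==> 0 \<odot> x = \<zero>"
  and one: "!!x. x \<in> carrier M ==> 1 \<odot> x = x"
  and l: "!!c d x. x \<in> carrier M ==> (c + d) \<odot> x = c \<odot> x \<oplus> d \<odot> x"
  and "!!c x y. [|x \<in> carrier M; y \<in> carrier M|] ==> c \<odot> (x \<oplus> y) = c \<odot> x \<oplus> c \<odot> y"
  and "!!c d x. x \<in> carrier M ==> (c * d) \<odot> x = c \<odot> (d \<odot> x)"
 shows "Module.module complex_field M"
proof (rule moduleI)
 have neg: "(-1) \<odot> x \<oplus> x = \<zero>" if "x \<in> carrier M" for x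
  using l[OF that, of "-1" 1] one[OF that] z[OF that] by simp
 show "abelian_group M"
 proof (rule abelian_groupI)
  fix x assume "x \<in> carrier M"
  with smc neg show "\<exists>y\<in>carrier M. y \<oplus> x = \<zero>" by (intro bexI[of _ "(-1) \<odot> x"])
 qed (fact assms)+
qed (use assms cring_complex_field in auto)

locale cvs =
 fixes M :: "(complex, 'a, 'z) module_scheme" (structure)
 assumes is_module: "Module.module complex_field M"

sublocale cvs \<subseteq> Module.module complex_field M
 by (rule is_module)

context cvs
begin

lemma smult_closed' [simp, intro]: "x \<in> carrier M ==> c \<odot> x \<in> carrier M"
 using smult_closed by simp

lemma smult_smult [simp]: "x \<in> carrier M ==> c \<odot> (d \<odot> x) = (c * d) \<odot> x"
 using smult_assoc1[of c d x] by simp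

lemma smult_add_l: "x \<in> carrier M ==> (c + d) \<odot> x = c \<odot> x \<oplus> d \<odot> x"
 using smult_l_distr[of c d x] by simp

lemma smult_add_r: "[|x \<in> carrier M; y \<in> carrier M|] ==> c \<odot> (x \<oplus> y) = c \<odot> x \<oplus> c \<odot> y"
 using smult_r_distr[of c x y] by simp

lemma smult_0_l [simp]: "x \<in> carrier M ==> 0 \<odot> x = \<zero>"
 using smult_l_null[of x] by simp

lemma smult_0_r [simp]: "c \<odot> \<zero> = \<zero>"
 using smult_r_null[of c] by simp

lemma smult_1 [simp]: "x \<in> carrier M ==> 1 \<odot> x = x"
 using smult_one[of x] by simp

lemma a_inv_smult: "x \<in> carrier M ==> \<ominus> x = (-1) \<odot> x"
 by (metis M.minus_equality add.left_inverse smult_0_l smult_1 smult_add_l smult_closed')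

lemma smult_eq_0_iff: "x \<in> carrier M ==> c \<odot> x = \<zero> \<longleftrightarrow> c = 0 \<or> x = \<zero>"
 by (metis left_inverse smult_0_l smult_0_r smult_1 smult_smult)

lemma neg_smult: "x \<in> carrier M ==> (-1) \<odot> x \<oplus> x = \<zero>"
 using smult_add_l[of x "-1" 1] by simp

lemma diff_add: "[|x \<in> carrier M; y \<in> carrier M|] ==> (x \<oplus> (-1) \<odot> y) \<oplus> y = x"
 by (simp add: M.a_assoc neg_smult)

lemma diff_eq_0D: "[|x \<oplus> (-1) \<odot> y = \<zero>; x \<in> carrier M; y \<in> carrier M|] ==> x = y"
 using diff_add[of x y] by simp

lemma smult_finsum: "f \<in> A \<rightarrow> carrier M ==> finite A ==> c \<odot> finsum M f A = (\<Oplus>i\<in>A. c \<odot> f i)"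
 using finsum_smult_ldistr[of A c f] by simp

lemma finsum_add: "[|f \<in> A \<rightarrow> carrier M; g \<in> A \<rightarrow> carrier M|] ==>
  (\<Oplus>i\<in>A. f i \<oplus> g i) = finsum M f A \<oplus> finsum M g A"
 by (rule M.finsum_addf)

lemma finsum_delta:
 assumes "finite A" "a \<in> A" "x \<in> carrier M"
 shows "(\<Oplus>i\<in>A. if i = a then x else \<zero>) = x"
 using M.finsum_singleton[of a A "%_. x"] assms by (simp add: eq_commute)

lemma spans_induct [consumes 2, case_names zero base add smult]:
 assumes "spans M B" "x \<in> carrier M"
  and z: "P \<zero>" and b: "!!b. b \<in> B ==> P b"
  and add: "!!x y. [|x \<in> carrier M; y \<in> carrier M; P x; P y|] ==> P (x \<oplus> y)"
  and sm: "!!c x. [|x \<in> carrier M; P x|] ==> P (c \<odot> x)"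
 shows "P x"
proof -
 from assms(1,2) obtain c where x: "x = (\<Oplus>b\<in>B. c b \<odot> b)" and B: "finite B" "B \<subseteq> carrier M"
  by (auto simp: spans_def)
 have "A \<subseteq> B ==> P (\<Oplus>b\<in>A. c b \<odot> b) \<and> (\<Oplus>b\<in>A. c b \<odot> b) \<in> carrier M" if "finite A" for A
  using that
 proof induct
  case empty
  then show ?case using z by simp
 next
  case (insert a A)
  then have "(%b. c b \<odot> b) \<in> A \<rightarrow> carrier M" "a \<in> carrier M" using B by auto
  moreover from this insert have "P (c a \<odot> a)" "P (\<Oplus>b\<in>A. c b \<odot> b)" "(\<Oplus>b\<in>A. c b \<odot> b) \<in> carrier M"
   using sm b by auto
  ultimately show ?case using insert by (simp add: add)
 qed
 with B x show ?thesis by blast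
qed

text \<open>Membership in the span of \<open>B\<close> is expressed as membership in every subspace containing \<open>B\<close>, so
 that coefficients have to be handled only here.\<close>

lemma spansI:
 assumes B: "finite B" "B \<subseteq> carrier M"
  and mem: "!!x W. [|x \<in> carrier M; \<zero> \<in> W; B \<subseteq> W; !!y z. [|y \<in> W; z \<in> W|] ==> y \<oplus> z \<in> W;
   !!c y. y \<in> W ==> c \<odot> y \<in> W|] ==> x \<in> W"
 shows "spans M B"
proof -
 define W where "W = range (%c. \<Oplus>b\<in>B. c b \<odot> b)"
 have cl: "(%b. c b \<odot> b) \<in> B \<rightarrow> carrier M" for c using B by auto
 have "x \<in> W" if x: "x \<in> carrier M" for x
 proof (rule mem[OF x])
  have "(\<Oplus>b\<in>B. 0 \<odot> b) = \<zero>"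
   using B by (intro M.add.finprod_one_eqI) auto
  then show "\<zero> \<in> W" by (auto simp: W_def intro!: range_eqI[of _ _ "%_. 0"])
  show "B \<subseteq> W"
  proof
   fix b assume b: "b \<in> B"
   have "(\<Oplus>a\<in>B. (if a = b then 1 else 0) \<odot> a) = (\<Oplus>a\<in>B. if a = b then b else \<zero>)"
    using B b by (intro M.finsum_cong') auto
   with finsum_delta[of B b b] B b show "b \<in> W"
    by (auto simp: W_def intro!: range_eqI[of _ _ "%a. if a = b then 1 else 0"])
  qed
 next
  fix y z assume "y \<in> W" "z \<in> W"
  then obtain c d where "y = (\<Oplus>b\<in>B. c b \<odot> b)" "z = (\<Oplus>b\<in>B. d b \<odot> b)" by (auto simp: W_def)
  then have "y \<oplus> z = (\<Oplus>b\<in>B. c b \<odot> b \<oplus> d b \<odot> b)" using cl by (simp add: finsum_add)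
  also have "\<dots> = (\<Oplus>b\<in>B. (c b + d b) \<odot> b)"
   using B by (intro M.finsum_cong') (auto simp: smult_add_l)
  finally show "y \<oplus> z \<in> W" by (auto simp: W_def)
 next
  fix c y assume "y \<in> W"
  then obtain d where "y = (\<Oplus>b\<in>B. d b \<odot> b)" by (auto simp: W_def)
  then have "c \<odot> y = (\<Oplus>b\<in>B. c \<odot> (d b \<odot> b))" using cl B by (simp add: smult_finsum)
  also have "\<dots> = (\<Oplus>b\<in>B. (c * d b) \<odot> b)"
   using B by (intro M.finsum_cong') auto
  finally show "c \<odot> y \<in> W" by (auto simp: W_def)
 qed
 with B show ?thesis by (auto simp: spans_def W_def)
qed

end

lemma finite_dimensional_image:
 assumes M: "Module.module complex_field M" and N: "Module.module complex_field N"
  and fd: "finite_dimensional M"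
  and mem: "!!x. x \<in> carrier M ==> f x \<in> carrier N"
  and add: "!!x y. [|x \<in> carrier M; y \<in> carrier M|] ==> f (x \<oplus>\<^bsub>M\<^esub> y) = f x \<oplus>\<^bsub>N\<^esub> f y"
  and sm: "!!c x. x \<in> carrier M ==> f (c \<odot>\<^bsub>M\<^esub> x) = c \<odot>\<^bsub>N\<^esub> f x"
  and surj: "!!y. y \<in> carrier N ==> \<exists>x\<in>carrier M. y = f x"
 shows "finite_dimensional N"
proof -
 interpret M: cvs M by (simp add: cvs_def M)
 interpret N: cvs N by (simp add: cvs_def N)
 obtain B where B: "spans M B" using fd by (auto simp: finite_dimensional_def)
 then have Bc: "finite B" "B \<subseteq> carrier M" by (auto simp: spans_def)
 have f0: "f \<zero>\<^bsub>M\<^esub> = \<zero>\<^bsub>N\<^esub>" using sm[of "\<zero>\<^bsub>M\<^esub>" 0] mem[of "\<zero>\<^bsub>M\<^esub>"] by simp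
 have "spans N (f ` B)"
 proof (rule N.spansI)
  fix y W
  assume y: "y \<in> carrier N" and W: "\<zero>\<^bsub>N\<^esub> \<in> W" "f ` B \<subseteq> W"
   "!!y z. [|y \<in> W; z \<in> W|] ==> y \<oplus>\<^bsub>N\<^esub> z \<in> W" "!!c y. y \<in> W ==> c \<odot>\<^bsub>N\<^esub> y \<in> W"
  obtain x where x: "x \<in> carrier M" "y = f x" using surj[OF y] by blast
  from B x(1) have "f x \<in> W"
   by (induct rule: M.spans_induct) (use W f0 add sm in auto)
  with x show "y \<in> W" by simp
 qed (use Bc mem in auto)
 then show ?thesis by (auto simp: finite_dimensional_def)
qed

text \<open>Gaussian elimination: solve one equation for an unknown with nonzero coefficient and substitute.\<close>

lemma underdetermined_system:
 fixes a :: "'j => 'i => complex"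
 assumes "finite J" "finite I" "card J < card I"
 shows "\<exists>x. (\<exists>i\<in>I. x i ~= 0) \<and> (\<forall>j\<in>J. (\<Sum>i\<in>I. a j i * x i) = 0)"
 using assms
proof (induct J arbitrary: I a)
 case empty
 then have "I ~= {}" by auto
 then show ?case by (auto intro!: exI[of _ "%_. 1"])
next
 case (insert j J)
 show ?case
 proof (cases "\<forall>i\<in>I. a j i = 0")
  case True
  have "card J < card I" using insert.prems insert.hyps by simp
  from insert.hyps(3)[OF insert.prems(1) this, of a] obtain x
   where "\<exists>i\<in>I. x i ~= 0" "\<forall>j\<in>J. (\<Sum>i\<in>I. a j i * x i) = 0" by blast
  with True show ?thesis by (intro exI[of _ x]) auto
 next
  case False
  then obtain p where p: "p \<in> I" "a j p ~= 0" by auto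
  define I' where "I' = I - {p}"
  have I': "finite I'" "card J < card I'" "I = insert p I'" "p \<notin> I'"
   using insert.prems insert.hyps p by (auto simp: I'_def)
  from insert.hyps(3)[OF I'(1,2), of "%j' i. a j' i - a j' p * a j i / a j p"] obtain x
   where x: "\<exists>i\<in>I'. x i ~= 0" "\<forall>j'\<in>J. (\<Sum>i\<in>I'. (a j' i - a j' p * a j i / a j p) * x i) = 0"
   by auto
  define s where "s = (\<Sum>i\<in>I'. a j i * x i)"
  define y where "y = x(p := - s / a j p)"
  have eq: "(\<Sum>i\<in>I. a j' i * y i) = a j' p * (- s / a j p) + (\<Sum>i\<in>I'. a j' i * x i)" for j'
  proof -
   have "(\<Sum>i\<in>I'. a j' i * y i) = (\<Sum>i\<in>I'. a j' i * x i)"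
    by (rule sum.cong) (use I' in "auto simp: y_def")
   with I' show ?thesis by (simp add: y_def)
  qed
  show ?thesis
  proof (intro exI[of _ y] conjI ballI)
   show "\<exists>i\<in>I. y i ~= 0" using x(1) I' by (auto simp: y_def)
   fix j' assume "j' \<in> insert j J"
   then consider "j' = j" | "j' \<in> J" by auto
   then show "(\<Sum>i\<in>I. a j' i * y i) = 0"
   proof cases
    case 1
    with p show ?thesis by (subst eq) (simp add: s_def)
   next
    case 2
    with x(2) have "0 = (\<Sum>i\<in>I'. (a j' i - a j' p * a j i / a j p) * x i)" by simp
    also have "\<dots> = (\<Sum>i\<in>I'. a j' i * x i) - a j' p / a j p * s"
     by (simp add: s_def algebra_simps sum_subtractf sum_distrib_left)
    finally show ?thesis by (subst eq) (simp add: algebra_simps)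
   qed
  qed
 qed
qed

lemma (in cvs) linearly_dependent:
 assumes B: "spans M B" and I: "finite I" "card B < card I" and f: "f \<in> I \<rightarrow> carrier M"
 shows "\<exists>c. (\<exists>i\<in>I. c i ~= 0) \<and> (\<Oplus>i\<in>I. c i \<odot> f i) = \<zero>"
proof -
 have Bc: "finite B" "B \<subseteq> carrier M" using B by (auto simp: spans_def)
 have "\<exists>a. \<forall>i\<in>I. f i = (\<Oplus>b\<in>B. a i b \<odot> b)"
  using B f by (intro bchoice) (auto simp: spans_def)
 then obtain a where a: "!!i. i \<in> I ==> f i = (\<Oplus>b\<in>B. a i b \<odot> b)" by blast
 from underdetermined_system[OF Bc(1) I, of "%b i. a i b"] obtain c
  where c: "\<exists>i\<in>I. c i ~= 0" "\<forall>b\<in>B. (\<Sum>i\<in>I. a i b * c i) = 0" by blast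
 have cl: "(%b. d b \<odot> b) \<in> B \<rightarrow> carrier M" for d using Bc by auto
 have "A \<subseteq> I ==> (\<Oplus>i\<in>A. c i \<odot> f i) = (\<Oplus>b\<in>B. (\<Sum>i\<in>A. a i b * c i) \<odot> b)" if "finite A" for A
  using that
 proof induct
  case empty
  show ?case using Bc by (auto intro!: M.add.finprod_one_eqI[symmetric])
 next
  case (insert i A)
  have "c i \<odot> f i = (\<Oplus>b\<in>B. c i \<odot> (a i b \<odot> b))"
   using insert a Bc cl by (simp add: smult_finsum)
  also have "\<dots> = (\<Oplus>b\<in>B. (a i b * c i) \<odot> b)"
   using Bc by (intro M.finsum_cong') (auto simp: mult.commute)
  finally have "(\<Oplus>i\<in>insert i A. c i \<odot> f i) =
    (\<Oplus>b\<in>B. (a i b * c i) \<odot> b) \<oplus> (\<Oplus>b\<in>B. (\<Sum>i\<in>A. a i b * c i) \<odot> b)"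
   using insert f M.finsum_closed[OF cl] by (subst M.finsum_insert) (auto simp: subset_iff Pi_iff)
  also have "\<dots> = (\<Oplus>b\<in>B. (a i b * c i) \<odot> b \<oplus> (\<Sum>i\<in>A. a i b * c i) \<odot> b)"
   using cl by (subst finsum_add) auto
  also have "\<dots> = (\<Oplus>b\<in>B. (\<Sum>i\<in>insert i A. a i b * c i) \<odot> b)"
   using Bc insert by (intro M.finsum_cong') (auto simp: smult_add_l)
  finally show ?case .
 qed
 from this[of I] I c have "(\<Oplus>i\<in>I. c i \<odot> f i) = (\<Oplus>b\<in>B. 0 \<odot> b)"
  using Bc by (auto intro!: M.finsum_cong' simp: )
 also have "\<dots> = \<zero>" using Bc by (intro M.add.finprod_one_eqI) auto
 finally show ?thesis using c by blast
qed

subsection \<open>Finite-dimensional Hilbert spaces\<close>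

sublocale fd_hilbert \<subseteq> cvs H
 by (simp add: cvs_def vector_space)

context fd_hilbert
begin

lemma ip_add_l: "[|x \<in> carrier H; y \<in> carrier H; z \<in> carrier H|] ==> ip H (y \<oplus>\<^bsub>H\<^esub> z) x = ip H y x + ip H z x"
 by (metis M.add.m_closed complex_cnj_add ip_add ip_cnj)

lemma ip_scale_l: "[|x \<in> carrier H; y \<in> carrier H|] ==> ip H (c \<odot>\<^bsub>H\<^esub> y) x = cnj c * ip H y x"
 by (metis smult_closed' complex_cnj_mult ip_scale ip_cnj)

lemma ip_0 [simp]: "x \<in> carrier H ==> ip H x \<zero>\<^bsub>H\<^esub> = 0"
 by (metis M.zero_closed ip_scale lambda_zero smult_0_l)

lemma ip_0_l [simp]: "x \<in> carrier H ==> ip H \<zero>\<^bsub>H\<^esub> x = 0"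
 by (metis M.zero_closed ip_scale_l complex_cnj_zero lambda_zero smult_0_l)

lemma ip_self: "x \<in> carrier H ==> ip H x x = of_real (Re (ip H x x))"
 by (metis ip_cnj complex_cnj_cancel_iff Reals_cnj_iff of_real_Re)

lemma ip_finsum: "finite A ==> x \<in> carrier H ==> f \<in> A \<rightarrow> carrier H ==>
  ip H x (finsum H f A) = (\<Sum>i\<in>A. ip H x (f i))"
 by (induct rule: finite_induct) (auto simp: ip_add)

lemma ip_eqI:
 assumes "x \<in> carrier H" "y \<in> carrier H" "!!z. z \<in> carrier H ==> ip H z x = ip H z y"
 shows "x = y"
proof -
 define z where "z = x \<oplus>\<^bsub>H\<^esub> (-1) \<odot>\<^bsub>H\<^esub> y"
 have z: "z \<in> carrier H" using assms by (simp add: z_def)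
 have "ip H z z = ip H z x - ip H z y"
  by (subst z_def, subst ip_add) (use assms z in "simp_all add: ip_scale")
 with assms z have "Re (ip H z z) = 0" by simp
 with ip_pos[OF z] have "z = \<zero>\<^bsub>H\<^esub>" by (metis less_irrefl)
 then show ?thesis using assms diff_eq_0D by (auto simp: z_def)
qed

text \<open>Gram-Schmidt: the vectors of a finite spanning set are added one by one, and the remainder of each
 after projection onto the vectors found so far is normalized unless it vanishes.\<close>

lemma orthonormal_basis_exists: "\<exists>B. orthonormal_basis H B"
proof -
 obtain B where B: "spans H B" using fin_dim by (auto simp: finite_dimensional_def)
 then have Bc: "finite B" "B \<subseteq> carrier H" by (auto simp: spans_def)
 have "A \<subseteq> B ==> \<exists>E. finite E \<and> E \<subseteq> carrier H \<and>
   (\<forall>a\<in>E. \<forall>b\<in>E. ip H a b = (if a = b then 1 else 0)) \<and>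
   (\<forall>b\<in>A. (\<Oplus>\<^bsub>H\<^esub>e\<in>E. ip H e b \<odot>\<^bsub>H\<^esub> e) = b)" if "finite A" for A
  using that
 proof induct
  case empty
  show ?case by (intro exI[of _ "{}"]) auto
 next
  case (insert b A)
  then have "A \<subseteq> B" by simp
  from insert.hyps(3)[OF this] obtain E where E: "finite E" "E \<subseteq> carrier H"
   and on': "\<forall>a\<in>E. \<forall>b\<in>E. ip H a b = (if a = b then 1 else 0)"
   and ex': "\<forall>b\<in>A. (\<Oplus>\<^bsub>H\<^esub>e\<in>E. ip H e b \<odot>\<^bsub>H\<^esub> e) = b"
   by (elim exE conjE) (rule that)
  note on = on'[rule_format] and ex = ex'[rule_format]
  have b: "b \<in> carrier H" using insert Bc by auto
  define s where "s = (\<Oplus>\<^bsub>H\<^esub>e\<in>E. ip H e b \<odot>\<^bsub>H\<^esub> e)"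
  have cl: "(%e. c e \<odot>\<^bsub>H\<^esub> e) \<in> E \<rightarrow> carrier H" for c using E by auto
  have s: "s \<in> carrier H" unfolding s_def using cl by (rule M.finsum_closed)
  define r where "r = b \<oplus>\<^bsub>H\<^esub> (-1) \<odot>\<^bsub>H\<^esub> s"
  have r: "r \<in> carrier H" using s b by (simp add: r_def)
  have br: "b = s \<oplus>\<^bsub>H\<^esub> r"
   using s b r diff_add[of b s] by (simp add: r_def M.a_comm)
  have proj: "ip H e (\<Oplus>\<^bsub>H\<^esub>e\<in>E. c e \<odot>\<^bsub>H\<^esub> e) = c e" if "e \<in> E" for e c
  proof -
   have "ip H e (\<Oplus>\<^bsub>H\<^esub>e\<in>E. c e \<odot>\<^bsub>H\<^esub> e) = (\<Sum>a\<in>E. ip H e (c a \<odot>\<^bsub>H\<^esub> a))"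
    using E that cl by (subst ip_finsum) auto
   also have "\<dots> = (\<Sum>a\<in>E. if a = e then c a else 0)"
    by (rule sum.cong) (use E that in "auto simp: ip_scale on subset_iff")
   also have "\<dots> = c e" using E that by simp
   finally show ?thesis .
  qed
  have er: "ip H e r = 0" if "e \<in> E" for e
  proof -
   have "ip H e r = ip H e b - ip H e s"
    unfolding r_def by (subst ip_add) (use that E b s in "auto simp: ip_scale")
   with proj[OF that] show ?thesis by (simp add: s_def)
  qed
  show ?case
  proof (cases "r = \<zero>\<^bsub>H\<^esub>")
   case True
   with br s have "b = s" by simp
   with E on ex show ?thesis by (intro exI[of _ E]) (auto simp: s_def)
  next
   case False
   define n where "n = sqrt (Re (ip H r r))"
   have n: "n > 0" using ip_pos[OF r False] by (simp add: n_def)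
   have "n * n = Re (ip H r r)" using ip_pos[OF r False] by (simp add: n_def)
   then have rr: "ip H r r = of_real n * of_real n" using ip_self[OF r] by (metis of_real_mult)
   define e' where "e' = of_real (1 / n) \<odot>\<^bsub>H\<^esub> r"
   have e': "e' \<in> carrier H" using r by (simp add: e'_def)
   have e'e': "ip H e' e' = 1"
    using n r by (simp add: e'_def ip_scale ip_scale_l rr)
   have ee': "ip H e e' = 0" if "e \<in> E" for e
    using er[OF that] that E r by (auto simp: e'_def ip_scale)
   have e'e: "ip H e' e = 0" if "e \<in> E" for e
    using ee'[OF that] ip_cnj[of e e'] that E e' by auto
   have nin: "e' \<notin> E" using ee' e'e' by force
   have e's: "ip H e' (\<Oplus>\<^bsub>H\<^esub>e\<in>E. c e \<odot>\<^bsub>H\<^esub> e) = 0" for c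
    using E e' cl e'e by (subst ip_finsum) (auto simp: ip_scale subset_iff intro!: sum.neutral)
   show ?thesis
   proof (intro exI[of _ "insert e' E"] conjI ballI)
    show "finite (insert e' E)" "insert e' E \<subseteq> carrier H" using E e' by auto
    fix x y assume "x \<in> insert e' E" "y \<in> insert e' E"
    then show "ip H x y = (if x = y then 1 else 0)"
     using on ee' e'e e'e' nin by auto
   next
    fix x assume "x \<in> insert b A"
    then consider "x = b" | "x \<in> A" by auto
    then show "(\<Oplus>\<^bsub>H\<^esub>e\<in>insert e' E. ip H e x \<odot>\<^bsub>H\<^esub> e) = x"
    proof cases
     case 1
     have "ip H e' b = ip H e' r"
      using e's[of "%e. ip H e b"] by (subst br, subst ip_add) (use e' r s in "auto simp: s_def")
     also have "\<dots> = of_real n" using r n by (simp add: e'_def ip_scale_l rr)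
     finally have "ip H e' b \<odot>\<^bsub>H\<^esub> e' = r" using r n by (simp add: e'_def)
     then have "(\<Oplus>\<^bsub>H\<^esub>e\<in>insert e' E. ip H e b \<odot>\<^bsub>H\<^esub> e) = r \<oplus>\<^bsub>H\<^esub> s"
      using E nin cl e' r by (subst M.finsum_insert) (auto simp: s_def)
     with 1 br r s show ?thesis by (simp add: M.a_comm)
    next
     case 2
     have xc: "x \<in> carrier H" using 2 insert Bc by auto
     have "ip H e' x = 0" using e's[of "%e. ip H e x"] ex[OF 2] by simp
     then have "(\<Oplus>\<^bsub>H\<^esub>e\<in>insert e' E. ip H e x \<odot>\<^bsub>H\<^esub> e) = (\<Oplus>\<^bsub>H\<^esub>e\<in>E. ip H e x \<odot>\<^bsub>H\<^esub> e)"
      using E nin cl e' by (subst M.finsum_insert) auto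
     with ex[OF 2] show ?thesis by simp
    qed
   qed
  qed
 qed
 from this[OF Bc(1) subset_refl] obtain E where E: "finite E" "E \<subseteq> carrier H"
   and on: "\<forall>a\<in>E. \<forall>b\<in>E. ip H a b = (if a = b then 1 else 0)"
   and ex': "\<forall>b\<in>B. (\<Oplus>\<^bsub>H\<^esub>e\<in>E. ip H e b \<odot>\<^bsub>H\<^esub> e) = b"
  by (elim exE conjE) (rule that)
 note ex = ex'[rule_format]
 have "spans H E"
 proof (rule spansI[OF E])
  fix x W assume x: "x \<in> carrier H" and W: "\<zero>\<^bsub>H\<^esub> \<in> W" "E \<subseteq> W"
   "!!y z. [|y \<in> W; z \<in> W|] ==> y \<oplus>\<^bsub>H\<^esub> z \<in> W" "!!c y. y \<in> W ==> c \<odot>\<^bsub>H\<^esub> y \<in> W"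
  have "A \<subseteq> E ==> (\<Oplus>\<^bsub>H\<^esub>e\<in>A. c e \<odot>\<^bsub>H\<^esub> e) \<in> W" if "finite A" for A c
   using that
  proof induct
   case (insert a A)
   have "(%e. c e \<odot>\<^bsub>H\<^esub> e) \<in> A \<rightarrow> carrier H" "a \<in> carrier H" using insert E by auto
   with insert show ?case using W by auto
  qed (use W in auto)
  then have "!!b. b \<in> B ==> b \<in> W" using ex E by (metis subset_refl)
  with B x show "x \<in> W" by (induct rule: spans_induct) (use W in auto)
 qed
 with on show ?thesis by (auto simp: orthonormal_basis_def)
qed

lemma orthonormal_expansion:
 assumes E: "orthonormal_basis H E" and x: "x \<in> carrier H"
 shows "x = (\<Oplus>\<^bsub>H\<^esub>e\<in>E. ip H e x \<odot>\<^bsub>H\<^esub> e)"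
proof -
 have Ec: "finite E" "E \<subseteq> carrier H"
  and on: "!!a b. [|a \<in> E; b \<in> E|] ==> ip H a b = (if a = b then 1 else 0)"
  using E by (auto simp: orthonormal_basis_def spans_def)
 obtain c where c: "x = (\<Oplus>\<^bsub>H\<^esub>e\<in>E. c e \<odot>\<^bsub>H\<^esub> e)"
  using E x by (auto simp: orthonormal_basis_def spans_def)
 have "ip H e x = c e" if "e \<in> E" for e
 proof -
  have "ip H e x = (\<Sum>a\<in>E. ip H e (c a \<odot>\<^bsub>H\<^esub> a))"
   unfolding c by (rule ip_finsum) (use Ec that in auto)
  also have "\<dots> = (\<Sum>a\<in>E. if a = e then c a else 0)"
   by (rule sum.cong) (use Ec that in "auto simp: ip_scale on subset_iff")
  finally show ?thesis using Ec that by simp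
 qed
 then have "(\<Oplus>\<^bsub>H\<^esub>e\<in>E. ip H e x \<odot>\<^bsub>H\<^esub> e) = (\<Oplus>\<^bsub>H\<^esub>e\<in>E. c e \<odot>\<^bsub>H\<^esub> e)"
  using Ec by (intro M.finsum_cong') auto
 with c show ?thesis by simp
qed

text \<open>The coefficients of the representing vector are the values on an orthonormal basis.\<close>

lemma riesz:
 assumes add: "!!x y. [|x \<in> carrier H; y \<in> carrier H|] ==> l (x \<oplus>\<^bsub>H\<^esub> y) = l x + l y"
  and sm: "!!c x. x \<in> carrier H ==> l (c \<odot>\<^bsub>H\<^esub> x) = cnj c * l x"
 shows "\<exists>!a. a \<in> carrier H \<and> (\<forall>x\<in>carrier H. l x = ip H x a)"
proof -
 obtain E where E: "orthonormal_basis H E" using orthonormal_basis_exists by blast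
 then have Ec: "finite E" "E \<subseteq> carrier H" by (auto simp: orthonormal_basis_def spans_def)
 define a where "a = (\<Oplus>\<^bsub>H\<^esub>e\<in>E. l e \<odot>\<^bsub>H\<^esub> e)"
 have a: "a \<in> carrier H" unfolding a_def by (rule M.finsum_closed) (use Ec in auto)
 have l0: "l \<zero>\<^bsub>H\<^esub> = 0" using sm[of "\<zero>\<^bsub>H\<^esub>" 0] by simp
 have lsum: "l (finsum H f A) = (\<Sum>i\<in>A. l (f i))" if "finite A" "f \<in> A \<rightarrow> carrier H" for f A
  using that by induct (auto simp: l0 add)
 have la: "l x = ip H x a" if x: "x \<in> carrier H" for x
 proof -
  have "l x = (\<Sum>e\<in>E. l (ip H e x \<odot>\<^bsub>H\<^esub> e))"
   by (subst orthonormal_expansion[OF E x], rule lsum) (use Ec in auto)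
  also have "\<dots> = (\<Sum>e\<in>E. ip H x (l e \<odot>\<^bsub>H\<^esub> e))"
   using Ec x by (intro sum.cong refl) (simp add: sm ip_scale ip_cnj[symmetric] subset_iff)
  also have "\<dots> = ip H x a"
   unfolding a_def by (rule ip_finsum[symmetric]) (use Ec x in auto)
  finally show ?thesis .
 qed
 show ?thesis
 proof (rule ex1I)
  show "a \<in> carrier H \<and> (\<forall>x\<in>carrier H. l x = ip H x a)" using a la by blast
  fix b assume b: "b \<in> carrier H \<and> (\<forall>x\<in>carrier H. l x = ip H x b)"
  show "b = a"
  proof (rule ip_eqI)
   fix z assume "z \<in> carrier H"
   with b la show "ip H z b = ip H z a" by metis
  qed (use a b in auto)
 qed
qed

end

lemma linear_mapsD:
 assumes "T \<in> linear_maps M N"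
 shows "x \<in> carrier M ==> T x \<in> carrier N"
  and "[|x \<in> carrier M; y \<in> carrier M|] ==> T (x \<oplus>\<^bsub>M\<^esub> y) = T x \<oplus>\<^bsub>N\<^esub> T y"
  and "x \<in> carrier M ==> T (c \<odot>\<^bsub>M\<^esub> x) = c \<odot>\<^bsub>N\<^esub> T x"
 using assms by (auto simp: linear_maps_def)

lemma hilbert_adjoint:
 assumes "fd_hilbert H" "fd_hilbert K" and T: "T \<in> linear_maps H K" and b: "b \<in> carrier K"
 shows "hilbert_adjoint H K T b \<in> carrier H"
  and "c \<in> carrier H ==> ip H c (hilbert_adjoint H K T b) = ip K (T c) b"
proof -
 interpret H: fd_hilbert H by fact
 interpret K: fd_hilbert K by fact
 note T = linear_mapsD[OF T]
 have ex: "\<exists>!a. a \<in> carrier H \<and> (\<forall>x\<in>carrier H. ip K (T x) b = ip H x a)"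
  by (rule H.riesz) (use T b in "auto simp: K.ip_add_l K.ip_scale_l")
 have "hilbert_adjoint H K T b = (THE a. a \<in> carrier H \<and> (\<forall>x\<in>carrier H. ip K (T x) b = ip H x a))"
  using b by (simp add: hilbert_adjoint_def)
 with theI'[OF ex] show "hilbert_adjoint H K T b \<in> carrier H"
  "c \<in> carrier H ==> ip H c (hilbert_adjoint H K T b) = ip K (T c) b"
  by (metis (no_types, lifting))+
qed

section \<open>Calculus in strict tensor categories\<close>

text \<open>Whiskering by an object, written as a tensor product in which the object stands for its
 identity arrow.\<close>

abbreviation lwhisker :: "('o, 'm, 'z) tensor_cat_scheme => 'o => 'm => 'm" (infixr \<open><|\<index>\<close> 75) where
 "lwhisker C \<rho> f \<equiv> tar C (idn C \<rho>) f"

abbreviation rwhisker :: "('o, 'm, 'z) tensor_cat_scheme => 'm => 'o => 'm" (infixr \<open>|>\<index>\<close> 75) where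
 "rwhisker C f \<rho> \<equiv> tar C f (idn C \<rho>)"

lemma in_Hom: "f \<in> Hom C \<rho> \<sigma> \<longleftrightarrow> f \<in> Arr C \<and> Dom C f = \<rho> \<and> Cod C f = \<sigma>"
 by (auto simp: Hom_def)

lemma HomD:
 assumes "f \<in> Hom C \<rho> \<sigma>"
 shows "f \<in> Arr C" "Dom C f = \<rho>" "Cod C f = \<sigma>"
 using assms by (auto simp: Hom_def)

lemma hom_space_simps [simp]:
 "carrier (hom_space C \<rho> \<sigma>) = Hom C \<rho> \<sigma>" "\<zero>\<^bsub>hom_space C \<rho> \<sigma>\<^esub> = hzero C \<rho> \<sigma>"
 "f \<oplus>\<^bsub>hom_space C \<rho> \<sigma>\<^esub> g = hadd C f g" "c \<odot>\<^bsub>hom_space C \<rho> \<sigma>\<^esub> f = hscale C c f"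
 by (simp_all add: hom_space_def)

abbreviation hsum ::
 "('o, 'm, 'z) tensor_cat_scheme => 'o => 'o => ('i => 'm) => 'i set => 'm" where
 "hsum C \<rho> \<sigma> \<equiv> finsum (hom_space C \<rho> \<sigma>)"

context complex_tensor_category
begin

text \<open>The axioms are restated with conditions on domains and codomains instead of membership in a
 \<open>Hom\<close>-set: in this form the simplifier can check composability by itself, which turns it into a
 normalizer for composites.\<close>

lemma Hom_obj: "f \<in> Hom C \<rho> \<sigma> ==> \<rho> \<in> Obj C \<and> \<sigma> \<in> Obj C"
 using Dom_Cod by (auto simp: in_Hom)

lemma Dom_obj [simp]: "f \<in> Arr C ==> Dom C f \<in> Obj C"
 and Cod_obj [simp]: "f \<in> Arr C ==> Cod C f \<in> Obj C"
 using Dom_Cod by auto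

declare unt_obj [simp] tob_obj [simp]

lemma tob_simps [simp]:
 "[|\<rho> \<in> Obj C; \<sigma> \<in> Obj C; \<tau> \<in> Obj C|] ==> (\<rho>\<boxdot>\<sigma>)\<boxdot>\<tau> = \<rho>\<boxdot>(\<sigma>\<boxdot>\<tau>)"
 "\<rho> \<in> Obj C ==> unt C\<boxdot>\<rho> = \<rho>" "\<rho> \<in> Obj C ==> \<rho>\<boxdot>unt C = \<rho>"
 by (simp_all add: tob_assoc tob_unt)

lemma idn_arr [simp]:
 assumes "\<rho> \<in> Obj C"
 shows "idn C \<rho> \<in> Arr C" "Dom C (idn C \<rho>) = \<rho>" "Cod C (idn C \<rho>) = \<rho>"
 using idn_hom[OF assms] by (auto simp: in_Hom)

lemma cmp_arr [simp]:
 assumes "g \<in> Arr C" "f \<in> Arr C" "Dom C g = Cod C f"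
 shows "g\<cdot>f \<in> Arr C" "Dom C (g\<cdot>f) = Dom C f" "Cod C (g\<cdot>f) = Cod C g"
 using cmp_hom[of g "Cod C f" "Cod C g" f "Dom C f"] assms by (auto simp: in_Hom)

lemma cmp_cmp [simp]:
 "[|h \<in> Arr C; g \<in> Arr C; f \<in> Arr C; Dom C h = Cod C g; Dom C g = Cod C f|] ==>
  (h\<cdot>g)\<cdot>f = h\<cdot>(g\<cdot>f)"
 by (rule cmp_assoc) (auto simp: in_Hom)

lemma cmp_idn_l [simp]: "[|f \<in> Arr C; Cod C f = \<sigma>|] ==> idn C \<sigma>\<cdot>f = f"
 and cmp_idn_r [simp]: "[|f \<in> Arr C; Dom C f = \<rho>|] ==> f\<cdot>idn C \<rho> = f"
 using cmp_idn[of f "Dom C f" "Cod C f"] by (auto simp: in_Hom)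

lemma tar_arr [simp]:
 assumes "f \<in> Arr C" "g \<in> Arr C"
 shows "f \<boxtimes> g \<in> Arr C" "Dom C (f \<boxtimes> g) = Dom C f\<boxdot>Dom C g" "Cod C (f \<boxtimes> g) = Cod C f\<boxdot>Cod C g"
 using tar_hom[of f "Dom C f" "Cod C f" g "Dom C g" "Cod C g"] assms by (auto simp: in_Hom)

declare tar_idn [simp] tar_assoc [simp]

lemma tar_unt_simps [simp]:
 "f \<in> Arr C ==> (unt C)<|f = f" "f \<in> Arr C ==> f|>(unt C) = f"
 by (simp_all add: tar_unt)

lemma tar_idn_idn [simp]:
 "[|\<rho> \<in> Obj C; \<sigma> \<in> Obj C; f \<in> Arr C|] ==> \<rho><|(\<sigma><|f) = (\<rho>\<boxdot>\<sigma>)<|f"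
 using tar_assoc[of "idn C \<rho>" "idn C \<sigma>" f] by simp

lemma interch:
 "[|g \<in> Arr C; f \<in> Arr C; g' \<in> Arr C; f' \<in> Arr C; Dom C g = Cod C f; Dom C g' = Cod C f'|]
  ==> (g \<boxtimes> g')\<cdot>(f \<boxtimes> f') = (g\<cdot>f) \<boxtimes> (g'\<cdot>f')"
 using interchange[of g "Dom C g" "Cod C g" f "Dom C f" g' "Dom C g'" "Cod C g'" f' "Dom C f'"]
 by (simp add: in_Hom)

lemma lwhisker_cmp:
 "[|\<rho> \<in> Obj C; g \<in> Arr C; f \<in> Arr C; Dom C g = Cod C f|] ==>
  \<rho><|(g\<cdot>f) = (\<rho><|g)\<cdot>(\<rho><|f)"
 by (simp add: interch)

lemma rwhisker_cmp:
 "[|\<rho> \<in> Obj C; g \<in> Arr C; f \<in> Arr C; Dom C g = Cod C f|] ==>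
  (g\<cdot>f)|>\<rho> = (g|>\<rho>)\<cdot>(f|>\<rho>)"
 by (simp add: interch)

lemmas whisker_cmp = lwhisker_cmp rwhisker_cmp

lemma tar_split':
 "[|f \<in> Arr C; g \<in> Arr C|] ==> f \<boxtimes> g = ((Cod C f)<|g)\<cdot>(f|>(Dom C g))"
 by (simp add: interch)

lemma slide:
 "[|f \<in> Arr C; g \<in> Arr C; Dom C f = \<rho>; Cod C f = \<rho>'; Dom C g = \<sigma>; Cod C g = \<sigma>'|] ==>
  (f|>\<sigma>')\<cdot>(\<rho><|g) = (\<rho>'<|g)\<cdot>(f|>\<sigma>)"
 by (auto simp: interch)

text \<open>An equation between composites of two arrows, in the form that rewrites the head of a longer
 right-nested composite.\<close>

lemma cmp_eq_cmp:
 "[|g\<cdot>f = h; g \<in> Arr C; f \<in> Arr C; z \<in> Arr C; Dom C g = Cod C f; Dom C f = Cod C z|]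
  ==> g\<cdot>(f\<cdot>z) = h\<cdot>z"
 using cmp_cmp[of g f z] by simp

subsection \<open>Linear structure of the arrow spaces\<close>

lemma hom_cvs: "[|\<rho> \<in> Obj C; \<sigma> \<in> Obj C|] ==> cvs (hom_space C \<rho> \<sigma>)"
 by (simp add: cvs_def vector_space)

lemma arr_cvs: "f \<in> Arr C ==> cvs (hom_space C (Dom C f) (Cod C f))"
 by (simp add: hom_cvs)

lemma arr_mem: "f \<in> Arr C ==> f \<in> Hom C (Dom C f) (Cod C f)"
 by (simp add: in_Hom)

lemma hzero_arr [simp]:
 assumes "\<rho> \<in> Obj C" "\<sigma> \<in> Obj C"
 shows "hzero C \<rho> \<sigma> \<in> Arr C" "Dom C (hzero C \<rho> \<sigma>) = \<rho>" "Cod C (hzero C \<rho> \<sigma>) = \<sigma>"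
proof -
 interpret cvs "hom_space C \<rho> \<sigma>" using assms by (rule hom_cvs)
 show "hzero C \<rho> \<sigma> \<in> Arr C" "Dom C (hzero C \<rho> \<sigma>) = \<rho>" "Cod C (hzero C \<rho> \<sigma>) = \<sigma>"
  using M.zero_closed by (auto simp: in_Hom)
qed

lemma hscale_arr [simp]:
 assumes "f \<in> Arr C"
 shows "hscale C c f \<in> Arr C" "Dom C (hscale C c f) = Dom C f" "Cod C (hscale C c f) = Cod C f"
proof -
 interpret cvs "hom_space C (Dom C f) (Cod C f)" using assms by (rule arr_cvs)
 show "hscale C c f \<in> Arr C" "Dom C (hscale C c f) = Dom C f" "Cod C (hscale C c f) = Cod C f"
  using smult_closed'[of f c] assms by (auto simp: in_Hom)
qed

lemma hadd_arr [simp]: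
 assumes "f \<in> Arr C" "g \<in> Arr C" "Dom C f = Dom C g" "Cod C f = Cod C g"
 shows "hadd C f g \<in> Arr C" "Dom C (hadd C f g) = Dom C g" "Cod C (hadd C f g) = Cod C g"
proof -
 interpret cvs "hom_space C (Dom C g) (Cod C g)" using assms by (intro arr_cvs)
 show "hadd C f g \<in> Arr C" "Dom C (hadd C f g) = Dom C g" "Cod C (hadd C f g) = Cod C g"
  using M.add.m_closed[of f g] assms by (auto simp: in_Hom)
qed

lemma hscale_hscale [simp]: "f \<in> Arr C ==> hscale C c (hscale C d f) = hscale C (c * d) f"
 using cvs.smult_smult[OF arr_cvs arr_mem[folded hom_space_simps(1)]] by simp

lemma hscale_1 [simp]: "f \<in> Arr C ==> hscale C 1 f = f"
 using cvs.smult_1[OF arr_cvs arr_mem[folded hom_space_simps(1)]] by simp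

lemma hscale_0 [simp]: "f \<in> Arr C ==> hscale C 0 f = hzero C (Dom C f) (Cod C f)"
 using cvs.smult_0_l[OF arr_cvs arr_mem[folded hom_space_simps(1)]] by simp

lemma hscale_hzero [simp]: "[|\<rho> \<in> Obj C; \<sigma> \<in> Obj C|] ==> hscale C c (hzero C \<rho> \<sigma>) = hzero C \<rho> \<sigma>"
 using cvs.smult_0_r[OF hom_cvs] by simp

lemma hscale_add: "f \<in> Arr C ==> hscale C (c + d) f = hadd C (hscale C c f) (hscale C d f)"
 using cvs.smult_add_l[OF arr_cvs arr_mem[folded hom_space_simps(1)]] by simp

lemma hscale_hadd:
 assumes "f \<in> Arr C" "g \<in> Arr C" "Dom C f = Dom C g" "Cod C f = Cod C g"
 shows "hscale C c (hadd C f g) = hadd C (hscale C c f) (hscale C c g)"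
 using cvs.smult_add_r[OF arr_cvs, of g f g c] assms by (simp add: in_Hom)

lemma hadd_comm:
 assumes "f \<in> Arr C" "g \<in> Arr C" "Dom C f = Dom C g" "Cod C f = Cod C g"
 shows "hadd C f g = hadd C g f"
proof -
 interpret cvs "hom_space C (Dom C g) (Cod C g)" using assms by (intro arr_cvs)
 show ?thesis using M.a_comm[of f g] assms by (simp add: in_Hom)
qed

lemma hadd_assoc:
 assumes "f \<in> Arr C" "g \<in> Arr C" "h \<in> Arr C" "Dom C f = Dom C g" "Cod C f = Cod C g"
  "Dom C g = Dom C h" "Cod C g = Cod C h"
 shows "hadd C (hadd C f g) h = hadd C f (hadd C g h)"
proof -
 interpret cvs "hom_space C (Dom C g) (Cod C g)" using assms by (intro arr_cvs)
 show ?thesis using M.a_assoc[of f g h] assms by (simp add: in_Hom)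
qed

lemma hadd_hzero [simp]:
 "[|f \<in> Arr C; Dom C f = \<rho>; Cod C f = \<sigma>|] ==> hadd C f (hzero C \<rho> \<sigma>) = f"
 "[|f \<in> Arr C; Dom C f = \<rho>; Cod C f = \<sigma>|] ==> hadd C (hzero C \<rho> \<sigma>) f = f"
proof -
 assume a: "f \<in> Arr C" "Dom C f = \<rho>" "Cod C f = \<sigma>"
 interpret cvs "hom_space C \<rho> \<sigma>" using arr_cvs[of f] a by simp
 from a show "hadd C f (hzero C \<rho> \<sigma>) = f" "hadd C (hzero C \<rho> \<sigma>) f = f"
  using M.l_zero[of f] M.r_zero[of f] by (auto simp: in_Hom)
qed

lemma hadd_neg [simp]: "f \<in> Arr C ==> hadd C f (hscale C (-1) f) = hzero C (Dom C f) (Cod C f)"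
 using hscale_add[of f 1 "-1"] by simp

lemma hdiff_eq_0D:
 assumes "hadd C f (hscale C (-1) g) = hzero C \<rho> \<sigma>" "f \<in> Hom C \<rho> \<sigma>" "g \<in> Hom C \<rho> \<sigma>"
 shows "f = g"
 using cvs.diff_eq_0D[OF hom_cvs, of \<rho> \<sigma> f g] assms Hom_obj[OF assms(2)] by simp

lemma hscale_eq_0D:
 assumes "hscale C c f = hzero C \<rho> \<sigma>" "f \<in> Hom C \<rho> \<sigma>"
 shows "c = 0 \<or> f = hzero C \<rho> \<sigma>"
 using cvs.smult_eq_0_iff[OF hom_cvs, of \<rho> \<sigma> f c] assms Hom_obj[OF assms(2)] by simp

lemma hminus_eq:
 assumes "f \<in> Hom C \<rho> \<sigma>" "g \<in> Hom C \<rho> \<sigma>"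
 shows "f \<ominus>\<^bsub>hom_space C \<rho> \<sigma>\<^esub> g = hadd C f (hscale C (-1) g)"
 using cvs.a_inv_smult[OF hom_cvs, of \<rho> \<sigma> g] assms Hom_obj[OF assms(1)]
 by (simp add: a_minus_def)

lemma cmp_hscale [simp]:
 "[|g \<in> Arr C; f \<in> Arr C; Dom C g = Cod C f|] ==> hscale C c g\<cdot>f = hscale C c (g\<cdot>f)"
 "[|g \<in> Arr C; f \<in> Arr C; Dom C g = Cod C f|] ==> g\<cdot>hscale C c f = hscale C c (g\<cdot>f)"
 using cmp_scale[of g "Dom C g" "Cod C g" f "Dom C f" c] by (auto simp: in_Hom)

lemma tar_hscale [simp]:
 "[|g \<in> Arr C; f \<in> Arr C|] ==> hscale C c g \<boxtimes> f = hscale C c (g \<boxtimes> f)"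
 "[|g \<in> Arr C; f \<in> Arr C|] ==> g \<boxtimes> hscale C c f = hscale C c (g \<boxtimes> f)"
 using tar_scale[of g f c] by auto

lemma cmp_hadd:
 "[|g \<in> Arr C; g' \<in> Arr C; f \<in> Arr C; Dom C g = Cod C f; Dom C g' = Cod C f; Cod C g = Cod C g'|]
  ==> hadd C g g'\<cdot>f = hadd C (g\<cdot>f) (g'\<cdot>f)"
 "[|g \<in> Arr C; f \<in> Arr C; f' \<in> Arr C; Dom C g = Cod C f; Cod C f = Cod C f'; Dom C f = Dom C f'|]
  ==> g\<cdot>hadd C f f' = hadd C (g\<cdot>f) (g\<cdot>f')"
 using cmp_add_left[of g "Dom C g" "Cod C g" g' f "Dom C f"]
  cmp_add_right[of g "Dom C g" "Cod C g" f "Dom C f" f'] by (auto simp: in_Hom)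

lemma tar_hadd:
 "[|g \<in> Arr C; g' \<in> Arr C; f \<in> Arr C; Dom C g = Dom C g'; Cod C g = Cod C g'|]
  ==> hadd C g g' \<boxtimes> f = hadd C (g \<boxtimes> f) (g' \<boxtimes> f)"
 "[|g \<in> Arr C; f \<in> Arr C; f' \<in> Arr C; Dom C f = Dom C f'; Cod C f = Cod C f'|]
  ==> g \<boxtimes> hadd C f f' = hadd C (g \<boxtimes> f) (g \<boxtimes> f')"
 using tar_add_left[of g "Dom C g" "Cod C g" g' f] tar_add_right[of g f "Dom C f" "Cod C f" f']
 by (auto simp: in_Hom)

lemma cmp_hzero [simp]:
 "[|\<rho> \<in> Obj C; f \<in> Arr C; Dom C f = \<sigma>|] ==> f\<cdot>hzero C \<rho> \<sigma> = hzero C \<rho> (Cod C f)"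
 "[|\<tau> \<in> Obj C; f \<in> Arr C; Cod C f = \<sigma>|] ==> hzero C \<sigma> \<tau>\<cdot>f = hzero C (Dom C f) \<tau>"
proof -
 assume a: "\<rho> \<in> Obj C" "f \<in> Arr C" "Dom C f = \<sigma>"
 then have "\<sigma> \<in> Obj C" using Dom_obj by blast
 with a show "f\<cdot>hzero C \<rho> \<sigma> = hzero C \<rho> (Cod C f)"
  using cmp_hscale(2)[of f "hzero C \<rho> \<sigma>" 0] by simp
next
 assume a: "\<tau> \<in> Obj C" "f \<in> Arr C" "Cod C f = \<sigma>"
 then have "\<sigma> \<in> Obj C" using Cod_obj by blast
 with a show "hzero C \<sigma> \<tau>\<cdot>f = hzero C (Dom C f) \<tau>"
  using cmp_hscale(1)[of "hzero C \<sigma> \<tau>" f 0] by simp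
qed

lemma tar_hzero [simp]:
 "[|\<rho> \<in> Obj C; \<sigma> \<in> Obj C; f \<in> Arr C|] ==> f \<boxtimes> hzero C \<rho> \<sigma> = hzero C (Dom C f\<boxdot>\<rho>) (Cod C f\<boxdot>\<sigma>)"
 "[|\<rho> \<in> Obj C; \<sigma> \<in> Obj C; f \<in> Arr C|] ==> hzero C \<rho> \<sigma> \<boxtimes> f = hzero C (\<rho>\<boxdot>Dom C f) (\<sigma>\<boxdot>Cod C f)"
 using tar_hscale(2)[of f "hzero C \<rho> \<sigma>" 0] tar_hscale(1)[of "hzero C \<rho> \<sigma>" f 0] by simp_all

lemma hsum_empty [simp]: "[|\<rho> \<in> Obj C; \<sigma> \<in> Obj C|] ==> hsum C \<rho> \<sigma> f {} = hzero C \<rho> \<sigma>"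
proof -
 assume "\<rho> \<in> Obj C" "\<sigma> \<in> Obj C"
 then interpret cvs "hom_space C \<rho> \<sigma>" by (rule hom_cvs)
 show ?thesis by simp
qed

lemma hsum_insert [simp]:
 assumes "\<rho> \<in> Obj C" "\<sigma> \<in> Obj C" "finite A" "a \<notin> A" "f \<in> A \<rightarrow> Hom C \<rho> \<sigma>" "f a \<in> Hom C \<rho> \<sigma>"
 shows "hsum C \<rho> \<sigma> f (insert a A) = hadd C (f a) (hsum C \<rho> \<sigma> f A)"
proof -
 interpret cvs "hom_space C \<rho> \<sigma>" using assms by (intro hom_cvs)
 show ?thesis using assms M.finsum_insert[of A a f] by simp
qed

lemma hsum_hom:
 assumes "\<rho> \<in> Obj C" "\<sigma> \<in> Obj C" "f \<in> A \<rightarrow> Hom C \<rho> \<sigma>"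
 shows "hsum C \<rho> \<sigma> f A \<in> Hom C \<rho> \<sigma>"
proof -
 interpret cvs "hom_space C \<rho> \<sigma>" using assms by (intro hom_cvs)
 show ?thesis using assms M.finsum_closed[of f A] by simp
qed

lemmas hsum_arr = hsum_hom[unfolded in_Hom]

lemma hsum_cong:
 assumes "\<rho> \<in> Obj C" "\<sigma> \<in> Obj C" "g \<in> A \<rightarrow> Hom C \<rho> \<sigma>" "!!i. i \<in> A ==> f i = g i"
 shows "hsum C \<rho> \<sigma> f A = hsum C \<rho> \<sigma> g A"
proof -
 interpret cvs "hom_space C \<rho> \<sigma>" using assms by (intro hom_cvs)
 show ?thesis using assms by (intro M.finsum_cong') auto
qed

lemma hsum_0:
 assumes "\<rho> \<in> Obj C" "\<sigma> \<in> Obj C" "!!i. i \<in> A ==> f i = hzero C \<rho> \<sigma>"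
 shows "hsum C \<rho> \<sigma> f A = hzero C \<rho> \<sigma>"
proof -
 interpret cvs "hom_space C \<rho> \<sigma>" using assms by (intro hom_cvs)
 show ?thesis using assms M.add.finprod_one_eqI[of A f] by simp
qed

text \<open>All the operations on arrows are additive, hence commute with finite sums.\<close>

lemma hsum_additive:
 assumes "finite A" "f \<in> A \<rightarrow> Hom C \<rho> \<sigma>" "\<rho> \<in> Obj C" "\<sigma> \<in> Obj C" "\<rho>' \<in> Obj C" "\<sigma>' \<in> Obj C"
  and L0: "L (hzero C \<rho> \<sigma>) = hzero C \<rho>' \<sigma>'"
  and Lh: "!!x. x \<in> Hom C \<rho> \<sigma> ==> L x \<in> Hom C \<rho>' \<sigma>'"
  and La: "!!x y. [|x \<in> Hom C \<rho> \<sigma>; y \<in> Hom C \<rho> \<sigma>|] ==> L (hadd C x y) = hadd C (L x) (L y)"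
 shows "L (hsum C \<rho> \<sigma> f A) = hsum C \<rho>' \<sigma>' (%i. L (f i)) A"
 using assms(1,2)
proof induct
 case empty
 then show ?case using assms by simp
next
 case (insert a A)
 then have "hsum C \<rho> \<sigma> f A \<in> Hom C \<rho> \<sigma>" using assms by (intro hsum_hom) auto
 moreover have "(%i. L (f i)) \<in> A \<rightarrow> Hom C \<rho>' \<sigma>'" using insert Lh by auto
 ultimately show ?case using insert assms by simp
qed

lemma cmp_hsum:
 assumes "finite A" "f \<in> A \<rightarrow> Hom C \<rho> \<sigma>" "\<rho> \<in> Obj C" "g \<in> Hom C \<sigma> \<tau>"
 shows "g\<cdot>hsum C \<rho> \<sigma> f A = hsum C \<rho> \<tau> (%i. g\<cdot>f i) A"
 by (rule hsum_additive) (use assms Hom_obj[OF assms(4)] in "auto simp: in_Hom cmp_hadd")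

lemma hsum_cmp:
 assumes "finite A" "f \<in> A \<rightarrow> Hom C \<sigma> \<tau>" "\<tau> \<in> Obj C" "g \<in> Hom C \<rho> \<sigma>"
 shows "hsum C \<sigma> \<tau> f A\<cdot>g = hsum C \<rho> \<tau> (%i. f i\<cdot>g) A"
 by (rule hsum_additive[where L = "%x. x\<cdot>g"])
  (use assms Hom_obj[OF assms(4)] in "auto simp: in_Hom cmp_hadd")

lemma isomorphic_sym: "isomorphic C \<rho> \<sigma> ==> isomorphic C \<sigma> \<rho>"
 by (auto simp: isomorphic_def)

lemma isomorphic_refl: "\<rho> \<in> Obj C ==> isomorphic C \<rho> \<rho>"
 by (auto simp: isomorphic_def in_Hom intro!: bexI[of _ "idn C \<rho>"])

lemma isomorphic_trans:
 assumes "isomorphic C \<rho> \<sigma>" "isomorphic C \<sigma> \<tau>"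
 shows "isomorphic C \<rho> \<tau>"
proof -
 obtain f g h k where f: "f \<in> Hom C \<rho> \<sigma>" "g \<in> Hom C \<sigma> \<rho>" "g\<cdot>f = idn C \<rho>" "f\<cdot>g = idn C \<sigma>"
  and h: "h \<in> Hom C \<sigma> \<tau>" "k \<in> Hom C \<tau> \<sigma>" "k\<cdot>h = idn C \<sigma>" "h\<cdot>k = idn C \<tau>"
  using assms by (auto simp: isomorphic_def)
 note [simp] = HomD[OF f(1)] HomD[OF f(2)] HomD[OF h(1)] HomD[OF h(2)]
 have "(g\<cdot>k)\<cdot>(h\<cdot>f) = g\<cdot>((k\<cdot>h)\<cdot>f)" "(h\<cdot>f)\<cdot>(g\<cdot>k) = h\<cdot>((f\<cdot>g)\<cdot>k)" by simp_all
 then have "(g\<cdot>k)\<cdot>(h\<cdot>f) = idn C \<rho>" "(h\<cdot>f)\<cdot>(g\<cdot>k) = idn C \<tau>"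
  using f(3,4) h(3,4) by (simp_all del: cmp_cmp)
 then show ?thesis unfolding isomorphic_def
  by (intro bexI[of _ "h\<cdot>f"] bexI[of _ "g\<cdot>k"] conjI) (simp_all add: in_Hom)
qed

lemma iso_class_eq_iff:
 assumes "\<rho> \<in> Obj C" "\<sigma> \<in> Obj C"
 shows "iso_class C \<rho> = iso_class C \<sigma> \<longleftrightarrow> isomorphic C \<rho> \<sigma>"
proof
 assume "iso_class C \<rho> = iso_class C \<sigma>"
 moreover have "\<rho> \<in> iso_class C \<rho>" using assms isomorphic_refl by (auto simp: iso_class_def)
 ultimately show "isomorphic C \<rho> \<sigma>" using isomorphic_sym by (auto simp: iso_class_def)
next
 assume "isomorphic C \<rho> \<sigma>"
 then show "iso_class C \<rho> = iso_class C \<sigma>"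
  by (auto simp: iso_class_def intro: isomorphic_trans isomorphic_sym)
qed

end

context tensor_category_with_star
begin

lemma star_arr [simp]:
 assumes "f \<in> Arr C"
 shows "f\<dagger> \<in> Arr C" "Dom C (f\<dagger>) = Cod C f" "Cod C (f\<dagger>) = Dom C f"
 using star_hom[of f "Dom C f" "Cod C f"] assms by (auto simp: in_Hom)

declare star_star [simp] star_tar [simp] star_scale [simp]

lemma star_cmp_arr [simp]:
 "[|g \<in> Arr C; f \<in> Arr C; Dom C g = Cod C f|] ==> (g\<cdot>f)\<dagger> = f\<dagger>\<cdot>g\<dagger>"
 by (rule star_cmp) (auto simp: in_Hom)

lemma star_hadd [simp]:
 "[|f \<in> Arr C; g \<in> Arr C; Dom C f = Dom C g; Cod C f = Cod C g|] ==>
  (hadd C f g)\<dagger> = hadd C (f\<dagger>) (g\<dagger>)"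
 by (rule star_add) (auto simp: in_Hom)

lemma star_idn [simp]: "\<rho> \<in> Obj C ==> (idn C \<rho>)\<dagger> = idn C \<rho>"
 using star_cmp_arr[of "(idn C \<rho>)\<dagger>" "idn C \<rho>"] by simp

lemma star_hzero [simp]: "[|\<rho> \<in> Obj C; \<sigma> \<in> Obj C|] ==> (hzero C \<rho> \<sigma>)\<dagger> = hzero C \<sigma> \<rho>"
 using star_scale[of "hzero C \<rho> \<sigma>" 0] by simp

lemma direct_sum_orthogonal:
 assumes V: "isometry C \<rho> \<tau> V" and W: "isometry C \<sigma> \<tau> W"
  and s: "hadd C (V\<cdot>V\<dagger>) (W\<cdot>W\<dagger>) = idn C \<tau>"
 shows "V\<dagger>\<cdot>W = hzero C \<sigma> \<rho>" "W\<dagger>\<cdot>V = hzero C \<rho> \<sigma>"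
proof -
 have VH: "V \<in> Hom C \<rho> \<tau>" "W \<in> Hom C \<sigma> \<tau>" using V W by (auto simp: isometry_def)
 note [simp] = HomD[OF VH(1)] HomD[OF VH(2)]
 have [simp]: "\<rho> \<in> Obj C" "\<sigma> \<in> Obj C" "\<tau> \<in> Obj C" using Hom_obj VH by auto
 have e: "V\<dagger>\<cdot>V = idn C \<rho>" "W\<dagger>\<cdot>W = idn C \<sigma>" using V W by (auto simp: isometry_def)
 have [simp]: "V\<dagger>\<cdot>(V\<cdot>z) = z" if "z \<in> Arr C" "Cod C z = \<rho>" for z
  using cmp_eq_cmp[OF e(1), of z] that by simp
 have "V\<dagger>\<cdot>W = V\<dagger>\<cdot>(hadd C (V\<cdot>V\<dagger>) (W\<cdot>W\<dagger>)\<cdot>W)" by (simp add: s)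
 also have "\<dots> = hadd C (V\<dagger>\<cdot>W) (V\<dagger>\<cdot>W)" by (simp add: cmp_hadd e)
 finally have "hadd C (V\<dagger>\<cdot>W) (hscale C (-1) (V\<dagger>\<cdot>W)) =
   hadd C (hadd C (V\<dagger>\<cdot>W) (V\<dagger>\<cdot>W)) (hscale C (-1) (V\<dagger>\<cdot>W))" by simp
 also have "\<dots> = V\<dagger>\<cdot>W" by (subst hadd_assoc) simp_all
 finally show *: "V\<dagger>\<cdot>W = hzero C \<sigma> \<rho>" by simp
 have "W\<dagger>\<cdot>V = (V\<dagger>\<cdot>W)\<dagger>" by simp
 then show "W\<dagger>\<cdot>V = hzero C \<rho> \<sigma>" by (simp only: * star_hzero \<open>\<rho> \<in> Obj C\<close> \<open>\<sigma> \<in> Obj C\<close>)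
qed

lemma isometryD:
 assumes "isometry C \<rho> \<sigma> V"
 shows "V \<in> Arr C" "Dom C V = \<rho>" "Cod C V = \<sigma>" "V\<dagger>\<cdot>V = idn C \<rho>" "\<rho> \<in> Obj C" "\<sigma> \<in> Obj C"
  "!!z. [|z \<in> Arr C; Cod C z = \<rho>|] ==> V\<dagger>\<cdot>(V\<cdot>z) = z"
proof -
 show V: "V \<in> Arr C" "Dom C V = \<rho>" "Cod C V = \<sigma>" "V\<dagger>\<cdot>V = idn C \<rho>"
  using assms by (auto simp: isometry_def in_Hom)
 then show "\<rho> \<in> Obj C" "\<sigma> \<in> Obj C" by (metis Dom_obj, metis Cod_obj)
 show "V\<dagger>\<cdot>(V\<cdot>z) = z" if "z \<in> Arr C" "Cod C z = \<rho>" for z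
  using cmp_eq_cmp[OF V(4), of z] that V(1-3) by simp
qed

lemma isometry_cmp:
 assumes "isometry C \<rho> \<sigma> V" "isometry C \<sigma> \<tau> W"
 shows "isometry C \<rho> \<tau> (W\<cdot>V)"
 unfolding isometry_def in_Hom
 by (simp add: isometryD[OF assms(1)] isometryD[OF assms(2)])

lemma star_hsum:
 assumes "finite A" "f \<in> A \<rightarrow> Hom C \<rho> \<sigma>" "\<rho> \<in> Obj C" "\<sigma> \<in> Obj C"
 shows "(hsum C \<rho> \<sigma> f A)\<dagger> = hsum C \<sigma> \<rho> (%i. (f i)\<dagger>) A"
 by (rule hsum_additive) (use assms in "auto simp: in_Hom")

end

section \<open>Irreducible objects and complete reducibility\<close>

definition coef :: "('o, 'm, 'z) tensor_cat_scheme => 'm => complex" where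
 "coef C x = (THE c. x = hscale C c (idn C (Dom C x)))"

text \<open>The square of the Hilbert space norm that \<open>y\<dagger>\<cdot>y'\<close> defines on the arrows out of an
 irreducible object.\<close>

definition sqn :: "('o, 'm, 'z) tensor_cat_scheme => 'm => real" where
 "sqn C y = Re (coef C (y\<dagger>\<^bsub>C\<^esub> \<cdot>\<^bsub>C\<^esub> y))"

definition decomposition :: "('o, 'm, 'z) tensor_cat_scheme => 'o => 'm set => bool" where
 "decomposition C \<rho> Q \<longleftrightarrow> finite Q \<and>
   (\<forall>w\<in>Q. irreducible_obj C (Dom C w) \<and> isometry C (Dom C w) \<rho> w) \<and>
   (\<forall>w\<in>Q. \<forall>w'\<in>Q. w ~= w' \<longrightarrow> w\<dagger>\<^bsub>C\<^esub> \<cdot>\<^bsub>C\<^esub> w' = hzero C (Dom C w') (Dom C w)) \<and>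
   hsum C \<rho> \<rho> (%w. w \<cdot>\<^bsub>C\<^esub> w\<dagger>\<^bsub>C\<^esub>) Q = idn C \<rho>"

context complex_tensor_category
begin

lemma hsum_delta:
 assumes "finite A" "a \<in> A" "x \<in> Hom C \<rho> \<sigma>"
 shows "hsum C \<rho> \<sigma> (%i. if i = a then x else hzero C \<rho> \<sigma>) A = x"
 using cvs.finsum_delta[OF hom_cvs, of \<rho> \<sigma> A a x] Hom_obj[OF assms(3)] assms
 unfolding hom_space_simps by blast

lemma hadd_left_comm:
 assumes "f \<in> Arr C" "g \<in> Arr C" "h \<in> Arr C" "Dom C f = Dom C g" "Cod C f = Cod C g"
  "Dom C g = Dom C h" "Cod C g = Cod C h"
 shows "hadd C f (hadd C g h) = hadd C g (hadd C f h)"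
 using assms hadd_assoc[of f g h] hadd_assoc[of g f h] hadd_comm[of f g] by simp

lemmas hadd_ac = hadd_assoc hadd_comm hadd_left_comm

lemma irreducible_objD: "irreducible_obj C \<tau> ==> \<tau> \<in> Obj C \<and> idn C \<tau> ~= hzero C \<tau> \<tau>"
 by (simp add: irreducible_obj_def)

lemma hscale_idn_inject:
 assumes "irreducible_obj C \<tau>" "hscale C c (idn C \<tau>) = hscale C d (idn C \<tau>)"
 shows "c = d"
proof -
 have [simp]: "\<tau> \<in> Obj C" and nz: "idn C \<tau> ~= hzero C \<tau> \<tau>" using irreducible_objD assms by auto
 have "hscale C (c + (- d)) (idn C \<tau>) = hscale C (d + (- d)) (idn C \<tau>)"
  by (simp only: hscale_add assms(2) idn_arr \<open>\<tau> \<in> Obj C\<close>)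
 then have "hscale C (c - d) (idn C \<tau>) = hzero C \<tau> \<tau>" by simp
 then show ?thesis using hscale_eq_0D[of "c - d" "idn C \<tau>" \<tau> \<tau>] nz by (simp add: in_Hom)
qed

lemma coef_hscale [simp]: "irreducible_obj C \<tau> ==> coef C (hscale C c (idn C \<tau>)) = c"
 unfolding coef_def using irreducible_objD[of \<tau>]
 by (intro the_equality) (auto dest: hscale_idn_inject)

lemma coef: "[|irreducible_obj C \<tau>; x \<in> Arr C; Dom C x = \<tau>; Cod C x = \<tau>|] ==>
  x = hscale C (coef C x) (idn C \<tau>)"
proof -
 assume a: "irreducible_obj C \<tau>" "x \<in> Arr C" "Dom C x = \<tau>" "Cod C x = \<tau>"
 then have "x \<in> range (%c. hscale C c (idn C \<tau>))" by (auto simp: irreducible_obj_def in_Hom)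
 then show ?thesis using a(1) by auto
qed

end

locale summable_category = tensor_star_category +
 assumes has_direct_sums: "has_direct_sums C"
begin

lemma star_positive_arr:
 "[|f\<dagger>\<cdot>f = hzero C \<rho> \<rho>; f \<in> Arr C; Dom C f = \<rho>; Cod C f = \<sigma>|] ==> f = hzero C \<rho> \<sigma>"
 by (rule star_positive) (auto simp: in_Hom)

text \<open>That \<open>y\<dagger>\<cdot>y\<close> is a nonnegative multiple of the identity does not follow from positivity of
 the \<open>*\<close>-operation on \<open>y\<close> alone: if it were \<open>-a\<close> with \<open>a > 0\<close>, the arrow with components \<open>y\<close> and
 \<open>\<surd>a\<close> into a direct sum would violate positivity.\<close>

lemma sqn:
 assumes \<tau>: "irreducible_obj C \<tau>" and y: "y \<in> Arr C" "Dom C y = \<tau>"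
 shows "y\<dagger>\<cdot>y = hscale C (of_real (sqn C y)) (idn C \<tau>)" and "sqn C y \<ge> 0"
  and "sqn C y = 0 \<longleftrightarrow> y = hzero C \<tau> (Cod C y)"
proof -
 note [simp] = y
 have [simp]: "\<tau> \<in> Obj C" using irreducible_objD \<tau> by auto
 have nz: "idn C \<tau> ~= hzero C \<tau> \<tau>" using irreducible_objD \<tau> by auto
 define c where "c = coef C (y\<dagger>\<cdot>y)"
 have yy: "y\<dagger>\<cdot>y = hscale C c (idn C \<tau>)"
  unfolding c_def by (rule coef) (simp_all add: \<tau>)
 have "(y\<dagger>\<cdot>y)\<dagger> = y\<dagger>\<cdot>y" by simp
 then have "hscale C (cnj c) (idn C \<tau>) = hscale C c (idn C \<tau>)" by (simp add: yy)
 then have "cnj c = c" using \<tau> hscale_idn_inject by blast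
 then have c: "c = of_real (sqn C y)" by (simp add: sqn_def c_def complex_is_Real_iff complex_eq_iff)
 with yy show yy': "y\<dagger>\<cdot>y = hscale C (of_real (sqn C y)) (idn C \<tau>)" by simp
 show "sqn C y \<ge> 0"
 proof (rule ccontr)
  assume "\<not> sqn C y \<ge> 0"
  then have r: "sqn C y < 0" by simp
  define s where "s = sqrt (- sqn C y)"
  have s: "s * s = - sqn C y" "s > 0" using r by (simp_all add: s_def)
  define \<rho> where "\<rho> = Cod C y"
  have [simp]: "\<rho> \<in> Obj C" "Cod C y = \<rho>" by (simp_all add: \<rho>_def)
  obtain \<mu> V W where V: "isometry C \<rho> \<mu> V" and W: "isometry C \<tau> \<mu> W"
   and VW: "hadd C (V\<cdot>V\<dagger>) (W\<cdot>W\<dagger>) = idn C \<mu>"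
   using has_direct_sums unfolding has_direct_sums_def direct_sum_def
   by (metis \<open>\<rho> \<in> Obj C\<close> \<open>\<tau> \<in> Obj C\<close>)
  note [simp] = isometryD[OF V] isometryD[OF W]
  note o = direct_sum_orthogonal[OF V W VW]
  have [simp]: "V\<dagger>\<cdot>(W\<cdot>z) = hzero C (Dom C z) \<rho>" if "z \<in> Arr C" "Cod C z = \<tau>" for z
   using cmp_eq_cmp[OF o(1), of z] that by simp
  have [simp]: "W\<dagger>\<cdot>(V\<cdot>z) = hzero C (Dom C z) \<tau>" if "z \<in> Arr C" "Cod C z = \<rho>" for z
   using cmp_eq_cmp[OF o(2), of z] that by simp
  define Z where "Z = hadd C (V\<cdot>y) (hscale C (of_real s) W)"
  have [simp]: "Z \<in> Arr C" "Dom C Z = \<tau>" "Cod C Z = \<mu>" by (simp_all add: Z_def)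
  have "Z\<dagger>\<cdot>Z = hadd C (y\<dagger>\<cdot>y) (hscale C (of_real (s * s)) (idn C \<tau>))"
   by (simp add: Z_def cmp_hadd o)
  also have "\<dots> = hscale C (of_real (sqn C y) + of_real (s * s)) (idn C \<tau>)"
   by (simp only: yy' hscale_add idn_arr \<open>\<tau> \<in> Obj C\<close>)
  also have "\<dots> = hzero C \<tau> \<tau>" by (simp add: s)
  finally have "Z = hzero C \<tau> \<mu>" by (rule star_positive_arr) simp_all
  then have "W\<dagger>\<cdot>Z = hzero C \<tau> \<tau>" by simp
  moreover have "W\<dagger>\<cdot>Z = hscale C (of_real s) (idn C \<tau>)" by (simp add: Z_def cmp_hadd)
  ultimately have "hscale C (of_real s) (idn C \<tau>) = hzero C \<tau> \<tau>" by simp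
  then show False using hscale_eq_0D[of "of_real s" "idn C \<tau>" \<tau> \<tau>] nz s(2) by (simp add: in_Hom)
 qed
 show "sqn C y = 0 \<longleftrightarrow> y = hzero C \<tau> (Cod C y)"
 proof
  assume "sqn C y = 0"
  with yy' have "y\<dagger>\<cdot>y = hzero C \<tau> \<tau>" by simp
  then show "y = hzero C \<tau> (Cod C y)" by (rule star_positive_arr) simp_all
 next
  assume 0: "y = hzero C \<tau> (Cod C y)"
  have "y\<dagger>\<cdot>y = hzero C \<tau> \<tau>" by (subst 0, simp)
  then show "sqn C y = 0"
   using yy' hscale_eq_0D[of "of_real (sqn C y)" "idn C \<tau>" \<tau> \<tau>] nz by (auto simp: in_Hom)
 qed
qed

lemma sqnI:
 assumes "irreducible_obj C \<tau>" "y\<dagger>\<cdot>y = hscale C (of_real c) (idn C \<tau>)"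
 shows "sqn C y = c"
 using assms by (simp add: sqn_def)

lemma sqn_isometry: "irreducible_obj C \<tau> ==> isometry C \<tau> \<rho> y ==> sqn C y = 1"
 by (rule sqnI[of \<tau>]) (auto simp: isometryD irreducible_objD)

lemma sqn_hscale:
 assumes "irreducible_obj C \<tau>" "y \<in> Arr C" "Dom C y = \<tau>"
 shows "sqn C (hscale C c y) = (cmod c)\<^sup>2 * sqn C y"
proof (rule sqnI[OF assms(1)])
 have "complex_of_real ((cmod c)\<^sup>2 * sqn C y) = c * cnj c * of_real (sqn C y)"
  by (simp only: of_real_mult complex_norm_square)
 then show "(hscale C c y)\<dagger>\<cdot>hscale C c y = hscale C (complex_of_real ((cmod c)\<^sup>2 * sqn C y)) (idn C \<tau>)"
  using assms sqn(1)[OF assms] irreducible_objD[OF assms(1)]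
  by (simp del: of_real_mult of_real_power add: mult_ac)
qed

lemma sqn_cmp:
 assumes \<tau>: "irreducible_obj C \<tau>" "irreducible_obj C \<tau>'"
  and [simp]: "b \<in> Arr C" "Dom C b = \<tau>" "Cod C b = \<tau>'" "a \<in> Arr C" "Dom C a = \<tau>'"
 shows "sqn C (a\<cdot>b) = sqn C a * sqn C b"
proof (rule sqnI[OF \<tau>(1)])
 have [simp]: "\<tau> \<in> Obj C" "\<tau>' \<in> Obj C" using irreducible_objD \<tau> by auto
 have "(a\<cdot>b)\<dagger>\<cdot>(a\<cdot>b) = b\<dagger>\<cdot>((a\<dagger>\<cdot>a)\<cdot>b)" by simp
 then show "(a\<cdot>b)\<dagger>\<cdot>(a\<cdot>b) = hscale C (of_real (sqn C a * sqn C b)) (idn C \<tau>)"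
  by (simp del: cmp_cmp add: sqn(1)[OF \<tau>(2)] sqn(1)[OF \<tau>(1)])
qed

text \<open>By \<open>sqn\<close>, an arrow out of an irreducible object is a multiple of an isometry.\<close>

lemma normalize_isometry:
 assumes \<tau>: "irreducible_obj C \<tau>" and y: "y \<in> Arr C" "Dom C y = \<tau>" "y ~= hzero C \<tau> (Cod C y)"
 shows "isometry C \<tau> (Cod C y) (hscale C (of_real (1 / sqrt (sqn C y))) y)" "sqn C y > 0"
proof -
 have [simp]: "\<tau> \<in> Obj C" using irreducible_objD \<tau> by auto
 note s = sqn[OF \<tau> y(1,2)]
 show p: "sqn C y > 0" using s y by linarith
 then have "1 / sqrt (sqn C y) * (1 / sqrt (sqn C y)) * sqn C y = 1" by (simp add: field_simps)
 then have "of_real (1 / sqrt (sqn C y)) * of_real (1 / sqrt (sqn C y)) * of_real (sqn C y) = (1 :: complex)"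
  by (metis of_real_mult of_real_1)
 then show "isometry C \<tau> (Cod C y) (hscale C (of_real (1 / sqrt (sqn C y))) y)"
  using y by (simp add: isometry_def in_Hom s(1))
qed

lemma isometry_irr_unitary:
 assumes \<tau>: "irreducible_obj C \<tau>" "irreducible_obj C \<tau>'" and e: "isometry C \<tau> \<tau>' e"
 shows "e\<cdot>e\<dagger> = idn C \<tau>'"
proof -
 note [simp] = isometryD[OF e]
 define c where "c = coef C (e\<cdot>e\<dagger>)"
 have ee: "e\<cdot>e\<dagger> = hscale C c (idn C \<tau>')"
  unfolding c_def by (rule coef[OF \<tau>(2)]) simp_all
 have "hscale C c (idn C \<tau>) = e\<dagger>\<cdot>(hscale C c (idn C \<tau>')\<cdot>e)" by simp
 also have "\<dots> = e\<dagger>\<cdot>((e\<cdot>e\<dagger>)\<cdot>e)" by (simp only: ee)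
 also have "\<dots> = hscale C 1 (idn C \<tau>)" by simp
 finally have "c = 1" using hscale_idn_inject \<tau>(1) by blast
 with ee show ?thesis by simp
qed

lemma irr_hom_isomorphic:
 assumes \<tau>: "irreducible_obj C \<tau>" "irreducible_obj C \<tau>'" and a: "a \<in> Hom C \<tau> \<tau>'" "a ~= hzero C \<tau> \<tau>'"
 shows "isomorphic C \<tau> \<tau>'"
proof -
 note [simp] = HomD[OF a(1)]
 obtain e where e: "isometry C \<tau> \<tau>' e"
  using normalize_isometry[OF \<tau>(1), of a] a(2) by auto
 note ee = isometryD[OF e] isometry_irr_unitary[OF \<tau> e]
 then show ?thesis unfolding isomorphic_def
  by (intro bexI[of _ e] bexI[of _ "e\<dagger>"]) (auto simp: in_Hom)
qed

end

locale semisimple_category = summable_category +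
 assumes has_subobjects: "has_subobjects C"
  and hom_fin_dim: "[|\<rho> \<in> Obj C; \<sigma> \<in> Obj C|] ==> finite_dimensional (hom_space C \<rho> \<sigma>)"
begin

definition pev :: "'a => 'b => complex poly => 'b" where
 "pev \<rho> h p = foldr (%a x. hadd C (hscale C a (idn C \<rho>)) (h\<cdot>x)) (coeffs p) (hzero C \<rho> \<rho>)"

context
 fixes \<rho> h
 assumes \<rho> [simp]: "\<rho> \<in> Obj C" and h [simp]: "h \<in> Arr C" "Dom C h = \<rho>" "Cod C h = \<rho>"
begin

lemma pev_0 [simp]: "pev \<rho> h 0 = hzero C \<rho> \<rho>"
 by (simp add: pev_def)

lemma pev_pCons: "pev \<rho> h (pCons a p) = hadd C (hscale C a (idn C \<rho>)) (h\<cdot>pev \<rho> h p)"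
 by (auto simp: pev_def coeffs_pCons_eq_cCons cCons_def)

lemma pev_arr [simp]:
 "pev \<rho> h p \<in> Arr C \<and> Dom C (pev \<rho> h p) = \<rho> \<and> Cod C (pev \<rho> h p) = \<rho>"
 by (induct p) (auto simp: pev_pCons)

lemma pev_smult: "pev \<rho> h (smult c p) = hscale C c (pev \<rho> h p)"
 by (induct p) (simp_all add: pev_pCons hscale_hadd)

lemma pev_add: "pev \<rho> h (p + q) = hadd C (pev \<rho> h p) (pev \<rho> h q)"
proof (induct p q rule: poly_induct2)
 case (pCons a p b q)
 then show ?case by (simp add: pev_pCons hscale_add cmp_hadd hadd_ac)
qed simp

lemma pev_sum: "finite A ==> pev \<rho> h (\<Sum>i\<in>A. f i) = hsum C \<rho> \<rho> (%i. pev \<rho> h (f i)) A"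
 by (induct rule: finite_induct) (auto simp: pev_add in_Hom Pi_iff)

text \<open>The powers of \<open>h\<close> lie in a finite-dimensional space, hence are linearly dependent.\<close>

lemma annihilating_poly: "\<exists>p. p ~= 0 \<and> pev \<rho> h p = hzero C \<rho> \<rho>"
proof -
 interpret cvs "hom_space C \<rho> \<rho>" by (simp add: hom_cvs)
 obtain B where B: "spans (hom_space C \<rho> \<rho>) B"
  using hom_fin_dim[of \<rho> \<rho>] by (auto simp: finite_dimensional_def)
 let ?f = "%i::nat. pev \<rho> h (monom 1 i)"
 have "\<exists>c. (\<exists>i\<in>{..card B}. c i ~= 0) \<and> hsum C \<rho> \<rho> (%i. hscale C (c i) (?f i)) {..card B} = hzero C \<rho> \<rho>"
  using linearly_dependent[OF B, of "{..card B}" ?f] unfolding hom_space_simps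
  by (simp add: in_Hom Pi_iff)
 then obtain c where c: "\<exists>i\<in>{..card B}. c i ~= 0"
  "hsum C \<rho> \<rho> (%i. hscale C (c i) (?f i)) {..card B} = hzero C \<rho> \<rho>" by blast
 let ?p = "\<Sum>i\<le>card B. monom (c i) i"
 have "pev \<rho> h ?p = hsum C \<rho> \<rho> (%i. hscale C (c i) (?f i)) {..card B}"
  by (subst pev_sum) (auto simp: smult_monom simp flip: pev_smult)
 moreover obtain i where "i \<le> card B" "c i ~= 0" using c by auto
 then have "coeff ?p i ~= 0" by (simp add: coeff_sum)
 then have "?p ~= 0" by (metis coeff_0)
 ultimately show ?thesis using c(2) by metis
qed

text \<open>A self-adjoint \<open>h\<close> has a spectral projection: if \<open>(X - \<lambda>) q\<close> is the minimal polynomial of \<open>h\<close>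
 then \<open>z = q(h)\<close> is nonzero with \<open>h z = \<lambda> z\<close>, so that \<open>z\<dagger> z\<close> is a multiple of \<open>z\<close>; this makes a
 multiple of \<open>z\<close> a projection.\<close>

lemma spectral_projection:
 assumes nz: "idn C \<rho> ~= hzero C \<rho> \<rho>" and sa: "h\<dagger> = h"
 shows "\<exists>l e. projection C \<rho> e \<and> e ~= hzero C \<rho> \<rho> \<and> h\<cdot>e = hscale C l e"
proof -
 obtain p where p: "p ~= 0" "pev \<rho> h p = hzero C \<rho> \<rho>"
  and least: "!!q. [|q ~= 0; pev \<rho> h q = hzero C \<rho> \<rho>|] ==> degree p \<le> degree q"
  using annihilating_poly ex_has_least_nat[of "%p. p ~= 0 \<and> pev \<rho> h p = hzero C \<rho> \<rho>" _ degree] by blast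
 have "degree p ~= 0"
 proof
  assume "degree p = 0"
  then obtain a where a: "p = [:a:]" by (meson degree_eq_zeroE)
  with p have "hscale C a (idn C \<rho>) = hzero C \<rho> \<rho>" "a ~= 0" by (auto simp: pev_pCons)
  then show False using hscale_eq_0D[of a "idn C \<rho>" \<rho> \<rho>] nz by (simp add: in_Hom)
 qed
 then obtain l where "poly p l = 0"
  using fundamental_theorem_of_algebra[of p] constant_degree[of p] by auto
 then obtain q where q: "p = [:- l, 1:] * q" by (metis poly_eq_0_iff_dvd dvdE)
 then have q0: "q ~= 0" using p by auto
 have "degree p = degree [:- l, 1:] + degree q"
  unfolding q by (intro degree_mult_eq) (use q0 in simp_all)
 then have z0: "pev \<rho> h q ~= hzero C \<rho> \<rho>" using least[OF q0] by force
 define z where "z = pev \<rho> h q"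
 have [simp]: "z \<in> Arr C" "Dom C z = \<rho>" "Cod C z = \<rho>" by (simp_all add: z_def)
 have "p = smult (- l) q + pCons 0 q" using q by simp
 then have "pev \<rho> h (smult (- l) q + pCons 0 q) = hzero C \<rho> \<rho>" using p(2) by metis
 then have "hadd C (pev \<rho> h (smult (- l) q)) (pev \<rho> h (pCons 0 q)) = hzero C \<rho> \<rho>"
  by (simp only: pev_add)
 then have "hadd C (hscale C (- l) z) (h\<cdot>z) = hzero C \<rho> \<rho>"
  by (simp only: pev_smult) (simp add: pev_pCons z_def)
 then have "hadd C (h\<cdot>z) (hscale C (- 1) (hscale C l z)) = hzero C \<rho> \<rho>"
  by (subst hadd_comm) simp_all
 then have hz: "h\<cdot>z = hscale C l z" by (rule hdiff_eq_0D) (simp_all add: in_Hom)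
 have "\<exists>c. (pev \<rho> h r)\<dagger>\<cdot>z = hscale C c z" for r
 proof (induct r)
  case 0
  show ?case by (rule exI[of _ 0]) simp
 next
  case (pCons a r)
  then obtain c where c: "(pev \<rho> h r)\<dagger>\<cdot>z = hscale C c z" by blast
  have "(pev \<rho> h (pCons a r))\<dagger>\<cdot>z = hadd C (hscale C (cnj a) z) ((pev \<rho> h r)\<dagger>\<cdot>(h\<cdot>z))"
   by (simp add: pev_pCons cmp_hadd sa)
  also have "\<dots> = hadd C (hscale C (cnj a) z) (hscale C (l * c) z)" by (simp add: hz c)
  finally show ?case by (auto simp flip: hscale_add)
 qed
 then obtain c where c: "z\<dagger>\<cdot>z = hscale C c z" unfolding z_def by blast
 have c0: "c ~= 0"
 proof
  assume "c = 0"
  with c have "z\<dagger>\<cdot>z = hzero C \<rho> \<rho>" by simp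
  then have "z = hzero C \<rho> \<rho>" by (rule star_positive_arr) simp_all
  with z0 show False by (simp add: z_def)
 qed
 have "(z\<dagger>\<cdot>z)\<dagger> = z\<dagger>\<cdot>z" by simp
 then have "hscale C (cnj c) (z\<dagger>) = hscale C c z" by (simp add: c)
 then have "hscale C (inverse (cnj c)) (hscale C (cnj c) (z\<dagger>)) = hscale C (inverse (cnj c)) (hscale C c z)"
  by simp
 then have zd: "z\<dagger> = hscale C (inverse (cnj c) * c) z" using c0 by simp
 have "hscale C (inverse c * cnj c) (z\<dagger>\<cdot>z) = hscale C (inverse c * cnj c) (hscale C c z)"
  by (simp only: c)
 then have zz: "z\<cdot>z = hscale C (cnj c) z" using c0 by (simp add: zd field_simps)
 let ?e = "hscale C (inverse (cnj c)) z"
 have "projection C \<rho> ?e"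
  using c0 by (simp add: projection_def in_Hom zz zd field_simps)
 moreover have "?e ~= hzero C \<rho> \<rho>"
  using hscale_eq_0D[of "inverse (cnj c)" z \<rho> \<rho>] c0 z0 by (auto simp: in_Hom z_def)
 moreover have "h\<cdot>?e = hscale C l ?e" by (simp add: hz mult.commute)
 ultimately show ?thesis by blast
qed

end

text \<open>A non-scalar arrow has a non-scalar real or imaginary part, and a spectral projection of the latter
 is neither zero nor the identity.\<close>

lemma nontrivial_projection:
 assumes [simp]: "\<rho> \<in> Obj C" and nz: "idn C \<rho> ~= hzero C \<rho> \<rho>" and red: "\<not> irreducible_obj C \<rho>"
 shows "\<exists>e. projection C \<rho> e \<and> e ~= hzero C \<rho> \<rho> \<and> e ~= idn C \<rho>"
proof -
 have "range (%c. hscale C c (idn C \<rho>)) \<subseteq> Hom C \<rho> \<rho>" by (auto simp: in_Hom)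
 then obtain x where x: "x \<in> Hom C \<rho> \<rho>" "!!c. x ~= hscale C c (idn C \<rho>)"
  using red nz unfolding irreducible_obj_def by (metis \<open>\<rho> \<in> Obj C\<close> equalityI rangeI subsetI)
 note [simp] = HomD[OF x(1)]
 \<comment> \<open>multiples of the real and imaginary parts of \<open>x\<close>\<close>
 define h1 where "h1 = hadd C x (x\<dagger>)"
 define h2 where "h2 = hadd C (hscale C \<i> x) (hscale C (- \<i>) (x\<dagger>))"
 have [simp]: "h1 \<in> Arr C" "Dom C h1 = \<rho>" "Cod C h1 = \<rho>" "h2 \<in> Arr C" "Dom C h2 = \<rho>" "Cod C h2 = \<rho>"
  by (simp_all add: h1_def h2_def)
 have sa: "h1\<dagger> = h1" "h2\<dagger> = h2"
  by (simp_all add: h1_def h2_def hadd_comm)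
 have "hadd C h1 (hscale C (- \<i>) h2) = hscale C 2 x"
 proof -
  have "hscale C (- \<i>) h2 = hadd C x (hscale C (- 1) (x\<dagger>))"
   by (simp add: h2_def hscale_hadd)
  then have "hadd C h1 (hscale C (- \<i>) h2) = hadd C (hadd C x (x\<dagger>)) (hadd C (hscale C (- 1) (x\<dagger>)) x)"
   by (simp add: h1_def hadd_comm)
  also have "\<dots> = hadd C x (hadd C (hadd C (x\<dagger>) (hscale C (-1) (x\<dagger>))) x)"
   by (simp only: hadd_assoc hadd_arr hscale_arr star_arr HomD[OF x(1)])
  also have "\<dots> = hscale C (1 + 1) x" by (subst hscale_add) simp_all
  finally show ?thesis by simp
 qed
 then have xe: "x = hscale C (1/2) (hadd C h1 (hscale C (- \<i>) h2))" by simp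
 have "\<exists>h. h \<in> Arr C \<and> Dom C h = \<rho> \<and> Cod C h = \<rho> \<and> h\<dagger> = h \<and> (\<forall>c. h ~= hscale C c (idn C \<rho>))"
 proof (rule ccontr)
  assume "\<not> ?thesis"
  then have sc: "\<exists>c. h = hscale C c (idn C \<rho>)"
   if "h \<in> Arr C" "Dom C h = \<rho>" "Cod C h = \<rho>" "h\<dagger> = h" for h
   using that by blast
  obtain a where a: "h1 = hscale C a (idn C \<rho>)" using sc[of h1] sa by auto
  obtain b where b: "h2 = hscale C b (idn C \<rho>)" using sc[of h2] sa by auto
  have "x = hscale C (1/2 * (a - \<i> * b)) (idn C \<rho>)"
   using xe by (simp add: a b flip: hscale_add)
  with x(2) show False by blast
 qed
 then obtain h where h: "h \<in> Arr C" "Dom C h = \<rho>" "Cod C h = \<rho>" "h\<dagger> = h"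
  and ns: "!!c. h ~= hscale C c (idn C \<rho>)" by blast
 from spectral_projection[OF assms(1) h(1-3) nz h(4)] obtain l e
  where e: "projection C \<rho> e" "e ~= hzero C \<rho> \<rho>" "h\<cdot>e = hscale C l e" by blast
 then have "e ~= idn C \<rho>" using ns h by auto
 with e show ?thesis by blast
qed

definition orthogonal_projections :: "'a => 'b set => bool" where
 "orthogonal_projections \<rho> P \<longleftrightarrow> finite P \<and>
   (\<forall>e\<in>P. projection C \<rho> e \<and> e ~= hzero C \<rho> \<rho>) \<and> (\<forall>e\<in>P. \<forall>f\<in>P. e ~= f \<longrightarrow> e\<cdot>f = hzero C \<rho> \<rho>)"

lemma projectionD:
 assumes "projection C \<rho> e"
 shows "e \<in> Arr C" "Dom C e = \<rho>" "Cod C e = \<rho>" "e\<dagger> = e" "e\<cdot>e = e"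
 using assms by (auto simp: projection_def in_Hom)

text \<open>Nonzero orthogonal projections are linearly independent.\<close>

lemma card_orthogonal_projections:
 assumes \<rho>[simp]: "\<rho> \<in> Obj C" and B: "spans (hom_space C \<rho> \<rho>) B" and P: "orthogonal_projections \<rho> P"
 shows "card P \<le> card B"
proof (rule ccontr)
 assume "\<not> card P \<le> card B"
 then have c: "card B < card P" by simp
 have P': "finite P" "!!e. e \<in> P ==> projection C \<rho> e" "!!e. e \<in> P ==> e ~= hzero C \<rho> \<rho>"
  and o: "!!e f. [|e \<in> P; f \<in> P; e ~= f|] ==> e\<cdot>f = hzero C \<rho> \<rho>"
  using P by (auto simp: orthogonal_projections_def)
 have m: "e \<in> Hom C \<rho> \<rho>" if "e \<in> P" for e using P'(2)[OF that] by (simp add: projection_def)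
 note [simp] = HomD[OF m]
 obtain c e where ce: "e \<in> P" "c e ~= 0" and s: "hsum C \<rho> \<rho> (%e. hscale C (c e) e) P = hzero C \<rho> \<rho>"
  using cvs.linearly_dependent[OF hom_cvs B P'(1) c, of "%e. e"] m by auto
 have "hzero C \<rho> \<rho> = e\<cdot>hsum C \<rho> \<rho> (%e. hscale C (c e) e) P" using ce by (simp add: s)
 also have "\<dots> = hsum C \<rho> \<rho> (%f. e\<cdot>hscale C (c f) f) P"
  by (rule cmp_hsum) (use P'(1) m[OF ce(1)] in "auto simp: in_Hom")
 also have "\<dots> = hsum C \<rho> \<rho> (%f. if f = e then hscale C (c e) e else hzero C \<rho> \<rho>) P"
  using ce o projectionD(5)[OF P'(2)[OF ce(1)]] by (intro hsum_cong) (auto simp: in_Hom)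
 also have "\<dots> = hscale C (c e) e"
  using ce by (intro hsum_delta P'(1)) (simp_all add: in_Hom)
 finally show False using hscale_eq_0D[of "c e" e \<rho> \<rho>] ce P'(3) m by auto
qed

lemma isometries_orthogonal:
 assumes v: "isometry C \<sigma> \<rho> v" and u: "isometry C \<sigma>' \<rho> u"
  and o: "(v\<cdot>v\<dagger>)\<cdot>(u\<cdot>u\<dagger>) = hzero C \<rho> \<rho>"
 shows "v\<dagger>\<cdot>u = hzero C \<sigma>' \<sigma>"
proof -
 note [simp] = isometryD[OF v] isometryD[OF u]
 have "v\<dagger>\<cdot>u = v\<dagger>\<cdot>(((v\<cdot>v\<dagger>)\<cdot>(u\<cdot>u\<dagger>))\<cdot>u)" by simp
 also have "\<dots> = hzero C \<sigma>' \<sigma>" unfolding o by simp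
 finally show ?thesis .
qed

text \<open>Complete reducibility: an orthogonal family of nonzero projections of maximal size sums to the
 identity, and none of its members splits, so that the corresponding subobjects are irreducible.\<close>

lemma decomposition_exists:
 assumes \<rho>[simp]: "\<rho> \<in> Obj C"
 shows "\<exists>Q. decomposition C \<rho> Q"
proof -
 obtain B where B: "spans (hom_space C \<rho> \<rho>) B"
  using hom_fin_dim[of \<rho> \<rho>] by (auto simp: finite_dimensional_def)
 have "orthogonal_projections \<rho> {}" by (simp add: orthogonal_projections_def)
 then obtain P where P: "orthogonal_projections \<rho> P"
  and max: "!!P'. orthogonal_projections \<rho> P' ==> card P' \<le> card P"
  using ex_has_greatest_nat[of "orthogonal_projections \<rho>" "{}" card "Suc (card B)"]
   card_orthogonal_projections[OF \<rho> B] le_imp_less_Suc by metis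
 have P': "finite P" "!!e. e \<in> P ==> projection C \<rho> e" "!!e. e \<in> P ==> e ~= hzero C \<rho> \<rho>"
  and o: "!!e f. [|e \<in> P; f \<in> P; e ~= f|] ==> e\<cdot>f = hzero C \<rho> \<rho>"
  using P by (auto simp: orthogonal_projections_def)
 have m: "e \<in> Hom C \<rho> \<rho>" if "e \<in> P" for e using P'(2)[OF that] by (simp add: projection_def)
 note [simp] = HomD[OF m] and ee[simp] = projectionD(4,5)[OF P'(2)]
 define s where "s = hsum C \<rho> \<rho> (%e. e) P"
 have s[simp]: "s \<in> Arr C" "Dom C s = \<rho>" "Cod C s = \<rho>"
  using hsum_arr[of \<rho> \<rho> "%e. e" P] m by (auto simp: s_def)
 have es: "e\<cdot>s = e" if e: "e \<in> P" for e
 proof -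
  have "e\<cdot>s = hsum C \<rho> \<rho> (%f. e\<cdot>f) P"
   unfolding s_def by (rule cmp_hsum) (use P'(1) m[OF e] m in auto)
  also have "\<dots> = hsum C \<rho> \<rho> (%f. if f = e then e else hzero C \<rho> \<rho>) P"
   using e o by (intro hsum_cong) (auto simp: in_Hom)
  also have "\<dots> = e"
   using hsum_delta[OF P'(1) e m[OF e]] .
  finally show ?thesis .
 qed
 have ssa: "s\<dagger> = s"
  unfolding s_def using m P' by (subst star_hsum[where \<rho> = \<rho> and \<sigma> = \<rho>]) (auto intro!: hsum_cong)
 have se: "s\<cdot>e = e" if e: "e \<in> P" for e
  using arg_cong[OF es[OF e], of "star C"] e by (simp add: ssa)
 have ss: "s\<cdot>s = s"
 proof -
  have "s\<cdot>s = hsum C \<rho> \<rho> (%e. s\<cdot>e) P"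
   by (subst (2) s_def, rule cmp_hsum) (use P'(1) m in "auto simp: in_Hom")
  also have "\<dots> = s" unfolding s_def[symmetric] using m
   by (subst (2) s_def) (intro hsum_cong, auto simp: se)
  finally show ?thesis .
 qed
 have "s = idn C \<rho>"
 proof (rule ccontr)
  assume ne: "s ~= idn C \<rho>"
  define r where "r = hadd C (idn C \<rho>) (hscale C (-1) s)"
  have r[simp]: "r \<in> Arr C" "Dom C r = \<rho>" "Cod C r = \<rho>" by (simp_all add: r_def)
  have r0: "r ~= hzero C \<rho> \<rho>"
   using ne hdiff_eq_0D[of "idn C \<rho>" s \<rho> \<rho>] by (auto simp: r_def in_Hom)
  have sr: "s\<cdot>r = hzero C \<rho> \<rho>" by (simp add: r_def cmp_hadd ss)
  have rp: "projection C \<rho> r" unfolding projection_def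
   by (simp add: in_Hom, subst (2) r_def) (simp add: cmp_hadd sr, simp add: r_def ssa)
  have er: "e\<cdot>r = hzero C \<rho> \<rho>" if "e \<in> P" for e
   using that by (simp add: r_def cmp_hadd es)
  have re: "r\<cdot>e = hzero C \<rho> \<rho>" if "e \<in> P" for e
   using that by (simp add: r_def cmp_hadd se)
  have "r \<notin> P"
  proof
   assume a: "r \<in> P"
   have "r\<cdot>r = hzero C \<rho> \<rho>" using er[OF a] .
   with r0 projectionD(5)[OF rp] show False by simp
  qed
  moreover have "orthogonal_projections \<rho> (insert r P)"
   using P rp r0 er re by (auto simp: orthogonal_projections_def)
  ultimately show False using max[of "insert r P"] P'(1) by simp
 qed
 have "\<exists>w. isometry C (Dom C w) \<rho> w \<and> w\<cdot>w\<dagger> = e" if e: "e \<in> P" for e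
  using has_subobjects P'(2)[OF e] \<rho> isometryD(2) unfolding has_subobjects_def by metis
 then obtain w where w: "!!e. e \<in> P ==> isometry C (Dom C (w e)) \<rho> (w e)"
  and ww: "!!e. e \<in> P ==> w e\<cdot>(w e)\<dagger> = e" by metis
 have irr: "irreducible_obj C (Dom C (w e))" if e: "e \<in> P" for e
 proof (rule ccontr)
  assume red: "\<not> irreducible_obj C (Dom C (w e))"
  define v where "v = w e"
  define \<tau> where "\<tau> = Dom C v"
  have v: "isometry C \<tau> \<rho> v" using w[OF e] by (simp add: v_def \<tau>_def)
  note [simp] = isometryD[OF v]
  have vv: "v\<cdot>v\<dagger> = e" using ww[OF e] by (simp add: v_def)
  have [simp]: "e\<cdot>(v\<cdot>z) = v\<cdot>z" if "z \<in> Arr C" "Cod C z = \<tau>" for z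
   using that by (simp flip: vv)
  have "idn C \<tau> ~= hzero C \<tau> \<tau>"
  proof
   assume "idn C \<tau> = hzero C \<tau> \<tau>"
   then have "v\<cdot>(idn C \<tau>\<cdot>v\<dagger>) = hzero C \<rho> \<rho>" by (simp del: cmp_idn_l)
   then have "e = hzero C \<rho> \<rho>" by (simp add: vv)
   with P'(3)[OF e] show False ..
  qed
  moreover have "\<not> irreducible_obj C \<tau>" using red by (simp only: v_def \<tau>_def not_False_eq_True)
  ultimately obtain f where f: "projection C \<tau> f" "f ~= hzero C \<tau> \<tau>" "f ~= idn C \<tau>"
   using nontrivial_projection[OF isometryD(5)[OF v]] by blast
  note [simp] = projectionD[OF f(1)]
  define g where "g = hadd C (idn C \<tau>) (hscale C (-1) f)"
  have [simp]: "g \<in> Arr C" "Dom C g = \<tau>" "Cod C g = \<tau>" "g\<dagger> = g" by (simp_all add: g_def)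
  have g0: "g ~= hzero C \<tau> \<tau>"
   using f(3) hdiff_eq_0D[of "idn C \<tau>" f \<tau> \<tau>] by (auto simp: g_def in_Hom)
  have fg: "f\<cdot>g = hzero C \<tau> \<tau>" "g\<cdot>f = hzero C \<tau> \<tau>" by (simp_all add: g_def cmp_hadd)
  have gg: "g\<cdot>g = g" by (subst (2) g_def) (simp add: cmp_hadd fg)
  have lift: "v\<cdot>(x\<cdot>v\<dagger>) = hzero C \<rho> \<rho> ==> x = hzero C \<tau> \<tau>"
   if "x \<in> Arr C" "Dom C x = \<tau>" "Cod C x = \<tau>" for x
  proof -
   assume a: "v\<cdot>(x\<cdot>v\<dagger>) = hzero C \<rho> \<rho>"
   have "x = v\<dagger>\<cdot>((v\<cdot>(x\<cdot>v\<dagger>))\<cdot>v)" using that by simp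
   then show ?thesis by (simp add: a del: cmp_cmp)
  qed
  define a b where "a = v\<cdot>(f\<cdot>v\<dagger>)" and "b = v\<cdot>(g\<cdot>v\<dagger>)"
  have [simp]: "a \<in> Arr C" "Dom C a = \<rho>" "Cod C a = \<rho>" "b \<in> Arr C" "Dom C b = \<rho>" "Cod C b = \<rho>"
   by (simp_all add: a_def b_def)
  have fz: "f\<cdot>(f\<cdot>z) = f\<cdot>z" "g\<cdot>(g\<cdot>z) = g\<cdot>z" "f\<cdot>(g\<cdot>z) = hzero C (Dom C z) \<tau>"
   "g\<cdot>(f\<cdot>z) = hzero C (Dom C z) \<tau>" if "z \<in> Arr C" "Cod C z = \<tau>" for z
   using that cmp_eq_cmp[OF gg] cmp_eq_cmp[OF projectionD(5)[OF f(1)]] cmp_eq_cmp[OF fg(1)]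
    cmp_eq_cmp[OF fg(2)] by simp_all
  have ap: "projection C \<rho> a" and bp: "projection C \<rho> b"
   unfolding projection_def in_Hom by (simp_all add: a_def b_def fz)
  have ab: "a\<cdot>b = hzero C \<rho> \<rho>" "b\<cdot>a = hzero C \<rho> \<rho>" by (simp_all add: a_def b_def fz)
  have a0: "a ~= hzero C \<rho> \<rho>" using lift[of f] f(2) by (auto simp: a_def)
  have b0: "b ~= hzero C \<rho> \<rho>" using lift[of g] g0 by (auto simp: b_def)
  have ea: "e\<cdot>a = a" "e\<cdot>b = b" by (simp_all add: a_def b_def)
  have ae: "a\<cdot>e = a" "b\<cdot>e = b"
   using arg_cong[OF ea(1), of "star C"] arg_cong[OF ea(2), of "star C"] e
    projectionD(4)[OF ap] projectionD(4)[OF bp] by simp_all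
  have oth: "x\<cdot>a = hzero C \<rho> \<rho>" "x\<cdot>b = hzero C \<rho> \<rho>" "a\<cdot>x = hzero C \<rho> \<rho>" "b\<cdot>x = hzero C \<rho> \<rho>"
   if x: "x \<in> P" "x ~= e" for x
  proof -
   have "x\<cdot>(e\<cdot>a) = hzero C \<rho> \<rho>" "x\<cdot>(e\<cdot>b) = hzero C \<rho> \<rho>"
    using cmp_eq_cmp[OF o[OF x(1) e x(2)]] x e by simp_all
   then show "x\<cdot>a = hzero C \<rho> \<rho>" "x\<cdot>b = hzero C \<rho> \<rho>" by (simp_all only: ea)
   have "(a\<cdot>e)\<cdot>x = hzero C \<rho> \<rho>" "(b\<cdot>e)\<cdot>x = hzero C \<rho> \<rho>"
    using o[OF e x(1)] x e by simp_all
   then show "a\<cdot>x = hzero C \<rho> \<rho>" "b\<cdot>x = hzero C \<rho> \<rho>" by (simp_all only: ae)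
  qed
  have "a ~= b" using ab(1) projectionD(5)[OF ap] a0 by auto
  moreover have "a \<notin> P - {e}" using oth(1)[of a] projectionD(5)[OF ap] a0 by auto
  moreover have "b \<notin> P - {e}" using oth(2)[of b] projectionD(5)[OF bp] b0 by auto
  moreover have "orthogonal_projections \<rho> (insert a (insert b (P - {e})))"
   unfolding orthogonal_projections_def
  proof (intro conjI ballI impI)
   fix x y
   assume x: "x \<in> insert a (insert b (P - {e}))" and y: "y \<in> insert a (insert b (P - {e}))"
    and ne: "x ~= y"
   have P2: "x \<in> P \<and> x ~= e \<or> x = a \<or> x = b" "y \<in> P \<and> y ~= e \<or> y = a \<or> y = b"
    using x y by blast+
   then show "x\<cdot>y = hzero C \<rho> \<rho>"
    by (elim disjE conjE) (use ab oth o ne in blast)+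
  next
   fix x assume "x \<in> insert a (insert b (P - {e}))"
   then have "x \<in> P \<or> x = a \<or> x = b" by blast
   then show "projection C \<rho> x" "x ~= hzero C \<rho> \<rho>"
    using P'(2,3) ap bp a0 b0 by blast+
  qed (simp add: P'(1))
  moreover have "card P = Suc (card (P - {e}))" using P'(1) e by (rule card.remove)
  ultimately have "card (insert a (insert b (P - {e}))) = Suc (card P)"
   and "orthogonal_projections \<rho> (insert a (insert b (P - {e})))"
   using P'(1) by auto
  then show False using max[of "insert a (insert b (P - {e}))"] by simp
 qed
 have orth: "(w e)\<dagger>\<cdot>w f = hzero C (Dom C (w f)) (Dom C (w e))" if ef: "e \<in> P" "f \<in> P" "e ~= f" for e f
  using isometries_orthogonal[OF w[OF ef(1)] w[OF ef(2)]] o[OF ef] unfolding ww[OF ef(1)] ww[OF ef(2)] .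
 have inj: "inj_on w P" by (metis inj_onI ww)
 have wa[simp]: "w e \<in> Arr C" "Cod C (w e) = \<rho>" if "e \<in> P" for e
  using isometryD[OF w[OF that]] by auto
 have "hsum C \<rho> \<rho> (%w. w\<cdot>w\<dagger>) (w ` P) = hsum C \<rho> \<rho> (%e. w e\<cdot>(w e)\<dagger>) P"
 proof -
  interpret cvs "hom_space C \<rho> \<rho>" by (simp add: hom_cvs)
  show ?thesis using inj by (subst M.finsum_reindex) (auto simp: in_Hom)
 qed
 also have "\<dots> = s" unfolding s_def using ww m by (intro hsum_cong) auto
 finally have "hsum C \<rho> \<rho> (%w. w\<cdot>w\<dagger>) (w ` P) = idn C \<rho>" using \<open>s = idn C \<rho>\<close> by simp
 then have "decomposition C \<rho> (w ` P)"
  using P'(1) w irr orth by (auto simp: decomposition_def)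
 then show ?thesis ..
qed

end

section \<open>The operator norm\<close>

context semisimple_category
begin

lemma decompositionD:
 assumes "decomposition C \<rho> Q"
 shows "finite Q" "!!w. w \<in> Q ==> irreducible_obj C (Dom C w)" "!!w. w \<in> Q ==> isometry C (Dom C w) \<rho> w"
  "!!w. w \<in> Q ==> w \<in> Arr C" "!!w. w \<in> Q ==> Cod C w = \<rho>"
  "hsum C \<rho> \<rho> (%w. w\<cdot>w\<dagger>) Q = idn C \<rho>"
  "!!w w'. [|w \<in> Q; w' \<in> Q; w ~= w'|] ==> w\<dagger>\<cdot>w' = hzero C (Dom C w') (Dom C w)"
 using assms by (auto simp: decomposition_def isometry_def in_Hom)

lemma expand_cod:
 assumes Q: "decomposition C \<rho> Q" and x: "x \<in> Arr C" "Cod C x = \<rho>"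
 shows "x = hsum C (Dom C x) \<rho> (%w. w\<cdot>(w\<dagger>\<cdot>x)) Q"
proof -
 note d = decompositionD[OF Q]
 have [simp]: "\<rho> \<in> Obj C" using x by auto
 have "x = hsum C \<rho> \<rho> (%w. w\<cdot>w\<dagger>) Q\<cdot>x" using x by (simp add: d(6))
 also have "\<dots> = hsum C (Dom C x) \<rho> (%w. (w\<cdot>w\<dagger>)\<cdot>x) Q"
  by (rule hsum_cmp) (use d x in "auto simp: in_Hom")
 also have "\<dots> = hsum C (Dom C x) \<rho> (%w. w\<cdot>(w\<dagger>\<cdot>x)) Q"
  by (rule hsum_cong) (use d x in "auto simp: in_Hom")
 finally show ?thesis .
qed

lemma expand_dom:
 assumes Q: "decomposition C \<rho> Q" and x: "x \<in> Arr C" "Dom C x = \<rho>"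
 shows "x = hsum C \<rho> (Cod C x) (%w. (x\<cdot>w)\<cdot>w\<dagger>) Q"
proof -
 note d = decompositionD[OF Q]
 have [simp]: "\<rho> \<in> Obj C" using x by auto
 have "x = x\<cdot>hsum C \<rho> \<rho> (%w. w\<cdot>w\<dagger>) Q" using x by (simp add: d(6))
 also have "\<dots> = hsum C \<rho> (Cod C x) (%w. x\<cdot>(w\<cdot>w\<dagger>)) Q"
  by (rule cmp_hsum) (use d x in "auto simp: in_Hom")
 also have "\<dots> = hsum C \<rho> (Cod C x) (%w. (x\<cdot>w)\<cdot>w\<dagger>) Q"
  by (rule hsum_cong) (use d x in "auto simp: in_Hom")
 finally show ?thesis .
qed

lemma zero_if_components_cod:
 assumes Q: "decomposition C \<rho> Q" and x: "x \<in> Arr C" "Cod C x = \<rho>" "Dom C x = \<sigma>"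
  and z: "!!w. w \<in> Q ==> w\<dagger>\<cdot>x = hzero C \<sigma> (Dom C w)"
 shows "x = hzero C \<sigma> \<rho>"
proof -
 note d = decompositionD[OF Q]
 have [simp]: "\<rho> \<in> Obj C" "\<sigma> \<in> Obj C" using x by auto
 show ?thesis using expand_cod[OF Q x(1,2)] hsum_0[of \<sigma> \<rho> Q "%w. w\<cdot>(w\<dagger>\<cdot>x)"] z x d by auto
qed

lemma zero_if_components_dom:
 assumes Q: "decomposition C \<rho> Q" and x: "x \<in> Arr C" "Dom C x = \<rho>" "Cod C x = \<sigma>"
  and z: "!!w. w \<in> Q ==> x\<cdot>w = hzero C (Dom C w) \<sigma>"
 shows "x = hzero C \<rho> \<sigma>"
proof -
 note d = decompositionD[OF Q]
 have [simp]: "\<rho> \<in> Obj C" "\<sigma> \<in> Obj C" using x by auto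
 show ?thesis using expand_dom[OF Q x(1,2)] hsum_0[of \<rho> \<sigma> Q "%w. (x\<cdot>w)\<cdot>w\<dagger>"] z x d by auto
qed

end

definition nm :: "('o, 'm, 'z) tensor_cat_scheme => 'm => real" where
 "nm C y = sqrt (sqn C y)"

abbreviation (in complex_tensor_category) hsub where
 "hsub f g \<equiv> hadd C f (hscale C (-1) g)"

context summable_category
begin

lemma nm_nonneg: "[|irreducible_obj C (Dom C y); y \<in> Arr C|] ==> 0 \<le> nm C y"
 using sqn(2) by (simp add: nm_def)

lemma nm_eq_0: "[|irreducible_obj C (Dom C y); y \<in> Arr C|] ==>
  nm C y = 0 \<longleftrightarrow> y = hzero C (Dom C y) (Cod C y)"
 using sqn(3) by (simp add: nm_def)

lemma nm_hscale: "[|irreducible_obj C (Dom C y); y \<in> Arr C|] ==> nm C (hscale C c y) = cmod c * nm C y"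
 by (simp add: nm_def sqn_hscale real_sqrt_mult)

lemma nm_cmp:
 "[|irreducible_obj C (Dom C b); irreducible_obj C (Cod C b); a \<in> Arr C; b \<in> Arr C; Dom C a = Cod C b|]
  ==> nm C (a\<cdot>b) = nm C a * nm C b"
 by (simp add: nm_def sqn_cmp[of "Dom C b" "Cod C b" b a] real_sqrt_mult)

lemma nm_isometry_cmp:
 assumes "isometry C \<sigma> \<rho> V" "irreducible_obj C (Dom C y)" "y \<in> Arr C" "Cod C y = \<sigma>"
 shows "nm C (V\<cdot>y) = nm C y"
 unfolding nm_def sqn_def using assms by (simp add: isometryD[OF assms(1)])

lemma nm_isometry: "[|irreducible_obj C \<tau>; isometry C \<tau> \<rho> y|] ==> nm C y = 1"
 by (simp add: nm_def sqn_isometry)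

text \<open>Bessel's inequality: \<open>y - VV\<^sup>*y\<close> is orthogonal to \<open>VV\<^sup>*y\<close>.\<close>

lemma nm_bessel:
 assumes V: "isometry C \<sigma> \<rho> V" and \<tau>: "irreducible_obj C (Dom C y)" and y: "y \<in> Arr C" "Cod C y = \<rho>"
 shows "nm C (V\<dagger>\<cdot>y) \<le> nm C y"
proof -
 define \<tau> where "\<tau> = Dom C y"
 have [simp]: "\<tau> \<in> Obj C" "Dom C y = \<tau>" using y by (auto simp: \<tau>_def)
 note [simp] = isometryD[OF V] y
 have \<tau>': "irreducible_obj C \<tau>" using \<tau> by simp
 define r where "r = hsub y (V\<cdot>(V\<dagger>\<cdot>y))"
 have [simp]: "r \<in> Arr C" "Dom C r = \<tau>" "Cod C r = \<rho>" by (simp_all add: r_def)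
 have "V\<dagger>\<cdot>r = hzero C \<tau> \<sigma>" by (simp add: r_def cmp_hadd)
 then have "(V\<cdot>(V\<dagger>\<cdot>y))\<dagger>\<cdot>r = hzero C \<tau> \<tau>" by simp
 then have "r\<dagger>\<cdot>r = y\<dagger>\<cdot>r" by (subst r_def) (simp add: cmp_hadd)
 also have "\<dots> = hsub (y\<dagger>\<cdot>y) ((V\<dagger>\<cdot>y)\<dagger>\<cdot>(V\<dagger>\<cdot>y))" by (simp add: r_def cmp_hadd)
 also have "\<dots> = hscale C (of_real (sqn C y - sqn C (V\<dagger>\<cdot>y))) (idn C \<tau>)"
  using sqn(1)[OF \<tau>', of y] sqn(1)[OF \<tau>', of "V\<dagger>\<cdot>y"] by (simp del: star_cmp_arr cmp_cmp flip: hscale_add)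
 finally have "sqn C r = sqn C y - sqn C (V\<dagger>\<cdot>y)" using \<tau>' by (intro sqnI)
 moreover have "sqn C r \<ge> 0" by (rule sqn(2)[OF \<tau>']) simp_all
 ultimately show ?thesis by (simp add: nm_def)
qed

lemma nm_triangle:
 assumes \<tau>: "irreducible_obj C \<tau>" and y: "y \<in> Hom C \<tau> \<rho>" "z \<in> Hom C \<tau> \<rho>"
 shows "nm C (hadd C y z) \<le> nm C y + nm C z"
proof -
 note [simp] = HomD[OF y(1)] HomD[OF y(2)]
 have [simp]: "\<tau> \<in> Obj C" "\<rho> \<in> Obj C" using Hom_obj y by auto
 define c where "c = coef C (y\<dagger>\<cdot>z)"
 have yz: "y\<dagger>\<cdot>z = hscale C c (idn C \<tau>)" unfolding c_def by (rule coef[OF \<tau>]) simp_all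
 have "z\<dagger>\<cdot>y = (y\<dagger>\<cdot>z)\<dagger>" by simp
 then have zy: "z\<dagger>\<cdot>y = hscale C (cnj c) (idn C \<tau>)" by (simp only: yz) simp
 have comb: "sqn C (hadd C (hscale C (of_real a) y) (hscale C (of_real b) z)) =
   a\<^sup>2 * sqn C y + b\<^sup>2 * sqn C z + 2 * a * b * Re c" for a b
 proof (rule sqnI[OF \<tau>])
  have "c + cnj c = of_real (2 * Re c)" by (simp add: complex_eq_iff)
  then have e: "of_real (a\<^sup>2 * sqn C y) + of_real (a * b) * cnj c + (of_real (a * b) * c + of_real (b\<^sup>2 * sqn C z)) =
    complex_of_real (a\<^sup>2 * sqn C y + b\<^sup>2 * sqn C z + 2 * a * b * Re c)"
   by (simp add: complex_eq_iff)
  show "(hadd C (hscale C (of_real a) y) (hscale C (of_real b) z))\<dagger> \<cdot>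
    hadd C (hscale C (of_real a) y) (hscale C (of_real b) z) =
   hscale C (of_real (a\<^sup>2 * sqn C y + b\<^sup>2 * sqn C z + 2 * a * b * Re c)) (idn C \<tau>)"
   unfolding e[symmetric]
   by (simp add: cmp_hadd yz zy sqn(1)[OF \<tau>] hscale_hadd power2_eq_square mult_ac flip: hscale_add)
    (simp add: algebra_simps)
 qed
 have s: "sqn C y = (nm C y)\<^sup>2" "sqn C z = (nm C z)\<^sup>2" and nn: "nm C y \<ge> 0" "nm C z \<ge> 0"
  using sqn(2)[OF \<tau>, of y] sqn(2)[OF \<tau>, of z] by (simp_all add: nm_def)
 have "Re c \<le> nm C y * nm C z"
 proof (cases "nm C y = 0 \<or> nm C z = 0")
  case True
  then have "y = hzero C \<tau> \<rho> \<or> z = hzero C \<tau> \<rho>" using nm_eq_0[of y] nm_eq_0[of z] \<tau> by simp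
  then have "y\<dagger>\<cdot>z = hzero C \<tau> \<tau>"
  proof
   assume "y = hzero C \<tau> \<rho>"
   then show ?thesis by (subst \<open>y = hzero C \<tau> \<rho>\<close>) simp
  next
   assume "z = hzero C \<tau> \<rho>"
   then show ?thesis by (subst \<open>z = hzero C \<tau> \<rho>\<close>) simp
  qed
  with yz have "c = 0" using \<tau> hscale_idn_inject[OF \<tau>, of c 0] by simp
  then show ?thesis using nn by simp
 next
  case False
  then have p: "nm C y * nm C z > 0" using nn by (simp add: less_le)
  have "0 \<le> sqn C (hadd C (hscale C (of_real (nm C z)) y) (hscale C (of_real (- nm C y)) z))"
   by (rule sqn(2)[OF \<tau>]) simp_all
  also have "\<dots> = 2 * ((nm C y * nm C z) * (nm C y * nm C z - Re c))"
   unfolding comb s by (simp add: power2_eq_square algebra_simps)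
  finally show ?thesis using p by (simp add: zero_le_mult_iff)
 qed
 then have "sqn C (hadd C y z) \<le> (nm C y + nm C z)\<^sup>2"
  using comb[of 1 1] s by (simp add: power2_eq_square algebra_simps)
 then show ?thesis using nn by (simp add: nm_def[of C "hadd C y z"] real_le_lsqrt)
qed

lemma nm_hsum:
 assumes \<tau>: "irreducible_obj C \<tau>" and f: "finite A" "f \<in> A \<rightarrow> Hom C \<tau> \<rho>" and \<rho>: "\<rho> \<in> Obj C"
 shows "nm C (hsum C \<tau> \<rho> f A) \<le> (\<Sum>i\<in>A. nm C (f i))"
 using f
proof induct
 case empty
 have "nm C (hzero C \<tau> \<rho>) = 0" using nm_eq_0[of "hzero C \<tau> \<rho>"] \<tau> \<rho> irreducible_objD[OF \<tau>] by simp
 then show ?case using \<rho> irreducible_objD[OF \<tau>] by simp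
next
 case (insert a A)
 have "hsum C \<tau> \<rho> f A \<in> Hom C \<tau> \<rho>" by (rule hsum_hom) (use insert \<rho> irreducible_objD[OF \<tau>] in auto)
 then have "nm C (hadd C (f a) (hsum C \<tau> \<rho> f A)) \<le> nm C (f a) + nm C (hsum C \<tau> \<rho> f A)"
  using insert by (intro nm_triangle[OF \<tau>]) auto
 moreover have "hsum C \<tau> \<rho> f (insert a A) = hadd C (f a) (hsum C \<tau> \<rho> f A)"
  by (rule hsum_insert) (use insert \<rho> irreducible_objD[OF \<tau>] in auto)
 ultimately show ?case using insert by fastforce
qed

end

context semisimple_category
begin

text \<open>The norm of \<open>x\<close> as an operator on the Hilbert spaces of arrows from irreducible objects into
 the source of \<open>x\<close>.\<close>

definition cnorm :: "'b => real" where
 "cnorm x = Sup (insert 0 {nm C (x\<cdot>y) |\<tau> y. irreducible_obj C \<tau> \<and> isometry C \<tau> (Dom C x) y})"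

lemma nm_cmp_le_sum:
 assumes Q: "decomposition C (Dom C x) Q" and x: "x \<in> Arr C"
  and y: "irreducible_obj C \<tau>" "isometry C \<tau> (Dom C x) y"
 shows "nm C (x\<cdot>y) \<le> (\<Sum>w\<in>Q. nm C (x\<cdot>w))"
proof -
 note d = decompositionD[OF Q] and [simp] = x isometryD(1-6)[OF y(2)]
 have "x\<cdot>y = hsum C (Dom C x) (Cod C x) (%w. (x\<cdot>w)\<cdot>w\<dagger>) Q\<cdot>y"
  using expand_dom[OF Q] by simp
 also have "\<dots> = hsum C \<tau> (Cod C x) (%w. ((x\<cdot>w)\<cdot>w\<dagger>)\<cdot>y) Q"
  by (rule hsum_cmp) (use d in "auto simp: in_Hom")
 finally have "nm C (x\<cdot>y) = nm C (hsum C \<tau> (Cod C x) (%w. ((x\<cdot>w)\<cdot>w\<dagger>)\<cdot>y) Q)" by simp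
 also have "\<dots> \<le> (\<Sum>w\<in>Q. nm C (((x\<cdot>w)\<cdot>w\<dagger>)\<cdot>y))"
  by (rule nm_hsum[OF y(1)]) (use d in "auto simp: in_Hom")
 also have "\<dots> \<le> (\<Sum>w\<in>Q. nm C (x\<cdot>w))"
 proof (rule sum_mono)
  fix w assume w: "w \<in> Q"
  have "nm C (((x\<cdot>w)\<cdot>w\<dagger>)\<cdot>y) = nm C ((x\<cdot>w)\<cdot>(w\<dagger>\<cdot>y))" using d w by simp
  also have "\<dots> = nm C (x\<cdot>w) * nm C (w\<dagger>\<cdot>y)"
   by (rule nm_cmp) (use d w y in simp_all)
  also have "\<dots> \<le> nm C (x\<cdot>w) * 1"
  proof (rule mult_left_mono)
   show "nm C (w\<dagger>\<cdot>y) \<le> 1"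
    using nm_bessel[OF d(3)[OF w], of y] nm_isometry[OF y] y(1) by simp
   show "0 \<le> nm C (x\<cdot>w)" by (rule nm_nonneg) (use d w in simp_all)
  qed
  finally show "nm C (((x\<cdot>w)\<cdot>w\<dagger>)\<cdot>y) \<le> nm C (x\<cdot>w)" by simp
 qed
 finally show ?thesis .
qed

lemma cnorm_bdd:
 assumes x: "x \<in> Arr C"
 shows "bdd_above (insert 0 {nm C (x\<cdot>y) |\<tau> y. irreducible_obj C \<tau> \<and> isometry C \<tau> (Dom C x) y})"
proof -
 obtain Q where Q: "decomposition C (Dom C x) Q" using decomposition_exists x Dom_obj by blast
 have "t \<le> max 0 (\<Sum>w\<in>Q. nm C (x\<cdot>w))"
  if t: "t \<in> insert 0 {nm C (x\<cdot>y) |\<tau> y. irreducible_obj C \<tau> \<and> isometry C \<tau> (Dom C x) y}" for t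
 proof (cases "t = 0")
  case False
  then obtain \<tau> y where "t = nm C (x\<cdot>y)" "irreducible_obj C \<tau>" "isometry C \<tau> (Dom C x) y" using t by blast
  then show ?thesis using nm_cmp_le_sum[OF Q x] by (simp add: le_max_iff_disj)
 qed simp
 then show ?thesis unfolding bdd_above_def by blast
qed

lemma cnorm_nonneg: "x \<in> Arr C ==> 0 \<le> cnorm x"
 unfolding cnorm_def by (rule cSup_upper[OF _ cnorm_bdd]) auto

lemma cnorm_le:
 assumes "0 \<le> B" "!!\<tau> y. [|irreducible_obj C \<tau>; isometry C \<tau> (Dom C x) y|] ==> nm C (x\<cdot>y) \<le> B"
 shows "cnorm x \<le> B"
 unfolding cnorm_def by (rule cSup_least) (use assms in auto)

lemma nm_cmp_cnorm:
 assumes x: "x \<in> Arr C" and z: "z \<in> Arr C" "Cod C z = Dom C x" "irreducible_obj C (Dom C z)"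
 shows "nm C (x\<cdot>z) \<le> cnorm x * nm C z"
proof (cases "z = hzero C (Dom C z) (Cod C z)")
 case True
 have "x\<cdot>z = hzero C (Dom C z) (Cod C x)" using z x by (subst True) simp
 moreover have "nm C (hzero C (Dom C z) (Cod C x)) = 0"
  using nm_eq_0[of "hzero C (Dom C z) (Cod C x)"] x z by simp
 ultimately show ?thesis using cnorm_nonneg[OF x] nm_nonneg[OF z(3,1)] by simp
next
 case False
 define y where "y = hscale C (of_real (1 / nm C z)) z"
 have p: "nm C z > 0" and y: "isometry C (Dom C z) (Dom C x) y"
  using normalize_isometry[OF z(3,1) refl False] z(2) by (simp_all add: nm_def y_def)
 have "nm C (x\<cdot>y) \<in> insert 0 {nm C (x\<cdot>y) |\<tau> y. irreducible_obj C \<tau> \<and> isometry C \<tau> (Dom C x) y}"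
  using y z(3) by blast
 then have "nm C (x\<cdot>y) \<le> cnorm x"
  unfolding cnorm_def by (rule cSup_upper[OF _ cnorm_bdd[OF x]])
 moreover have "nm C (x\<cdot>y) = 1 / nm C z * nm C (x\<cdot>z)"
  using z x p by (simp add: y_def nm_hscale norm_divide)
 ultimately show ?thesis using p by (simp add: field_simps)
qed

lemma cnorm_eq_0:
 assumes x: "x \<in> Hom C \<rho> \<sigma>"
 shows "cnorm x = 0 \<longleftrightarrow> x = hzero C \<rho> \<sigma>"
proof
 note [simp] = HomD[OF x] and [simp] = conjunct1[OF Hom_obj[OF x]] conjunct2[OF Hom_obj[OF x]]
 assume 0: "cnorm x = 0"
 obtain Q where Q: "decomposition C \<rho> Q" using decomposition_exists[of \<rho>] by auto
 note d = decompositionD[OF Q]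
 show "x = hzero C \<rho> \<sigma>"
 proof (rule zero_if_components_dom[OF Q])
  fix w assume w: "w \<in> Q"
  have "nm C (x\<cdot>w) \<le> 0" using nm_cmp_cnorm[of x w] d w 0 by simp
  moreover have "0 \<le> nm C (x\<cdot>w)" by (rule nm_nonneg) (use d w in simp_all)
  ultimately have "nm C (x\<cdot>w) = 0" by simp
  then show "x\<cdot>w = hzero C (Dom C w) \<sigma>" using nm_eq_0[of "x\<cdot>w"] d w by simp
 qed simp_all
next
 note [simp] = conjunct1[OF Hom_obj[OF x]] conjunct2[OF Hom_obj[OF x]]
 assume 0: "x = hzero C \<rho> \<sigma>"
 have "cnorm (hzero C \<rho> \<sigma>) \<le> 0"
 proof (rule cnorm_le)
  fix \<tau> y assume \<tau>: "irreducible_obj C \<tau>" and "isometry C \<tau> (Dom C (hzero C \<rho> \<sigma>)) y"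
  then have y: "isometry C \<tau> \<rho> y" by simp
  note y = isometryD[OF y]
  have "nm C (hzero C \<tau> \<sigma>) = 0" using nm_eq_0[of "hzero C \<tau> \<sigma>"] \<tau> y by simp
  then show "nm C (hzero C \<rho> \<sigma>\<cdot>y) \<le> 0" using y by simp
 qed simp
 then show "cnorm x = 0" using cnorm_nonneg[of "hzero C \<rho> \<sigma>"] by (simp add: 0)
qed

lemma cnorm_triangle:
 assumes x: "x \<in> Hom C \<rho> \<sigma>" "x' \<in> Hom C \<rho> \<sigma>"
 shows "cnorm (hadd C x x') \<le> cnorm x + cnorm x'"
proof (rule cnorm_le)
 note [simp] = HomD[OF x(1)] HomD[OF x(2)]
 show "0 \<le> cnorm x + cnorm x'" using cnorm_nonneg by simp
 fix \<tau> y assume \<tau>: "irreducible_obj C \<tau>" and "isometry C \<tau> (Dom C (hadd C x x')) y"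
 then have y': "isometry C \<tau> \<rho> y" by simp
 note [simp] = isometryD(1-6)[OF y']
 have "nm C (hadd C x x'\<cdot>y) \<le> nm C (x\<cdot>y) + nm C (x'\<cdot>y)"
  using nm_triangle[OF \<tau>, of "x\<cdot>y" \<sigma> "x'\<cdot>y"] by (simp add: cmp_hadd in_Hom)
 also have "\<dots> \<le> cnorm x + cnorm x'"
  using nm_cmp_cnorm[of x y] nm_cmp_cnorm[of x' y] \<tau> nm_isometry[OF \<tau> y'] by simp
 finally show "nm C (hadd C x x'\<cdot>y) \<le> cnorm x + cnorm x'" .
qed

lemma cnorm_cmp:
 assumes [simp]: "x \<in> Arr C" "z \<in> Arr C" "Dom C x = Cod C z"
 shows "cnorm (x\<cdot>z) \<le> cnorm x * cnorm z"
proof (rule cnorm_le)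
 show "0 \<le> cnorm x * cnorm z" using cnorm_nonneg by simp
 fix \<tau> y assume \<tau>: "irreducible_obj C \<tau>" and "isometry C \<tau> (Dom C (x\<cdot>z)) y"
 then have y: "isometry C \<tau> (Dom C z) y" by simp
 note [simp] = isometryD(1-6)[OF y]
 have "nm C ((x\<cdot>z)\<cdot>y) = nm C (x\<cdot>(z\<cdot>y))" by simp
 also have "\<dots> \<le> cnorm x * nm C (z\<cdot>y)" using \<tau> by (intro nm_cmp_cnorm) simp_all
 also have "\<dots> \<le> cnorm x * cnorm z"
  using nm_cmp_cnorm[of z y] \<tau> nm_isometry[OF \<tau> y] cnorm_nonneg[of x] by (intro mult_left_mono) simp_all
 finally show "nm C ((x\<cdot>z)\<cdot>y) \<le> cnorm x * cnorm z" .
qed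

lemma cnorm_hscale:
 assumes x[simp]: "x \<in> Arr C"
 shows "cnorm (hscale C c x) = cmod c * cnorm x"
proof -
 have le: "cnorm (hscale C c x) \<le> cmod c * cnorm x" if [simp]: "x \<in> Arr C" for c x
 proof (rule cnorm_le)
  show "0 \<le> cmod c * cnorm x" using cnorm_nonneg by simp
  fix \<tau> y assume \<tau>: "irreducible_obj C \<tau>" and "isometry C \<tau> (Dom C (hscale C c x)) y"
  then have y: "isometry C \<tau> (Dom C x) y" by simp
  note [simp] = isometryD(1-6)[OF y]
  show "nm C (hscale C c x\<cdot>y) \<le> cmod c * cnorm x"
   using nm_cmp_cnorm[of x y] \<tau> nm_isometry[OF \<tau> y] by (simp add: nm_hscale mult_left_mono)
 qed
 show ?thesis
 proof (cases "c = 0")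
  case True
  have "cnorm (hzero C (Dom C x) (Cod C x)) = 0"
   using cnorm_eq_0[of "hzero C (Dom C x) (Cod C x)"] by (simp add: in_Hom)
  with True show ?thesis by simp
 next
  case False
  have "cnorm (hscale C (inverse c) (hscale C c x)) \<le> cmod (inverse c) * cnorm (hscale C c x)"
   by (rule le) simp
  then have "cmod c * cnorm x \<le> cnorm (hscale C c x)"
   using False by (simp add: norm_inverse norm_divide divide_simps mult.commute)
  with le[of x c] show ?thesis by simp
 qed
qed

text \<open>\<open>\<parallel>xy\<parallel>\<^sup>2 = \<parallel>y\<^sup>*x\<^sup>*xy\<parallel> \<le> \<parallel>x\<^sup>*x\<parallel>\<close> for an isometry \<open>y\<close>; this inequality also shows that the star preserves the norm,
 which gives the converse.\<close>

lemma cnorm_Cstar: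
 assumes x[simp]: "x \<in> Arr C"
 shows "cnorm (x\<dagger>\<cdot>x) = (cnorm x)\<^sup>2"
proof -
 have sq: "(cnorm x)\<^sup>2 \<le> cnorm (x\<dagger>\<cdot>x)" if [simp]: "x \<in> Arr C" for x
 proof -
  have "cnorm x \<le> sqrt (cnorm (x\<dagger>\<cdot>x))"
  proof (rule cnorm_le)
   show "0 \<le> sqrt (cnorm (x\<dagger>\<cdot>x))" using cnorm_nonneg[of "x\<dagger>\<cdot>x"] by simp
   fix \<tau> y assume \<tau>: "irreducible_obj C \<tau>" and y: "isometry C \<tau> (Dom C x) y"
   note [simp] = isometryD(1-6)[OF y]
   have "y\<dagger>\<cdot>((x\<dagger>\<cdot>x)\<cdot>y) = (x\<cdot>y)\<dagger>\<cdot>(x\<cdot>y)" by simp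
   also have "\<dots> = hscale C (of_real (sqn C (x\<cdot>y))) (idn C \<tau>)" by (rule sqn(1)[OF \<tau>]) simp_all
   finally have "nm C (y\<dagger>\<cdot>((x\<dagger>\<cdot>x)\<cdot>y)) = \<bar>sqn C (x\<cdot>y)\<bar> * nm C (idn C \<tau>)"
    using \<tau> by (simp add: nm_hscale)
   moreover have "nm C (idn C \<tau>) = 1"
    using \<tau> by (intro nm_isometry[of \<tau> \<tau>]) (simp_all add: isometry_def in_Hom)
   moreover have "sqn C (x\<cdot>y) \<ge> 0" by (rule sqn(2)[OF \<tau>]) simp_all
   ultimately have "sqn C (x\<cdot>y) = nm C (y\<dagger>\<cdot>((x\<dagger>\<cdot>x)\<cdot>y))" by simp
   also have "\<dots> \<le> nm C ((x\<dagger>\<cdot>x)\<cdot>y)" by (rule nm_bessel[OF y]) (simp_all add: \<tau>)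
   also have "\<dots> \<le> cnorm (x\<dagger>\<cdot>x)"
    using nm_cmp_cnorm[of "x\<dagger>\<cdot>x" y] \<tau> nm_isometry[OF \<tau> y] by simp
   finally show "nm C (x\<cdot>y) \<le> sqrt (cnorm (x\<dagger>\<cdot>x))" by (simp add: nm_def)
  qed
  then have "(cnorm x)\<^sup>2 \<le> (sqrt (cnorm (x\<dagger>\<cdot>x)))\<^sup>2" using cnorm_nonneg[of x] by (intro power_mono) simp_all
  then show ?thesis using cnorm_nonneg[of "x\<dagger>\<cdot>x"] by simp
 qed
 have le: "cnorm x \<le> cnorm (x\<dagger>)" if [simp]: "x \<in> Arr C" for x
 proof (cases "cnorm x = 0")
  case True
  then show ?thesis using cnorm_nonneg[of "x\<dagger>"] by simp
 next
  case False
  have "(cnorm x)\<^sup>2 \<le> cnorm (x\<dagger>) * cnorm x"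
   using sq[of x] cnorm_cmp[of "x\<dagger>" x] by simp
  then show ?thesis using False cnorm_nonneg[of x] by (simp add: power2_eq_square)
 qed
 have "cnorm (x\<dagger>) = cnorm x" using le[of x] le[of "x\<dagger>"] by simp
 then have "cnorm (x\<dagger>\<cdot>x) \<le> (cnorm x)\<^sup>2"
  using cnorm_cmp[of "x\<dagger>" x] by (simp add: power2_eq_square)
 with sq[of x] show ?thesis by simp
qed

subsection \<open>Completeness\<close>

text \<open>Completeness is first shown for arrows between irreducible objects, which are multiples of a
 single one, and then transported along decompositions of target and source.\<close>

lemma irr_irr_complete:
 assumes \<tau>: "irreducible_obj C \<tau>" "irreducible_obj C \<tau>'" and e: "!!n. e n \<in> Hom C \<tau> \<tau>'"
  and cauchy: "!!\<epsilon>. \<epsilon> > 0 ==> \<exists>N. \<forall>m\<ge>N. \<forall>n\<ge>N. nm C (hsub (e m) (e n)) < \<epsilon>"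
 shows "\<exists>l\<in>Hom C \<tau> \<tau>'. (%n::nat. nm C (hsub (e n) l)) \<longlonglongrightarrow> 0"
proof (cases "\<exists>a\<in>Hom C \<tau> \<tau>'. a ~= hzero C \<tau> \<tau>'")
 case False
 have [simp]: "\<tau> \<in> Obj C" "\<tau>' \<in> Obj C" using irreducible_objD \<tau> by auto
 have "e n = hzero C \<tau> \<tau>'" for n using False e by blast
 moreover have "nm C (hzero C \<tau> \<tau>') = 0" using nm_eq_0[of "hzero C \<tau> \<tau>'"] \<tau> by simp
 ultimately show ?thesis by (intro bexI[of _ "hzero C \<tau> \<tau>'"]) (simp_all add: in_Hom)
next
 case True
 then obtain a where a: "a \<in> Hom C \<tau> \<tau>'" "a ~= hzero C \<tau> \<tau>'" by blast
 have [simp]: "\<tau> \<in> Obj C" "\<tau>' \<in> Obj C" using irreducible_objD \<tau> by auto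
 note [simp] = HomD[OF a(1)] HomD[OF e]
 obtain u where u: "isometry C \<tau> \<tau>' u" using normalize_isometry[OF \<tau>(1), of a] a(2) by auto
 note [simp] = isometryD(1-6)[OF u]
 have uu: "u\<cdot>u\<dagger> = idn C \<tau>'" by (rule isometry_irr_unitary[OF \<tau> u])
 define c where "c n = coef C (u\<dagger>\<cdot>e n)" for n
 have ec: "e n = hscale C (c n) u" for n
 proof -
  have "u\<dagger>\<cdot>e n = hscale C (c n) (idn C \<tau>)" unfolding c_def by (rule coef[OF \<tau>(1)]) simp_all
  then have "u\<cdot>(u\<dagger>\<cdot>e n) = hscale C (c n) u" by simp
  moreover have "u\<cdot>(u\<dagger>\<cdot>e n) = e n" using cmp_eq_cmp[OF uu, of "e n"] by simp
  ultimately show ?thesis by simp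
 qed
 have d: "nm C (hsub (e n) (hscale C l u)) = cmod (c n - l)" for n l
 proof -
  have "hsub (e n) (hscale C l u) = hscale C (c n + - l) u" unfolding hscale_add[OF isometryD(1)[OF u]] by (simp add: ec)
  then show ?thesis using \<tau>(1) nm_isometry[OF \<tau>(1) u] by (simp add: nm_hscale)
 qed
 have "Cauchy c"
 proof (rule CauchyI)
  fix \<epsilon> :: real assume "\<epsilon> > 0"
  from cauchy[OF this] obtain N where "\<forall>m\<ge>N. \<forall>n\<ge>N. nm C (hsub (e m) (e n)) < \<epsilon>" by blast
  then have "\<forall>m\<ge>N. \<forall>n\<ge>N. nm C (hsub (e m) (hscale C (c n) u)) < \<epsilon>" using ec by metis
  then show "\<exists>M. \<forall>m\<ge>M. \<forall>n\<ge>M. norm (c m - c n) < \<epsilon>" unfolding d by blast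
 qed
 then obtain l where "c \<longlonglongrightarrow> l" using Cauchy_convergent convergent_def by blast
 then have "(%n. norm (c n - l)) \<longlonglongrightarrow> 0" by (simp add: LIM_zero tendsto_norm_zero)
 then have "(%n. nm C (hsub (e n) (hscale C l u))) \<longlonglongrightarrow> 0" unfolding d .
 then show ?thesis by (intro bexI[of _ "hscale C l u"]) (simp_all add: in_Hom)
qed

lemma cnorm_le_entries:
 assumes x: "x \<in> Hom C \<rho> \<sigma>" and Q: "decomposition C \<rho> Q" and Q': "decomposition C \<sigma> Q'"
 shows "cnorm x \<le> (\<Sum>w\<in>Q. \<Sum>u\<in>Q'. nm C (u\<dagger>\<cdot>(x\<cdot>w)))"
proof -
 note [simp] = HomD[OF x]
 note d = decompositionD[OF Q] and d' = decompositionD[OF Q']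
 have o[simp]: "\<sigma> \<in> Obj C" using Hom_obj[OF x] by blast
 have "nm C (x\<cdot>w) \<le> (\<Sum>u\<in>Q'. nm C (u\<dagger>\<cdot>(x\<cdot>w)))" if w: "w \<in> Q" for w
 proof -
  note [simp] = d(4,5)[OF w]
  have "nm C (x\<cdot>w) = nm C (hsum C (Dom C w) \<sigma> (%u. u\<cdot>(u\<dagger>\<cdot>(x\<cdot>w))) Q')"
   using expand_cod[OF Q', of "x\<cdot>w"] by simp
  also have "\<dots> \<le> (\<Sum>u\<in>Q'. nm C (u\<cdot>(u\<dagger>\<cdot>(x\<cdot>w))))"
   by (rule nm_hsum[OF d(2)[OF w]]) (use d' in "auto simp: in_Hom")
  also have "\<dots> = (\<Sum>u\<in>Q'. nm C (u\<dagger>\<cdot>(x\<cdot>w)))"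
   by (rule sum.cong[OF refl], rule nm_isometry_cmp[OF d'(3)]) (use d(2)[OF w] d'(4,5) in simp_all)
  finally show ?thesis .
 qed
 then have s: "(\<Sum>w\<in>Q. nm C (x\<cdot>w)) \<le> (\<Sum>w\<in>Q. \<Sum>u\<in>Q'. nm C (u\<dagger>\<cdot>(x\<cdot>w)))" by (rule sum_mono)
 have "0 \<le> (\<Sum>w\<in>Q. nm C (x\<cdot>w))" by (intro sum_nonneg nm_nonneg) (use d(2,4,5) in simp_all)
 with s show ?thesis by (intro cnorm_le) (use nm_cmp_le_sum[of x Q] Q in "fastforce intro: order_trans")+
qed

text \<open>A Cauchy sequence converges entrywise with respect to decompositions of source and target, and the
 norm is bounded by the sum of the norms of the entries.\<close>

lemma cnorm_complete:
 assumes \<rho>: "\<rho> \<in> Obj C" and \<sigma>: "\<sigma> \<in> Obj C" and e: "!!n. e n \<in> Hom C \<rho> \<sigma>"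
  and cauchy: "!!\<epsilon>. \<epsilon> > 0 ==> \<exists>N. \<forall>m\<ge>N. \<forall>n\<ge>N. cnorm (hsub (e m) (e n)) < \<epsilon>"
 shows "\<exists>l\<in>Hom C \<rho> \<sigma>. (%n::nat. cnorm (hsub (e n) l)) \<longlonglongrightarrow> 0"
proof -
 note [simp] = HomD[OF e] \<rho> \<sigma>
 obtain Q Q' where Q: "decomposition C \<rho> Q" and Q': "decomposition C \<sigma> Q'" using decomposition_exists[OF \<rho>] decomposition_exists[OF \<sigma>] by blast
 note d = decompositionD[OF Q] and d' = decompositionD[OF Q']
 have "\<exists>l\<in>Hom C (Dom C w) (Dom C u). (%n. nm C (hsub (u\<dagger>\<cdot>(e n\<cdot>w)) l)) \<longlonglongrightarrow> 0" if w: "w \<in> Q" and u: "u \<in> Q'" for w u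
 proof (rule irr_irr_complete[OF d(2)[OF w] d'(2)[OF u]])
  note [simp] = d(4,5)[OF w] d'(4,5)[OF u]
  show "u\<dagger>\<cdot>(e n\<cdot>w) \<in> Hom C (Dom C w) (Dom C u)" for n by (simp add: in_Hom)
  fix \<epsilon> :: real assume "\<epsilon> > 0"
  from cauchy[OF this] obtain N where N: "!!m n. [|m \<ge> N; n \<ge> N|] ==> cnorm (hsub (e m) (e n)) < \<epsilon>" by blast
  have "nm C (hsub (u\<dagger>\<cdot>(e m\<cdot>w)) (u\<dagger>\<cdot>(e n\<cdot>w))) \<le> cnorm (hsub (e m) (e n))" for m n
   using nm_bessel[OF d'(3)[OF u], of "hsub (e m) (e n)\<cdot>w"] nm_cmp_cnorm[of "hsub (e m) (e n)" w]
    d(2)[OF w] nm_isometry[OF d(2,3)[OF w]] by (simp add: cmp_hadd)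
  with N show "\<exists>N. \<forall>m\<ge>N. \<forall>n\<ge>N. nm C (hsub (u\<dagger>\<cdot>(e m\<cdot>w)) (u\<dagger>\<cdot>(e n\<cdot>w))) < \<epsilon>"
   by (meson le_less_trans)
 qed
 then obtain l where l: "!!w u. [|w \<in> Q; u \<in> Q'|] ==> l w u \<in> Hom C (Dom C w) (Dom C u)"
  and lim: "!!w u. [|w \<in> Q; u \<in> Q'|] ==> (%n. nm C (hsub (u\<dagger>\<cdot>(e n\<cdot>w)) (l w u))) \<longlonglongrightarrow> 0" by metis
 define z where "z w = hsum C (Dom C w) \<sigma> (%u. u\<cdot>l w u) Q'" for w
 have lu: "(%u. u\<cdot>l w u) \<in> Q' \<rightarrow> Hom C (Dom C w) \<sigma>" if "w \<in> Q" for w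
  using l[OF that] d'(4,5) by (auto simp: in_Hom)
 have z: "z w \<in> Hom C (Dom C w) \<sigma>" if "w \<in> Q" for w
  unfolding z_def by (rule hsum_hom[OF _ \<sigma> lu[OF that]]) (use d(4)[OF that] in simp)
 have zw: "(%w. z w\<cdot>w\<dagger>) \<in> Q \<rightarrow> Hom C \<rho> \<sigma>" using z d(4,5) by (auto simp: in_Hom)
 define L where "L = hsum C \<rho> \<sigma> (%w. z w\<cdot>w\<dagger>) Q"
 have L: "L \<in> Hom C \<rho> \<sigma>" unfolding L_def by (rule hsum_hom[OF \<rho> \<sigma> zw])
 note [simp] = HomD[OF L]
 have entry: "u\<dagger>\<cdot>(L\<cdot>w) = l w u" if w: "w \<in> Q" and u: "u \<in> Q'" for w u
 proof -
  note [simp] = HomD[OF z] d(4,5) d'(4,5) HomD[OF l] HomD[OF z[OF w]] d(4,5)[OF w] d'(4,5)[OF u]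
  have "L\<cdot>w = hsum C (Dom C w) \<sigma> (%v. (z v\<cdot>v\<dagger>)\<cdot>w) Q"
   unfolding L_def by (rule hsum_cmp[OF d(1) zw]) (simp_all add: in_Hom)
  also have "\<dots> = hsum C (Dom C w) \<sigma> (%v. if v = w then z w else hzero C (Dom C w) \<sigma>) Q"
   using isometryD(4)[OF d(3)[OF w]] d(7)[OF _ w] by (intro hsum_cong) (auto simp: in_Hom)
  also have "\<dots> = z w" by (rule hsum_delta[OF d(1) w z[OF w]])
  finally have "u\<dagger>\<cdot>(L\<cdot>w) = u\<dagger>\<cdot>z w" by simp
  also have "\<dots> = hsum C (Dom C w) (Dom C u) (%v. u\<dagger>\<cdot>(v\<cdot>l w v)) Q'"
   unfolding z_def by (rule cmp_hsum[OF d'(1) lu[OF w]]) (simp_all add: in_Hom)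
  also have "\<dots> = hsum C (Dom C w) (Dom C u) (%v. if v = u then l w u else hzero C (Dom C w) (Dom C u)) Q'"
  proof (rule hsum_cong)
   fix v assume v: "v \<in> Q'"
   have "u\<dagger>\<cdot>v = (if v = u then idn C (Dom C u) else hzero C (Dom C v) (Dom C u))"
    using isometryD(4)[OF d'(3)[OF u]] d'(7)[OF u v] by auto
   from cmp_eq_cmp[OF this, of "l w v"]
   show "u\<dagger>\<cdot>(v\<cdot>l w v) = (if v = u then l w u else hzero C (Dom C w) (Dom C u))" using v w by auto
  qed (use l w u in "auto simp: in_Hom")
  also have "\<dots> = l w u" by (rule hsum_delta[OF d'(1) u l[OF w u]])
  finally show ?thesis .
 qed
 have b: "cnorm (hsub (e n) L) \<le> (\<Sum>w\<in>Q. \<Sum>u\<in>Q'. nm C (hsub (u\<dagger>\<cdot>(e n\<cdot>w)) (l w u)))" for n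
 proof -
  have "(\<Sum>w\<in>Q. \<Sum>u\<in>Q'. nm C (u\<dagger>\<cdot>(hsub (e n) L\<cdot>w))) = (\<Sum>w\<in>Q. \<Sum>u\<in>Q'. nm C (hsub (u\<dagger>\<cdot>(e n\<cdot>w)) (l w u)))"
   by (intro sum.cong refl) (use d(4,5) d'(4,5) in "simp add: cmp_hadd entry")
  then show ?thesis using cnorm_le_entries[OF _ Q Q', of "hsub (e n) L"] by (simp add: in_Hom)
 qed
 have "(%n. \<Sum>w\<in>Q. \<Sum>u\<in>Q'. nm C (hsub (u\<dagger>\<cdot>(e n\<cdot>w)) (l w u))) \<longlonglongrightarrow> (\<Sum>w\<in>Q. \<Sum>u\<in>Q'. 0)"
  by (intro tendsto_sum lim)
 then have t: "(%n. \<Sum>w\<in>Q. \<Sum>u\<in>Q'. nm C (hsub (u\<dagger>\<cdot>(e n\<cdot>w)) (l w u))) \<longlonglongrightarrow> 0" by simp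
 have "(%n. cnorm (hsub (e n) L)) \<longlonglongrightarrow> 0"
  by (rule tendsto_sandwich[OF _ _ tendsto_const t])
   (use b in "auto intro!: always_eventually cnorm_nonneg")
 with L show ?thesis by blast
qed

lemma cnorm_mcomplete:
 assumes \<rho>: "\<rho> \<in> Obj C" and \<sigma>: "\<sigma> \<in> Obj C"
 shows "Metric_space.mcomplete (Hom C \<rho> \<sigma>)
  (%f g. if f \<in> Hom C \<rho> \<sigma> \<and> g \<in> Hom C \<rho> \<sigma> then cnorm (f \<ominus>\<^bsub>hom_space C \<rho> \<sigma>\<^esub> g) else 0)"
proof -
 note [simp] = \<rho> \<sigma>
 define d where "d = (%f g. if f \<in> Hom C \<rho> \<sigma> \<and> g \<in> Hom C \<rho> \<sigma> then cnorm (f \<ominus>\<^bsub>hom_space C \<rho> \<sigma>\<^esub> g) else 0)"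
 have d: "d f g = cnorm (hsub f g)" if "f \<in> Hom C \<rho> \<sigma>" "g \<in> Hom C \<rho> \<sigma>" for f g
  using that by (simp add: d_def hminus_eq)
 have sub: "hsub f g \<in> Hom C \<rho> \<sigma>" if "f \<in> Hom C \<rho> \<sigma>" "g \<in> Hom C \<rho> \<sigma>" for f g
  using that by (simp add: in_Hom)
 interpret M: Metric_space "Hom C \<rho> \<sigma>" d
 proof
  fix f g
  show "0 \<le> d f g"
   by (cases "f \<in> Hom C \<rho> \<sigma> \<and> g \<in> Hom C \<rho> \<sigma>")
    (simp add: d cnorm_nonneg HomD(1)[OF sub], auto simp: d_def)
  show "d f g = d g f"
  proof (cases "f \<in> Hom C \<rho> \<sigma> \<and> g \<in> Hom C \<rho> \<sigma>")
   case True
   then have "hsub f g = hscale C (-1) (hsub g f)" by (simp add: in_Hom hscale_hadd hadd_comm)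
   then show ?thesis using True cnorm_hscale[of "hsub g f" "-1"] by (simp add: d in_Hom)
  qed (auto simp: d_def)
 next
  fix f g assume fg: "f \<in> Hom C \<rho> \<sigma>" "g \<in> Hom C \<rho> \<sigma>"
  show "d f g = 0 \<longleftrightarrow> f = g"
   unfolding d[OF fg] cnorm_eq_0[OF sub[OF fg]] using hdiff_eq_0D[OF _ fg] fg by (auto simp: in_Hom)
 next
  fix f g h assume fgh: "f \<in> Hom C \<rho> \<sigma>" "g \<in> Hom C \<rho> \<sigma>" "h \<in> Hom C \<rho> \<sigma>"
  note [simp] = HomD[OF fgh(1)] HomD[OF fgh(2)] HomD[OF fgh(3)]
  have "hadd C (hsub f g) (hsub g h) = hadd C f (hadd C (hadd C (hscale C (-1) g) g) (hscale C (-1) h))"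
   by (simp only: hadd_assoc hadd_arr hscale_arr HomD[OF fgh(1)] HomD[OF fgh(2)] HomD[OF fgh(3)])
  also have "hadd C (hscale C (-1) g) g = hzero C \<rho> \<sigma>" by (subst hadd_comm) simp_all
  finally have "hadd C (hsub f g) (hsub g h) = hsub f h" by simp
  then show "d f h \<le> d f g + d g h"
   using cnorm_triangle[OF sub[OF fgh(1,2)] sub[OF fgh(2,3)]] by (simp add: d fgh)
 qed
 have "M.mcomplete"
  unfolding M.mcomplete_def
 proof (intro allI impI)
  fix e assume c: "M.MCauchy e"
  then have e: "e n \<in> Hom C \<rho> \<sigma>" for n by (auto simp: M.MCauchy_def)
  have "\<exists>N. \<forall>m\<ge>N. \<forall>n\<ge>N. cnorm (hsub (e m) (e n)) < \<epsilon>" if "\<epsilon> > 0" for \<epsilon>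
  proof -
   have "\<exists>N. \<forall>n n'. N \<le> n \<longrightarrow> N \<le> n' \<longrightarrow> d (e n) (e n') < \<epsilon>"
    using c that by (simp add: M.MCauchy_def)
   then obtain N where N: "!!n n'. [|N \<le> n; N \<le> n'|] ==> d (e n) (e n') < \<epsilon>" by blast
   show ?thesis
    using N by (intro exI[of _ N] allI impI) (simp only: d[OF e e])
  qed
  from cnorm_complete[OF \<rho> \<sigma> e this] obtain l where l: "l \<in> Hom C \<rho> \<sigma>"
   and lim: "(%n. cnorm (hsub (e n) l)) \<longlonglongrightarrow> 0" by blast
  have "\<exists>N. \<forall>n\<ge>N. e n \<in> Hom C \<rho> \<sigma> \<and> d (e n) l < \<epsilon>" if "\<epsilon> > 0" for \<epsilon>
   using order_tendstoD(2)[OF lim that] e d[OF e l] by (auto simp: eventually_sequentially)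
  then have "limitin M.mtopology e l sequentially" using l by (auto simp: M.limit_metric_sequentially)
  then show "\<exists>x. limitin M.mtopology e x sequentially" by blast
 qed
 then show ?thesis unfolding d_def .
qed

theorem Cstar_norm: "Cstar_tensor_category C cnorm"
proof
 show "cnorm (g\<cdot>f) \<le> cnorm f * cnorm g" if "g \<in> Hom C \<sigma> \<tau>" "f \<in> Hom C \<rho> \<sigma>" for f g \<rho> \<sigma> \<tau>
  using cnorm_cmp[of g f] HomD[OF that(1)] HomD[OF that(2)] by (simp add: mult.commute)
qed (simp_all add: cnorm_nonneg cnorm_eq_0 cnorm_triangle cnorm_hscale cnorm_mcomplete cnorm_Cstar)

end

section \<open>Conjugates\<close>

context tensor_category_with_star
begin

lemma conjugateD:
 assumes "conjugate_solution C \<rho> \<rho>b R Rb"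
 shows "\<rho> \<in> Obj C" "\<rho>b \<in> Obj C" "R \<in> Arr C" "Dom C R = unt C" "Cod C R = \<rho>b\<boxdot>\<rho>"
  "Rb \<in> Arr C" "Dom C Rb = unt C" "Cod C Rb = \<rho>\<boxdot>\<rho>b"
  and "(Rb\<dagger>|>\<rho>)\<cdot>(\<rho><|R) = idn C \<rho>"
  and "(R\<dagger>|>\<rho>b)\<cdot>(\<rho>b<|Rb) = idn C \<rho>b"
  and "(\<rho><|R\<dagger>)\<cdot>(Rb|>\<rho>) = idn C \<rho>"
  and "(\<rho>b<|Rb\<dagger>)\<cdot>(R|>\<rho>b) = idn C \<rho>b"
proof -
 show [simp]: "\<rho> \<in> Obj C" "\<rho>b \<in> Obj C" "R \<in> Arr C" "Dom C R = unt C" "Cod C R = \<rho>b\<boxdot>\<rho>"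
  "Rb \<in> Arr C" "Dom C Rb = unt C" "Cod C Rb = \<rho>\<boxdot>\<rho>b"
  and a: "(Rb\<dagger>|>\<rho>)\<cdot>(\<rho><|R) = idn C \<rho>"
  and b: "(R\<dagger>|>\<rho>b)\<cdot>(\<rho>b<|Rb) = idn C \<rho>b"
  using assms by (auto simp: conjugate_solution_def in_Hom)
 have "((Rb\<dagger>|>\<rho>)\<cdot>(\<rho><|R))\<dagger> = idn C \<rho>" by (simp only: a star_idn \<open>\<rho> \<in> Obj C\<close>)
 then show "(\<rho><|R\<dagger>)\<cdot>(Rb|>\<rho>) = idn C \<rho>" by simp
 have "((R\<dagger>|>\<rho>b)\<cdot>(\<rho>b<|Rb))\<dagger> = idn C \<rho>b" by (simp only: b star_idn \<open>\<rho>b \<in> Obj C\<close>)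
 then show "(\<rho>b<|Rb\<dagger>)\<cdot>(R|>\<rho>b) = idn C \<rho>b" by simp
qed

lemma conjugate_solution_sym:
 "conjugate_solution C \<rho> \<rho>b R Rb ==> conjugate_solution C \<rho>b \<rho> Rb R"
 by (auto simp: conjugate_solution_def)

text \<open>Frobenius reciprocity: a composite of \<open>a\<close> and \<open>b\<close> can be straightened out of a zigzag on which they are threaded.\<close>

lemma bend:
 assumes s: "conjugate_solution C \<rho> \<rho>b R Rb"
  and a: "a \<in> Arr C" "Dom C a = \<tau>" "Cod C a = \<rho>" and b: "b \<in> Arr C" "Dom C b = \<rho>" "Cod C b = \<tau>'"
 shows "(Rb\<dagger>|>\<tau>')\<cdot>((a \<boxtimes> (\<rho>b<|b))\<cdot>(\<tau><|R)) = b\<cdot>a"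
proof -
 note [simp] = conjugateD(1-8)[OF s] a b
 have [simp]: "\<tau> \<in> Obj C" "\<tau>' \<in> Obj C" using Dom_obj[OF a(1)] Cod_obj[OF b(1)] by simp_all
 have "a \<boxtimes> (\<rho>b<|b) = ((\<rho>\<boxdot>\<rho>b)<|b)\<cdot>(a|>(\<rho>b\<boxdot>\<rho>))"
  using tar_split'[of a "\<rho>b<|b"] by simp
 moreover have "(a|>(\<rho>b\<boxdot>\<rho>))\<cdot>(\<tau><|R) = (\<rho><|R)\<cdot>a"
  using slide[of a R \<tau> \<rho> "unt C" "\<rho>b\<boxdot>\<rho>"] by simp
 moreover have "(Rb\<dagger>|>\<tau>')\<cdot>((\<rho>\<boxdot>\<rho>b)<|b) = b\<cdot>(Rb\<dagger>|>\<rho>)"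
  using slide[of "Rb\<dagger>" b "\<rho>\<boxdot>\<rho>b" "unt C" \<rho> \<tau>'] by simp
 ultimately have "(Rb\<dagger>|>\<tau>')\<cdot>((a \<boxtimes> (\<rho>b<|b))\<cdot>(\<tau><|R)) =
   (b\<cdot>(Rb\<dagger>|>\<rho>))\<cdot>((\<rho><|R)\<cdot>a)"
  using cmp_eq_cmp[of "Rb\<dagger>|>\<tau>'" "(\<rho>\<boxdot>\<rho>b)<|b" _ "(\<rho><|R)\<cdot>a"]
  by simp
 also have "\<dots> = b\<cdot>(((Rb\<dagger>|>\<rho>)\<cdot>(\<rho><|R))\<cdot>a)" by simp
 also have "\<dots> = b\<cdot>a" by (simp only: conjugateD(9)[OF s]) simp
 finally show ?thesis .
qed

lemma zigzag_transport:
 assumes R: "R \<in> Arr C" "Dom C R = unt C" "Cod C R = \<sigma>b\<boxdot>\<sigma>"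
  and Rb: "Rb \<in> Arr C" "Dom C Rb = unt C" "Cod C Rb = \<rho>\<boxdot>\<rho>b"
  and u: "u \<in> Arr C" "Dom C u = \<sigma>" "Cod C u = \<tau>" and ub: "ub \<in> Arr C" "Dom C ub = \<sigma>b" "Cod C ub = \<mu>"
  and v: "v \<in> Arr C" "Dom C v = \<rho>" "Cod C v = \<tau>" and vb: "vb \<in> Arr C" "Dom C vb = \<rho>b" "Cod C vb = \<mu>"
 shows "(((v \<boxtimes> vb)\<cdot>Rb)\<dagger>|>\<tau>)\<cdot>(\<tau><|((ub \<boxtimes> u)\<cdot>R)) =
  (Rb\<dagger>|>\<tau>)\<cdot>((v\<dagger> \<boxtimes> ((vb\<dagger>\<cdot>ub) \<boxtimes> u))\<cdot>(\<tau><|R))"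
proof -
 note [simp] = R Rb u ub v vb
 have [simp]: "\<sigma> \<in> Obj C" "\<tau> \<in> Obj C" "\<sigma>b \<in> Obj C" "\<mu> \<in> Obj C" "\<rho> \<in> Obj C" "\<rho>b \<in> Obj C"
  using Dom_obj Cod_obj u ub v vb by blast+
 have "(v\<dagger> \<boxtimes> (vb\<dagger>|>\<tau>))\<cdot>(\<tau><|(ub \<boxtimes> u)) = v\<dagger> \<boxtimes> ((vb\<dagger>\<cdot>ub) \<boxtimes> u)"
  by (simp add: interch)
 from cmp_eq_cmp[OF this, of "\<tau><|R"] show ?thesis
  by (simp add: whisker_cmp del: interch)
qed

lemma frobenius_left:
 assumes s: "conjugate_solution C \<rho> \<rho>b R Rb" and x: "x \<in> Arr C" "Dom C x = \<rho>" "Cod C x = \<sigma>"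
 shows "(Rb\<dagger>|>\<sigma>)\<cdot>(\<rho><|((\<rho>b<|x)\<cdot>R)) = x"
proof -
 note [simp] = conjugateD(1-8)[OF s] x
 have [simp]: "\<sigma> \<in> Obj C" using Cod_obj[OF x(1)] by simp
 have "\<rho><|((\<rho>b<|x)\<cdot>R) = (\<rho><|(\<rho>b<|x))\<cdot>(\<rho><|R)"
  by (rule lwhisker_cmp) simp_all
 with bend[OF s, of "idn C \<rho>" \<rho> x \<sigma>] show ?thesis by simp
qed

lemma frobenius_right:
 assumes s: "conjugate_solution C \<rho> \<rho>b R Rb" and \<sigma>[simp]: "\<sigma> \<in> Obj C"
  and y: "y \<in> Arr C" "Dom C y = unt C" "Cod C y = \<rho>b\<boxdot>\<sigma>"
 shows "(\<rho>b<|((Rb\<dagger>|>\<sigma>)\<cdot>(\<rho><|y)))\<cdot>R = y"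
proof -
 note [simp] = conjugateD(1-8)[OF s] y
 have a: "((\<rho>b\<boxdot>\<rho>)<|y)\<cdot>R = (R|>(\<rho>b\<boxdot>\<sigma>))\<cdot>y"
  using slide[of R y "unt C" "\<rho>b\<boxdot>\<rho>" "unt C" "\<rho>b\<boxdot>\<sigma>"] by simp
 have "(\<rho>b<|((Rb\<dagger>|>\<sigma>)\<cdot>(\<rho><|y)))\<cdot>R =
   (\<rho>b<|(Rb\<dagger>|>\<sigma>))\<cdot>(((\<rho>b\<boxdot>\<rho>)<|y)\<cdot>R)"
  by (simp add: whisker_cmp)
 also have "\<dots> = (((\<rho>b<|Rb\<dagger>)\<cdot>(R|>\<rho>b))|>\<sigma>)\<cdot>y"
  unfolding a by (simp add: whisker_cmp)
 also have "\<dots> = y" unfolding conjugateD(12)[OF s] by simp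
 finally show ?thesis .
qed

lemma frobenius_conj:
 assumes s: "conjugate_solution C \<rho> \<rho>b R Rb" and x: "x \<in> Arr C" "Dom C x = \<rho>b" "Cod C x = \<sigma>"
 shows "(\<sigma><|Rb\<dagger>)\<cdot>(((x|>\<rho>)\<cdot>R)|>\<rho>b) = x"
proof -
 note [simp] = conjugateD(1-8)[OF s] x
 have [simp]: "\<sigma> \<in> Obj C" using Cod_obj[OF x(1)] by simp
 have a: "(\<sigma><|Rb\<dagger>)\<cdot>(x|>(\<rho>\<boxdot>\<rho>b)) = x\<cdot>(\<rho>b<|Rb\<dagger>)"
  using slide[of x "Rb\<dagger>" \<rho>b \<sigma> "\<rho>\<boxdot>\<rho>b" "unt C"] by simp
 have "(\<sigma><|Rb\<dagger>)\<cdot>(((x|>\<rho>)\<cdot>R)|>\<rho>b) =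
   ((\<sigma><|Rb\<dagger>)\<cdot>(x|>(\<rho>\<boxdot>\<rho>b)))\<cdot>(R|>\<rho>b)"
  by (simp add: whisker_cmp)
 also have "\<dots> = x\<cdot>((\<rho>b<|Rb\<dagger>)\<cdot>(R|>\<rho>b))" unfolding a by simp
 also have "\<dots> = x" unfolding conjugateD(12)[OF s] by simp
 finally show ?thesis .
qed

text \<open>Frobenius reciprocity turns an endomorphism of \<open>\<rho>b\<close> into one of \<open>\<rho>\<close>, a multiple of the identity, and back.\<close>

lemma conjugate_irreducible:
 assumes s: "conjugate_solution C \<rho> \<rho>b R Rb" and \<rho>: "irreducible_obj C \<rho>"
 shows "irreducible_obj C \<rho>b"
proof -
 note [simp] = conjugateD(1-8)[OF s]
 have "idn C \<rho>b ~= hzero C \<rho>b \<rho>b"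
 proof
  assume 0: "idn C \<rho>b = hzero C \<rho>b \<rho>b"
  have "R = (\<rho>b<|idn C \<rho>)\<cdot>R" by simp
  then have "R = hzero C (unt C) (\<rho>b\<boxdot>\<rho>)" unfolding 0 by simp
  then have "idn C \<rho> = (Rb\<dagger>|>\<rho>)\<cdot>(\<rho><|hzero C (unt C) (\<rho>b\<boxdot>\<rho>))"
   using conjugateD(9)[OF s] by simp
  then show False using irreducible_objD[OF \<rho>] by simp
 qed
 moreover have "\<exists>c. x = hscale C c (idn C \<rho>b)" if x: "x \<in> Hom C \<rho>b \<rho>b" for x
 proof -
  note [simp] = HomD[OF x]
  define y where "y = (x|>\<rho>)\<cdot>R"
  have y: "y \<in> Arr C" "Dom C y = unt C" "Cod C y = \<rho>b\<boxdot>\<rho>" by (simp_all add: y_def)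
  define z where "z = (Rb\<dagger>|>\<rho>)\<cdot>(\<rho><|y)"
  have "z = hscale C (coef C z) (idn C \<rho>)" by (rule coef[OF \<rho>]) (use y in "simp_all add: z_def")
  moreover have "y = (\<rho>b<|z)\<cdot>R" unfolding z_def by (rule frobenius_right[OF s, symmetric]) (use y in simp_all)
  ultimately have "y = (\<rho>b<|hscale C (coef C z) (idn C \<rho>))\<cdot>R" by simp
  then have "y = hscale C (coef C z) R" by simp
  then have "x = hscale C (coef C z) ((\<rho>b<|Rb\<dagger>)\<cdot>(R|>\<rho>b))"
   using frobenius_conj[OF s, of x \<rho>b] by (simp add: y_def)
  then show ?thesis unfolding conjugateD(12)[OF s] by blast
 qed
 moreover have "hscale C c (idn C \<rho>b) \<in> Hom C \<rho>b \<rho>b" for c by (simp add: in_Hom)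
 ultimately show ?thesis unfolding irreducible_obj_def by (intro conjI) (simp, blast, blast)
qed

text \<open>Threading one solution into the other gives mutually inverse arrows.\<close>

lemma conjugate_unique:
 assumes s: "conjugate_solution C \<rho> \<sigma> R Rb" and s': "conjugate_solution C \<rho> \<sigma>' R' Rb'"
 shows "isomorphic C \<sigma> \<sigma>'"
proof -
 have inv: "((R'\<dagger>|>\<sigma>)\<cdot>(\<sigma>'<|Rb))\<cdot>((R\<dagger>|>\<sigma>')\<cdot>(\<sigma><|Rb')) = idn C \<sigma>"
  if s: "conjugate_solution C \<rho> \<sigma> R Rb" and s': "conjugate_solution C \<rho> \<sigma>' R' Rb'" for \<sigma> \<sigma>' R Rb R' Rb'
 proof -
  note [simp] = conjugateD(1-8)[OF s] conjugateD(1-8)[OF s']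
  have 1: "(\<sigma>'<|Rb)\<cdot>(R\<dagger>|>\<sigma>') = (R\<dagger>|>(\<sigma>'\<boxdot>(\<rho>\<boxdot>\<sigma>)))\<cdot>((\<sigma>\<boxdot>(\<rho>\<boxdot>\<sigma>'))<|Rb)"
   using slide[of "R\<dagger>" "\<sigma>'<|Rb" "\<sigma>\<boxdot>\<rho>" "unt C" \<sigma>' "\<sigma>'\<boxdot>(\<rho>\<boxdot>\<sigma>)"] by simp
  have 2: "(R'\<dagger>|>\<sigma>)\<cdot>(R\<dagger>|>(\<sigma>'\<boxdot>(\<rho>\<boxdot>\<sigma>))) = (R\<dagger>|>\<sigma>)\<cdot>((\<sigma>\<boxdot>\<rho>)<|(R'\<dagger>|>\<sigma>))"
   using slide[of "R\<dagger>" "R'\<dagger>|>\<sigma>" "\<sigma>\<boxdot>\<rho>" "unt C" "\<sigma>'\<boxdot>(\<rho>\<boxdot>\<sigma>)" \<sigma>] by simp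
  have 3: "((\<sigma>\<boxdot>(\<rho>\<boxdot>\<sigma>'))<|Rb)\<cdot>(\<sigma><|Rb') = (\<sigma><|(Rb'|>(\<rho>\<boxdot>\<sigma>)))\<cdot>(\<sigma><|Rb)"
   using slide[of "\<sigma><|Rb'" Rb \<sigma> "\<sigma>\<boxdot>(\<rho>\<boxdot>\<sigma>')" "unt C" "\<rho>\<boxdot>\<sigma>"] by simp
  have "((R'\<dagger>|>\<sigma>)\<cdot>(\<sigma>'<|Rb))\<cdot>((R\<dagger>|>\<sigma>')\<cdot>(\<sigma><|Rb')) =
    (R'\<dagger>|>\<sigma>)\<cdot>(((\<sigma>'<|Rb)\<cdot>(R\<dagger>|>\<sigma>'))\<cdot>(\<sigma><|Rb'))" by simp
  also have "\<dots> = ((R'\<dagger>|>\<sigma>)\<cdot>(R\<dagger>|>(\<sigma>'\<boxdot>(\<rho>\<boxdot>\<sigma>))))\<cdot>(((\<sigma>\<boxdot>(\<rho>\<boxdot>\<sigma>'))<|Rb)\<cdot>(\<sigma><|Rb'))"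
   unfolding 1 by simp
  also have "\<dots> = (R\<dagger>|>\<sigma>)\<cdot>((((\<sigma>\<boxdot>\<rho>)<|(R'\<dagger>|>\<sigma>))\<cdot>(\<sigma><|(Rb'|>(\<rho>\<boxdot>\<sigma>))))\<cdot>(\<sigma><|Rb))"
   unfolding 2 3 by simp
  also have "((\<sigma>\<boxdot>\<rho>)<|(R'\<dagger>|>\<sigma>))\<cdot>(\<sigma><|(Rb'|>(\<rho>\<boxdot>\<sigma>))) =
    \<sigma><|(((\<rho><|R'\<dagger>)\<cdot>(Rb'|>\<rho>))|>\<sigma>)"
   by (simp add: whisker_cmp)
  also have "\<dots> = idn C (\<sigma>\<boxdot>(\<rho>\<boxdot>\<sigma>))" unfolding conjugateD(11)[OF s'] by simp
  also have "(R\<dagger>|>\<sigma>)\<cdot>(idn C (\<sigma>\<boxdot>(\<rho>\<boxdot>\<sigma>))\<cdot>(\<sigma><|Rb)) = idn C \<sigma>"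
   using conjugateD(10)[OF s] by simp
  finally show ?thesis .
 qed
 note [simp] = conjugateD(1-8)[OF s] conjugateD(1-8)[OF s']
 show ?thesis unfolding isomorphic_def
  by (intro bexI[of _ "(R\<dagger>|>\<sigma>')\<cdot>(\<sigma><|Rb')"] bexI[of _ "(R'\<dagger>|>\<sigma>)\<cdot>(\<sigma>'<|Rb)"]
    conjI inv[OF s s'] inv[OF s' s]) (simp_all add: in_Hom)
qed

lemma conjugate_transport:
 assumes s: "conjugate_solution C \<rho> \<sigma> R Rb" and i: "isomorphic C \<sigma> \<sigma>'"
 shows "\<exists>R' Rb'. conjugate_solution C \<rho> \<sigma>' R' Rb'"
proof -
 obtain u v where u: "u \<in> Hom C \<sigma> \<sigma>'" "v \<in> Hom C \<sigma>' \<sigma>" and vu: "v\<cdot>u = idn C \<sigma>" "u\<cdot>v = idn C \<sigma>'"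
  using i by (auto simp: isomorphic_def)
 have [simp]: "\<sigma>' \<in> Obj C" using Hom_obj u by blast
 note [simp] = conjugateD(1-8)[OF s] HomD[OF u(1)] HomD[OF u(2)]
 have "(((\<rho><|v\<dagger>)\<cdot>Rb)\<dagger>|>\<rho>)\<cdot>(\<rho><|((u|>\<rho>)\<cdot>R)) = idn C \<rho>"
  by (subst zigzag_transport[where \<sigma> = \<rho> and \<sigma>b = \<sigma> and \<rho> = \<rho> and \<rho>b = \<sigma> and \<mu> = \<sigma>'])
   (use bend[OF s, of "idn C \<rho>" \<rho> "idn C \<rho>" \<rho>] in "simp_all add: vu")
 moreover have "v\<dagger>\<cdot>u\<dagger> = (u\<cdot>v)\<dagger>" by simp
 then have "v\<dagger>\<cdot>u\<dagger> = idn C \<sigma>'" unfolding vu by simp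
 then have "(((u|>\<rho>)\<cdot>R)\<dagger>|>\<sigma>')\<cdot>(\<sigma>'<|((\<rho><|v\<dagger>)\<cdot>Rb)) = idn C \<sigma>'"
  by (subst zigzag_transport[where \<sigma> = \<sigma> and \<sigma>b = \<rho> and \<rho> = \<sigma> and \<rho>b = \<rho> and \<mu> = \<rho>])
   (use bend[OF conjugate_solution_sym[OF s], of "u\<dagger>" \<sigma>' "v\<dagger>" \<sigma>'] in simp_all)
 ultimately have "conjugate_solution C \<rho> \<sigma>' ((u|>\<rho>)\<cdot>R) ((\<rho><|v\<dagger>)\<cdot>Rb)"
  by (simp add: conjugate_solution_def in_Hom)
 then show ?thesis by blast
qed

lemma conjugate_zero:
 assumes [simp]: "\<rho> \<in> Obj C" and 0: "idn C \<rho> = hzero C \<rho> \<rho>"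
 shows "conjugate_solution C \<rho> \<rho> (hzero C (unt C) (\<rho>\<boxdot>\<rho>)) (hzero C (unt C) (\<rho>\<boxdot>\<rho>))"
 by (simp add: conjugate_solution_def in_Hom 0)

end

context summable_category
begin

lemma conjugate_direct_sum:
 assumes s1: "conjugate_solution C \<rho>1 \<rho>b1 R1 Rb1" and s2: "conjugate_solution C \<rho>2 \<rho>b2 R2 Rb2"
  and V: "isometry C \<rho>1 \<tau> V" and W: "isometry C \<rho>2 \<tau> W"
  and VW: "hadd C (V\<cdot>V\<dagger>) (W\<cdot>W\<dagger>) = idn C \<tau>"
 shows "\<exists>\<mu> R Rb. conjugate_solution C \<tau> \<mu> R Rb"
proof -
 obtain \<mu> Vb Wb where Vb: "isometry C \<rho>b1 \<mu> Vb" and Wb: "isometry C \<rho>b2 \<mu> Wb"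
  and VWb: "hadd C (Vb\<cdot>Vb\<dagger>) (Wb\<cdot>Wb\<dagger>) = idn C \<mu>"
  using has_direct_sums conjugateD(2)[OF s1] conjugateD(2)[OF s2]
  unfolding has_direct_sums_def direct_sum_def by blast
 \<comment> \<open>in the zigzag of the sums the mixed terms vanish by orthogonality\<close>
 have zz: "((hadd C ((V \<boxtimes> Vb)\<cdot>Rb1) ((W \<boxtimes> Wb)\<cdot>Rb2))\<dagger>|>\<tau>) \<cdot>
   (\<tau><|hadd C ((Vb \<boxtimes> V)\<cdot>R1) ((Wb \<boxtimes> W)\<cdot>R2)) = idn C \<tau>"
  if s1: "conjugate_solution C \<rho>1 \<rho>b1 R1 Rb1" and s2: "conjugate_solution C \<rho>2 \<rho>b2 R2 Rb2"
   and V: "isometry C \<rho>1 \<tau> V" and W: "isometry C \<rho>2 \<tau> W"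
   and VW: "hadd C (V\<cdot>V\<dagger>) (W\<cdot>W\<dagger>) = idn C \<tau>"
   and Vb: "isometry C \<rho>b1 \<mu> Vb" and Wb: "isometry C \<rho>b2 \<mu> Wb"
   and VWb: "hadd C (Vb\<cdot>Vb\<dagger>) (Wb\<cdot>Wb\<dagger>) = idn C \<mu>"
  for \<rho>1 \<rho>2 \<rho>b1 \<rho>b2 R1 Rb1 R2 Rb2 V W \<tau> Vb Wb \<mu>
 proof -
  note [simp] = conjugateD(1-8)[OF s1] conjugateD(1-8)[OF s2]
   isometryD(1-6)[OF V] isometryD(1-6)[OF W] isometryD(1-6)[OF Vb] isometryD(1-6)[OF Wb]
   direct_sum_orthogonal[OF Vb Wb VWb]
  let ?z = "%v vb Rb ub u R. (((v \<boxtimes> vb)\<cdot>Rb)\<dagger>|>\<tau>)\<cdot>(\<tau><|((ub \<boxtimes> u)\<cdot>R))"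
  have 11: "?z V Vb Rb1 Vb V R1 = V\<cdot>V\<dagger>"
   by (subst zigzag_transport[where \<sigma> = \<rho>1 and \<sigma>b = \<rho>b1 and \<rho> = \<rho>1 and \<rho>b = \<rho>b1 and \<mu> = \<mu>])
    (simp_all add: bend[OF s1])
  have 22: "?z W Wb Rb2 Wb W R2 = W\<cdot>W\<dagger>"
   by (subst zigzag_transport[where \<sigma> = \<rho>2 and \<sigma>b = \<rho>b2 and \<rho> = \<rho>2 and \<rho>b = \<rho>b2 and \<mu> = \<mu>])
    (simp_all add: bend[OF s2])
  have 12: "?z V Vb Rb1 Wb W R2 = hzero C \<tau> \<tau>"
   by (subst zigzag_transport[where \<sigma> = \<rho>2 and \<sigma>b = \<rho>b2 and \<rho> = \<rho>1 and \<rho>b = \<rho>b1 and \<mu> = \<mu>]) simp_all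
  have 21: "?z W Wb Rb2 Vb V R1 = hzero C \<tau> \<tau>"
   by (subst zigzag_transport[where \<sigma> = \<rho>1 and \<sigma>b = \<rho>b1 and \<rho> = \<rho>2 and \<rho>b = \<rho>b2 and \<mu> = \<mu>]) simp_all
  have "((hadd C ((V \<boxtimes> Vb)\<cdot>Rb1) ((W \<boxtimes> Wb)\<cdot>Rb2))\<dagger>|>\<tau>) \<cdot>
    (\<tau><|hadd C ((Vb \<boxtimes> V)\<cdot>R1) ((Wb \<boxtimes> W)\<cdot>R2)) =
   hadd C (hadd C (?z V Vb Rb1 Vb V R1) (?z W Wb Rb2 Vb V R1)) (hadd C (?z V Vb Rb1 Wb W R2) (?z W Wb Rb2 Wb W R2))"
   by (simp only: star_hadd tar_hadd cmp_hadd tar_arr cmp_arr star_arr idn_arr hadd_arr tob_simps tob_obj unt_obj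
     conjugateD(1-8)[OF s1] conjugateD(1-8)[OF s2]
     isometryD(1-6)[OF V] isometryD(1-6)[OF W] isometryD(1-6)[OF Vb] isometryD(1-6)[OF Wb])
  also have "\<dots> = idn C \<tau>" unfolding 11 22 12 21 by (simp add: VW)
  finally show ?thesis .
 qed
 note [simp] = conjugateD(1-8)[OF s1] conjugateD(1-8)[OF s2]
  isometryD(1-6)[OF V] isometryD(1-6)[OF W] isometryD(1-6)[OF Vb] isometryD(1-6)[OF Wb]
 have "conjugate_solution C \<tau> \<mu> (hadd C ((Vb \<boxtimes> V)\<cdot>R1) ((Wb \<boxtimes> W)\<cdot>R2))
   (hadd C ((V \<boxtimes> Vb)\<cdot>Rb1) ((W \<boxtimes> Wb)\<cdot>Rb2))"
  unfolding conjugate_solution_def in_Hom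
  using zz[OF s1 s2 V W VW Vb Wb VWb]
   zz[OF conjugate_solution_sym[OF s1] conjugate_solution_sym[OF s2] Vb Wb VWb V W VW]
  by (intro conjI) (assumption | simp)+
 then show ?thesis by blast
qed

end

locale semisimple_tensor_category = semisimple_category +
 assumes irreducible_unt: "irreducible_obj C (unt C)"
begin

text \<open>Let \<open>X\<close> be an irreducible subobject of an object with conjugate \<open>\<rho>b\<close>. The solution for \<open>\<rho>\<close>
 compresses to \<open>X\<close> and each irreducible component of \<open>\<rho>b\<close>; the zigzags of these compressions add up
 to the identity, so one of them is nonzero and can be scaled to a normalized solution.\<close>

lemma irreducible_conjugate:
 assumes X: "irreducible_obj C X" and w: "isometry C X \<rho> w" and s: "conjugate_solution C \<rho> \<rho>b R Rb"
 shows "\<exists>Y R' Rb'. normalized_solution C X Y R' Rb'"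
proof -
 note [simp] = conjugateD(1-8)[OF s] isometryD(1-6)[OF w]
 obtain Q where Q: "decomposition C \<rho>b Q" using decomposition_exists[of \<rho>b] by auto
 note d = decompositionD[OF Q]
 define L where "L e = (Rb\<dagger>|>X)\<cdot>((w \<boxtimes> (e \<boxtimes> w\<dagger>))\<cdot>(X<|R))" for e
 have Lh: "L e \<in> Hom C X X" if "e \<in> Hom C \<rho>b \<rho>b" for e
  using HomD[OF that] by (simp add: L_def in_Hom)
 have "L (hsum C \<rho>b \<rho>b (%u. u\<cdot>u\<dagger>) Q) = hsum C X X (%u. L (u\<cdot>u\<dagger>)) Q"
 proof (rule hsum_additive)
  show "L (hzero C \<rho>b \<rho>b) = hzero C X X" by (simp add: L_def)
  show "L (hadd C x y) = hadd C (L x) (L y)" if "x \<in> Hom C \<rho>b \<rho>b" "y \<in> Hom C \<rho>b \<rho>b" for x y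
   using HomD[OF that(1)] HomD[OF that(2)] by (simp add: L_def tar_hadd cmp_hadd)
 qed (use Lh d in "auto simp: in_Hom")
 moreover have "L (idn C \<rho>b) = idn C X"
  using bend[OF s, of w X "w\<dagger>" X] by (simp add: L_def)
 ultimately have sum: "hsum C X X (%u. L (u\<cdot>u\<dagger>)) Q = idn C X" by (simp add: d(6))
 have "\<exists>u\<in>Q. L (u\<cdot>u\<dagger>) ~= hzero C X X"
 proof (rule ccontr)
  assume "\<not> ?thesis"
  then have "hsum C X X (%u. L (u\<cdot>u\<dagger>)) Q = hzero C X X" by (intro hsum_0) auto
  with sum irreducible_objD[OF X] show False by simp
 qed
 then obtain u where u: "u \<in> Q" and L0: "L (u\<cdot>u\<dagger>) ~= hzero C X X" by blast
 define Y where "Y = Dom C u"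
 have Y: "irreducible_obj C Y" and uY: "isometry C Y \<rho>b u" using d(2,3)[OF u] by (auto simp: Y_def)
 note [simp] = isometryD(1-6)[OF uY]
 define R1 where "R1 = (u\<dagger> \<boxtimes> w\<dagger>)\<cdot>R"
 define Rb1 where "Rb1 = (w\<dagger> \<boxtimes> u\<dagger>)\<cdot>Rb"
 have [simp]: "R1 \<in> Arr C" "Dom C R1 = unt C" "Cod C R1 = Y\<boxdot>X"
  "Rb1 \<in> Arr C" "Dom C Rb1 = unt C" "Cod C Rb1 = X\<boxdot>Y" by (simp_all add: R1_def Rb1_def)
 define z where "z = (Rb1\<dagger>|>X)\<cdot>(X<|R1)"
 have [simp]: "z \<in> Arr C" "Dom C z = X" "Cod C z = X" by (simp_all add: z_def)
 have zL: "z = L (u\<cdot>u\<dagger>)"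
  unfolding z_def R1_def Rb1_def L_def
  by (subst zigzag_transport[where \<sigma> = \<rho> and \<sigma>b = \<rho>b and \<rho> = \<rho> and \<rho>b = \<rho>b and \<mu> = Y]) simp_all
 define c where "c = coef C z"
 have z: "z = hscale C c (idn C X)" unfolding c_def by (rule coef[OF X]) simp_all
 with zL L0 have c0: "c ~= 0" by auto
 define y where "y = (R1\<dagger>|>Y)\<cdot>(Y<|Rb1)"
 have [simp]: "y \<in> Arr C" "Dom C y = Y" "Cod C y = Y" by (simp_all add: y_def)
 define c' where "c' = coef C y"
 have y: "y = hscale C c' (idn C Y)" unfolding c'_def by (rule coef[OF Y]) simp_all
 have R10: "R1 ~= hzero C (unt C) (Y\<boxdot>X)"
 proof
  assume 0: "R1 = hzero C (unt C) (Y\<boxdot>X)"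
  have "z = hzero C X X" unfolding z_def 0 by simp
  with zL L0 show False by simp
 qed
 have "R1\<dagger>\<cdot>((Y\<boxdot>X)<|R1\<dagger>) = R1\<dagger>\<cdot>(R1\<dagger>|>(Y\<boxdot>X))"
  using slide[of "R1\<dagger>" "R1\<dagger>" "Y\<boxdot>X" "unt C" "Y\<boxdot>X" "unt C"] by simp
 then have "R1\<dagger>\<cdot>(((Y\<boxdot>X)<|R1\<dagger>)\<cdot>(Y<|(Rb1|>X))) =
   R1\<dagger>\<cdot>((R1\<dagger>|>(Y\<boxdot>X))\<cdot>(Y<|(Rb1|>X)))"
  using cmp_cmp[of "R1\<dagger>" "(Y\<boxdot>X)<|R1\<dagger>" "Y<|(Rb1|>X)"]
   cmp_cmp[of "R1\<dagger>" "R1\<dagger>|>(Y\<boxdot>X)" "Y<|(Rb1|>X)"] by simp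
 moreover have "((Y\<boxdot>X)<|R1\<dagger>)\<cdot>(Y<|(Rb1|>X)) = Y<|z\<dagger>"
  by (simp add: z_def whisker_cmp)
 moreover have "(R1\<dagger>|>(Y\<boxdot>X))\<cdot>(Y<|(Rb1|>X)) = y|>X"
  by (simp add: y_def whisker_cmp)
 ultimately have "R1\<dagger>\<cdot>(Y<|z\<dagger>) = R1\<dagger>\<cdot>(y|>X)" by simp
 then have "hscale C (cnj c) (R1\<dagger>) = hscale C c' (R1\<dagger>)" by (simp add: z y)
 then have "hscale C (cnj c + - c') (R1\<dagger>) = hscale C (c' + - c') (R1\<dagger>)"
  using hscale_add[of "R1\<dagger>" "cnj c" "- c'"] hscale_add[of "R1\<dagger>" c' "- c'"] by (simp del: hadd_neg)
 then have "hscale C (cnj c + - c') (R1\<dagger>) = hzero C (Y\<boxdot>X) (unt C)" by simp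
 then have "cnj c + - c' = 0 \<or> R1\<dagger> = hzero C (Y\<boxdot>X) (unt C)"
  by (rule hscale_eq_0D) (simp add: in_Hom)
 moreover have "R1\<dagger> ~= hzero C (Y\<boxdot>X) (unt C)"
 proof
  assume 0: "R1\<dagger> = hzero C (Y\<boxdot>X) (unt C)"
  have "(R1\<dagger>)\<dagger> = hzero C (unt C) (Y\<boxdot>X)" unfolding 0 by simp
  with R10 show False by simp
 qed
 ultimately have c': "c' = cnj c" by simp
 have Rb10: "Rb1 ~= hzero C (unt C) (X\<boxdot>Y)"
 proof
  assume 0: "Rb1 = hzero C (unt C) (X\<boxdot>Y)"
  have "z = hzero C X X" unfolding z_def 0 by simp
  with zL L0 show False by simp
 qed
 define a b where "a = sqn C R1" and "b = sqn C Rb1"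
 have RR: "R1\<dagger>\<cdot>R1 = hscale C (of_real a) (idn C (unt C))" "Rb1\<dagger>\<cdot>Rb1 = hscale C (of_real b) (idn C (unt C))"
  unfolding a_def b_def by (rule sqn(1)[OF irreducible_unt]; simp)+
 have ab: "a > 0" "b > 0"
  using normalize_isometry(2)[OF irreducible_unt, of R1] normalize_isometry(2)[OF irreducible_unt, of Rb1] R10 Rb10
  by (simp_all add: a_def b_def)
 define q where "q = a / (b * (cmod c)\<^sup>2)"
 define s where "s = sqrt (sqrt q)"
 have q: "q > 0" using ab c0 by (simp add: q_def)
 then have s0: "s > 0" and s2: "s\<^sup>2 * s\<^sup>2 = q" by (simp_all add: s_def)
 have "a = q * b * (cmod c)\<^sup>2" using ab c0 by (simp add: q_def)
 then have s4: "a / (s\<^sup>2 * (cmod c)\<^sup>2) = s\<^sup>2 * b"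
  using s0 c0 by (simp add: divide_simps flip: s2)
 define R' where "R' = hscale C (1 / (of_real s * c)) R1"
 define Rb' where "Rb' = hscale C (of_real s) Rb1"
 have "conjugate_solution C X Y R' Rb'"
  using z y c' c0 s0
  by (simp add: conjugate_solution_def in_Hom R'_def Rb'_def flip: z_def y_def)
 moreover have "R'\<dagger>\<cdot>R' = hscale C (of_real (a / (s\<^sup>2 * (cmod c)\<^sup>2))) (idn C (unt C))"
 proof -
  have "complex_of_real (a / (s\<^sup>2 * (cmod c)\<^sup>2)) = of_real a / (of_real s * of_real s * (c * cnj c))"
   by (simp only: of_real_divide of_real_mult complex_norm_square power2_eq_square[of s])
  also have "\<dots> = cnj (1 / (of_real s * c)) * (1 / (of_real s * c) * of_real a)" by (simp add: mult_ac)
  finally have k: "complex_of_real (a / (s\<^sup>2 * (cmod c)\<^sup>2)) =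
    cnj (1 / (of_real s * c)) * (1 / (of_real s * c) * of_real a)" .
  show ?thesis unfolding k by (simp add: R'_def RR mult_ac)
 qed
 moreover have "Rb'\<dagger>\<cdot>Rb' = hscale C (of_real (s\<^sup>2 * b)) (idn C (unt C))"
  by (simp add: Rb'_def RR power2_eq_square mult.assoc)
 ultimately show ?thesis unfolding normalized_solution_def s4 by blast
qed

text \<open>Splitting off one component, to allow induction on the number of components.\<close>

lemma decomposition_split:
 assumes \<rho>[simp]: "\<rho> \<in> Obj C" and Q: "decomposition C \<rho> Q" and w: "w \<in> Q"
 shows "\<exists>\<sigma> V Q'. isometry C \<sigma> \<rho> V \<and> hadd C (w\<cdot>w\<dagger>) (V\<cdot>V\<dagger>) = idn C \<rho> \<and>
  decomposition C \<sigma> Q' \<and> card Q = Suc (card Q')"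
proof -
 note d = decompositionD[OF Q]
 note [simp] = isometryD(1,3-7)[OF d(3)[OF w]]
 define E where "E = hsub (idn C \<rho>) (w\<cdot>w\<dagger>)"
 have E[simp]: "E \<in> Arr C" "Dom C E = \<rho>" "Cod C E = \<rho>" "E\<dagger> = E" by (simp_all add: E_def)
 have "w\<dagger>\<cdot>E = hzero C \<rho> (Dom C w)" by (simp add: E_def cmp_hadd)
 then have "E\<cdot>E = E" by (subst (1) E_def) (simp add: cmp_hadd)
 then have "projection C \<rho> E" by (simp add: projection_def in_Hom)
 then obtain \<sigma> V where V: "isometry C \<sigma> \<rho> V" and VV: "V\<cdot>V\<dagger> = E"
  using has_subobjects[unfolded has_subobjects_def] \<rho> by blast
 note [simp] = isometryD[OF V]
 define Q1 where "Q1 = Q - {w}"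
 have fin: "finite Q1" using d(1) by (simp add: Q1_def)
 have Qd: "!!v. v \<in> Q1 ==> v \<in> Arr C" "!!v. v \<in> Q1 ==> Cod C v = \<rho>" "!!v. v \<in> Q1 ==> isometry C (Dom C v) \<rho> v"
  "!!v. v \<in> Q1 ==> irreducible_obj C (Dom C v)" "!!v. v \<in> Q1 ==> w\<dagger>\<cdot>v = hzero C (Dom C v) (Dom C w)"
  using d w by (auto simp: Q1_def)
 note [simp] = Qd(1,2,5)
 have Ev: "E\<cdot>v = v" if "v \<in> Q1" for v using that by (simp add: E_def cmp_hadd)
 have VVv: "V\<cdot>(V\<dagger>\<cdot>v) = v" if "v \<in> Q1" for v
  using cmp_eq_cmp[OF VV, of v] Ev that by simp
 define S where "S = hsum C \<rho> \<rho> (%v. v\<cdot>v\<dagger>) Q1"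
 have h: "(%v. v\<cdot>v\<dagger>) \<in> Q1 \<rightarrow> Hom C \<rho> \<rho>" by (auto simp: in_Hom)
 have [simp]: "S \<in> Arr C" "Dom C S = \<rho>" "Cod C S = \<rho>"
  using hsum_arr[OF _ _ h] by (auto simp: S_def)
 have "insert w Q1 = Q" "w \<notin> Q1" using w by (auto simp: Q1_def)
 then have "hadd C (w\<cdot>w\<dagger>) S = idn C \<rho>"
  using d(6) hsum_insert[OF \<rho> \<rho> fin _ h, of w] by (simp add: S_def in_Hom)
 then have "E = hsub (hadd C S (w\<cdot>w\<dagger>)) (w\<cdot>w\<dagger>)" by (simp add: E_def hadd_comm)
 also have "\<dots> = S" by (subst hadd_assoc) simp_all
 finally have ES: "E = S" .
 have inj: "inj_on (%v. V\<dagger>\<cdot>v) Q1" by (metis (no_types, lifting) VVv inj_onI)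
 have "decomposition C \<sigma> ((%v. V\<dagger>\<cdot>v) ` Q1)"
  unfolding decomposition_def
 proof (intro conjI ballI impI)
  show "finite ((%v. V\<dagger>\<cdot>v) ` Q1)" using fin by simp
 next
  fix x assume "x \<in> (%v. V\<dagger>\<cdot>v) ` Q1"
  then obtain v where v: "v \<in> Q1" "x = V\<dagger>\<cdot>v" by blast
  then show "irreducible_obj C (Dom C x)" using Qd(4) by simp
  show "isometry C (Dom C x) \<sigma> x" using v isometryD(4)[OF Qd(3)[OF v(1)]]
   by (simp add: isometry_def in_Hom VVv)
  fix x' assume "x' \<in> (%v. V\<dagger>\<cdot>v) ` Q1" and ne: "x ~= x'"
  then obtain v' where v': "v' \<in> Q1" "x' = V\<dagger>\<cdot>v'" by blast
  with v ne have "v ~= v'" by auto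
  then have "v\<dagger>\<cdot>v' = hzero C (Dom C v') (Dom C v)"
   using v v' d(7)[of v v'] by (auto simp: Q1_def)
  then show "x\<dagger>\<cdot>x' = hzero C (Dom C x') (Dom C x)" using v v' by (simp add: VVv)
 next
  have "hsum C \<sigma> \<sigma> (%x. x\<cdot>x\<dagger>) ((%v. V\<dagger>\<cdot>v) ` Q1) = hsum C \<sigma> \<sigma> (%v. (V\<dagger>\<cdot>v)\<cdot>(V\<dagger>\<cdot>v)\<dagger>) Q1"
  proof -
   interpret cvs "hom_space C \<sigma> \<sigma>" by (simp add: hom_cvs)
   show ?thesis using inj by (subst M.finsum_reindex) (auto simp: in_Hom)
  qed
  also have "\<dots> = hsum C \<sigma> \<sigma> (%v. V\<dagger>\<cdot>((v\<cdot>v\<dagger>)\<cdot>V)) Q1"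
   by (rule hsum_cong) (auto simp: in_Hom)
  also have "\<dots> = V\<dagger>\<cdot>(S\<cdot>V)"
   unfolding S_def using h fin
   by (subst hsum_cmp[where \<rho> = \<sigma>], simp_all add: in_Hom)
    (subst cmp_hsum[where \<tau> = \<sigma>], auto simp: in_Hom)
  also have "\<dots> = idn C \<sigma>" by (simp flip: ES VV)
  finally show "hsum C \<sigma> \<sigma> (%x. x\<cdot>x\<dagger>) ((%v. V\<dagger>\<cdot>v) ` Q1) = idn C \<sigma>" .
 qed
 moreover have "hadd C (w\<cdot>w\<dagger>) (V\<cdot>V\<dagger>) = idn C \<rho>"
  unfolding VV ES by (rule \<open>hadd C (w\<cdot>w\<dagger>) S = idn C \<rho>\<close>)
 moreover have "card Q = Suc (card ((%v. V\<dagger>\<cdot>v) ` Q1))"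
  using card.remove[OF d(1) w] card_image[OF inj] by (simp add: Q1_def)
 ultimately show ?thesis using V by blast
qed

lemma conjugate_if_components:
 assumes irr: "!!X. irreducible_obj C X ==> \<exists>Y R Rb. conjugate_solution C X Y R Rb"
  and \<rho>: "\<rho> \<in> Obj C" and Q: "decomposition C \<rho> Q"
 shows "\<exists>\<rho>b R Rb. conjugate_solution C \<rho> \<rho>b R Rb"
 using \<rho> Q
proof (induct "card Q" arbitrary: \<rho> Q)
 case 0
 note d = decompositionD[OF 0(3)]
 have "Q = {}" using 0(1) d(1) by simp
 then have "idn C \<rho> = hzero C \<rho> \<rho>" using d(6) 0(2) by simp
 then show ?case using conjugate_zero 0(2) by blast
next
 case (Suc n)
 then obtain w where w: "w \<in> Q" by (metis card.empty equals0I nat.distinct(1))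
 note d = decompositionD[OF Suc(4)]
 obtain \<sigma> V Q' where V: "isometry C \<sigma> \<rho> V" "hadd C (w\<cdot>w\<dagger>) (V\<cdot>V\<dagger>) = idn C \<rho>"
  and Q': "decomposition C \<sigma> Q'" "card Q = Suc (card Q')"
  using decomposition_split[OF Suc(3,4) w] by blast
 have "n = card Q'" using Suc(2) Q'(2) by simp
 from Suc(1)[OF this isometryD(5)[OF V(1)] Q'(1)] irr[OF d(2)[OF w]]
 show ?case using conjugate_direct_sum[OF _ _ d(3)[OF w] V] by blast
qed

text \<open>Irreducible subobjects inherit normalized solutions, and any object is a direct sum of irreducible ones.
 The solution of the ambient object need not restrict to a subobject directly, because the transpose of
 a projection is an idempotent that is self-adjoint only for standard solutions.\<close>

theorem conjugates_of_subobjects: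
 assumes "!!X. X \<in> Obj C ==> \<exists>\<rho> w \<rho>b R Rb. isometry C X \<rho> w \<and> conjugate_solution C \<rho> \<rho>b R Rb"
 shows "has_conjugates C"
 unfolding has_conjugates_def
proof
 fix \<rho> assume \<rho>: "\<rho> \<in> Obj C"
 have irr: "\<exists>Y R Rb. normalized_solution C X Y R Rb" if X: "irreducible_obj C X" for X
  using assms[of X] irreducible_conjugate[OF X] irreducible_objD[OF X] by blast
 then have irr': "\<exists>Y R Rb. conjugate_solution C X Y R Rb" if X: "irreducible_obj C X" for X
  using X unfolding normalized_solution_def by blast
 show "\<exists>\<rho>b R Rb. conjugate_solution C \<rho> \<rho>b R Rb \<and>
   (irreducible_obj C \<rho> \<longrightarrow> normalized_solution C \<rho> \<rho>b R Rb)"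
 proof (cases "irreducible_obj C \<rho>")
  case True
  then show ?thesis using irr unfolding normalized_solution_def by blast
 next
  case False
  obtain Q where "decomposition C \<rho> Q" using decomposition_exists[OF \<rho>] by blast
  with False show ?thesis using conjugate_if_components[OF irr' \<rho>] by blast
 qed
qed

end

section \<open>The closure under subobjects\<close>

locale closure_category = tensor_star_category A for A :: "('o, 'x) braided_cat" (structure)
begin

abbreviation "B \<equiv> subobject_closure A"

lemma closure_simps [simp]:
 "Dom B = src" "Cod B = trg" "unt B = (unt A, idn A (unt A))"
 "idn B X = Arrow X X (snd X)"
 "cmp B g f = Arrow (src f) (trg g) (val g\<cdot>val f)"
 "tob B X Y = (fst X\<boxdot>fst Y, snd X \<boxtimes> snd Y)"
 "tar B f g = Arrow (fst (src f)\<boxdot>fst (src g), snd (src f) \<boxtimes> snd (src g))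
   (fst (trg f)\<boxdot>fst (trg g), snd (trg f) \<boxtimes> snd (trg g)) (val f \<boxtimes> val g)"
 "star B f = Arrow (trg f) (src f) ((val f)\<dagger>)"
 "hadd B f g = Arrow (src f) (trg f) (hadd A (val f) (val g))"
 "hzero B X Y = Arrow X Y (hzero A (fst X) (fst Y))"
 "hscale B c f = Arrow (src f) (trg f) (hscale A c (val f))"
 "braid B X Y = Arrow (fst X\<boxdot>fst Y, snd X \<boxtimes> snd Y) (fst Y\<boxdot>fst X, snd Y \<boxtimes> snd X)
   ((snd Y \<boxtimes> snd X)\<cdot>braid A (fst X) (fst Y)\<cdot>(snd X \<boxtimes> snd Y))"
 by (simp_all add: subobject_closure_def split: prod.splits)

lemma Obj_B: "X \<in> Obj B \<longleftrightarrow> fst X \<in> Obj A \<and> snd X \<in> Arr A \<and> Dom A (snd X) = fst X \<and>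
  Cod A (snd X) = fst X \<and> (snd X)\<dagger> = snd X \<and> snd X\<cdot>snd X = snd X"
 by (cases X) (auto simp: subobject_closure_def projection_def in_Hom)

lemma Arr_B: "f \<in> Arr B \<longleftrightarrow> src f \<in> Obj B \<and> trg f \<in> Obj B \<and> val f \<in> Arr A \<and>
  Dom A (val f) = fst (src f) \<and> Cod A (val f) = fst (trg f) \<and>
  snd (trg f)\<cdot>val f = val f \<and> val f\<cdot>snd (src f) = val f"
 (is "_ \<longleftrightarrow> ?P")
proof
 assume "f \<in> Arr B"
 then obtain \<rho> E \<sigma> F x where f: "f = Arrow (\<rho>, E) (\<sigma>, F) (F\<cdot>(x\<cdot>E))"
  and o: "\<rho> \<in> Obj A" "\<sigma> \<in> Obj A" "projection A \<rho> E" "projection A \<sigma> F" "x \<in> Hom A \<rho> \<sigma>"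
  by (auto simp: subobject_closure_def)
 have [simp]: "E \<in> Arr A" "Dom A E = \<rho>" "Cod A E = \<rho>" "E\<dagger> = E" "F \<in> Arr A" "Dom A F = \<sigma>" "Cod A F = \<sigma>" "F\<dagger> = F"
  "x \<in> Arr A" "Dom A x = \<rho>" "Cod A x = \<sigma>" and e: "E\<cdot>E = E" "F\<cdot>F = F"
  using o by (auto simp: projection_def in_Hom)
 have "F\<cdot>(F\<cdot>(x\<cdot>E)) = F\<cdot>(x\<cdot>E)" using cmp_eq_cmp[OF e(2), of "x\<cdot>E"] by simp
 then show ?P using o e by (simp add: f Obj_B)
next
 assume p: ?P
 have B: "Arr B = {Arrow (\<rho>, E) (\<sigma>, E') (E'\<cdot>x\<cdot>E) |\<rho> E \<sigma> E' x.
   \<rho> \<in> Obj A \<and> \<sigma> \<in> Obj A \<and> projection A \<rho> E \<and> projection A \<sigma> E' \<and> x \<in> Hom A \<rho> \<sigma>}"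
  by (simp add: subobject_closure_def)
 have "f = Arrow (fst (src f), snd (src f)) (fst (trg f), snd (trg f)) (snd (trg f)\<cdot>(val f\<cdot>snd (src f)))"
  using p by (intro arrow.expand) simp
 moreover have "projection A (fst (src f)) (snd (src f))" "projection A (fst (trg f)) (snd (trg f))"
  "val f \<in> Hom A (fst (src f)) (fst (trg f))" "fst (src f) \<in> Obj A" "fst (trg f) \<in> Obj A"
  using p by (auto simp: Obj_B projection_def in_Hom[of _ A])
 ultimately show "f \<in> Arr B" unfolding B by blast
qed

lemma Hom_B: "f \<in> Hom B X Y \<longleftrightarrow> src f = X \<and> trg f = Y \<and> X \<in> Obj B \<and> Y \<in> Obj B \<and>
  val f \<in> Arr A \<and> Dom A (val f) = fst X \<and> Cod A (val f) = fst Y \<and>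
  snd Y\<cdot>val f = val f \<and> val f\<cdot>snd X = val f"
 by (auto simp: in_Hom Arr_B)

lemma arrow_eq_iff: "f = g \<longleftrightarrow> src f = src g \<and> trg f = trg g \<and> val f = val g"
 by (auto intro: arrow.expand)

lemma absorb:
 assumes "E\<cdot>f = f" "E \<in> Arr A" "f \<in> Arr A" "z \<in> Arr A" "Dom A E = Cod A f" "Dom A f = Cod A z"
 shows "E\<cdot>(f\<cdot>z) = f\<cdot>z"
 using cmp_eq_cmp[OF assms(1-4)] assms by simp

lemma module_B:
 assumes X: "X \<in> Obj B" and Y: "Y \<in> Obj B"
 shows "Module.module complex_field (hom_space B X Y)"
proof (rule complex_moduleI, unfold hom_space_simps)
 note [simp] = X[unfolded Obj_B] Y[unfolded Obj_B]
 show "hzero B X Y \<in> Hom B X Y" using X Y by (simp add: Hom_B)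
qed (auto simp: Hom_B Obj_B arrow_eq_iff hadd_ac cmp_hadd hscale_add hscale_hadd)

lemma complex_tensor_category_B: "complex_tensor_category B"
 by (rule complex_tensor_category.intro)
  (simp_all only: module_B, auto simp: Hom_B Arr_B Obj_B arrow_eq_iff interch cmp_hadd tar_hadd absorb)

lemma star_B:
 assumes f: "f \<in> Arr B"
 shows "snd (src f)\<cdot>(val f)\<dagger> = (val f)\<dagger>" "(val f)\<dagger>\<cdot>snd (trg f) = (val f)\<dagger>"
proof -
 note p = f[unfolded Arr_B Obj_B]
 have "(val f\<cdot>snd (src f))\<dagger> = snd (src f)\<cdot>(val f)\<dagger>" by (subst star_cmp_arr) (use p in simp_all)
 then show "snd (src f)\<cdot>(val f)\<dagger> = (val f)\<dagger>" using p by simp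
 have "(snd (trg f)\<cdot>val f)\<dagger> = (val f)\<dagger>\<cdot>snd (trg f)" by (subst star_cmp_arr) (use p in simp_all)
 then show "(val f)\<dagger>\<cdot>snd (trg f) = (val f)\<dagger>" using p by simp
qed

lemma tensor_star_category_B: "tensor_star_category B"
proof -
 interpret B: complex_tensor_category B by (rule complex_tensor_category_B)
 show ?thesis
 proof
  fix f X Y assume f: "f \<in> Hom B X Y"
  then have fA: "f \<in> Arr B" by (simp add: in_Hom)
  show "star B f \<in> Hom B Y X" using f star_B[OF fA] by (auto simp: Hom_B)
  assume "cmp B (star B f) f = hzero B X X"
  then have "(val f)\<dagger>\<cdot>val f = hzero A (fst X) (fst X)" by simp
  then have "val f = hzero A (fst X) (fst Y)"
   by (rule star_positive[rotated]) (use f in "auto simp: Hom_B in_Hom[of _ A]")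
  then show "f = hzero B X Y" using f by (simp add: Hom_B arrow_eq_iff)
 qed (auto simp: Hom_B Arr_B arrow_eq_iff)
qed

lemma has_subobjects_B: "has_subobjects B"
 unfolding has_subobjects_def
proof (intro ballI allI impI)
 fix X e assume X: "X \<in> Obj B" and e: "projection B X e"
 have p: "src e = X" "trg e = X" "val e \<in> Arr A" "Dom A (val e) = fst X" "Cod A (val e) = fst X"
  "snd X\<cdot>val e = val e" "val e\<cdot>snd X = val e" "(val e)\<dagger> = val e" "val e\<cdot>val e = val e"
  using e by (auto simp: projection_def Hom_B arrow_eq_iff)
 let ?Y = "(fst X, val e)" and ?V = "Arrow (fst X, val e) X (val e)"
 have "?Y \<in> Obj B" using X p by (simp add: Obj_B)
 moreover have "isometry B ?Y X ?V" using X p by (auto simp: isometry_def Hom_B Obj_B)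
 moreover have "cmp B ?V (star B ?V) = e" using p by (simp add: arrow_eq_iff)
 ultimately show "\<exists>Y\<in>Obj B. \<exists>V. isometry B Y X V \<and> cmp B V (star B V) = e" by blast
qed

lemma has_direct_sums_B:
 assumes "has_direct_sums A"
 shows "has_direct_sums B"
 unfolding has_direct_sums_def
proof (intro ballI)
 fix X Y assume X: "X \<in> Obj B" and Y: "Y \<in> Obj B"
 note [simp] = X[unfolded Obj_B] Y[unfolded Obj_B]
 obtain \<tau> V W where V: "isometry A (fst X) \<tau> V" and W: "isometry A (fst Y) \<tau> W"
  and VW: "hadd A (V\<cdot>V\<dagger>) (W\<cdot>W\<dagger>) = idn A \<tau>"
  using assms X Y unfolding has_direct_sums_def direct_sum_def Obj_B by blast
 note [simp] = isometryD[OF V] isometryD[OF W]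
 note o = direct_sum_orthogonal[OF V W VW]
 have [simp]: "V\<dagger>\<cdot>(W\<cdot>z) = hzero A (Dom A z) (fst X)" if "z \<in> Arr A" "Cod A z = fst Y" for z
  using cmp_eq_cmp[OF o(1), of z] that by simp
 have [simp]: "W\<dagger>\<cdot>(V\<cdot>z) = hzero A (Dom A z) (fst Y)" if "z \<in> Arr A" "Cod A z = fst X" for z
  using cmp_eq_cmp[OF o(2), of z] that by simp
 have [simp]: "snd X\<cdot>(snd X\<cdot>z) = snd X\<cdot>z" if "z \<in> Arr A" "Cod A z = fst X" for z
  by (rule absorb) (use that in simp_all)
 have [simp]: "snd Y\<cdot>(snd Y\<cdot>z) = snd Y\<cdot>z" if "z \<in> Arr A" "Cod A z = fst Y" for z
  by (rule absorb) (use that in simp_all)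
 define E where "E = hadd A (V\<cdot>(snd X\<cdot>V\<dagger>)) (W\<cdot>(snd Y\<cdot>W\<dagger>))"
 have [simp]: "E \<in> Arr A" "Dom A E = \<tau>" "Cod A E = \<tau>" by (simp_all add: E_def)
 have EV: "E\<cdot>(V\<cdot>snd X) = V\<cdot>snd X" and EW: "E\<cdot>(W\<cdot>snd Y) = W\<cdot>snd Y"
  by (simp_all add: E_def cmp_hadd)
 have "E\<dagger> = E" "E\<cdot>E = E" by (simp_all add: E_def cmp_hadd)
 then have Z: "(\<tau>, E) \<in> Obj B" by (simp add: Obj_B)
 let ?V = "Arrow X (\<tau>, E) (V\<cdot>snd X)" and ?W = "Arrow Y (\<tau>, E) (W\<cdot>snd Y)"
 have "isometry B X (\<tau>, E) ?V" "isometry B Y (\<tau>, E) ?W"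
  using X Y Z EV EW by (simp_all add: isometry_def Hom_B)
 moreover have "hadd B (cmp B ?V (star B ?V)) (cmp B ?W (star B ?W)) = idn B (\<tau>, E)"
  by (simp add: E_def)
 ultimately show "\<exists>Z\<in>Obj B. direct_sum B X Y Z" using Z unfolding direct_sum_def by blast
qed

lemma finite_dimensional_B:
 assumes fd: "!!\<rho> \<sigma>. [|\<rho> \<in> Obj A; \<sigma> \<in> Obj A|] ==> finite_dimensional (hom_space A \<rho> \<sigma>)"
  and X: "X \<in> Obj B" and Y: "Y \<in> Obj B"
 shows "finite_dimensional (hom_space B X Y)"
proof -
 interpret B: complex_tensor_category B by (rule complex_tensor_category_B)
 note [simp] = X[unfolded Obj_B] Y[unfolded Obj_B]
 have [simp]: "snd Y\<cdot>(snd Y\<cdot>z) = snd Y\<cdot>z" if "z \<in> Arr A" "Cod A z = fst Y" for z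
  by (rule absorb) (use that in simp_all)
 show ?thesis
 proof (rule finite_dimensional_image[where f = "%x. Arrow X Y (snd Y\<cdot>(x\<cdot>snd X))"])
  show "Module.module complex_field (hom_space A (fst X) (fst Y))"
   by (rule vector_space) simp_all
  show "finite_dimensional (hom_space A (fst X) (fst Y))" by (rule fd) simp_all
  show "Module.module complex_field (hom_space B X Y)" by (rule B.vector_space[OF X Y])
  fix y assume "y \<in> carrier (hom_space B X Y)"
  then have y: "y \<in> Hom B X Y" by simp
  then show "\<exists>x\<in>carrier (hom_space A (fst X) (fst Y)). y = Arrow X Y (snd Y\<cdot>(x\<cdot>snd X))"
   by (intro bexI[of _ "val y"]) (auto simp: Hom_B arrow_eq_iff in_Hom[of _ A])
 qed (use X Y in "auto simp: Hom_B in_Hom[of _ A] cmp_hadd")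
qed

text \<open>The full and faithful embedding \<open>\<rho> \<mapsto> (\<rho>, id)\<close>.\<close>

definition J :: "'x => ('o \<times> 'x, 'x) arrow" where
 "J x = Arrow (Dom A x, idn A (Dom A x)) (Cod A x, idn A (Cod A x)) x"

lemma J_hom: "x \<in> Hom A \<rho> \<sigma> ==> J x \<in> Hom B (\<rho>, idn A \<rho>) (\<sigma>, idn A \<sigma>)"
 using Hom_obj[of x \<rho> \<sigma>] by (auto simp: J_def Hom_B Obj_B in_Hom[of _ A])

lemma Obj_J: "\<rho> \<in> Obj A ==> (\<rho>, idn A \<rho>) \<in> Obj B"
 by (simp add: Obj_B)

lemma irreducible_unt_B:
 assumes "irreducible_obj A (unt A)"
 shows "irreducible_obj B (unt B)"
proof -
 have [simp]: "unt A \<in> Obj A" by simp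
 have "\<exists>c. f = hscale B c (idn B (unt B))" if "f \<in> Hom B (unt B) (unt B)" for f
 proof -
  have f: "val f \<in> Arr A" "Dom A (val f) = unt A" "Cod A (val f) = unt A" "src f = unt B" "trg f = unt B"
   using that by (auto simp: Hom_B)
  show ?thesis using coef[OF assms f(1-3)] f(4,5) by (auto simp: arrow_eq_iff)
 qed
 moreover have "hscale B c (idn B (unt B)) \<in> Hom B (unt B) (unt B)" for c
  by (simp add: Hom_B Obj_B)
 ultimately have "Hom B (unt B) (unt B) = range (%c. hscale B c (idn B (unt B)))" by blast
 moreover have "idn B (unt B) ~= hzero B (unt B) (unt B)"
  using irreducible_objD[OF assms] by simp
 ultimately show ?thesis
  unfolding irreducible_obj_def by (simp add: Obj_B)
qed

lemma semisimple_tensor_category_B: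
 assumes "has_direct_sums A" "irreducible_obj A (unt A)"
  and "!!\<rho> \<sigma>. [|\<rho> \<in> Obj A; \<sigma> \<in> Obj A|] ==> finite_dimensional (hom_space A \<rho> \<sigma>)"
 shows "semisimple_tensor_category B"
proof -
 interpret B: tensor_star_category B by (rule tensor_star_category_B)
 show ?thesis
  by unfold_locales
   (use assms has_direct_sums_B has_subobjects_B irreducible_unt_B finite_dimensional_B in blast)+
qed

lemma unitary_braiding_B:
 assumes "unitary_braiding A"
 shows "unitary_braiding B"
proof -
 interpret unitary_braiding A by fact
 let ?b = "%X Y. braid A (fst X) (fst Y)"
 have bh[simp]: "braid A \<rho> \<sigma> \<in> Arr A" "Dom A (braid A \<rho> \<sigma>) = \<rho>\<boxdot>\<sigma>" "Cod A (braid A \<rho> \<sigma>) = \<sigma>\<boxdot>\<rho>"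
  if "\<rho> \<in> Obj A" "\<sigma> \<in> Obj A" for \<rho> \<sigma> using braid_hom[OF that] by (auto simp: in_Hom)
 have nat: "braid A \<rho>' \<sigma>'\<cdot>(f \<boxtimes> g) = (g \<boxtimes> f)\<cdot>braid A \<rho> \<sigma>"
  if "f \<in> Arr A" "g \<in> Arr A" "Dom A f = \<rho>" "Cod A f = \<rho>'" "Dom A g = \<sigma>" "Cod A g = \<sigma>'" for f g \<rho> \<rho>' \<sigma> \<sigma>'
  by (rule braid_natural) (use that in "auto simp: in_Hom")
 have b: "braid B X Y = Arrow (X \<boxdot>\<^bsub>B\<^esub> Y) (Y \<boxdot>\<^bsub>B\<^esub> X) (?b X Y\<cdot>(snd X \<boxtimes> snd Y))"
  if X: "X \<in> Obj B" and Y: "Y \<in> Obj B" for X Y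
 proof -
  note [simp] = X[unfolded Obj_B] Y[unfolded Obj_B]
  have "?b X Y\<cdot>(snd X \<boxtimes> snd Y) = (snd Y \<boxtimes> snd X)\<cdot>?b X Y"
   by (rule nat) simp_all
  then have "(snd Y \<boxtimes> snd X)\<cdot>(?b X Y\<cdot>(snd X \<boxtimes> snd Y)) =
    ((snd Y \<boxtimes> snd X)\<cdot>(snd Y \<boxtimes> snd X))\<cdot>?b X Y" by simp
  also have "\<dots> = (snd Y \<boxtimes> snd X)\<cdot>?b X Y" by (simp add: interch)
  also have "\<dots> = ?b X Y\<cdot>(snd X \<boxtimes> snd Y)" by (rule nat[symmetric]) simp_all
  finally show ?thesis by simp
 qed
 interpret B: tensor_star_category B by (rule tensor_star_category_B)
 show ?thesis
 proof
  fix X Y assume X: "X \<in> Obj B" and Y: "Y \<in> Obj B"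
  note [simp] = X[unfolded Obj_B] Y[unfolded Obj_B]
  have n: "(snd Y \<boxtimes> snd X)\<cdot>?b X Y = ?b X Y\<cdot>(snd X \<boxtimes> snd Y)"
   by (rule nat[symmetric]) simp_all
  have n': "(snd Y \<boxtimes> snd X)\<cdot>(?b X Y\<cdot>(snd X \<boxtimes> snd Y)) =
    ?b X Y\<cdot>(snd X \<boxtimes> snd Y)"
   using cmp_eq_cmp[OF n, of "snd X \<boxtimes> snd Y"] by (simp add: interch)
  have u: "(?b X Y)\<dagger>\<cdot>?b X Y = idn A (fst X\<boxdot>fst Y)"
   "?b X Y\<cdot>(?b X Y)\<dagger> = idn A (fst Y\<boxdot>fst X)"
   using braid_unitary[of "fst X" "fst Y"] by auto
  show "braid B X Y \<in> Hom B (X \<boxdot>\<^bsub>B\<^esub> Y) (Y \<boxdot>\<^bsub>B\<^esub> X)"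
   unfolding b[OF X Y] using X Y n' by (simp add: Hom_B Obj_B interch)
  have "(snd X \<boxtimes> snd Y)\<cdot>((?b X Y)\<dagger>\<cdot>(?b X Y\<cdot>(snd X \<boxtimes> snd Y))) =
    snd X \<boxtimes> snd Y"
   using cmp_eq_cmp[OF u(1), of "snd X \<boxtimes> snd Y"] by (simp add: interch)
  moreover have "?b X Y\<cdot>((snd X \<boxtimes> snd Y)\<cdot>((snd X \<boxtimes> snd Y)\<cdot>(?b X Y)\<dagger>)) =
    snd Y \<boxtimes> snd X"
  proof -
   have "(snd X \<boxtimes> snd Y)\<cdot>((snd X \<boxtimes> snd Y)\<cdot>(?b X Y)\<dagger>) =
     (snd X \<boxtimes> snd Y)\<cdot>(?b X Y)\<dagger>"
    by (rule absorb) (simp_all add: interch)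
   then have "?b X Y\<cdot>((snd X \<boxtimes> snd Y)\<cdot>((snd X \<boxtimes> snd Y)\<cdot>(?b X Y)\<dagger>)) =
     ((snd Y \<boxtimes> snd X)\<cdot>?b X Y)\<cdot>(?b X Y)\<dagger>"
    unfolding n by simp
   then show ?thesis by (simp add: u(2))
  qed
  ultimately show "cmp B (star B (braid B X Y)) (braid B X Y) = idn B (X \<boxdot>\<^bsub>B\<^esub> Y) \<and>
    cmp B (braid B X Y) (star B (braid B X Y)) = idn B (Y \<boxdot>\<^bsub>B\<^esub> X)"
   unfolding b[OF X Y] by simp
 next
  fix f g X X' Y Y' assume f: "f \<in> Hom B X X'" and g: "g \<in> Hom B Y Y'"
  then have o: "X \<in> Obj B" "X' \<in> Obj B" "Y \<in> Obj B" "Y' \<in> Obj B" by (auto simp: Hom_B)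
  note [simp] = o[unfolded Obj_B] f[unfolded Hom_B] g[unfolded Hom_B]
  have n: "(val g \<boxtimes> val f)\<cdot>?b X Y = ?b X' Y'\<cdot>(val f \<boxtimes> val g)"
   by (rule nat[symmetric]) simp_all
  show "cmp B (braid B X' Y') (tar B f g) = cmp B (tar B g f) (braid B X Y)"
   unfolding b[OF o(1,3)] b[OF o(2,4)]
   using cmp_eq_cmp[OF n, of "snd X \<boxtimes> snd Y"] by (simp add: interch)
 next
  fix X Y Z assume X: "X \<in> Obj B" and Y: "Y \<in> Obj B" and Z: "Z \<in> Obj B"
  note [simp] = X[unfolded Obj_B] Y[unfolded Obj_B] Z[unfolded Obj_B]
  have XY: "X \<boxdot>\<^bsub>B\<^esub> Y \<in> Obj B" "Y \<boxdot>\<^bsub>B\<^esub> Z \<in> Obj B" using X Y Z B.tob_obj by blast+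
  have n: "(snd Y' \<boxtimes> snd X')\<cdot>?b X' Y' = ?b X' Y'\<cdot>(snd X' \<boxtimes> snd Y')"
   if "X' \<in> Obj B" "Y' \<in> Obj B" for X' Y'
   using that by (intro nat[symmetric]) (simp_all add: Obj_B)
  have "(snd Y \<boxtimes> (snd X \<boxtimes> snd Z))\<cdot>(?b X Y|>(fst Z)) =
    (?b X Y|>(fst Z))\<cdot>(snd X \<boxtimes> (snd Y \<boxtimes> snd Z))"
   using n[OF X Y] interch[of "snd Y \<boxtimes> snd X" "?b X Y" "snd Z" "idn A (fst Z)"]
    interch[of "?b X Y" "snd X \<boxtimes> snd Y" "idn A (fst Z)" "snd Z"] by simp
  from cmp_eq_cmp[OF this, of "snd X \<boxtimes> (snd Y \<boxtimes> snd Z)"]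
  have 1: "(snd Y \<boxtimes> (snd X \<boxtimes> snd Z))\<cdot>((?b X Y|>(fst Z))\<cdot>(snd X \<boxtimes> (snd Y \<boxtimes> snd Z))) =
    (?b X Y|>(fst Z))\<cdot>(snd X \<boxtimes> (snd Y \<boxtimes> snd Z))"
   by (simp add: interch)
  have 2: "snd Y \<boxtimes> (?b X Z\<cdot>(snd X \<boxtimes> snd Z)) =
    ((fst Y)<|?b X Z)\<cdot>(snd Y \<boxtimes> (snd X \<boxtimes> snd Z))"
   by (simp add: interch)
  have 3: "(?b X Y\<cdot>(snd X \<boxtimes> snd Y)) \<boxtimes> snd Z =
    (?b X Y|>(fst Z))\<cdot>(snd X \<boxtimes> (snd Y \<boxtimes> snd Z))"
   using interch[of "?b X Y" "snd X \<boxtimes> snd Y" "idn A (fst Z)" "snd Z"] by simp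
  show "braid B X (Y \<boxdot>\<^bsub>B\<^esub> Z) = cmp B (tar B (idn B Y) (braid B X Z)) (tar B (braid B X Y) (idn B Z))"
   unfolding b[OF X XY(2)] b[OF X Z] b[OF X Y]
   using 1 by (simp add: 2 3 braid_tob_right)
  have "(snd X \<boxtimes> (snd Z \<boxtimes> snd Y))\<cdot>((fst X)<|?b Y Z) =
    ((fst X)<|?b Y Z)\<cdot>(snd X \<boxtimes> (snd Y \<boxtimes> snd Z))"
   using n[OF Y Z] by (simp add: interch)
  from cmp_eq_cmp[OF this, of "snd X \<boxtimes> (snd Y \<boxtimes> snd Z)"]
  have 4: "(snd X \<boxtimes> (snd Z \<boxtimes> snd Y))\<cdot>(((fst X)<|?b Y Z)\<cdot>(snd X \<boxtimes> (snd Y \<boxtimes> snd Z))) =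
    ((fst X)<|?b Y Z)\<cdot>(snd X \<boxtimes> (snd Y \<boxtimes> snd Z))"
   by (simp add: interch)
  have 5: "(?b X Z\<cdot>(snd X \<boxtimes> snd Z)) \<boxtimes> snd Y =
    (?b X Z|>(fst Y))\<cdot>(snd X \<boxtimes> (snd Z \<boxtimes> snd Y))"
   using interch[of "?b X Z" "snd X \<boxtimes> snd Z" "idn A (fst Y)" "snd Y"] by simp
  have 6: "snd X \<boxtimes> (?b Y Z\<cdot>(snd Y \<boxtimes> snd Z)) =
    ((fst X)<|?b Y Z)\<cdot>(snd X \<boxtimes> (snd Y \<boxtimes> snd Z))"
   by (simp add: interch)
  show "braid B (X \<boxdot>\<^bsub>B\<^esub> Y) Z = cmp B (tar B (braid B X Z) (idn B Y)) (tar B (idn B X) (braid B Y Z))"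
   unfolding b[OF XY(1) Z] b[OF X Z] b[OF Y Z]
   using 4 by (simp add: 5 6 braid_tob_left)
 qed
qed

end

section \<open>The fibre functor\<close>

sublocale TC_star \<subseteq> semisimple_tensor_category
 by unfold_locales (fact direct_sums subobjects fin_dim irreducible_unt)+

context complex_tensor_category
begin

lemma isomorphic_irreducible:
 assumes i: "isomorphic C \<rho> \<sigma>" and \<rho>: "irreducible_obj C \<rho>"
 shows "irreducible_obj C \<sigma>"
proof -
 obtain f g where f: "f \<in> Hom C \<rho> \<sigma>" and g: "g \<in> Hom C \<sigma> \<rho>" and gf: "g\<cdot>f = idn C \<rho>" and fg: "f\<cdot>g = idn C \<sigma>"
  using i by (auto simp: isomorphic_def)
 note [simp] = HomD[OF f] HomD[OF g]
 have [simp]: "\<rho> \<in> Obj C" "\<sigma> \<in> Obj C" using Hom_obj f by auto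
 have "idn C \<sigma> ~= hzero C \<sigma> \<sigma>"
 proof
  assume "idn C \<sigma> = hzero C \<sigma> \<sigma>"
  then have "g\<cdot>(idn C \<sigma>\<cdot>f) = hzero C \<rho> \<rho>" by (simp del: cmp_idn_l)
  then have "idn C \<rho> = hzero C \<rho> \<rho>" by (simp add: gf)
  with irreducible_objD[OF \<rho>] show False by simp
 qed
 moreover have "\<exists>c. x = hscale C c (idn C \<sigma>)" if x: "x \<in> Hom C \<sigma> \<sigma>" for x
 proof -
  note [simp] = HomD[OF x]
  have e: "g\<cdot>(x\<cdot>f) = hscale C (coef C (g\<cdot>(x\<cdot>f))) (idn C \<rho>)" by (rule coef[OF \<rho>]) simp_all
  have "x = (f\<cdot>g)\<cdot>(x\<cdot>(f\<cdot>g))" unfolding fg by simp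
  also have "\<dots> = f\<cdot>((g\<cdot>(x\<cdot>f))\<cdot>g)" by simp
  also have "\<dots> = hscale C (coef C (g\<cdot>(x\<cdot>f))) (idn C \<sigma>)" by (subst e) (simp add: fg)
  finally show ?thesis by blast
 qed
 moreover have "hscale C c (idn C \<sigma>) \<in> Hom C \<sigma> \<sigma>" for c by (simp add: in_Hom)
 ultimately show ?thesis unfolding irreducible_obj_def by (intro conjI) (simp, blast, blast)
qed

end

context summable_category
begin

text \<open>A nonzero arrow between irreducible objects is a multiple of a unitary.\<close>

lemma isomorphic_irreducible_isometry:
 assumes \<tau>: "irreducible_obj C \<tau>" and i: "isomorphic C \<tau> \<tau>'"
 shows "\<exists>e. isometry C \<tau> \<tau>' e \<and> e\<cdot>e\<dagger> = idn C \<tau>'"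
proof -
 have \<tau>': "irreducible_obj C \<tau>'" using isomorphic_irreducible[OF i \<tau>] .
 obtain f g where f: "f \<in> Hom C \<tau> \<tau>'" and g: "g \<in> Hom C \<tau>' \<tau>" and gf: "g\<cdot>f = idn C \<tau>"
  using i by (auto simp: isomorphic_def)
 note [simp] = HomD[OF f] HomD[OF g]
 have [simp]: "\<tau> \<in> Obj C" "\<tau>' \<in> Obj C" using irreducible_objD \<tau> \<tau>' by auto
 have "f ~= hzero C \<tau> \<tau>'"
 proof
  assume "f = hzero C \<tau> \<tau>'"
  with gf have "idn C \<tau> = hzero C \<tau> \<tau>" by simp
  with irreducible_objD[OF \<tau>] show False by simp
 qed
 then obtain e where "isometry C \<tau> \<tau>' e" using normalize_isometry[OF \<tau>, of f] by auto
 then show ?thesis using isometry_irr_unitary[OF \<tau> \<tau>'] by blast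
qed

end

locale crossed_product_setting =
 BTC_star C + sub: even_symmetric_subcategory C S + rep: rep_category G U +
 F: symmetric_tensor_isomorphism C S G U Fo Fa + ch: crossed_product_choices C S \<gamma> V R Rb +
 crossed_product_data C S U Fo Fa \<gamma> V R Rb
 for C :: "('o, 'm) braided_cat" (structure) and S :: "'o set"
  and G :: "'g top_group" and U :: "('u, 'g, 'v) rep_cat"
  and Fo :: "'o => 'u" and Fa :: "'m => 'v => 'v"
  and \<gamma> :: "'o set => 'o" and V :: "'o set => 'o set => 'o set => 'm set"
  and R :: "'o set => 'm" and Rb :: "'o set => 'm"
begin

abbreviation "Sp g \<equiv> rspace U (Fo g)"
abbreviation "Vec g \<equiv> carrier (Sp g)"
abbreviation "tv g h \<equiv> rtvec U (Fo g) (Fo h)"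
abbreviation "\<Omega> \<equiv> romega U"

lemma S_obj [simp]: "g \<in> S ==> g \<in> Obj C"
 using sub.sub_obj by auto

declare sub.unt_mem [simp] sub.tob_mem [simp]

lemma Fo_mem: "g \<in> S ==> Fo g \<in> robj U"
 using F.Fo_bij by (auto simp: bij_betw_def)

lemma hilb: "g \<in> S ==> fd_hilbert (Sp g)"
 using rep.rep[OF Fo_mem] by (simp add: unitary_rep_def)

lemma sp_cvs: "g \<in> S ==> cvs (Sp g)"
 using fd_hilbert.vector_space[OF hilb] by (simp add: cvs_def)

lemma F_linear:
 assumes "f \<in> Hom C g h" "g \<in> S" "h \<in> S"
 shows "Fa f \<in> linear_maps (Sp g) (Sp h)"
proof -
 have "Fa f \<in> rhom G U (Fo g) (Fo h)" using F.Fa_bij[OF assms(2,3)] assms(1) by (auto simp: bij_betw_def)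
 then show ?thesis by (simp add: rhom_def intertwiners_def)
qed

lemmas F_mem = linear_mapsD(1)[OF F_linear]
lemmas F_add = linear_mapsD(2)[OF F_linear]
lemmas F_scale = linear_mapsD(3)[OF F_linear]

lemma F_adjoint:
 assumes f: "f \<in> Hom C g h" "g \<in> S" "h \<in> S" and x: "x \<in> Vec g" "y \<in> Vec h"
 shows "ip (Sp h) (Fa f x) y = ip (Sp g) x (Fa (f\<dagger>) y)"
 using hilbert_adjoint(2)[OF hilb[OF f(2)] hilb[OF f(3)] F_linear[OF f] x(2,1)] F.Fa_star[OF f(2,3,1)] by simp

lemma F_hzero:
 assumes [simp]: "g \<in> S" "h \<in> S" and x: "x \<in> Vec g"
 shows "Fa (hzero C g h) x = \<zero>\<^bsub>Sp h\<^esub>"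
proof -
 interpret cvs "Sp h" by (simp add: sp_cvs)
 have "hzero C g h \<in> Hom C g h" by (simp add: in_Hom)
 then have "Fa (hscale C 0 (hzero C g h)) x = \<zero>\<^bsub>Sp h\<^esub>"
  using F.Fa_scale[of g h "hzero C g h" x 0] F_mem[of "hzero C g h" g h x] x by simp
 then show ?thesis by simp
qed

lemma tv_mem: "[|g \<in> S; h \<in> S; x \<in> Vec g; y \<in> Vec h|] ==>
  tv g h x y \<in> Vec (g\<boxdot>h)"
 using linear_mapsD(1)[OF rep.rtvec_left[OF Fo_mem Fo_mem], of g h y x] by (simp add: F.Fo_tob)

lemma tv_add_left:
 assumes gh: "g \<in> S" "h \<in> S" and x: "x \<in> Vec g" "x' \<in> Vec g" "y \<in> Vec h"
 shows "tv g h (x \<oplus>\<^bsub>Sp g\<^esub> x') y = tv g h x y \<oplus>\<^bsub>Sp (g\<boxdot>h)\<^esub> tv g h x' y"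
proof -
 interpret cvs "Sp g" using gh by (simp add: sp_cvs)
 show ?thesis
  using linear_mapsD(2)[OF rep.rtvec_left[OF Fo_mem[OF gh(1)] Fo_mem[OF gh(2)] x(3)] x(1,2)] x gh
  by (simp add: F.Fo_tob)
qed

lemma tv_add_right:
 assumes gh: "g \<in> S" "h \<in> S" and x: "x \<in> Vec g" "y \<in> Vec h" "y' \<in> Vec h"
 shows "tv g h x (y \<oplus>\<^bsub>Sp h\<^esub> y') = tv g h x y \<oplus>\<^bsub>Sp (g\<boxdot>h)\<^esub> tv g h x y'"
proof -
 interpret cvs "Sp h" using gh by (simp add: sp_cvs)
 show ?thesis
  using linear_mapsD(2)[OF rep.rtvec_right[OF Fo_mem[OF gh(1)] Fo_mem[OF gh(2)] x(1)] x(2,3)] x gh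
  by (simp add: F.Fo_tob)
qed

lemma tv_scale_left:
 assumes gh: "g \<in> S" "h \<in> S" and x: "x \<in> Vec g" "y \<in> Vec h"
 shows "tv g h (c \<odot>\<^bsub>Sp g\<^esub> x) y = c \<odot>\<^bsub>Sp (g\<boxdot>h)\<^esub> tv g h x y"
proof -
 interpret cvs "Sp g" using gh by (simp add: sp_cvs)
 show ?thesis
  using linear_mapsD(3)[OF rep.rtvec_left[OF Fo_mem[OF gh(1)] Fo_mem[OF gh(2)] x(2)] x(1), of c] x gh
  by (simp add: F.Fo_tob)
qed

lemma tv_scale_right:
 assumes gh: "g \<in> S" "h \<in> S" and x: "x \<in> Vec g" "y \<in> Vec h"
 shows "tv g h x (c \<odot>\<^bsub>Sp h\<^esub> y) = c \<odot>\<^bsub>Sp (g\<boxdot>h)\<^esub> tv g h x y"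
proof -
 interpret cvs "Sp h" using gh by (simp add: sp_cvs)
 show ?thesis
  using linear_mapsD(3)[OF rep.rtvec_right[OF Fo_mem[OF gh(1)] Fo_mem[OF gh(2)] x(1)] x(2), of c] x gh
  by (simp add: F.Fo_tob)
qed

lemma tv_ip:
 "[|g \<in> S; h \<in> S; x \<in> Vec g; x' \<in> Vec g; y \<in> Vec h; y' \<in> Vec h|] ==>
  ip (Sp (g\<boxdot>h)) (tv g h x y) (tv g h x' y') = ip (Sp g) x x' * ip (Sp h) y y'"
 using rep.rtvec_ip[OF Fo_mem Fo_mem] by (simp add: F.Fo_tob)

lemma tv_assoc:
 "[|g \<in> S; h \<in> S; k \<in> S; x \<in> Vec g; y \<in> Vec h; z \<in> Vec k|] ==>
  tv (g\<boxdot>h) k (tv g h x y) z = tv g (h\<boxdot>k) x (tv h k y z)"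
 using rep.rtvec_assoc[OF Fo_mem Fo_mem Fo_mem, of g h k x y z] by (simp add: F.Fo_tob)

lemma \<Omega>_mem: "\<Omega> \<in> Vec (unt C)"
 and \<Omega>_ip: "ip (Sp (unt C)) \<Omega> \<Omega> = 1"
 and tv_unt: "[|g \<in> S; x \<in> Vec g|] ==> tv (unt C) g \<Omega> x = x"
  "[|g \<in> S; x \<in> Vec g|] ==> tv g (unt C) x \<Omega> = x"
 using rep.runt_space rep.rtvec_unt[OF Fo_mem] by (simp_all add: F.Fo_unt)

lemma \<Omega>_span: assumes "x \<in> Vec (unt C)" shows "x = ip (Sp (unt C)) \<Omega> x \<odot>\<^bsub>Sp (unt C)\<^esub> \<Omega>"
proof -
 interpret fd_hilbert "Sp (unt C)" by (simp add: hilb)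
 have "orthonormal_basis (Sp (unt C)) {\<Omega>}"
  using rep.runt_space by (simp add: orthonormal_basis_def F.Fo_unt)
 from orthonormal_expansion[OF this assms] assms \<Omega>_mem show ?thesis by simp
qed

lemma F_tv:
 "[|f \<in> Hom C g h; f' \<in> Hom C g' h'; g \<in> S; h \<in> S; g' \<in> S; h' \<in> S; x \<in> Vec g; y \<in> Vec g'|]
  ==> Fa (f \<boxtimes> f') (tv g g' x y) = tv h h' (Fa f x) (Fa f' y)"
 by (rule F.Fa_tar)

text \<open>The space of a tensor product is spanned by the products of vectors.\<close>

lemma tv_induct [consumes 3, case_names tv add smult]:
 assumes gh: "g \<in> S" "h \<in> S" and t: "t \<in> Vec (g\<boxdot>h)"
  and tv: "!!x y. [|x \<in> Vec g; y \<in> Vec h|] ==> P (tv g h x y)"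
  and add: "!!t t'. [|t \<in> Vec (g\<boxdot>h); t' \<in> Vec (g\<boxdot>h); P t; P t'|] ==> P (t \<oplus>\<^bsub>Sp (g\<boxdot>h)\<^esub> t')"
  and sm: "!!c t. [|t \<in> Vec (g\<boxdot>h); P t|] ==> P (c \<odot>\<^bsub>Sp (g\<boxdot>h)\<^esub> t)"
 shows "P t"
proof -
 interpret gh: cvs "Sp (g\<boxdot>h)" using gh by (simp add: sp_cvs)
 interpret g: cvs "Sp g" using gh by (simp add: sp_cvs)
 interpret h: cvs "Sp h" using gh by (simp add: sp_cvs)
 obtain A B where AB: "A \<subseteq> Vec g" "B \<subseteq> Vec h"
  and sp: "spans (Sp (g\<boxdot>h)) ((%(x, y). tv g h x y) ` (A \<times> B))"
  using rep.rtvec_total[OF Fo_mem[OF gh(1)] Fo_mem[OF gh(2)]] by (auto simp: F.Fo_tob gh)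
 from sp t show ?thesis
 proof (induct rule: gh.spans_induct)
  case zero
  have "P (0 \<odot>\<^bsub>Sp (g\<boxdot>h)\<^esub> tv g h \<zero>\<^bsub>Sp g\<^esub> \<zero>\<^bsub>Sp h\<^esub>)"
   by (intro sm tv tv_mem gh) simp_all
  then show ?case using tv_mem[OF gh, of "\<zero>\<^bsub>Sp g\<^esub>" "\<zero>\<^bsub>Sp h\<^esub>"] by simp
 next
  case (base b)
  then show ?case using AB tv by auto
 qed (use add sm in auto)
qed

subsection \<open>The irreducible objects of the subcategory\<close>

lemma Ghat:
 assumes k: "k \<in> Ghat"
 shows "\<gamma> k \<in> S" "irreducible_obj C (\<gamma> k)" "iso_class C (\<gamma> k) = k"
proof -
 obtain \<rho> where \<rho>: "\<rho> \<in> S" "irreducible_obj C \<rho>" "k = iso_class C \<rho>"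
  using k by (auto simp: irr_classes_def)
 have i: "\<gamma> k \<in> Obj C" "isomorphic C \<rho> (\<gamma> k)" using ch.rep_mem[OF k] \<rho>(3) by (auto simp: iso_class_def)
 show "\<gamma> k \<in> S" by (rule sub.replete[OF \<rho>(1) i])
 show "irreducible_obj C (\<gamma> k)" by (rule isomorphic_irreducible[OF i(2) \<rho>(2)])
 show "iso_class C (\<gamma> k) = k" using iso_class_eq_iff[of "\<gamma> k" \<rho>] isomorphic_sym[OF i(2)] \<rho> i(1) by simp
qed

lemma \<gamma>_obj [simp]: "k \<in> Ghat ==> \<gamma> k \<in> Obj C" "k \<in> Ghat ==> \<gamma> k \<in> S"
 using Ghat by auto

lemma H_Sp: "H k = Sp (\<gamma> k)"
 by (simp add: H_def)

lemma iso_class_mem_Ghat: "[|\<tau> \<in> S; irreducible_obj C \<tau>|] ==> iso_class C \<tau> \<in> Ghat"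
 by (auto simp: irr_classes_def)

lemma \<gamma>_isometry:
 assumes \<tau>: "\<tau> \<in> S" "irreducible_obj C \<tau>"
 shows "\<exists>e. isometry C (\<gamma> (iso_class C \<tau>)) \<tau> e \<and> e\<cdot>e\<dagger> = idn C \<tau>"
proof -
 note k = Ghat[OF iso_class_mem_Ghat[OF \<tau>]]
 then have "isomorphic C (\<gamma> (iso_class C \<tau>)) \<tau>"
  using iso_class_eq_iff[of "\<gamma> (iso_class C \<tau>)" \<tau>] \<tau>(1) by simp
 with k(2) show ?thesis by (rule isomorphic_irreducible_isometry)
qed

lemma unt_Ghat: "iso_class C (unt C) \<in> Ghat"
 by (rule iso_class_mem_Ghat) (simp_all add: irreducible_unt)

lemma Hom_\<gamma>_zero:
 assumes "k \<in> Ghat" "l \<in> Ghat" "k ~= l" "f \<in> Hom C (\<gamma> k) (\<gamma> l)"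
 shows "f = hzero C (\<gamma> k) (\<gamma> l)"
proof (rule ccontr)
 assume "f ~= hzero C (\<gamma> k) (\<gamma> l)"
 then have "isomorphic C (\<gamma> k) (\<gamma> l)"
  using irr_hom_isomorphic[OF Ghat(2)[OF assms(1)] Ghat(2)[OF assms(2)] assms(4)] by blast
 then show False using assms(3) iso_class_eq_iff[of "\<gamma> k" "\<gamma> l"] Ghat assms(1,2) by simp
qed

text \<open>A decomposition into irreducible objects, composed with unitaries from the chosen representatives.\<close>

lemma S_decomposition:
 assumes g: "g \<in> S"
 shows "\<exists>Q. decomposition C g Q \<and> (\<forall>w\<in>Q. \<exists>k\<in>Ghat. Dom C w = \<gamma> k)"
proof -
 obtain Q where Q: "decomposition C g Q" using decomposition_exists[of g] g by auto
 note d = decompositionD[OF Q]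
 have \<tau>: "Dom C w \<in> S" if "w \<in> Q" for w
  using sub.subobject_mem[OF g _ d(3)[OF that]] d(4)[OF that] by simp
 have "\<exists>e. isometry C (\<gamma> (iso_class C (Dom C w))) (Dom C w) e \<and> e\<cdot>e\<dagger> = idn C (Dom C w)" if "w \<in> Q" for w
  by (rule \<gamma>_isometry[OF \<tau>[OF that] d(2)[OF that]])
 then obtain e where e: "!!w. w \<in> Q ==> isometry C (\<gamma> (iso_class C (Dom C w))) (Dom C w) (e w)"
  and ee: "!!w. w \<in> Q ==> e w\<cdot>(e w)\<dagger> = idn C (Dom C w)" by metis
 have kG: "iso_class C (Dom C w) \<in> Ghat" if "w \<in> Q" for w
  by (rule iso_class_mem_Ghat[OF \<tau>[OF that] d(2)[OF that]])
 note [simp] = d(4,5) isometryD(1,2,3)[OF e]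
 have iso: "isometry C (\<gamma> (iso_class C (Dom C w))) g (w\<cdot>e w)" if "w \<in> Q" for w
  by (rule isometry_cmp[OF e[OF that] d(3)[OF that]])
 have orth: "(w\<cdot>e w)\<dagger>\<cdot>(w'\<cdot>e w') = hzero C (Dom C (w'\<cdot>e w')) (Dom C (w\<cdot>e w))"
  if w: "w \<in> Q" "w' \<in> Q" "w ~= w'" for w w'
 proof -
  have "(w\<cdot>e w)\<dagger>\<cdot>(w'\<cdot>e w') = (e w)\<dagger>\<cdot>((w\<dagger>\<cdot>w')\<cdot>e w')" using w by simp
  also have "\<dots> = hzero C (Dom C (w'\<cdot>e w')) (Dom C (w\<cdot>e w))"
   unfolding d(7)[OF w] using w kG by simp
  finally show ?thesis .
 qed
 have inj: "inj_on (%w. w\<cdot>e w) Q"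
 proof (rule inj_onI, rule ccontr)
  fix w w' assume w: "w \<in> Q" "w' \<in> Q" "w\<cdot>e w = w'\<cdot>e w'" "w ~= w'"
  have "(w\<cdot>e w)\<dagger>\<cdot>(w\<cdot>e w) = hzero C (Dom C (w'\<cdot>e w')) (Dom C (w\<cdot>e w))"
   using orth[OF w(1,2,4)] unfolding w(3) .
  moreover have "Dom C (w\<cdot>e w) = Dom C (w'\<cdot>e w')" using w(3) by simp
  ultimately have "idn C (Dom C (w\<cdot>e w)) = hzero C (Dom C (w\<cdot>e w)) (Dom C (w\<cdot>e w))"
   using isometryD(4)[OF iso[OF w(1)]] w(1) by simp
  then show False using irreducible_objD[OF Ghat(2)[OF kG[OF w(1)]]] w(1) by simp
 qed
 have "decomposition C g ((%w. w\<cdot>e w) ` Q)"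
  unfolding decomposition_def
 proof (intro conjI ballI impI)
  show "finite ((%w. w\<cdot>e w) ` Q)" using d(1) by simp
 next
  fix x assume "x \<in> (%w. w\<cdot>e w) ` Q"
  then obtain w where w: "w \<in> Q" "x = w\<cdot>e w" by blast
  then show "irreducible_obj C (Dom C x)" "isometry C (Dom C x) g x"
   using Ghat(2)[OF kG] iso[OF w(1)] by simp_all
  fix x' assume "x' \<in> (%w. w\<cdot>e w) ` Q" and ne: "x ~= x'"
  then obtain w' where w': "w' \<in> Q" "x' = w'\<cdot>e w'" by blast
  then show "x\<dagger>\<cdot>x' = hzero C (Dom C x') (Dom C x)" using orth[of w w'] w ne by blast
 next
  have "hsum C g g (%x. x\<cdot>x\<dagger>) ((%w. w\<cdot>e w) ` Q) = hsum C g g (%w. (w\<cdot>e w)\<cdot>(w\<cdot>e w)\<dagger>) Q"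
  proof -
   interpret cvs "hom_space C g g" using g by (simp add: hom_cvs)
   show ?thesis using inj by (subst M.finsum_reindex) (auto simp: in_Hom)
  qed
  also have "\<dots> = hsum C g g (%w. w\<cdot>w\<dagger>) Q"
  proof (rule hsum_cong)
   fix w assume w: "w \<in> Q"
   have "(w\<cdot>e w)\<cdot>(w\<cdot>e w)\<dagger> = w\<cdot>((e w\<cdot>(e w)\<dagger>)\<cdot>w\<dagger>)" using w by simp
   then show "(w\<cdot>e w)\<cdot>(w\<cdot>e w)\<dagger> = w\<cdot>w\<dagger>" unfolding ee[OF w] using w by simp
  qed (use g in "auto simp: in_Hom")
  finally show "hsum C g g (%x. x\<cdot>x\<dagger>) ((%w. w\<cdot>e w) ` Q) = idn C g" by (simp add: d(6))
 qed
 moreover have "\<forall>x\<in>(%w. w\<cdot>e w) ` Q. \<exists>k\<in>Ghat. Dom C x = \<gamma> k" using kG by auto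
 ultimately show ?thesis by blast
qed

definition constituents :: "'o => 'o set set" where
 "constituents g = {k \<in> Ghat. \<exists>f\<in>Hom C (\<gamma> k) g. f ~= hzero C (\<gamma> k) g}"

lemma finite_constituents:
 assumes g: "g \<in> S"
 shows "finite (constituents g)"
proof -
 obtain Q where Q: "decomposition C g Q" and Qk: "!!w. w \<in> Q ==> \<exists>k\<in>Ghat. Dom C w = \<gamma> k"
  using S_decomposition[OF g] by blast
 note d = decompositionD[OF Q]
 have "constituents g \<subseteq> (%w. iso_class C (Dom C w)) ` Q"
 proof
  fix k assume "k \<in> constituents g"
  then obtain f where k: "k \<in> Ghat" and f: "f \<in> Hom C (\<gamma> k) g" "f ~= hzero C (\<gamma> k) g"
   by (auto simp: constituents_def)
  note [simp] = HomD[OF f(1)] d(4,5)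
  obtain w where w: "w \<in> Q" "w\<dagger>\<cdot>f ~= hzero C (\<gamma> k) (Dom C w)"
   using zero_if_components_cod[OF Q, of f "\<gamma> k"] f(2) by auto
  then obtain l where l: "l \<in> Ghat" "Dom C w = \<gamma> l" using Qk by blast
  then have "k = l" using Hom_\<gamma>_zero[OF k l(1), of "w\<dagger>\<cdot>f"] w by (auto simp: in_Hom)
  then have "k = iso_class C (Dom C w)" using l Ghat(3)[OF l(1)] by simp
  then show "k \<in> (%w. iso_class C (Dom C w)) ` Q" using w(1) by blast
 qed
 then show ?thesis using d(1) finite_surj by blast
qed

subsection \<open>Dyads\<close>

text \<open>The component of the operator \<open>\<bar>\<psi>\<rangle>\<langle>\<phi>\<bar>\<close> that comes from an arrow \<open>\<gamma> k \<rightarrow> g\<close>: its pairing with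
 any arrow \<open>w\<close> is the matrix coefficient \<open>\<langle>F(w)\<phi>, \<psi>\<rangle>\<close>. This condition determines it
 without reference to an orthonormal basis of \<open>Hom(\<gamma> k, g)\<close>.\<close>

definition is_dyad :: "'o set => 'o => 'v => 'v => 'm => bool" where
 "is_dyad k g \<phi> \<psi> d \<longleftrightarrow> d \<in> Hom C (\<gamma> k) g \<and>
   (\<forall>w\<in>Hom C (\<gamma> k) g. w\<dagger>\<cdot>d = hscale C (ip (Sp g) (Fa w \<phi>) \<psi>) (idn C (\<gamma> k)))"

definition dyad :: "'o set => 'o => 'v => 'v => 'm" where
 "dyad k g \<phi> \<psi> = (THE d. is_dyad k g \<phi> \<psi> d)"

lemma is_dyad_unique:
 assumes k: "k \<in> Ghat" and g: "g \<in> S" and d: "is_dyad k g \<phi> \<psi> d" "is_dyad k g \<phi> \<psi> d'"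
 shows "d = d'"
proof -
 have h: "d \<in> Hom C (\<gamma> k) g" "d' \<in> Hom C (\<gamma> k) g" using d by (auto simp: is_dyad_def)
 note [simp] = HomD[OF h(1)] HomD[OF h(2)]
 have e: "hsub d d' \<in> Hom C (\<gamma> k) g" by (simp add: in_Hom)
 have "(hsub d d')\<dagger>\<cdot>d = (hsub d d')\<dagger>\<cdot>d'" using d e unfolding is_dyad_def by metis
 then have "(hsub d d')\<dagger>\<cdot>hsub d d' = hzero C (\<gamma> k) (\<gamma> k)"
  using k g by (subst cmp_hadd(2)) (simp_all del: star_hadd)
 then have "hsub d d' = hzero C (\<gamma> k) g" by (rule star_positive_arr) simp_all
 then show ?thesis by (rule hdiff_eq_0D) (rule h)+
qed

text \<open>Pairing with the members \<open>w\<close> of a decomposition into representatives shows that the dyad is the sum of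
 the \<open>\<langle>F(w)\<phi>, \<psi>\<rangle> w\<close>.\<close>

lemma is_dyad_basis:
 assumes k: "k \<in> Ghat" and g: "g \<in> S" and \<phi>: "\<phi> \<in> Vec (\<gamma> k)" and \<psi>: "\<psi> \<in> Vec g"
  and Q: "decomposition C g Q" and Qk: "!!w. w \<in> Q ==> \<exists>k\<in>Ghat. Dom C w = \<gamma> k"
 shows "is_dyad k g \<phi> \<psi> (hsum C (\<gamma> k) g (%w. hscale C (ip (Sp g) (Fa w \<phi>) \<psi>) w) {w\<in>Q. Dom C w = \<gamma> k})"
proof -
 interpret g: fd_hilbert "Sp g" using g by (rule hilb)
 note [simp] = k g
 note d = decompositionD[OF Q]
 note [simp] = d(4,5)
 let ?A = "{w\<in>Q. Dom C w = \<gamma> k}"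
 have fin: "finite ?A" using d(1) by simp
 have A: "w \<in> Hom C (\<gamma> k) g" if "w \<in> ?A" for w using that by (auto simp: in_Hom)
 define D where "D = hsum C (\<gamma> k) g (%w. hscale C (ip (Sp g) (Fa w \<phi>) \<psi>) w) ?A"
 have hD: "(%w. hscale C (ip (Sp g) (Fa w \<phi>) \<psi>) w) \<in> ?A \<rightarrow> Hom C (\<gamma> k) g" by (auto simp: in_Hom)
 have D: "D \<in> Hom C (\<gamma> k) g" unfolding D_def by (rule hsum_hom) (use hD in auto)
 note [simp] = HomD[OF D]
 have orth: "w\<dagger>\<cdot>w' = (if w' = w then idn C (\<gamma> k) else hzero C (\<gamma> k) (\<gamma> k))" if "w \<in> ?A" "w' \<in> ?A" for w w'
 proof (cases "w' = w")
  case True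
  have "w\<dagger>\<cdot>w = idn C (Dom C w)" by (rule isometryD(4)[OF d(3)]) (use that in auto)
  then show ?thesis using True that by simp
 next
  case False
  then show ?thesis using d(7)[of w w'] that by auto
 qed
 have bas: "w\<dagger>\<cdot>D = hscale C (ip (Sp g) (Fa w \<phi>) \<psi>) (idn C (\<gamma> k))" if w: "w \<in> ?A" for w
 proof -
  have "w\<dagger>\<cdot>D = hsum C (\<gamma> k) (\<gamma> k) (%w'. w\<dagger>\<cdot>hscale C (ip (Sp g) (Fa w' \<phi>) \<psi>) w') ?A"
   unfolding D_def by (rule cmp_hsum) (use fin hD w in "auto simp: in_Hom")
  also have "\<dots> = hsum C (\<gamma> k) (\<gamma> k) (%w'. if w' = w then hscale C (ip (Sp g) (Fa w \<phi>) \<psi>) (idn C (\<gamma> k)) else hzero C (\<gamma> k) (\<gamma> k)) ?A"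
   by (rule hsum_cong) (use orth[OF w] w in "auto simp: in_Hom")
  also have "\<dots> = hscale C (ip (Sp g) (Fa w \<phi>) \<psi>) (idn C (\<gamma> k))"
   by (rule hsum_delta[OF fin w]) (simp add: in_Hom)
  finally show ?thesis .
 qed
 have "v\<dagger>\<cdot>D = hscale C (ip (Sp g) (Fa v \<phi>) \<psi>) (idn C (\<gamma> k))" if v: "v \<in> Hom C (\<gamma> k) g" for v
 proof -
  note [simp] = HomD[OF v]
  define c where "c w = coef C (w\<dagger>\<cdot>v)" for w
  have cw: "w\<dagger>\<cdot>v = hscale C (c w) (idn C (\<gamma> k))" if "w \<in> ?A" for w
   unfolding c_def by (rule coef[OF Ghat(2)[OF k]]) (use that in auto)
  have ex: "v = hsum C (\<gamma> k) g (%w. w\<cdot>(w\<dagger>\<cdot>v)) Q" using expand_cod[OF Q, of v] by simp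
  have z: "w\<cdot>(w\<dagger>\<cdot>v) = hzero C (\<gamma> k) g" if w: "w \<in> Q - ?A" for w
  proof -
   obtain l where l: "l \<in> Ghat" "Dom C w = \<gamma> l" using Qk w by blast
   then have "k ~= l" using w by auto
   then have "w\<dagger>\<cdot>v = hzero C (\<gamma> k) (\<gamma> l)" using Hom_\<gamma>_zero[OF k l(1), of "w\<dagger>\<cdot>v"] w l by (simp add: in_Hom)
   then show ?thesis using w l by simp
  qed
  have "v = hsum C (\<gamma> k) g (%w. w\<cdot>(w\<dagger>\<cdot>v)) ?A"
  proof -
   interpret h: cvs "hom_space C (\<gamma> k) g" by (simp add: hom_cvs)
   have "hsum C (\<gamma> k) g (%w. w\<cdot>(w\<dagger>\<cdot>v)) Q = hsum C (\<gamma> k) g (%w. w\<cdot>(w\<dagger>\<cdot>v)) ?A"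
    by (rule h.M.add.finprod_mono_neutral_cong_right) (use d(1) z in "auto simp: in_Hom")
   with ex show ?thesis by simp
  qed
  also have "\<dots> = hsum C (\<gamma> k) g (%w. hscale C (c w) w) ?A"
   by (rule hsum_cong) (use cw in "auto simp: in_Hom")
  finally have v': "v = hsum C (\<gamma> k) g (%w. hscale C (c w) w) ?A" .
  have L: "x\<dagger>\<cdot>D = hscale C (ip (Sp g) (Fa x \<phi>) \<psi>) (idn C (\<gamma> k)) \<and> x \<in> Hom C (\<gamma> k) g"
   if "finite B" "B \<subseteq> ?A" "x = hsum C (\<gamma> k) g (%w. hscale C (c w) w) B" for x B
   using that
  proof (induct arbitrary: x)
   case empty
   then have "x = hzero C (\<gamma> k) g" by simp
   then show ?case using F_hzero[of "\<gamma> k" g \<phi>] \<phi> \<psi> by (simp add: in_Hom)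
  next
   case (insert w B)
   define y where "y = hsum C (\<gamma> k) g (%w. hscale C (c w) w) B"
   have y: "y\<dagger>\<cdot>D = hscale C (ip (Sp g) (Fa y \<phi>) \<psi>) (idn C (\<gamma> k))" "y \<in> Hom C (\<gamma> k) g"
    using insert y_def by auto
   have w: "w \<in> ?A" using insert by simp
   have wH: "w \<in> Hom C (\<gamma> k) g" by (rule A[OF w])
   note [simp] = HomD[OF y(2)] HomD[OF wH]
   have x: "x = hadd C (hscale C (c w) w) y"
    unfolding insert(5) y_def by (rule hsum_insert) (use insert wH in "auto simp: in_Hom")
   have "Fa x \<phi> = Fa (hscale C (c w) w) \<phi> \<oplus>\<^bsub>Sp g\<^esub> Fa y \<phi>"
    unfolding x by (rule F.Fa_add) (use \<phi> y(2) in "simp_all add: in_Hom")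
   also have "Fa (hscale C (c w) w) \<phi> = c w \<odot>\<^bsub>Sp g\<^esub> Fa w \<phi>"
    by (rule F.Fa_scale) (use \<phi> wH in simp_all)
   finally have "ip (Sp g) (Fa x \<phi>) \<psi> = cnj (c w) * ip (Sp g) (Fa w \<phi>) \<psi> + ip (Sp g) (Fa y \<phi>) \<psi>"
    using F_mem[OF wH _ _ \<phi>] F_mem[OF y(2) _ _ \<phi>] \<psi> by (simp add: g.ip_add_l g.ip_scale_l)
   then show ?case using bas[OF w] y by (simp add: x cmp_hadd hscale_add in_Hom)
  qed
  from L[OF fin subset_refl v'] show ?thesis by blast
 qed
 then show ?thesis using D unfolding is_dyad_def D_def by blast
qed

context
 fixes k g
 assumes k [simp]: "k \<in> Ghat" and g [simp]: "g \<in> S"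
begin

lemma dyad: "[|\<phi> \<in> Vec (\<gamma> k); \<psi> \<in> Vec g|] ==> is_dyad k g \<phi> \<psi> (dyad k g \<phi> \<psi>)"
proof -
 assume a: "\<phi> \<in> Vec (\<gamma> k)" "\<psi> \<in> Vec g"
 obtain Q where Q: "decomposition C g Q" and Qk: "!!w. w \<in> Q ==> \<exists>k\<in>Ghat. Dom C w = \<gamma> k"
  using S_decomposition[OF g] by blast
 have "\<exists>d. is_dyad k g \<phi> \<psi> d" using is_dyad_basis[OF k g a Q Qk] by blast
 then have "\<exists>!d. is_dyad k g \<phi> \<psi> d" using is_dyad_unique[OF k g] by blast
 then show ?thesis unfolding dyad_def by (rule theI')
qed

lemma dyad_eqI: "is_dyad k g \<phi> \<psi> d ==> dyad k g \<phi> \<psi> = d"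
 unfolding dyad_def by (rule the_equality) (auto intro: is_dyad_unique[OF k g])

lemma dyad_hom: "[|\<phi> \<in> Vec (\<gamma> k); \<psi> \<in> Vec g|] ==> dyad k g \<phi> \<psi> \<in> Hom C (\<gamma> k) g"
 using dyad by (simp add: is_dyad_def)

lemmas dyad_arr [simp] = HomD[OF dyad_hom]

lemma dyad_pair: "[|\<phi> \<in> Vec (\<gamma> k); \<psi> \<in> Vec g; w \<in> Hom C (\<gamma> k) g|] ==>
  w\<dagger>\<cdot>dyad k g \<phi> \<psi> = hscale C (ip (Sp g) (Fa w \<phi>) \<psi>) (idn C (\<gamma> k))"
 using dyad by (simp add: is_dyad_def)

lemma dyad_add_right:
 assumes "\<phi> \<in> Vec (\<gamma> k)" "\<psi> \<in> Vec g" "\<psi>' \<in> Vec g"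
 shows "dyad k g \<phi> (\<psi> \<oplus>\<^bsub>Sp g\<^esub> \<psi>') = hadd C (dyad k g \<phi> \<psi>) (dyad k g \<phi> \<psi>')"
proof -
 interpret g: fd_hilbert "Sp g" by (simp add: hilb)
 show ?thesis
  by (rule dyad_eqI) (use assms dyad_pair F_mem[of _ "\<gamma> k" g \<phi>] in
   \<open>auto simp: is_dyad_def in_Hom cmp_hadd hscale_add g.ip_add\<close>)
qed

lemma dyad_scale_right:
 assumes "\<phi> \<in> Vec (\<gamma> k)" "\<psi> \<in> Vec g"
 shows "dyad k g \<phi> (c \<odot>\<^bsub>Sp g\<^esub> \<psi>) = hscale C c (dyad k g \<phi> \<psi>)"
proof -
 interpret g: fd_hilbert "Sp g" by (simp add: hilb)
 show ?thesis
  by (rule dyad_eqI) (use assms dyad_pair F_mem[of _ "\<gamma> k" g \<phi>] in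
   \<open>auto simp: is_dyad_def in_Hom g.ip_scale\<close>)
qed

lemma dyad_add_left:
 assumes a: "\<phi> \<in> Vec (\<gamma> k)" "\<phi>' \<in> Vec (\<gamma> k)" "\<psi> \<in> Vec g"
 shows "dyad k g (\<phi> \<oplus>\<^bsub>Sp (\<gamma> k)\<^esub> \<phi>') \<psi> = hadd C (dyad k g \<phi> \<psi>) (dyad k g \<phi>' \<psi>)"
proof -
 interpret g: fd_hilbert "Sp g" by (simp add: hilb)
 have "ip (Sp g) (Fa w (\<phi> \<oplus>\<^bsub>Sp (\<gamma> k)\<^esub> \<phi>')) \<psi> = ip (Sp g) (Fa w \<phi>) \<psi> + ip (Sp g) (Fa w \<phi>') \<psi>"
  if w: "w \<in> Hom C (\<gamma> k) g" for w
  using F_add[OF w _ _ a(1,2)] F_mem[OF w _ _ a(1)] F_mem[OF w _ _ a(2)] a by (simp add: g.ip_add_l)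
 then show ?thesis
  by (intro dyad_eqI) (use a dyad_pair in "auto simp: is_dyad_def in_Hom cmp_hadd hscale_add")
qed

lemma dyad_scale_left:
 assumes a: "\<phi> \<in> Vec (\<gamma> k)" "\<psi> \<in> Vec g"
 shows "dyad k g (c \<odot>\<^bsub>Sp (\<gamma> k)\<^esub> \<phi>) \<psi> = hscale C (cnj c) (dyad k g \<phi> \<psi>)"
proof -
 interpret g: fd_hilbert "Sp g" by (simp add: hilb)
 have "ip (Sp g) (Fa w (c \<odot>\<^bsub>Sp (\<gamma> k)\<^esub> \<phi>)) \<psi> = cnj c * ip (Sp g) (Fa w \<phi>) \<psi>"
  if w: "w \<in> Hom C (\<gamma> k) g" for w
  using F_scale[OF w _ _ a(1)] F_mem[OF w _ _ a(1)] a by (simp add: g.ip_scale_l)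
 then show ?thesis
  by (intro dyad_eqI) (use a dyad_pair in "auto simp: is_dyad_def in_Hom")
qed

text \<open>Both sides have the pairing \<open>\<langle>F(v\<^sup>*w)\<phi>, \<psi>\<rangle> = \<langle>F(w)\<phi>, F(v)\<psi>\<rangle>\<close> with \<open>w\<close>.\<close>

lemma dyad_natural:
 assumes a: "\<phi> \<in> Vec (\<gamma> k)" "\<psi> \<in> Vec g" and h[simp]: "h \<in> S" and v: "v \<in> Hom C g h"
 shows "dyad k h \<phi> (Fa v \<psi>) = v\<cdot>dyad k g \<phi> \<psi>"
proof -
 note [simp] = HomD[OF v] a
 have [simp]: "Fa v \<psi> \<in> Vec h" using F_mem[OF v] by simp
 have "is_dyad k h \<phi> (Fa v \<psi>) (v\<cdot>dyad k g \<phi> \<psi>)"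
  unfolding is_dyad_def
 proof (intro conjI ballI)
  show "v\<cdot>dyad k g \<phi> \<psi> \<in> Hom C (\<gamma> k) h" by (simp add: in_Hom)
  fix w assume w: "w \<in> Hom C (\<gamma> k) h"
  note [simp] = HomD[OF w]
  have vw: "v\<dagger>\<cdot>w \<in> Hom C (\<gamma> k) g" by (simp add: in_Hom)
  have "w\<dagger>\<cdot>(v\<cdot>dyad k g \<phi> \<psi>) = (v\<dagger>\<cdot>w)\<dagger>\<cdot>dyad k g \<phi> \<psi>" by simp
  also have "\<dots> = hscale C (ip (Sp g) (Fa (v\<dagger>\<cdot>w) \<phi>) \<psi>) (idn C (\<gamma> k))" by (rule dyad_pair[OF a vw])
  also have "Fa (v\<dagger>\<cdot>w) \<phi> = Fa (v\<dagger>) (Fa w \<phi>)"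
   by (rule F.Fa_cmp[of "\<gamma> k" h g]) (use w in "simp_all add: in_Hom")
  also have "ip (Sp g) (Fa (v\<dagger>) (Fa w \<phi>)) \<psi> = ip (Sp h) (Fa w \<phi>) (Fa v \<psi>)"
   using F_adjoint[of "v\<dagger>" h g "Fa w \<phi>" \<psi>] F_mem[OF w, of \<phi>] by (simp add: in_Hom)
  finally show "w\<dagger>\<cdot>(v\<cdot>dyad k g \<phi> \<psi>) = hscale C (ip (Sp h) (Fa w \<phi>) (Fa v \<psi>)) (idn C (\<gamma> k))" .
 qed
 then show ?thesis unfolding dyad_def
  by (intro the_equality) (auto intro: is_dyad_unique[OF k h])
qed

end

lemma dyad_\<gamma>:
 assumes k[simp]: "k \<in> Ghat" "l \<in> Ghat" and a: "\<phi> \<in> Vec (\<gamma> k)" "\<psi> \<in> Vec (\<gamma> l)"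
 shows "dyad k (\<gamma> l) \<phi> \<psi> = (if k = l then hscale C (ip (Sp (\<gamma> l)) \<phi> \<psi>) (idn C (\<gamma> l)) else hzero C (\<gamma> k) (\<gamma> l))"
proof (cases "k = l")
 case False
 then show ?thesis using Hom_\<gamma>_zero[OF k False dyad_hom[OF k(1) _ a]] by simp
next
 case True
 with dyad_pair[of k "\<gamma> l" \<phi> \<psi> "idn C (\<gamma> l)"] a F.Fa_idn[of "\<gamma> l" \<phi>]
 show ?thesis by (simp add: in_Hom)
qed

lemma dyad_zero:
 assumes "k \<in> Ghat" "g \<in> S" "k \<notin> constituents g" "\<phi> \<in> Vec (\<gamma> k)" "\<psi> \<in> Vec g"
 shows "dyad k g \<phi> \<psi> = hzero C (\<gamma> k) g"
 using assms dyad_hom[OF assms(1,2,4,5)] by (auto simp: constituents_def)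

lemma onb: "k \<in> Ghat ==> orthonormal_basis (Sp (\<gamma> k)) (onb k)"
 unfolding onb_def H_Sp by (rule someI_ex) (rule fd_hilbert.orthonormal_basis_exists, simp add: hilb)

lemma onb_mem: "k \<in> Ghat ==> finite (onb k)" "k \<in> Ghat ==> b \<in> onb k ==> b \<in> Vec (\<gamma> k)"
 using onb[of k] by (auto simp: orthonormal_basis_def spans_def)

lemma F_hsum:
 assumes "g \<in> S" "h \<in> S" "finite A" "f \<in> A \<rightarrow> Hom C g h" "x \<in> Vec g"
 shows "Fa (hsum C g h f A) x = finsum (Sp h) (%i. Fa (f i) x) A"
 using assms(3,4)
proof induct
 case empty
 interpret h: cvs "Sp h" using assms by (simp add: sp_cvs)
 show ?case using F_hzero assms by simp
next
 case (insert i A)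
 interpret h: cvs "Sp h" using assms by (simp add: sp_cvs)
 have fi: "f i \<in> Hom C g h" and fA: "f \<in> A \<rightarrow> Hom C g h" using insert by auto
 have s: "hsum C g h f A \<in> Hom C g h" by (rule hsum_hom) (use assms fA in auto)
 have "hsum C g h f (insert i A) = hadd C (f i) (hsum C g h f A)"
  by (rule hsum_insert) (use assms insert fi fA in auto)
 then have "Fa (hsum C g h f (insert i A)) x = Fa (f i) x \<oplus>\<^bsub>Sp h\<^esub> Fa (hsum C g h f A) x"
  using F.Fa_add[OF assms(1,2) fi s assms(5)] by simp
 also have "\<dots> = finsum (Sp h) (%i. Fa (f i) x) (insert i A)"
  using insert fi fA F_mem[OF _ assms(1,2,5)] by (subst h.M.finsum_insert) auto
 finally show ?case .
qed

text \<open>Completeness: \<open>\<psi>\<close> is recovered from all its dyads. By additivity and naturality it suffices to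
 consider the vectors \<open>F(w)\<xi>\<close> for \<open>w\<close> in a decomposition of \<open>g\<close>, where it is the expansion of \<open>\<xi>\<close>.\<close>

lemma dyad_complete:
 assumes g[simp]: "g \<in> S" and \<psi>: "\<psi> \<in> Vec g"
 shows "finsum (Sp g) (%p. Fa (dyad (fst p) g (snd p) \<psi>) (snd p)) (Sigma (constituents g) onb) = \<psi>"
proof -
 let ?I = "Sigma (constituents g) onb"
 interpret g: fd_hilbert "Sp g" by (simp add: hilb)
 have cG: "k \<in> Ghat" if "k \<in> constituents g" for k using that by (simp add: constituents_def)
 obtain Q where Q: "decomposition C g Q" and Qk: "!!w. w \<in> Q ==> \<exists>k\<in>Ghat. Dom C w = \<gamma> k"
  using S_decomposition[OF g] by blast
 note d = decompositionD[OF Q]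
 have fin: "finite ?I" using finite_constituents[OF g] onb_mem(1) cG by (intro finite_SigmaI) auto
 have I: "fst p \<in> Ghat" "snd p \<in> Vec (\<gamma> (fst p))" if "p \<in> ?I" for p
  using that cG onb_mem(2)[of "fst p" "snd p"] by auto
 have mem: "Fa (dyad (fst p) g (snd p) x) (snd p) \<in> Vec g" if "p \<in> ?I" "x \<in> Vec g" for p x
  by (rule F_mem[OF dyad_hom]) (use I[OF that(1)] that(2) in simp_all)
 have wH: "w \<in> Hom C (Dom C w) g" "w\<dagger> \<in> Hom C g (Dom C w)" "Dom C w \<in> S" if "w \<in> Q" for w
  using d(4,5)[OF that] Qk[OF that] by (auto simp: in_Hom)
 show ?thesis
 proof (rule g.ip_eqI)
  show "finsum (Sp g) (%p. Fa (dyad (fst p) g (snd p) \<psi>) (snd p)) ?I \<in> Vec g"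
   by (rule g.M.finsum_closed) (use mem \<psi> in blast)
  show "\<psi> \<in> Vec g" by fact
  fix \<eta> assume \<eta>: "\<eta> \<in> Vec g"
  define L where "L x = (\<Sum>p\<in>?I. ip (Sp g) \<eta> (Fa (dyad (fst p) g (snd p) x) (snd p)))" for x
  have add: "L (x \<oplus>\<^bsub>Sp g\<^esub> y) = L x + L y" if x: "x \<in> Vec g" "y \<in> Vec g" for x y
   unfolding L_def sum.distrib[symmetric]
  proof (rule sum.cong[OF refl])
   fix p assume p: "p \<in> ?I"
   show "ip (Sp g) \<eta> (Fa (dyad (fst p) g (snd p) (x \<oplus>\<^bsub>Sp g\<^esub> y)) (snd p)) =
     ip (Sp g) \<eta> (Fa (dyad (fst p) g (snd p) x) (snd p)) + ip (Sp g) \<eta> (Fa (dyad (fst p) g (snd p) y) (snd p))"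
    using F.Fa_add[of "\<gamma> (fst p)" g "dyad (fst p) g (snd p) x" "dyad (fst p) g (snd p) y" "snd p"]
     dyad_add_right[of "fst p" g "snd p" x y] g.ip_add[OF \<eta> mem[OF p x(1)] mem[OF p x(2)]] I[OF p] x
    by (simp add: dyad_hom)
  qed
  have comp: "L (Fa w \<xi>) = ip (Sp g) \<eta> (Fa w \<xi>)" if w: "w \<in> Q" and \<xi>: "\<xi> \<in> Vec (Dom C w)" for w \<xi>
  proof -
   obtain l where l[simp]: "l \<in> Ghat" and Dl: "Dom C w = \<gamma> l" using Qk[OF w] by blast
   interpret l: fd_hilbert "Sp (\<gamma> l)" by (simp add: hilb)
   note wl = wH(1,2)[OF w, unfolded Dl] and \<xi>l = \<xi>[unfolded Dl]
   note [simp] = HomD[OF wl(1)]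
   let ?\<eta> = "Fa (w\<dagger>) \<eta>"
   have \<eta>m: "?\<eta> \<in> Vec (\<gamma> l)" by (rule F_mem[OF wl(2)]) (use \<eta> in simp_all)
   have adj: "ip (Sp g) \<eta> (Fa w x) = ip (Sp (\<gamma> l)) ?\<eta> x" if "x \<in> Vec (\<gamma> l)" for x
    using F_adjoint[OF wl(2) _ _ \<eta> that] by (simp add: star_star)
   have v: "ip (Sp g) \<eta> (Fa (dyad k g b (Fa w \<xi>)) b) =
     (if k = l then ip (Sp (\<gamma> l)) ?\<eta> (ip (Sp (\<gamma> l)) b \<xi> \<odot>\<^bsub>Sp (\<gamma> l)\<^esub> b) else 0)"
    if k: "k \<in> Ghat" and b: "b \<in> Vec (\<gamma> k)" for k b
   proof (cases "k = l")
    case True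
    have "Fa (hscale C (ip (Sp (\<gamma> l)) b \<xi>) w) b = ip (Sp (\<gamma> l)) b \<xi> \<odot>\<^bsub>Sp g\<^esub> Fa w b"
     by (rule F.Fa_scale[OF _ _ wl(1)]) (use b True in simp_all)
    then show ?thesis
     using True b \<xi>l dyad_natural[OF k _ b _ g wl(1), of \<xi>] adj[of b] F_mem[OF wl(1) _ _ b[unfolded True]] \<eta> \<eta>m
     by (simp add: dyad_\<gamma> g.ip_scale l.ip_scale)
   next
    case False
    then show ?thesis
     using k b \<xi>l dyad_natural[OF k _ b _ g wl(1), of \<xi>] F_hzero[of "\<gamma> k" g b] \<eta> by (simp add: dyad_\<gamma>)
   qed
   have lc: "l \<in> constituents g"
   proof -
    have "w ~= hzero C (\<gamma> l) g"
    proof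
     assume 0: "w = hzero C (\<gamma> l) g"
     have "idn C (\<gamma> l) = w\<dagger>\<cdot>w" using isometryD(4)[OF d(3)[OF w]] Dl by simp
     also have "\<dots> = hzero C (\<gamma> l) (\<gamma> l)" unfolding 0 by simp
     finally show False using irreducible_objD[OF Ghat(2)[OF l]] by simp
    qed
    then show ?thesis using wl by (auto simp: constituents_def)
   qed
   have "L (Fa w \<xi>) = (\<Sum>k\<in>constituents g. \<Sum>b\<in>onb k. ip (Sp g) \<eta> (Fa (dyad k g b (Fa w \<xi>)) b))"
    unfolding L_def by (subst sum.Sigma) (use finite_constituents[OF g] onb_mem(1) cG in "auto simp: split_beta")
   also have "\<dots> = (\<Sum>k\<in>constituents g. if k = l then (\<Sum>b\<in>onb l. ip (Sp (\<gamma> l)) ?\<eta> (ip (Sp (\<gamma> l)) b \<xi> \<odot>\<^bsub>Sp (\<gamma> l)\<^esub> b)) else 0)"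
    by (rule sum.cong[OF refl]) (use v cG onb_mem(2) in auto)
   also have "\<dots> = (\<Sum>b\<in>onb l. ip (Sp (\<gamma> l)) ?\<eta> (ip (Sp (\<gamma> l)) b \<xi> \<odot>\<^bsub>Sp (\<gamma> l)\<^esub> b))"
    using lc finite_constituents[OF g] by simp
   also have "\<dots> = ip (Sp (\<gamma> l)) ?\<eta> (finsum (Sp (\<gamma> l)) (%b. ip (Sp (\<gamma> l)) b \<xi> \<odot>\<^bsub>Sp (\<gamma> l)\<^esub> b) (onb l))"
    by (rule l.ip_finsum[symmetric]) (use onb_mem[OF l] \<eta>m in auto)
   also have "\<dots> = ip (Sp (\<gamma> l)) ?\<eta> \<xi>" using l.orthonormal_expansion[OF onb[OF l] \<xi>l] by simp
   finally show ?thesis using adj[OF \<xi>l] by simp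
  qed
  have Fm: "Fa w (Fa (w\<dagger>) \<psi>) \<in> Vec g" "Fa (w\<dagger>) \<psi> \<in> Vec (Dom C w)" if "w \<in> Q" for w
   using F_mem[OF wH(2)[OF that] g wH(3)[OF that] \<psi>] F_mem[OF wH(1)[OF that] wH(3)[OF that] g] by simp_all
  have L0: "L \<zero>\<^bsub>Sp g\<^esub> = 0" using add[of "\<zero>\<^bsub>Sp g\<^esub>" "\<zero>\<^bsub>Sp g\<^esub>"] by simp
  have Ls: "L (finsum (Sp g) (%w. Fa w (Fa (w\<dagger>) \<psi>)) A) = ip (Sp g) \<eta> (finsum (Sp g) (%w. Fa w (Fa (w\<dagger>) \<psi>)) A)"
   if "finite A" "A \<subseteq> Q" for A
   using that
  proof (induct rule: finite_induct)
   case (insert w A)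
   then have w: "w \<in> Q" and A: "(%w. Fa w (Fa (w\<dagger>) \<psi>)) \<in> A \<rightarrow> Vec g" using Fm(1) by auto
   show ?case
    using insert(3,4) g.M.finsum_insert[OF insert(1,2) A Fm(1)[OF w]] add[OF Fm(1)[OF w] g.M.finsum_closed[OF A]]
     comp[OF w Fm(2)[OF w]] g.ip_add[OF \<eta> Fm(1)[OF w] g.M.finsum_closed[OF A]] by simp
  qed (use \<eta> L0 in simp)
  moreover have "finsum (Sp g) (%w. Fa w (Fa (w\<dagger>) \<psi>)) Q = \<psi>"
  proof -
   have "finsum (Sp g) (%w. Fa w (Fa (w\<dagger>) \<psi>)) Q = finsum (Sp g) (%w. Fa (w\<cdot>w\<dagger>) \<psi>) Q"
    by (rule g.M.finsum_cong') (use Fm F.Fa_cmp[OF g wH(3) g wH(1,2) \<psi>] in auto)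
   also have "\<dots> = Fa (hsum C g g (%w. w\<cdot>w\<dagger>) Q) \<psi>"
    by (rule F_hsum[symmetric, OF g g d(1) _ \<psi>]) (use d(4,5) in "auto simp: in_Hom")
   also have "\<dots> = \<psi>" using \<psi> by (simp add: d(6) F.Fa_idn)
   finally show ?thesis .
  qed
  ultimately have "L \<psi> = ip (Sp g) \<eta> \<psi>" using Ls[OF d(1) subset_refl] by simp
  then show "ip (Sp g) \<eta> (finsum (Sp g) (%p. Fa (dyad (fst p) g (snd p) \<psi>) (snd p)) ?I) = ip (Sp g) \<eta> \<psi>"
   unfolding L_def by (subst g.ip_finsum[OF fin \<eta>]) (use mem \<psi> in auto)
 qed
qed

end

section \<open>Arrows of the crossed product\<close>

lemma (in cvs) finsum_subset:
 assumes "finite B" "A \<subseteq> B" "!!i. i \<in> B - A ==> f i = \<zero>" "f \<in> B \<rightarrow> carrier M"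
 shows "finsum M f A = finsum M f B"
 by (rule M.add.finprod_mono_neutral_cong_left) (use assms in auto)

context crossed_product_setting
begin

lemma tv_finsum:
 assumes gh: "g \<in> S" "h \<in> S" and A: "finite A" "a \<in> A \<rightarrow> Vec g"
  and B: "finite B" "b \<in> B \<rightarrow> Vec h"
 shows "finsum (Sp (g\<boxdot>h)) (%p. tv g h (a (fst p)) (b (snd p))) (A \<times> B) = tv g h (finsum (Sp g) a A) (finsum (Sp h) b B)"
proof -
 interpret g: fd_hilbert "Sp g" using gh by (simp add: hilb)
 interpret h: fd_hilbert "Sp h" using gh by (simp add: hilb)
 interpret gh: fd_hilbert "Sp (g\<boxdot>h)" using gh by (simp add: hilb)
 have sa: "finsum (Sp g) a A \<in> Vec g" by (rule g.M.finsum_closed[OF A(2)])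
 have sb: "finsum (Sp h) b B \<in> Vec h" by (rule h.M.finsum_closed[OF B(2)])
 have ab: "tv g h (a (fst p)) (b (snd p)) \<in> Vec (g\<boxdot>h)" if "p \<in> A \<times> B" for p
  using that A B by (intro tv_mem gh) auto
 show ?thesis
 proof (rule gh.ip_eqI)
  show 1: "finsum (Sp (g\<boxdot>h)) (%p. tv g h (a (fst p)) (b (snd p))) (A \<times> B) \<in> Vec (g\<boxdot>h)"
   by (rule gh.M.finsum_closed) (use ab in auto)
  show 2: "tv g h (finsum (Sp g) a A) (finsum (Sp h) b B) \<in> Vec (g\<boxdot>h)"
   by (rule tv_mem[OF gh sa sb])
  fix z assume "z \<in> Vec (g\<boxdot>h)"
  with gh show "ip (Sp (g\<boxdot>h)) z (finsum (Sp (g\<boxdot>h)) (%p. tv g h (a (fst p)) (b (snd p))) (A \<times> B)) =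
    ip (Sp (g\<boxdot>h)) z (tv g h (finsum (Sp g) a A) (finsum (Sp h) b B))"
  proof (induct rule: tv_induct)
   case (tv x y)
   have "ip (Sp (g\<boxdot>h)) (tv g h x y) (finsum (Sp (g\<boxdot>h)) (%p. tv g h (a (fst p)) (b (snd p))) (A \<times> B)) =
     (\<Sum>p\<in>A \<times> B. ip (Sp (g\<boxdot>h)) (tv g h x y) (tv g h (a (fst p)) (b (snd p))))"
    by (rule gh.ip_finsum) (use A B ab tv_mem[OF gh tv] in auto)
   also have "\<dots> = (\<Sum>p\<in>A \<times> B. ip (Sp g) x (a (fst p)) * ip (Sp h) y (b (snd p)))"
    by (rule sum.cong[OF refl], rule tv_ip) (use gh tv A B in auto)
   also have "\<dots> = (\<Sum>i\<in>A. ip (Sp g) x (a i)) * (\<Sum>j\<in>B. ip (Sp h) y (b j))"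
    by (simp add: sum_product sum.cartesian_product split_beta)
   also have "(\<Sum>i\<in>A. ip (Sp g) x (a i)) = ip (Sp g) x (finsum (Sp g) a A)"
    by (rule g.ip_finsum[symmetric]) (use A tv in auto)
   also have "(\<Sum>j\<in>B. ip (Sp h) y (b j)) = ip (Sp h) y (finsum (Sp h) b B)"
    by (rule h.ip_finsum[symmetric]) (use B tv in auto)
   finally show ?case using tv_ip[OF gh tv(1) sa tv(2) sb] by simp
  qed (use 1 2 in "simp_all add: gh.ip_add_l gh.ip_scale_l")
 qed
qed

subsection \<open>The vector spaces of arrows\<close>

lemma cr_space_simps [simp]:
 "carrier (cr_space \<rho> \<sigma>) = cr_hom \<rho> \<sigma>" "\<zero>\<^bsub>cr_space \<rho> \<sigma>\<^esub> = cr_zero \<rho> \<sigma>"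
 "x \<oplus>\<^bsub>cr_space \<rho> \<sigma>\<^esub> y = cr_add x y" "c \<odot>\<^bsub>cr_space \<rho> \<sigma>\<^esub> x = cr_scale c x"
 by (simp_all add: cr_space_def)

lemma cr_homD:
 assumes "x \<in> cr_hom \<rho> \<sigma>"
 shows "src x = \<rho>" "trg x = \<sigma>" "finite (supp x)"
  and "[|k \<in> Ghat; \<phi> \<in> Vec (\<gamma> k)|] ==> val x k \<phi> \<in> Hom C (\<gamma> k\<boxdot>\<rho>) \<sigma>"
  and "[|k \<in> Ghat; \<phi> \<in> Vec (\<gamma> k); \<phi>' \<in> Vec (\<gamma> k)|] ==>
   val x k (\<phi> \<oplus>\<^bsub>Sp (\<gamma> k)\<^esub> \<phi>') = hadd C (val x k \<phi>) (val x k \<phi>')"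
  and "[|k \<in> Ghat; \<phi> \<in> Vec (\<gamma> k)|] ==>
   val x k (c \<odot>\<^bsub>Sp (\<gamma> k)\<^esub> \<phi>) = hscale C (cnj c) (val x k \<phi>)"
proof -
 show "src x = \<rho>" "trg x = \<sigma>" "finite (supp x)" using assms by (auto simp: cr_hom_def)
 have "val x k \<in> antilinear_maps (Sp (\<gamma> k)) (hom_space C (\<gamma> k\<boxdot>\<rho>) \<sigma>)" if "k \<in> Ghat"
  using assms that by (auto simp: cr_hom_def coeff_space_def H_Sp)
 then show "[|k \<in> Ghat; \<phi> \<in> Vec (\<gamma> k)|] ==> val x k \<phi> \<in> Hom C (\<gamma> k\<boxdot>\<rho>) \<sigma>"
  "[|k \<in> Ghat; \<phi> \<in> Vec (\<gamma> k); \<phi>' \<in> Vec (\<gamma> k)|] ==>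
   val x k (\<phi> \<oplus>\<^bsub>Sp (\<gamma> k)\<^esub> \<phi>') = hadd C (val x k \<phi>) (val x k \<phi>')"
  "[|k \<in> Ghat; \<phi> \<in> Vec (\<gamma> k)|] ==>
   val x k (c \<odot>\<^bsub>Sp (\<gamma> k)\<^esub> \<phi>) = hscale C (cnj c) (val x k \<phi>)"
  by (auto simp: antilinear_maps_def)
qed

lemma cr_hom_eqI:
 assumes x: "x \<in> cr_hom \<rho> \<sigma>" and y: "y \<in> cr_hom \<rho> \<sigma>"
  and v: "!!k \<phi>. [|k \<in> Ghat; \<phi> \<in> Vec (\<gamma> k)|] ==> val x k \<phi> = val y k \<phi>"
 shows "x = y"
proof (rule arrow.expand, intro conjI)
 show "src x = src y" "trg x = trg y" using cr_homD[OF x] cr_homD[OF y] by simp_all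
 have xe: "val x \<in> (\<Pi>\<^sub>E k\<in>Ghat. antilinear_maps (Sp (\<gamma> k)) (hom_space C (\<gamma> k\<boxdot>\<rho>) \<sigma>))"
  and ye: "val y \<in> (\<Pi>\<^sub>E k\<in>Ghat. antilinear_maps (Sp (\<gamma> k)) (hom_space C (\<gamma> k\<boxdot>\<rho>) \<sigma>))"
  using x y by (simp_all add: cr_hom_def coeff_space_def H_Sp)
 show "val x = val y"
 proof (rule PiE_ext[OF xe ye])
  fix k assume k: "k \<in> Ghat"
  have a: "val x k \<in> Vec (\<gamma> k) \<rightarrow>\<^sub>E Hom C (\<gamma> k\<boxdot>\<rho>) \<sigma>" "val y k \<in> Vec (\<gamma> k) \<rightarrow>\<^sub>E Hom C (\<gamma> k\<boxdot>\<rho>) \<sigma>"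
   using PiE_mem[OF xe k] PiE_mem[OF ye k] by (simp_all add: antilinear_maps_def)
  show "val x k = val y k" by (rule PiE_ext[OF a]) (rule v[OF k])
 qed
qed

lemma cr_homI:
 assumes "\<rho> \<in> Obj C" "\<sigma> \<in> Obj C"
  and "!!k \<phi>. [|k \<in> Ghat; \<phi> \<in> Vec (\<gamma> k)|] ==> f k \<phi> \<in> Hom C (\<gamma> k\<boxdot>\<rho>) \<sigma>"
  and "!!k \<phi> \<phi>'. [|k \<in> Ghat; \<phi> \<in> Vec (\<gamma> k); \<phi>' \<in> Vec (\<gamma> k)|] ==>
   f k (\<phi> \<oplus>\<^bsub>Sp (\<gamma> k)\<^esub> \<phi>') = hadd C (f k \<phi>) (f k \<phi>')"
  and "!!k \<phi> c. [|k \<in> Ghat; \<phi> \<in> Vec (\<gamma> k)|] ==>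
   f k (c \<odot>\<^bsub>Sp (\<gamma> k)\<^esub> \<phi>) = hscale C (cnj c) (f k \<phi>)"
  and K: "finite K" "!!k \<phi>. [|k \<in> Ghat; k \<notin> K; \<phi> \<in> Vec (\<gamma> k)|] ==> f k \<phi> = hzero C (\<gamma> k\<boxdot>\<rho>) \<sigma>"
 shows "Arrow \<rho> \<sigma> (\<lambda>k\<in>Ghat. \<lambda>\<phi>\<in>carrier (H k). f k \<phi>) \<in> cr_hom \<rho> \<sigma>"
proof -
 have m: "(\<lambda>\<phi>\<in>carrier (H k). f k \<phi>) \<in> coeff_space \<rho> \<sigma> k" if k: "k \<in> Ghat" for k
 proof -
  interpret k: cvs "Sp (\<gamma> k)" using k by (simp add: sp_cvs)
  show ?thesis using assms k by (auto simp: coeff_space_def antilinear_maps_def H_Sp)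
 qed
 have "supp (Arrow \<rho> \<sigma> (\<lambda>k\<in>Ghat. \<lambda>\<phi>\<in>carrier (H k). f k \<phi>)) \<subseteq> K"
  using K(2) by (auto simp: supp_def H_Sp)
 then have "finite (supp (Arrow \<rho> \<sigma> (\<lambda>k\<in>Ghat. \<lambda>\<phi>\<in>carrier (H k). f k \<phi>)))" using K(1) finite_subset by blast
 with m show ?thesis by (simp add: cr_hom_def)
qed

lemma val_cr_add [simp]: "[|k \<in> Ghat; \<phi> \<in> Vec (\<gamma> k)|] ==> val (cr_add x y) k \<phi> = hadd C (val x k \<phi>) (val y k \<phi>)"
 and val_cr_scale [simp]: "[|k \<in> Ghat; \<phi> \<in> Vec (\<gamma> k)|] ==> val (cr_scale c x) k \<phi> = hscale C c (val x k \<phi>)"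
 and val_cr_zero [simp]: "[|k \<in> Ghat; \<phi> \<in> Vec (\<gamma> k)|] ==> val (cr_zero \<rho> \<sigma>) k \<phi> = hzero C (\<gamma> k\<boxdot>\<rho>) \<sigma>"
 by (simp_all add: cr_add_def cr_scale_def cr_zero_def H_Sp)

lemma val_notin_supp: "[|x \<in> cr_hom \<rho> \<sigma>; k \<in> Ghat; k \<notin> supp x; \<phi> \<in> Vec (\<gamma> k)|] ==>
  val x k \<phi> = hzero C (\<gamma> k\<boxdot>\<rho>) \<sigma>"
 using cr_homD(1,2)[of x \<rho> \<sigma>] by (auto simp: supp_def H_Sp)

lemma cr_zero_hom: "[|\<rho> \<in> Obj C; \<sigma> \<in> Obj C|] ==> cr_zero \<rho> \<sigma> \<in> cr_hom \<rho> \<sigma>"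
 unfolding cr_zero_def by (rule cr_homI[where K = "{}"]) (auto simp: in_Hom)

lemma cr_add_hom:
 assumes o: "\<rho> \<in> Obj C" "\<sigma> \<in> Obj C" and x: "x \<in> cr_hom \<rho> \<sigma>" and y: "y \<in> cr_hom \<rho> \<sigma>"
 shows "cr_add x y \<in> cr_hom \<rho> \<sigma>"
proof -
 note dx = cr_homD[OF x] and dy = cr_homD[OF y]
 have [simp]: "val x k \<phi> \<in> Arr C" "Dom C (val x k \<phi>) = \<gamma> k\<boxdot>\<rho>" "Cod C (val x k \<phi>) = \<sigma>"
  "val y k \<phi> \<in> Arr C" "Dom C (val y k \<phi>) = \<gamma> k\<boxdot>\<rho>" "Cod C (val y k \<phi>) = \<sigma>"
  if "k \<in> Ghat" "\<phi> \<in> Vec (\<gamma> k)" for k \<phi>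
  using dx(4) dy(4) that by (auto simp: in_Hom)
 show ?thesis unfolding cr_add_def dx(1,2)
 proof (rule cr_homI[OF o, where K = "supp x \<union> supp y"])
  show "finite (supp x \<union> supp y)" using dx(3) dy(3) by simp
 qed (use dx dy o val_notin_supp[OF x] val_notin_supp[OF y] in "simp_all add: in_Hom hadd_ac hscale_hadd")
qed

lemma cr_scale_hom:
 assumes o: "\<rho> \<in> Obj C" "\<sigma> \<in> Obj C" and x: "x \<in> cr_hom \<rho> \<sigma>"
 shows "cr_scale c x \<in> cr_hom \<rho> \<sigma>"
proof -
 note dx = cr_homD[OF x]
 have [simp]: "val x k \<phi> \<in> Arr C" "Dom C (val x k \<phi>) = \<gamma> k\<boxdot>\<rho>" "Cod C (val x k \<phi>) = \<sigma>"
  if "k \<in> Ghat" "\<phi> \<in> Vec (\<gamma> k)" for k \<phi>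
  using dx(4) that by (auto simp: in_Hom)
 show ?thesis unfolding cr_scale_def dx(1,2)
 proof (rule cr_homI[OF o, where K = "supp x"])
  show "finite (supp x)" using dx(3) by simp
 qed (use dx o val_notin_supp[OF x] in "simp_all add: in_Hom hscale_hadd mult.commute")
qed

lemma cr_module:
 assumes o: "\<rho> \<in> Obj C" "\<sigma> \<in> Obj C"
 shows "Module.module complex_field (cr_space \<rho> \<sigma>)"
proof -
 note [simp] = o
 have [simp]: "val x k \<phi> \<in> Arr C" "Dom C (val x k \<phi>) = \<gamma> k\<boxdot>\<rho>" "Cod C (val x k \<phi>) = \<sigma>"
  if "x \<in> cr_hom \<rho> \<sigma>" "k \<in> Ghat" "\<phi> \<in> Vec (\<gamma> k)" for x k \<phi>
  using cr_homD(4)[OF that] by (auto simp: in_Hom)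
 note cl = cr_zero_hom[OF o] cr_add_hom[OF o] cr_scale_hom[OF o]
 show ?thesis
 proof (rule complex_moduleI, unfold cr_space_simps)
  fix x y z assume xyz: "x \<in> cr_hom \<rho> \<sigma>" "y \<in> cr_hom \<rho> \<sigma>" "z \<in> cr_hom \<rho> \<sigma>"
  show "cr_add (cr_add x y) z = cr_add x (cr_add y z)"
   by (rule cr_hom_eqI[of _ \<rho> \<sigma>]) (use xyz cl in "simp_all add: hadd_assoc")
 next
  fix x y c assume xy: "x \<in> cr_hom \<rho> \<sigma>" "y \<in> cr_hom \<rho> \<sigma>"
  show "cr_add x y = cr_add y x"
   by (rule cr_hom_eqI[of _ \<rho> \<sigma>]) (use xy cl in "simp_all add: hadd_comm")
  show "cr_scale c (cr_add x y) = cr_add (cr_scale c x) (cr_scale c y)"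
   by (rule cr_hom_eqI[of _ \<rho> \<sigma>]) (use xy cl in "simp_all add: hscale_hadd")
 next
  fix x c d assume x: "x \<in> cr_hom \<rho> \<sigma>"
  show "cr_add (cr_zero \<rho> \<sigma>) x = x" "cr_scale 0 x = cr_zero \<rho> \<sigma>" "cr_scale 1 x = x"
   "cr_scale (c + d) x = cr_add (cr_scale c x) (cr_scale d x)"
   "cr_scale (c * d) x = cr_scale c (cr_scale d x)"
   by (rule cr_hom_eqI[of _ \<rho> \<sigma>]; use x cl in "simp add: hscale_add")+
 qed (use cl in auto)
qed

lemma cr_cvs: "[|\<rho> \<in> Obj C; \<sigma> \<in> Obj C|] ==> cvs (cr_space \<rho> \<sigma>)"
 by (simp add: cvs_def cr_module)

lemma val_finsum:
 assumes o: "\<rho> \<in> Obj C" "\<sigma> \<in> Obj C" and A: "finite A" "f \<in> A \<rightarrow> cr_hom \<rho> \<sigma>"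
  and k: "k \<in> Ghat" "\<phi> \<in> Vec (\<gamma> k)"
 shows "val (finsum (cr_space \<rho> \<sigma>) f A) k \<phi> = hsum C (\<gamma> k\<boxdot>\<rho>) \<sigma> (%i. val (f i) k \<phi>) A"
 using A
proof induct
 case empty
 interpret cvs "cr_space \<rho> \<sigma>" using o by (rule cr_cvs)
 show ?case using o k by simp
next
 case (insert i A)
 interpret cvs "cr_space \<rho> \<sigma>" using o by (rule cr_cvs)
 have "finsum (cr_space \<rho> \<sigma>) f (insert i A) = cr_add (f i) (finsum (cr_space \<rho> \<sigma>) f A)"
  using insert M.finsum_insert[of A i f] by simp
 moreover have "hsum C (\<gamma> k\<boxdot>\<rho>) \<sigma> (%i. val (f i) k \<phi>) (insert i A) =
   hadd C (val (f i) k \<phi>) (hsum C (\<gamma> k\<boxdot>\<rho>) \<sigma> (%i. val (f i) k \<phi>) A)"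
  by (rule hsum_insert) (use insert k o cr_homD(4)[OF _ k] in auto)
 ultimately show ?case using insert k by simp
qed

subsection \<open>Generalized elementary tensors\<close>

text \<open>The arrow \<open>T \<otimes> \<psi>\<close> for an arbitrary object \<open>g\<close> of the subcategory instead of a chosen
 representative. Conceptually the arrows are the coend of \<open>Hom(g \<rho>, \<sigma>) \<otimes> F(g)\<close> over \<open>g\<close>:
 every arrow is a single such tensor (\<open>cr_hom_gen\<close>), the only relation being \<open>gen_natural\<close>, and the
 operations on them do not involve any choices.\<close>

definition gen :: "'o => 'o => 'o => 'm => 'v => ('o, 'o set => 'v => 'm) arrow" where
 "gen \<rho> \<sigma> g T \<psi> = Arrow \<rho> \<sigma> (\<lambda>k\<in>Ghat. \<lambda>\<phi>\<in>carrier (H k). T\<cdot>(dyad k g \<phi> \<psi>|>\<rho>))"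

definition gen_ok :: "'o => 'o => 'o => 'm => 'v => bool" where
 "gen_ok \<rho> \<sigma> g T \<psi> \<longleftrightarrow> \<rho> \<in> Obj C \<and> \<sigma> \<in> Obj C \<and> g \<in> S \<and> T \<in> Arr C \<and> Dom C T = g\<boxdot>\<rho> \<and> Cod C T = \<sigma> \<and>
   \<psi> \<in> Vec g"

lemmas gen_okD = gen_ok_def[THEN iffD1]

lemma src_gen [simp]: "src (gen \<rho> \<sigma> g T \<psi>) = \<rho>" and trg_gen [simp]: "trg (gen \<rho> \<sigma> g T \<psi>) = \<sigma>"
 by (simp_all add: gen_def)

lemma val_gen [simp]: "[|k \<in> Ghat; \<phi> \<in> Vec (\<gamma> k)|] ==>
  val (gen \<rho> \<sigma> g T \<psi>) k \<phi> = T\<cdot>(dyad k g \<phi> \<psi>|>\<rho>)"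
 by (simp add: gen_def H_Sp)

lemma gen_hom:
 assumes "gen_ok \<rho> \<sigma> g T \<psi>"
 shows "gen \<rho> \<sigma> g T \<psi> \<in> cr_hom \<rho> \<sigma>"
proof -
 note [simp] = assms[unfolded gen_ok_def]
 show ?thesis unfolding gen_def
  by (rule cr_homI[where K = "constituents g"])
   (simp_all add: in_Hom dyad_add_left dyad_scale_left tar_hadd cmp_hadd finite_constituents dyad_zero)
qed

lemma gen_eqI:
 assumes "gen_ok \<rho> \<sigma> g T \<psi>" "gen_ok \<rho> \<sigma> g' T' \<psi>'"
  and "!!k \<phi>. [|k \<in> Ghat; \<phi> \<in> Vec (\<gamma> k)|] ==>
   T\<cdot>(dyad k g \<phi> \<psi>|>\<rho>) = T'\<cdot>(dyad k g' \<phi> \<psi>'|>\<rho>)"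
 shows "gen \<rho> \<sigma> g T \<psi> = gen \<rho> \<sigma> g' T' \<psi>'"
 by (rule cr_hom_eqI[OF gen_hom[OF assms(1)] gen_hom[OF assms(2)]]) (simp add: assms(3))

lemma gen_natural:
 assumes ok: "gen_ok \<rho> \<sigma> h T \<xi>" and g[simp]: "g \<in> S" and v: "v \<in> Hom C g h" and \<psi>[simp]: "\<psi> \<in> Vec g"
 shows "gen \<rho> \<sigma> g (T\<cdot>(v|>\<rho>)) \<psi> = gen \<rho> \<sigma> h T (Fa v \<psi>)"
proof -
 note [simp] = gen_okD[OF ok] HomD[OF v]
 have [simp]: "Fa v \<psi> \<in> Vec h" using F_mem[OF v] by simp
 show ?thesis
  by (rule gen_eqI) (simp_all add: gen_ok_def dyad_natural[OF _ _ _ _ _ v] rwhisker_cmp)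
qed

lemma gen_add_arrow:
 assumes "gen_ok \<rho> \<sigma> g T \<psi>" "gen_ok \<rho> \<sigma> g T' \<psi>"
 shows "cr_add (gen \<rho> \<sigma> g T \<psi>) (gen \<rho> \<sigma> g T' \<psi>) = gen \<rho> \<sigma> g (hadd C T T') \<psi>"
proof -
 note [simp] = assms[unfolded gen_ok_def]
 show ?thesis
  by (rule cr_hom_eqI[of _ \<rho> \<sigma>]) (simp_all add: cr_add_hom gen_hom gen_ok_def cmp_hadd)
qed

lemma gen_add_vec:
 assumes "gen_ok \<rho> \<sigma> g T \<psi>" "gen_ok \<rho> \<sigma> g T \<psi>'"
 shows "cr_add (gen \<rho> \<sigma> g T \<psi>) (gen \<rho> \<sigma> g T \<psi>') = gen \<rho> \<sigma> g T (\<psi> \<oplus>\<^bsub>Sp g\<^esub> \<psi>')"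
proof -
 note [simp] = assms[unfolded gen_ok_def]
 interpret g: cvs "Sp g" by (simp add: sp_cvs)
 show ?thesis
  by (rule cr_hom_eqI[of _ \<rho> \<sigma>]) (simp_all add: cr_add_hom gen_hom gen_ok_def cmp_hadd tar_hadd dyad_add_right)
qed

lemma gen_scale:
 assumes "gen_ok \<rho> \<sigma> g T \<psi>"
 shows "cr_scale c (gen \<rho> \<sigma> g T \<psi>) = gen \<rho> \<sigma> g (hscale C c T) \<psi>"
  and "cr_scale c (gen \<rho> \<sigma> g T \<psi>) = gen \<rho> \<sigma> g T (c \<odot>\<^bsub>Sp g\<^esub> \<psi>)"
proof -
 note [simp] = assms[unfolded gen_ok_def]
 interpret g: cvs "Sp g" by (simp add: sp_cvs)
 show "cr_scale c (gen \<rho> \<sigma> g T \<psi>) = gen \<rho> \<sigma> g (hscale C c T) \<psi>"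
  by (rule cr_hom_eqI[of _ \<rho> \<sigma>]) (simp_all add: cr_scale_hom gen_hom gen_ok_def)
 show "cr_scale c (gen \<rho> \<sigma> g T \<psi>) = gen \<rho> \<sigma> g T (c \<odot>\<^bsub>Sp g\<^esub> \<psi>)"
  by (rule cr_hom_eqI[of _ \<rho> \<sigma>]) (simp_all add: cr_scale_hom gen_hom gen_ok_def dyad_scale_right)
qed

lemma gen_zero_arrow:
 assumes "gen_ok \<rho> \<sigma> g (hzero C (g\<boxdot>\<rho>) \<sigma>) \<psi>"
 shows "gen \<rho> \<sigma> g (hzero C (g\<boxdot>\<rho>) \<sigma>) \<psi> = cr_zero \<rho> \<sigma>"
proof -
 note [simp] = assms[unfolded gen_ok_def]
 show ?thesis by (rule cr_hom_eqI[of _ \<rho> \<sigma>]) (simp_all add: cr_zero_hom gen_hom assms)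
qed

lemma gen_zero_vec:
 assumes "gen_ok \<rho> \<sigma> g T \<zero>\<^bsub>Sp g\<^esub>"
 shows "gen \<rho> \<sigma> g T \<zero>\<^bsub>Sp g\<^esub> = cr_zero \<rho> \<sigma>"
proof -
 note [simp] = assms[unfolded gen_ok_def]
 interpret g: cvs "Sp g" by (simp add: sp_cvs)
 interpret cr: cvs "cr_space \<rho> \<sigma>" by (simp add: cr_cvs)
 show ?thesis using gen_scale(2)[OF assms, of 0] cr.smult_0_l[of "gen \<rho> \<sigma> g T \<zero>\<^bsub>Sp g\<^esub>"] gen_hom[OF assms] by simp
qed

lemma gen_finsum_vec:
 assumes ok: "gen_ok \<rho> \<sigma> g T \<psi>" and A: "finite A" "f \<in> A \<rightarrow> Vec g"
 shows "finsum (cr_space \<rho> \<sigma>) (%i. gen \<rho> \<sigma> g T (f i)) A = gen \<rho> \<sigma> g T (finsum (Sp g) f A)"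
proof -
 note [simp] = gen_okD[OF ok]
 interpret g: cvs "Sp g" by (simp add: sp_cvs)
 interpret cr: cvs "cr_space \<rho> \<sigma>" by (simp add: cr_cvs)
 from A show ?thesis
 proof induct
  case empty
  then show ?case using gen_zero_vec[of \<rho> \<sigma> g T] by (simp add: gen_ok_def)
 next
  case (insert i A)
  then have i: "f i \<in> Vec g" and fA: "f \<in> A \<rightarrow> Vec g" by auto
  have s: "finsum (Sp g) f A \<in> Vec g" by (rule g.M.finsum_closed[OF fA])
  have "finsum (cr_space \<rho> \<sigma>) (%i. gen \<rho> \<sigma> g T (f i)) (insert i A) =
    cr_add (gen \<rho> \<sigma> g T (f i)) (finsum (cr_space \<rho> \<sigma>) (%i. gen \<rho> \<sigma> g T (f i)) A)"
   using cr.M.finsum_insert[of A i "%i. gen \<rho> \<sigma> g T (f i)"] insert fA i gen_hom[of \<rho> \<sigma> g T]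
   by (auto simp: gen_ok_def Pi_iff)
  also have "\<dots> = gen \<rho> \<sigma> g T (f i \<oplus>\<^bsub>Sp g\<^esub> finsum (Sp g) f A)"
   using insert(3)[OF fA] gen_add_vec[of \<rho> \<sigma> g T "f i" "finsum (Sp g) f A"] i s by (simp add: gen_ok_def)
  also have "f i \<oplus>\<^bsub>Sp g\<^esub> finsum (Sp g) f A = finsum (Sp g) f (insert i A)"
   using g.M.finsum_insert[of A i f] insert fA i by simp
  finally show ?case .
 qed
qed

lemma elem_gen:
 assumes k[simp]: "k \<in> Ghat" and ok: "gen_ok \<rho> \<sigma> (\<gamma> k) T \<psi>"
 shows "elem \<rho> \<sigma> k T \<psi> = gen \<rho> \<sigma> (\<gamma> k) T \<psi>"
proof -
 note [simp] = gen_okD[OF ok]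
 show ?thesis unfolding elem_def gen_def
  by (rule arrow.expand) (auto intro!: restrict_ext simp: H_Sp dyad_\<gamma>)
qed

text \<open>Two generalized elementary tensors can be written over the same object and with the same vector:
 over a direct sum with isometries \<open>V\<^sub>1\<close>, \<open>V\<^sub>2\<close> take the vector \<open>V\<^sub>1\<psi>\<^sub>1 + V\<^sub>2\<psi>\<^sub>2\<close> and precompose with
 the adjoint isometries.\<close>

lemma gen_common:
 assumes 1: "gen_ok \<rho> \<sigma> g1 T1 \<psi>1" and 2: "gen_ok \<rho>' \<sigma>' g2 T2 \<psi>2"
 shows "\<exists>g T T' \<psi>. gen_ok \<rho> \<sigma> g T \<psi> \<and> gen_ok \<rho>' \<sigma>' g T' \<psi> \<and>
  gen \<rho> \<sigma> g1 T1 \<psi>1 = gen \<rho> \<sigma> g T \<psi> \<and> gen \<rho>' \<sigma>' g2 T2 \<psi>2 = gen \<rho>' \<sigma>' g T' \<psi>"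
proof -
 note [simp] = gen_okD[OF 1] gen_okD[OF 2]
 obtain g where g: "g \<in> Obj C" "direct_sum C g1 g2 g"
  using has_direct_sums unfolding has_direct_sums_def by (meson 1 2 gen_ok_def S_obj)
 then have gS[simp]: "g \<in> S" using sub.direct_sum_mem[of g1 g2 g] by simp
 obtain V1 V2 where V1: "isometry C g1 g V1" and V2: "isometry C g2 g V2"
  and V12: "hadd C (V1\<cdot>V1\<dagger>) (V2\<cdot>V2\<dagger>) = idn C g" using g by (auto simp: direct_sum_def)
 note [simp] = isometryD(1-6)[OF V1] isometryD(1-6)[OF V2]
 note o = direct_sum_orthogonal[OF V1 V2 V12]
 have h: "V1 \<in> Hom C g1 g" "V2 \<in> Hom C g2 g" "V1\<dagger> \<in> Hom C g g1" "V2\<dagger> \<in> Hom C g g2" by (simp_all add: in_Hom)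
 have m: "Fa V1 \<psi>1 \<in> Vec g" "Fa V2 \<psi>2 \<in> Vec g"
  using F_mem[OF h(1), of \<psi>1] F_mem[OF h(2), of \<psi>2] by simp_all
 define \<psi> where "\<psi> = Fa V1 \<psi>1 \<oplus>\<^bsub>Sp g\<^esub> Fa V2 \<psi>2"
 interpret g: cvs "Sp g" by (simp add: sp_cvs)
 interpret g1: cvs "Sp g1" by (simp add: sp_cvs)
 interpret g2: cvs "Sp g2" by (simp add: sp_cvs)
 have \<psi>[simp]: "\<psi> \<in> Vec g" using m by (simp add: \<psi>_def)
 have "Fa (V1\<dagger>) \<psi> = Fa (V1\<dagger>) (Fa V1 \<psi>1) \<oplus>\<^bsub>Sp g1\<^esub> Fa (V1\<dagger>) (Fa V2 \<psi>2)"
  unfolding \<psi>_def by (rule F_add[OF h(3)]) (simp_all add: m)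
 also have "Fa (V1\<dagger>) (Fa V1 \<psi>1) = \<psi>1"
  using F.Fa_cmp[of g1 g g1 "V1\<dagger>" V1 \<psi>1] h by (simp add: F.Fa_idn)
 also have "Fa (V1\<dagger>) (Fa V2 \<psi>2) = \<zero>\<^bsub>Sp g1\<^esub>"
  using F.Fa_cmp[of g2 g g1 "V1\<dagger>" V2 \<psi>2] h F_hzero[of g2 g1 \<psi>2] by (simp add: o)
 finally have F1: "Fa (V1\<dagger>) \<psi> = \<psi>1" by simp
 have "Fa (V2\<dagger>) \<psi> = Fa (V2\<dagger>) (Fa V1 \<psi>1) \<oplus>\<^bsub>Sp g2\<^esub> Fa (V2\<dagger>) (Fa V2 \<psi>2)"
  unfolding \<psi>_def by (rule F_add[OF h(4)]) (simp_all add: m)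
 also have "Fa (V2\<dagger>) (Fa V2 \<psi>2) = \<psi>2"
  using F.Fa_cmp[of g2 g g2 "V2\<dagger>" V2 \<psi>2] h by (simp add: F.Fa_idn)
 also have "Fa (V2\<dagger>) (Fa V1 \<psi>1) = \<zero>\<^bsub>Sp g2\<^esub>"
  using F.Fa_cmp[of g1 g g2 "V2\<dagger>" V1 \<psi>1] h F_hzero[of g1 g2 \<psi>1] by (simp add: o)
 finally have F2: "Fa (V2\<dagger>) \<psi> = \<psi>2" by simp
 have "gen \<rho> \<sigma> g (T1\<cdot>(V1\<dagger>|>\<rho>)) \<psi> = gen \<rho> \<sigma> g1 T1 \<psi>1"
  using gen_natural[OF 1 gS h(3) \<psi>] by (simp add: F1)
 moreover have "gen \<rho>' \<sigma>' g (T2\<cdot>(V2\<dagger>|>\<rho>')) \<psi> = gen \<rho>' \<sigma>' g2 T2 \<psi>2"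
  using gen_natural[OF 2 gS h(4) \<psi>] by (simp add: F2)
 moreover have "gen_ok \<rho> \<sigma> g (T1\<cdot>(V1\<dagger>|>\<rho>)) \<psi>" "gen_ok \<rho>' \<sigma>' g (T2\<cdot>(V2\<dagger>|>\<rho>')) \<psi>"
  by (simp_all add: gen_ok_def)
 ultimately show ?thesis by metis
qed

lemma finite_terms: "x \<in> cr_hom \<rho> \<sigma> ==> finite (terms x)"
 unfolding terms_def using cr_homD(3)[of x \<rho> \<sigma>] onb_mem(1) by (auto simp: supp_def)

lemma terms_Ghat: "p \<in> terms x ==> fst p \<in> Ghat \<and> snd p \<in> onb (fst p)"
 by (auto simp: terms_def supp_def)

text \<open>The decomposition of an antilinear map \<open>c\<close> into the elementary tensors \<open>c b \<otimes> b\<close>.\<close>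

lemma cr_hom_expansion:
 assumes o[simp]: "\<rho> \<in> Obj C" "\<sigma> \<in> Obj C" and x: "x \<in> cr_hom \<rho> \<sigma>"
 shows "x = finsum (cr_space \<rho> \<sigma>) (%p. gen \<rho> \<sigma> (\<gamma> (fst p)) (val x (fst p) (snd p)) (snd p)) (terms x)"
  (is "x = finsum _ ?f _")
proof -
 interpret cr: cvs "cr_space \<rho> \<sigma>" by (simp add: cr_cvs)
 note dx = cr_homD[OF x]
 note [simp] = HomD[OF dx(4)]
 have pm: "fst p \<in> Ghat" "snd p \<in> Vec (\<gamma> (fst p))" if "p \<in> terms x" for p
  using terms_Ghat[OF that] onb_mem(2) by auto
 have f: "?f \<in> terms x \<rightarrow> cr_hom \<rho> \<sigma>"
  using pm by (auto intro!: gen_hom simp: gen_ok_def)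
 show ?thesis
 proof (rule cr_hom_eqI[OF x])
  show "finsum (cr_space \<rho> \<sigma>) ?f (terms x) \<in> cr_hom \<rho> \<sigma>" using cr.M.finsum_closed[of ?f "terms x"] f by simp
  fix k \<phi> assume k[simp]: "k \<in> Ghat" and \<phi>[simp]: "\<phi> \<in> Vec (\<gamma> k)"
  interpret k: fd_hilbert "Sp (\<gamma> k)" by (simp add: hilb)
  interpret h: cvs "hom_space C (\<gamma> k\<boxdot>\<rho>) \<sigma>" by (simp add: hom_cvs)
  have v: "val (?f p) k \<phi> = (if fst p = k then hscale C (ip (Sp (\<gamma> k)) \<phi> (snd p)) (val x k (snd p)) else hzero C (\<gamma> k\<boxdot>\<rho>) \<sigma>)"
   if p: "p \<in> terms x" for p
   using pm[OF p] dyad_\<gamma>[OF k pm(1)[OF p] \<phi> pm(2)[OF p]] by auto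
  have L: "val (finsum (cr_space \<rho> \<sigma>) ?f (terms x)) k \<phi> = hsum C (\<gamma> k\<boxdot>\<rho>) \<sigma> (%p. val (?f p) k \<phi>) (terms x)"
   by (rule val_finsum) (use f finite_terms[OF x] in auto)
  show "val x k \<phi> = val (finsum (cr_space \<rho> \<sigma>) ?f (terms x)) k \<phi>"
  proof (cases "k \<in> supp x")
   case False
   have "hsum C (\<gamma> k\<boxdot>\<rho>) \<sigma> (%p. val (?f p) k \<phi>) (terms x) = hzero C (\<gamma> k\<boxdot>\<rho>) \<sigma>"
   proof (rule hsum_0)
    fix p assume p: "p \<in> terms x"
    with False have "fst p ~= k" by (auto simp: terms_def)
    with v[OF p] show "val (?f p) k \<phi> = hzero C (\<gamma> k\<boxdot>\<rho>) \<sigma>" by simp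
   qed simp_all
   with L val_notin_supp[OF x k False \<phi>] show ?thesis by simp
  next
   case True
   have on: "finite (onb k)" "!!b. b \<in> onb k ==> b \<in> Vec (\<gamma> k)" using onb_mem[OF k] by auto
   have vs: "val x k (finsum (Sp (\<gamma> k)) (%b. c b \<odot>\<^bsub>Sp (\<gamma> k)\<^esub> b) B) =
     hsum C (\<gamma> k\<boxdot>\<rho>) \<sigma> (%b. hscale C (cnj (c b)) (val x k b)) B"
    if "finite B" "B \<subseteq> onb k" for B c
    using that
   proof induct
    case empty
    have "val x k (0 \<odot>\<^bsub>Sp (\<gamma> k)\<^esub> \<zero>\<^bsub>Sp (\<gamma> k)\<^esub>) = hzero C (\<gamma> k\<boxdot>\<rho>) \<sigma>"
     using dx(6)[OF k k.M.zero_closed, of 0] by simp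
    then show ?case by simp
   next
    case (insert b B)
    have cl: "(%b. c b \<odot>\<^bsub>Sp (\<gamma> k)\<^esub> b) \<in> B \<rightarrow> Vec (\<gamma> k)" "b \<in> Vec (\<gamma> k)"
     using insert on(2) by auto
    have "hsum C (\<gamma> k\<boxdot>\<rho>) \<sigma> (%b. hscale C (cnj (c b)) (val x k b)) (insert b B) =
      hadd C (hscale C (cnj (c b)) (val x k b)) (hsum C (\<gamma> k\<boxdot>\<rho>) \<sigma> (%b. hscale C (cnj (c b)) (val x k b)) B)"
     by (rule hsum_insert) (use insert on(2) in "auto simp: in_Hom")
    moreover have "finsum (Sp (\<gamma> k)) (%b. c b \<odot>\<^bsub>Sp (\<gamma> k)\<^esub> b) (insert b B) =
      c b \<odot>\<^bsub>Sp (\<gamma> k)\<^esub> b \<oplus>\<^bsub>Sp (\<gamma> k)\<^esub> finsum (Sp (\<gamma> k)) (%b. c b \<odot>\<^bsub>Sp (\<gamma> k)\<^esub> b) B"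
     by (rule k.M.finsum_insert) (use insert cl in auto)
    moreover have "finsum (Sp (\<gamma> k)) (%b. c b \<odot>\<^bsub>Sp (\<gamma> k)\<^esub> b) B \<in> Vec (\<gamma> k)"
     by (rule k.M.finsum_closed[OF cl(1)])
    ultimately show ?case using insert dx(5)[OF k] dx(6)[OF k cl(2)] cl(2) by auto
   qed
   have "val x k \<phi> = hsum C (\<gamma> k\<boxdot>\<rho>) \<sigma> (%b. hscale C (cnj (ip (Sp (\<gamma> k)) b \<phi>)) (val x k b)) (onb k)"
    using vs[OF on(1) subset_refl, of "%b. ip (Sp (\<gamma> k)) b \<phi>"] k.orthonormal_expansion[OF onb[OF k] \<phi>] by simp
   also have "\<dots> = hsum C (\<gamma> k\<boxdot>\<rho>) \<sigma> (%b. val (?f (k, b)) k \<phi>) (onb k)"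
   proof (rule hsum_cong)
    fix b assume b: "b \<in> onb k"
    then have p: "(k, b) \<in> terms x" using True by (simp add: terms_def)
    have "cnj (ip (Sp (\<gamma> k)) b \<phi>) = ip (Sp (\<gamma> k)) \<phi> b" using k.ip_cnj[of b \<phi>] on(2)[OF b] by simp
    then show "hscale C (cnj (ip (Sp (\<gamma> k)) b \<phi>)) (val x k b) = val (?f (k, b)) k \<phi>"
     unfolding v[OF p] by simp
   next
    show "(%b. val (?f (k, b)) k \<phi>) \<in> onb k \<rightarrow> Hom C (\<gamma> k\<boxdot>\<rho>) \<sigma>"
    proof
     fix b assume b: "b \<in> onb k"
     then have p: "(k, b) \<in> terms x" using True by (simp add: terms_def)
     show "val (?f (k, b)) k \<phi> \<in> Hom C (\<gamma> k\<boxdot>\<rho>) \<sigma>" unfolding v[OF p] using on(2)[OF b] by (simp add: in_Hom)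
    qed
   qed simp_all
   also have "\<dots> = hsum C (\<gamma> k\<boxdot>\<rho>) \<sigma> (%p. val (?f p) k \<phi>) (Pair k ` onb k)"
    by (subst h.M.finsum_reindex)
     (use True on(2) cr_homD(4)[OF funcset_mem[OF f] k \<phi>] in "auto simp: terms_def inj_on_def simp del: val_gen")
   also have "\<dots> = hsum C (\<gamma> k\<boxdot>\<rho>) \<sigma> (%p. val (?f p) k \<phi>) (terms x)"
   proof (rule h.finsum_subset[unfolded hom_space_simps, OF finite_terms[OF x]])
    show "Pair k ` onb k \<subseteq> terms x" using True by (auto simp: terms_def)
    show "val (?f p) k \<phi> = hzero C (\<gamma> k\<boxdot>\<rho>) \<sigma>" if "p \<in> terms x - Pair k ` onb k" for p
    proof -
     have "fst p ~= k" using that by (cases p) (auto simp: terms_def)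
     then show ?thesis using v[of p] that by simp
    qed
    show "(%p. val (?f p) k \<phi>) \<in> terms x \<rightarrow> Hom C (\<gamma> k\<boxdot>\<rho>) \<sigma>"
     using cr_homD(4)[OF funcset_mem[OF f] k \<phi>] by blast
   qed
   finally show ?thesis using L by simp
  qed
 qed
qed

lemma cr_hom_gen:
 assumes o[simp]: "\<rho> \<in> Obj C" "\<sigma> \<in> Obj C" and x: "x \<in> cr_hom \<rho> \<sigma>"
 shows "\<exists>g T \<psi>. gen_ok \<rho> \<sigma> g T \<psi> \<and> x = gen \<rho> \<sigma> g T \<psi>"
proof -
 interpret cr: cvs "cr_space \<rho> \<sigma>" by (simp add: cr_cvs)
 let ?f = "%p. gen \<rho> \<sigma> (\<gamma> (fst p)) (val x (fst p) (snd p)) (snd p)"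
 have pm: "fst p \<in> Ghat" "snd p \<in> Vec (\<gamma> (fst p))" if "p \<in> terms x" for p
  using terms_Ghat[OF that] onb_mem(2) by auto
 have ok: "gen_ok \<rho> \<sigma> (\<gamma> (fst p)) (val x (fst p) (snd p)) (snd p)" if "p \<in> terms x" for p
  using cr_homD(4)[OF x pm[OF that]] pm[OF that] by (simp add: gen_ok_def in_Hom)
 have "\<exists>g T \<psi>. gen_ok \<rho> \<sigma> g T \<psi> \<and> finsum (cr_space \<rho> \<sigma>) ?f A = gen \<rho> \<sigma> g T \<psi>" if "finite A" "A \<subseteq> terms x" for A
  using that
 proof induct
  case empty
  have "gen_ok \<rho> \<sigma> (unt C) (hzero C (unt C\<boxdot>\<rho>) \<sigma>) \<Omega>" by (simp add: gen_ok_def \<Omega>_mem)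
  with gen_zero_arrow[OF this] show ?case by (metis cr.M.finsum_empty cr_space_simps(2))
 next
  case (insert p A)
  then obtain g T \<psi> where g: "gen_ok \<rho> \<sigma> g T \<psi>" "finsum (cr_space \<rho> \<sigma>) ?f A = gen \<rho> \<sigma> g T \<psi>" by blast
  have p: "p \<in> terms x" using insert by simp
  have fp: "?f p \<in> cr_hom \<rho> \<sigma>" by (rule gen_hom[OF ok[OF p]])
  have fA: "?f \<in> A \<rightarrow> cr_hom \<rho> \<sigma>" using gen_hom[OF ok] insert(4) by blast
  have "finsum (cr_space \<rho> \<sigma>) ?f (insert p A) = cr_add (?f p) (finsum (cr_space \<rho> \<sigma>) ?f A)"
   using cr.M.finsum_insert[OF insert(1,2), of ?f] fp fA by simp
  moreover obtain h T1 T2 \<psi>' where "gen_ok \<rho> \<sigma> h T1 \<psi>'" "gen_ok \<rho> \<sigma> h T2 \<psi>'"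
   "?f p = gen \<rho> \<sigma> h T1 \<psi>'" "gen \<rho> \<sigma> g T \<psi> = gen \<rho> \<sigma> h T2 \<psi>'"
   using gen_common[OF ok[OF p] g(1)] by blast
  moreover from this have "gen_ok \<rho> \<sigma> h (hadd C T1 T2) \<psi>'" by (simp add: gen_ok_def)
  ultimately show ?case using gen_add_arrow[of \<rho> \<sigma> h T1 \<psi>' T2] g(2) by metis
 qed
 from this[OF finite_terms[OF x] subset_refl] cr_hom_expansion[OF o x] show ?thesis by simp
qed

text \<open>Parallel arrows can therefore be added by adding the arrow components only, so additivity of the
 operations is additivity in these components.\<close>

lemma cr_hom_gen2:
 assumes "\<rho> \<in> Obj C" "\<sigma> \<in> Obj C" "x \<in> cr_hom \<rho> \<sigma>" "y \<in> cr_hom \<rho> \<sigma>"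
 shows "\<exists>g T T' \<psi>. gen_ok \<rho> \<sigma> g T \<psi> \<and> gen_ok \<rho> \<sigma> g T' \<psi> \<and> gen_ok \<rho> \<sigma> g (hadd C T T') \<psi> \<and>
  x = gen \<rho> \<sigma> g T \<psi> \<and> y = gen \<rho> \<sigma> g T' \<psi> \<and> cr_add x y = gen \<rho> \<sigma> g (hadd C T T') \<psi>"
proof -
 obtain g1 T1 \<psi>1 where 1: "gen_ok \<rho> \<sigma> g1 T1 \<psi>1" "x = gen \<rho> \<sigma> g1 T1 \<psi>1" using cr_hom_gen assms by blast
 obtain g2 T2 \<psi>2 where 2: "gen_ok \<rho> \<sigma> g2 T2 \<psi>2" "y = gen \<rho> \<sigma> g2 T2 \<psi>2" using cr_hom_gen assms by blast
 obtain g T T' \<psi> where g: "gen_ok \<rho> \<sigma> g T \<psi>" "gen_ok \<rho> \<sigma> g T' \<psi>"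
  "gen \<rho> \<sigma> g1 T1 \<psi>1 = gen \<rho> \<sigma> g T \<psi>" "gen \<rho> \<sigma> g2 T2 \<psi>2 = gen \<rho> \<sigma> g T' \<psi>"
  using gen_common[OF 1(1) 2(1)] by blast
 have "gen_ok \<rho> \<sigma> g (hadd C T T') \<psi>" using g(1,2) by (simp add: gen_ok_def)
 with g 1(2) 2(2) gen_add_arrow[OF g(1,2)] show ?thesis by metis
qed

end

section \<open>The operations on generalized elementary tensors\<close>

context crossed_product_setting
begin

lemma braid_arr [simp]:
 assumes "\<rho> \<in> Obj C" "\<sigma> \<in> Obj C"
 shows "braid C \<rho> \<sigma> \<in> Arr C" "Dom C (braid C \<rho> \<sigma>) = \<rho>\<boxdot>\<sigma>" "Cod C (braid C \<rho> \<sigma>) = \<sigma>\<boxdot>\<rho>"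
 using braid_hom[OF assms] by (auto simp: in_Hom)

lemma braid_nat:
 "[|f \<in> Arr C; g \<in> Arr C; Dom C f = \<rho>; Cod C f = \<rho>'; Dom C g = \<sigma>; Cod C g = \<sigma>'|] ==>
  braid C \<rho>' \<sigma>'\<cdot>(f \<boxtimes> g) = (g \<boxtimes> f)\<cdot>braid C \<rho> \<sigma>"
 by (rule braid_natural) (auto simp: in_Hom)

subsection \<open>Independence of the orthonormal bases\<close>

context
 fixes k l
 assumes k[simp]: "k \<in> Ghat" and l[simp]: "l \<in> Ghat"
begin

lemma V_hom: "[|m \<in> Ghat; v \<in> V k l m|] ==> v \<in> Hom C (\<gamma> m) (\<gamma> k\<boxdot>\<gamma> l)"
 using ch.basis[OF k l, of m] by (auto simp: spans_def)

lemma V_orthonormal: "[|m \<in> Ghat; v \<in> V k l m; w \<in> V k l m|] ==>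
  v\<dagger>\<cdot>w = (if v = w then idn C (\<gamma> m) else hzero C (\<gamma> m) (\<gamma> m))"
 using ch.basis[OF k l] by blast

lemma finite_V: "finite (Sigma Ghat (V k l))"
proof -
 have "m \<in> constituents (\<gamma> k\<boxdot>\<gamma> l)" if m: "m \<in> Ghat" "v \<in> V k l m" for m v
 proof -
  have "v ~= hzero C (\<gamma> m) (\<gamma> k\<boxdot>\<gamma> l)"
  proof
   assume 0: "v = hzero C (\<gamma> m) (\<gamma> k\<boxdot>\<gamma> l)"
   have "idn C (\<gamma> m) = v\<dagger>\<cdot>v" using V_orthonormal[OF m m(2)] by simp
   also have "\<dots> = hzero C (\<gamma> m) (\<gamma> m)" unfolding 0 using m(1) by simp
   finally show False using irreducible_objD[OF Ghat(2)[OF m(1)]] by simp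
  qed
  then show ?thesis using m V_hom[OF m] by (auto simp: constituents_def)
 qed
 then have "Sigma Ghat (V k l) \<subseteq> Sigma (constituents (\<gamma> k\<boxdot>\<gamma> l)) (V k l)" by auto
 moreover have "finite (Sigma (constituents (\<gamma> k\<boxdot>\<gamma> l)) (V k l))"
  using finite_constituents[of "\<gamma> k\<boxdot>\<gamma> l"] ch.basis[OF k l]
  by (intro finite_SigmaI) (auto simp: spans_def constituents_def)
 ultimately show ?thesis by (rule finite_subset)
qed

text \<open>The sum \<open>P\<close> of the \<open>vv\<^sup>*\<close> fixes the members of the bases, hence all arrows from representatives, and these
 decompose the identity.\<close>

lemma V_complete:
 "hsum C (\<gamma> k\<boxdot>\<gamma> l) (\<gamma> k\<boxdot>\<gamma> l) (%p. snd p\<cdot>(snd p)\<dagger>) (Sigma Ghat (V k l)) = idn C (\<gamma> k\<boxdot>\<gamma> l)"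
proof -
 let ?g = "\<gamma> k\<boxdot>\<gamma> l" and ?V = "Sigma Ghat (V k l)"
 define P where "P = hsum C ?g ?g (%p. snd p\<cdot>(snd p)\<dagger>) ?V"
 have vH: "snd p \<in> Arr C" "Dom C (snd p) = \<gamma> (fst p)" "Cod C (snd p) = ?g" "fst p \<in> Ghat" if "p \<in> ?V" for p
  using that V_hom[of "fst p" "snd p"] by (auto simp: in_Hom)
 note [simp] = vH
 have h: "(%p. snd p\<cdot>(snd p)\<dagger>) \<in> ?V \<rightarrow> Hom C ?g ?g"
 proof
  fix p assume p: "p \<in> ?V"
  show "snd p\<cdot>(snd p)\<dagger> \<in> Hom C ?g ?g" using vH[OF p] by (simp add: in_Hom)
 qed
 have PH: "P \<in> Hom C ?g ?g" unfolding P_def by (rule hsum_hom) (use h in auto)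
 note [simp] = HomD[OF PH]
 have Pv: "P\<cdot>v = v" if m: "m \<in> Ghat" "v \<in> V k l m" for m v
 proof -
  have v[simp]: "v \<in> Arr C" "Dom C v = \<gamma> m" "Cod C v = ?g" using V_hom[OF m] by (auto simp: in_Hom)
  have "P\<cdot>v = hsum C (\<gamma> m) ?g (%p. (snd p\<cdot>(snd p)\<dagger>)\<cdot>v) ?V"
   unfolding P_def by (rule hsum_cmp[OF finite_V h]) (use m in "simp_all add: in_Hom")
  also have "\<dots> = hsum C (\<gamma> m) ?g (%p. if p = (m, v) then v else hzero C (\<gamma> m) ?g) ?V"
  proof (rule hsum_cong)
   fix p assume p: "p \<in> ?V"
   show "(snd p\<cdot>(snd p)\<dagger>)\<cdot>v = (if p = (m, v) then v else hzero C (\<gamma> m) ?g)"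
   proof (cases "fst p = m")
    case True
    then have "(snd p)\<dagger>\<cdot>v = (if snd p = v then idn C (\<gamma> m) else hzero C (\<gamma> m) (\<gamma> m))"
     using V_orthonormal[OF m(1) _ m(2), of "snd p"] p by auto
    then show ?thesis using vH[OF p] True m(1) by (auto simp: prod_eq_iff)
   next
    case False
    have "(snd p)\<dagger>\<cdot>v = hzero C (\<gamma> m) (\<gamma> (fst p))"
     by (rule Hom_\<gamma>_zero[OF m(1)]) (use vH[OF p] False in "auto simp: in_Hom")
    then show ?thesis using vH[OF p] False m(1) by auto
   qed
  qed (use m in "auto simp: in_Hom")
  also have "\<dots> = v" by (rule hsum_delta[OF finite_V]) (use m in "auto simp: in_Hom")
  finally show ?thesis .
 qed
 have Pw: "P\<cdot>w = w" if m: "m \<in> Ghat" and w: "w \<in> Hom C (\<gamma> m) ?g" for m w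
 proof -
  interpret h: cvs "hom_space C (\<gamma> m) ?g" using m by (simp add: hom_cvs)
  have sp: "spans (hom_space C (\<gamma> m) ?g) (V k l m)" using ch.basis[OF k l m] by blast
  have "w \<in> carrier (hom_space C (\<gamma> m) ?g)" using w by simp
  with sp show ?thesis
   by (induct rule: h.spans_induct) (use m Pv in "auto simp: cmp_hadd in_Hom")
 qed
 obtain Q where Q: "decomposition C ?g Q" and Qk: "!!w. w \<in> Q ==> \<exists>k\<in>Ghat. Dom C w = \<gamma> k"
  using S_decomposition[of ?g] by auto
 note d = decompositionD[OF Q]
 have hw: "(%w. w\<cdot>w\<dagger>) \<in> Q \<rightarrow> Hom C ?g ?g" using d(4,5) by (auto simp: in_Hom)
 have "P = P\<cdot>hsum C ?g ?g (%w. w\<cdot>w\<dagger>) Q" by (simp add: d(6))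
 also have "\<dots> = hsum C ?g ?g (%w. P\<cdot>(w\<cdot>w\<dagger>)) Q" by (rule cmp_hsum[OF d(1) hw]) (simp_all add: in_Hom)
 also have "\<dots> = hsum C ?g ?g (%w. w\<cdot>w\<dagger>) Q"
 proof (rule hsum_cong[OF _ _ hw])
  fix w assume w: "w \<in> Q"
  note [simp] = d(4,5)[OF w]
  obtain m where "m \<in> Ghat" "Dom C w = \<gamma> m" using Qk[OF w] by blast
  then have "P\<cdot>w = w" using Pw[of m w] by (simp add: in_Hom)
  then show "P\<cdot>(w\<cdot>w\<dagger>) = w\<cdot>w\<dagger>" using cmp_eq_cmp[of P w w "w\<dagger>"] by simp
 qed simp_all
 finally show ?thesis using d(6) by (simp add: P_def)
qed

lemma F_adj_eq:
 assumes "m \<in> Ghat" "v \<in> V k l m"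
 shows "F_adj k l m v = Fa (v\<dagger>)"
 unfolding F_adj_def H_Sp using F.Fa_star[of "\<gamma> m" "\<gamma> k\<boxdot>\<gamma> l" v] V_hom[OF assms] assms(1) by simp

text \<open>By naturality each summand is the tensor of \<open>X\<close> with \<open>F(vv\<^sup>*)\<xi>\<close>, and the \<open>vv\<^sup>*\<close> sum up to the identity; so the
 orthonormal bases in the definition of the operations disappear.\<close>

lemma gen_basis_sum:
 assumes o[simp]: "\<mu> \<in> Obj C" "\<nu> \<in> Obj C" and X[simp]: "X \<in> Arr C" "Dom C X = (\<gamma> k\<boxdot>\<gamma> l)\<boxdot>\<mu>" "Cod C X = \<nu>"
  and \<xi>[simp]: "\<xi> \<in> Vec (\<gamma> k\<boxdot>\<gamma> l)"
  and Y: "!!m v. [|m \<in> Ghat; v \<in> V k l m|] ==> Y m v = X\<cdot>(v|>\<mu>)"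
 shows "finsum (cr_space \<mu> \<nu>) (%(m, v). elem \<mu> \<nu> m (Y m v) (F_adj k l m v \<xi>)) (Sigma Ghat (V k l)) =
  gen \<mu> \<nu> (\<gamma> k\<boxdot>\<gamma> l) X \<xi>"
proof -
 let ?g = "\<gamma> k\<boxdot>\<gamma> l" and ?V = "Sigma Ghat (V k l)"
 interpret cr: cvs "cr_space \<mu> \<nu>" by (simp add: cr_cvs)
 have ok: "gen_ok \<mu> \<nu> ?g X \<xi>" using X by (simp add: gen_ok_def)
 have m: "Fa (v\<cdot>v\<dagger>) \<xi> \<in> Vec ?g \<and>
   elem \<mu> \<nu> m (Y m v) (F_adj k l m v \<xi>) = gen \<mu> \<nu> ?g X (Fa (v\<cdot>v\<dagger>) \<xi>)" if mv: "m \<in> Ghat" "v \<in> V k l m" for m v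
 proof -
  note vH = V_hom[OF mv]
  note [simp] = HomD[OF vH] mv(1)
  have vd: "v\<dagger> \<in> Hom C ?g (\<gamma> m)" by (simp add: in_Hom)
  have 1: "Fa (v\<dagger>) \<xi> \<in> Vec (\<gamma> m)" by (rule F_mem[OF vd]) simp_all
  have 2: "Fa v (Fa (v\<dagger>) \<xi>) \<in> Vec ?g" by (rule F_mem[OF vH _ _ 1]) simp_all
  have 3: "Fa (v\<cdot>v\<dagger>) \<xi> = Fa v (Fa (v\<dagger>) \<xi>)"
   by (rule F.Fa_cmp[OF _ _ _ vH vd]) simp_all
  have ok': "gen_ok \<mu> \<nu> ?g X (Fa v (Fa (v\<dagger>) \<xi>))" using ok 2 by (simp add: gen_ok_def)
  have "elem \<mu> \<nu> m (Y m v) (F_adj k l m v \<xi>) = gen \<mu> \<nu> (\<gamma> m) (X\<cdot>(v|>\<mu>)) (Fa (v\<dagger>) \<xi>)"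
   unfolding Y[OF mv] F_adj_eq[OF mv] by (rule elem_gen) (use 1 in "simp_all add: gen_ok_def")
  also have "\<dots> = gen \<mu> \<nu> ?g X (Fa v (Fa (v\<dagger>) \<xi>))" by (rule gen_natural[OF ok' _ vH 1]) simp
  finally show ?thesis using 2 3 by simp
 qed
 have "finsum (cr_space \<mu> \<nu>) (%(m, v). elem \<mu> \<nu> m (Y m v) (F_adj k l m v \<xi>)) ?V =
   finsum (cr_space \<mu> \<nu>) (%p. gen \<mu> \<nu> ?g X (Fa (snd p\<cdot>(snd p)\<dagger>) \<xi>)) ?V"
  by (rule cr.M.finsum_cong') (use m ok in "auto intro!: gen_hom simp: gen_ok_def")
 also have "\<dots> = gen \<mu> \<nu> ?g X (finsum (Sp ?g) (%p. Fa (snd p\<cdot>(snd p)\<dagger>) \<xi>) ?V)"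
  by (rule gen_finsum_vec[OF ok finite_V]) (use m in auto)
 also have "finsum (Sp ?g) (%p. Fa (snd p\<cdot>(snd p)\<dagger>) \<xi>) ?V = Fa (hsum C ?g ?g (%p. snd p\<cdot>(snd p)\<dagger>) ?V) \<xi>"
  by (rule F_hsum[symmetric, OF _ _ finite_V]) (use V_hom in "auto simp: in_Hom")
 also have "\<dots> = \<xi>" by (simp add: V_complete F.Fa_idn)
 finally show ?thesis .
qed

end

subsection \<open>Composition and tensor product\<close>

abbreviation "Jset g \<equiv> Sigma (constituents g) onb"

lemma Jset: assumes "g \<in> S" shows "finite (Jset g)"
  "!!p. p \<in> Jset g ==> fst p \<in> Ghat" "!!p. p \<in> Jset g ==> snd p \<in> Vec (\<gamma> (fst p))"
proof -
 have c: "k \<in> Ghat" if "k \<in> constituents g" for k using that by (simp add: constituents_def)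
 show "finite (Jset g)" using finite_constituents[OF assms] onb_mem(1) c by (intro finite_SigmaI) auto
 show "!!p. p \<in> Jset g ==> fst p \<in> Ghat" "!!p. p \<in> Jset g ==> snd p \<in> Vec (\<gamma> (fst p))"
  using c onb_mem(2) by auto
qed

text \<open>A common index set for the expansion of the tensor: the indices missing from its support contribute zero.\<close>

lemma terms_gen:
 assumes ok: "gen_ok \<rho> \<sigma> g T \<psi>"
 shows "terms (gen \<rho> \<sigma> g T \<psi>) \<subseteq> Jset g"
  and "p \<in> Jset g - terms (gen \<rho> \<sigma> g T \<psi>) ==> T\<cdot>(dyad (fst p) g (snd p) \<psi>|>\<rho>) = hzero C (\<gamma> (fst p)\<boxdot>\<rho>) \<sigma>"
proof -
 note [simp] = gen_okD[OF ok]
 have "supp (gen \<rho> \<sigma> g T \<psi>) \<subseteq> constituents g"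
 proof
  fix k assume "k \<in> supp (gen \<rho> \<sigma> g T \<psi>)"
  then obtain \<phi> where k: "k \<in> Ghat" "\<phi> \<in> Vec (\<gamma> k)"
   "T\<cdot>(dyad k g \<phi> \<psi>|>\<rho>) ~= hzero C (\<gamma> k\<boxdot>\<rho>) \<sigma>"
   by (auto simp: supp_def H_Sp)
  show "k \<in> constituents g"
  proof (rule ccontr)
   assume "k \<notin> constituents g"
   then have "dyad k g \<phi> \<psi> = hzero C (\<gamma> k) g" by (intro dyad_zero[OF k(1) _ _ k(2)]) simp_all
   with k show False by simp
  qed
 qed
 then show "terms (gen \<rho> \<sigma> g T \<psi>) \<subseteq> Jset g" by (auto simp: terms_def)
 assume p: "p \<in> Jset g - terms (gen \<rho> \<sigma> g T \<psi>)"
 have g: "g \<in> S" by simp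
 have pm: "fst p \<in> Ghat" "snd p \<in> Vec (\<gamma> (fst p))" using Jset(2,3)[OF g, of p] p by auto
 have "fst p \<notin> supp (gen \<rho> \<sigma> g T \<psi>)" using p by (auto simp: terms_def)
 then show "T\<cdot>(dyad (fst p) g (snd p) \<psi>|>\<rho>) = hzero C (\<gamma> (fst p)\<boxdot>\<rho>) \<sigma>"
  using val_notin_supp[OF gen_hom[OF ok] pm(1) _ pm(2)] pm by simp
qed

lemma dyad_sum:
 assumes g: "g \<in> S" and \<psi>: "\<psi> \<in> Vec g"
 shows "finsum (Sp g) (%p. Fa (dyad (fst p) g (snd p) \<psi>) (snd p)) (Jset g) = \<psi>"
  and "p \<in> Jset g ==> Fa (dyad (fst p) g (snd p) \<psi>) (snd p) \<in> Vec g"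
proof -
 show "finsum (Sp g) (%p. Fa (dyad (fst p) g (snd p) \<psi>) (snd p)) (Jset g) = \<psi>" by (rule dyad_complete[OF g \<psi>])
 assume p: "p \<in> Jset g"
 show "Fa (dyad (fst p) g (snd p) \<psi>) (snd p) \<in> Vec g"
  by (rule F_mem[OF dyad_hom[OF Jset(2)[OF g p] g Jset(3)[OF g p] \<psi>]]) (use Jset(2,3)[OF g p] g in simp_all)
qed

text \<open>The double sum over elementary tensors by which the bilinear operations are defined collapses:
 each summand is a tensor with the arrow \<open>X\<close> precomposed with two dyads, and the dyads sum up to the
 two given vectors.\<close>

lemma gen_double_sum:
 assumes g[simp]: "g \<in> S" "g' \<in> S" and \<psi>[simp]: "\<psi> \<in> Vec g" "\<psi>' \<in> Vec g'"
  and o[simp]: "\<mu> \<in> Obj C" "\<nu> \<in> Obj C" and X[simp]: "X \<in> Arr C" "Dom C X = (g\<boxdot>g')\<boxdot>\<mu>" "Cod C X = \<nu>"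
  and AB: "A \<subseteq> Jset g" "B \<subseteq> Jset g'"
  and E: "!!p q. [|p \<in> Jset g; q \<in> Jset g'|] ==>
   E p q = X\<cdot>((dyad (fst p) g (snd p) \<psi> \<boxtimes> dyad (fst q) g' (snd q) \<psi>')|>\<mu>)"
  and E0: "!!p q. [|p \<in> Jset g; q \<in> Jset g'; p \<notin> A \<or> q \<notin> B|] ==>
   E p q = hzero C ((\<gamma> (fst p)\<boxdot>\<gamma> (fst q))\<boxdot>\<mu>) \<nu>"
  and Z: "!!p q. [|p \<in> A; q \<in> B|] ==>
   Z (p, q) = gen \<mu> \<nu> (\<gamma> (fst p)\<boxdot>\<gamma> (fst q)) (E p q) (tv (\<gamma> (fst p)) (\<gamma> (fst q)) (snd p) (snd q))"
 shows "finsum (cr_space \<mu> \<nu>) Z (A \<times> B) = gen \<mu> \<nu> (g\<boxdot>g') X (tv g g' \<psi> \<psi>')"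
proof -
 interpret cr: cvs "cr_space \<mu> \<nu>" by (simp add: cr_cvs)
 note J = Jset[OF g(1)] and J' = Jset[OF g(2)]
 note [simp] = J(2,3) J'(2,3)
 note D = dyad_sum[OF g(1) \<psi>(1)] and D' = dyad_sum[OF g(2) \<psi>(2)]
 define W where "W r = gen \<mu> \<nu> (\<gamma> (fst (fst r))\<boxdot>\<gamma> (fst (snd r))) (E (fst r) (snd r))
  (tv (\<gamma> (fst (fst r))) (\<gamma> (fst (snd r))) (snd (fst r)) (snd (snd r)))" for r
 let ?t = "%r. tv g g' (Fa (dyad (fst (fst r)) g (snd (fst r)) \<psi>) (snd (fst r))) (Fa (dyad (fst (snd r)) g' (snd (snd r)) \<psi>') (snd (snd r)))"
 have tm: "?t r \<in> Vec (g\<boxdot>g')" if "r \<in> Jset g \<times> Jset g'" for r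
  using that D(2) D'(2) by (intro tv_mem g) auto
 have ok: "gen_ok \<mu> \<nu> (g\<boxdot>g') X (tv g g' \<psi> \<psi>')" using tv_mem[OF g \<psi>] X by (simp add: gen_ok_def)
 have W: "W r = gen \<mu> \<nu> (g\<boxdot>g') X (?t r)" if r: "r \<in> Jset g \<times> Jset g'" for r
 proof -
  obtain p q where pq: "r = (p, q)" "p \<in> Jset g" "q \<in> Jset g'" using r by blast
  let ?d = "dyad (fst p) g (snd p) \<psi>" and ?d' = "dyad (fst q) g' (snd q) \<psi>'"
  have dh: "?d \<in> Hom C (\<gamma> (fst p)) g" "?d' \<in> Hom C (\<gamma> (fst q)) g'" using pq by (intro dyad_hom; simp)+
  note [simp] = HomD[OF dh(1)] HomD[OF dh(2)] J(2,3)[OF pq(2)] J'(2,3)[OF pq(3)]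
  have dd: "?d \<boxtimes> ?d' \<in> Hom C (\<gamma> (fst p)\<boxdot>\<gamma> (fst q)) (g\<boxdot>g')" by (simp add: in_Hom)
  have e: "Fa (?d \<boxtimes> ?d') (tv (\<gamma> (fst p)) (\<gamma> (fst q)) (snd p) (snd q)) = ?t r"
   unfolding pq(1) fst_conv snd_conv by (rule F_tv[OF dh]) simp_all
  have ok': "gen_ok \<mu> \<nu> (g\<boxdot>g') X (Fa (?d \<boxtimes> ?d') (tv (\<gamma> (fst p)) (\<gamma> (fst q)) (snd p) (snd q)))"
   unfolding e using tm[OF r] ok by (simp add: gen_ok_def)
  have "W r = gen \<mu> \<nu> (\<gamma> (fst p)\<boxdot>\<gamma> (fst q)) (X\<cdot>((?d \<boxtimes> ?d')|>\<mu>)) (tv (\<gamma> (fst p)) (\<gamma> (fst q)) (snd p) (snd q))"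
   unfolding W_def pq(1) fst_conv snd_conv E[OF pq(2,3)] ..
  also have "\<dots> = gen \<mu> \<nu> (g\<boxdot>g') X (Fa (?d \<boxtimes> ?d') (tv (\<gamma> (fst p)) (\<gamma> (fst q)) (snd p) (snd q)))"
   by (rule gen_natural[OF ok' _ dd]) (simp_all add: tv_mem)
  finally show ?thesis unfolding e .
 qed
 have Wh: "W r \<in> cr_hom \<mu> \<nu>" if "r \<in> Jset g \<times> Jset g'" for r
  unfolding W[OF that] by (rule gen_hom) (use tm[OF that] ok in "simp add: gen_ok_def")
 have "finsum (cr_space \<mu> \<nu>) Z (A \<times> B) = finsum (cr_space \<mu> \<nu>) W (A \<times> B)"
 proof (rule cr.M.finsum_cong')
  show "W \<in> A \<times> B \<rightarrow> carrier (cr_space \<mu> \<nu>)"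
   unfolding cr_space_simps by (intro Pi_I Wh) (use AB in blast)
  show "Z i = W i" if "i \<in> A \<times> B" for i using that Z by (auto simp: W_def)
 qed simp
 also have "\<dots> = finsum (cr_space \<mu> \<nu>) W (Jset g \<times> Jset g')"
 proof (rule cr.finsum_subset)
  show "finite (Jset g \<times> Jset g')" using J(1) J'(1) by simp
  show "A \<times> B \<subseteq> Jset g \<times> Jset g'" using AB by blast
  show "W \<in> Jset g \<times> Jset g' \<rightarrow> carrier (cr_space \<mu> \<nu>)" using Wh by (simp add: Pi_iff)
  fix r assume r: "r \<in> Jset g \<times> Jset g' - A \<times> B"
  then obtain p q where pq: "r = (p, q)" "p \<in> Jset g" "q \<in> Jset g'" "p \<notin> A \<or> q \<notin> B" by blast
  note [simp] = J(2,3)[OF pq(2)] J'(2,3)[OF pq(3)]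
  show "W r = \<zero>\<^bsub>cr_space \<mu> \<nu>\<^esub>"
   unfolding W_def pq(1) fst_conv snd_conv E0[OF pq(2,3,4)] cr_space_simps
   by (rule gen_zero_arrow) (simp add: gen_ok_def tv_mem)
 qed
 also have "\<dots> = finsum (cr_space \<mu> \<nu>) (%r. gen \<mu> \<nu> (g\<boxdot>g') X (?t r)) (Jset g \<times> Jset g')"
  by (rule cr.M.finsum_cong') (use W Wh in "auto simp: Pi_iff")
 also have "\<dots> = gen \<mu> \<nu> (g\<boxdot>g') X (finsum (Sp (g\<boxdot>g')) ?t (Jset g \<times> Jset g'))"
  by (rule gen_finsum_vec[OF ok]) (use tm J(1) J'(1) in auto)
 also have "finsum (Sp (g\<boxdot>g')) ?t (Jset g \<times> Jset g') = tv g g' \<psi> \<psi>'"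
  using tv_finsum[OF g J(1) _ J'(1), of "%p. Fa (dyad (fst p) g (snd p) \<psi>) (snd p)"
    "%q. Fa (dyad (fst q) g' (snd q) \<psi>') (snd q)"] D D' by (simp add: Pi_iff)
 finally show ?thesis .
qed

theorem cr_cmp_gen:
 assumes x: "gen_ok \<sigma> \<delta> g T \<psi>" and y: "gen_ok \<rho> \<sigma> g' T' \<psi>'"
 shows "cr_cmp (gen \<sigma> \<delta> g T \<psi>) (gen \<rho> \<sigma> g' T' \<psi>') =
   gen \<rho> \<delta> (g\<boxdot>g') (T\<cdot>(g<|T')) (tv g g' \<psi> \<psi>')"
  and "gen_ok \<rho> \<delta> (g\<boxdot>g') (T\<cdot>(g<|T')) (tv g g' \<psi> \<psi>')"
proof -
 note [simp] = gen_okD[OF x] gen_okD[OF y]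
 have gS: "g \<in> S" "g' \<in> S" by simp_all
 show "gen_ok \<rho> \<delta> (g\<boxdot>g') (T\<cdot>(g<|T')) (tv g g' \<psi> \<psi>')"
  by (simp add: gen_ok_def tv_mem)
 let ?x = "gen \<sigma> \<delta> g T \<psi>" and ?y = "gen \<rho> \<sigma> g' T' \<psi>'"
 let ?E = "%p q. (T\<cdot>(dyad (fst p) g (snd p) \<psi>|>\<sigma>)) \<cdot>
   ((\<gamma> (fst p))<|(T'\<cdot>(dyad (fst q) g' (snd q) \<psi>'|>\<rho>)))"
 note J = Jset[OF gS(1)] and J' = Jset[OF gS(2)]
 show "cr_cmp ?x ?y = gen \<rho> \<delta> (g\<boxdot>g') (T\<cdot>(g<|T')) (tv g g' \<psi> \<psi>')"
  unfolding cr_cmp_def src_gen trg_gen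
 proof (rule gen_double_sum[where E = ?E])
  show "terms ?x \<subseteq> Jset g" "terms ?y \<subseteq> Jset g'" by (rule terms_gen[OF x], rule terms_gen[OF y])
 next
  fix p q assume p: "p \<in> Jset g" and q: "q \<in> Jset g'"
  let ?d = "dyad (fst p) g (snd p) \<psi>" and ?d' = "dyad (fst q) g' (snd q) \<psi>'"
  have dh: "?d \<in> Hom C (\<gamma> (fst p)) g" "?d' \<in> Hom C (\<gamma> (fst q)) g'"
   using J(2,3)[OF p] J'(2,3)[OF q] by (intro dyad_hom; simp)+
  note [simp] = HomD[OF dh(1)] HomD[OF dh(2)] J(2,3)[OF p] J'(2,3)[OF q]
  have "(?d|>\<sigma>)\<cdot>((\<gamma> (fst p))<|(T'\<cdot>(?d'|>\<rho>))) =
    (g<|T')\<cdot>(?d \<boxtimes> (?d'|>\<rho>))" by (simp add: interch)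
  then show "?E p q = (T\<cdot>(g<|T'))\<cdot>((?d \<boxtimes> ?d')|>\<rho>)" by simp
  assume "p \<notin> terms ?x \<or> q \<notin> terms ?y"
  then show "?E p q = hzero C ((\<gamma> (fst p)\<boxdot>\<gamma> (fst q))\<boxdot>\<rho>) \<delta>"
  proof
   assume "p \<notin> terms ?x"
   then have 0: "T\<cdot>(?d|>\<sigma>) = hzero C (\<gamma> (fst p)\<boxdot>\<sigma>) \<delta>" using terms_gen(2)[OF x, of p] p by simp
   show ?thesis unfolding 0 by simp
  next
   assume "q \<notin> terms ?y"
   then have 0: "T'\<cdot>(?d'|>\<rho>) = hzero C (\<gamma> (fst q)\<boxdot>\<rho>) \<sigma>" using terms_gen(2)[OF y, of q] q by simp
   show ?thesis unfolding 0 by simp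
  qed
 next
  fix p q assume "p \<in> terms ?x" "q \<in> terms ?y"
  then have p: "p \<in> Jset g" and q: "q \<in> Jset g'" using terms_gen(1)[OF x] terms_gen(1)[OF y] by auto
  let ?d = "dyad (fst p) g (snd p) \<psi>" and ?d' = "dyad (fst q) g' (snd q) \<psi>'"
  have dh: "?d \<in> Hom C (\<gamma> (fst p)) g" "?d' \<in> Hom C (\<gamma> (fst q)) g'"
   using J(2,3)[OF p] J'(2,3)[OF q] by (intro dyad_hom; simp)+
  note [simp] = HomD[OF dh(1)] HomD[OF dh(2)] J(2,3)[OF p] J'(2,3)[OF q]
  have "elem_cmp \<rho> \<delta> (fst p) (T\<cdot>(?d|>\<sigma>)) (snd p) (fst q) (T'\<cdot>(?d'|>\<rho>)) (snd q) =
    gen \<rho> \<delta> (\<gamma> (fst p)\<boxdot>\<gamma> (fst q)) (?E p q) (tv (\<gamma> (fst p)) (\<gamma> (fst q)) (snd p) (snd q))"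
   unfolding elem_cmp_def vec_tensor_def
  proof (rule gen_basis_sum)
   fix m v assume mv: "m \<in> Ghat" "v \<in> V (fst p) (fst q) m"
   note [simp] = mv(1) HomD[OF V_hom[OF J(2)[OF p] J'(2)[OF q] mv]]
   show "(T\<cdot>(?d|>\<sigma>))\<cdot>(((\<gamma> (fst p))<|(T'\<cdot>(?d'|>\<rho>)))\<cdot>(v|>\<rho>)) =
     ?E p q\<cdot>(v|>\<rho>)" by simp
  qed (simp_all add: tv_mem)
  then show "(case (p, q) of (pa, q) => (case pa of (k, b) => %(l, c).
     elem_cmp \<rho> \<delta> k (val ?x k b) b l (val ?y l c) c) q) =
    gen \<rho> \<delta> (\<gamma> (fst p)\<boxdot>\<gamma> (fst q)) (?E p q) (tv (\<gamma> (fst p)) (\<gamma> (fst q)) (snd p) (snd q))"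
   by (simp only: split_beta prod.case fst_conv snd_conv val_gen J(2,3)[OF p] J'(2,3)[OF q])
 qed simp_all
qed

theorem cr_tar_gen:
 assumes x: "gen_ok \<rho> \<sigma> g T \<psi>" and y: "gen_ok \<rho>' \<sigma>' g' T' \<psi>'"
 shows "cr_tar (gen \<rho> \<sigma> g T \<psi>) (gen \<rho>' \<sigma>' g' T' \<psi>') =
   gen (\<rho>\<boxdot>\<rho>') (\<sigma>\<boxdot>\<sigma>') (g\<boxdot>g') ((T \<boxtimes> T')\<cdot>(g<|(braid C g' \<rho>|>\<rho>'))) (tv g g' \<psi> \<psi>')"
  and "gen_ok (\<rho>\<boxdot>\<rho>') (\<sigma>\<boxdot>\<sigma>') (g\<boxdot>g') ((T \<boxtimes> T')\<cdot>(g<|(braid C g' \<rho>|>\<rho>'))) (tv g g' \<psi> \<psi>')"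
proof -
 note [simp] = gen_okD[OF x] gen_okD[OF y]
 have gS: "g \<in> S" "g' \<in> S" by simp_all
 let ?X = "(T \<boxtimes> T')\<cdot>(g<|(braid C g' \<rho>|>\<rho>'))"
 show "gen_ok (\<rho>\<boxdot>\<rho>') (\<sigma>\<boxdot>\<sigma>') (g\<boxdot>g') ?X (tv g g' \<psi> \<psi>')"
  by (simp add: gen_ok_def tv_mem)
 let ?x = "gen \<rho> \<sigma> g T \<psi>" and ?y = "gen \<rho>' \<sigma>' g' T' \<psi>'"
 let ?E = "%p q. ((T\<cdot>(dyad (fst p) g (snd p) \<psi>|>\<rho>)) \<boxtimes> (T'\<cdot>(dyad (fst q) g' (snd q) \<psi>'|>\<rho>'))) \<cdot>
   ((\<gamma> (fst p))<|(braid C (\<gamma> (fst q)) \<rho>|>\<rho>'))"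
 note J = Jset[OF gS(1)] and J' = Jset[OF gS(2)]
 show "cr_tar ?x ?y = gen (\<rho>\<boxdot>\<rho>') (\<sigma>\<boxdot>\<sigma>') (g\<boxdot>g') ?X (tv g g' \<psi> \<psi>')"
  unfolding cr_tar_def src_gen trg_gen
 proof (rule gen_double_sum[where E = ?E])
  show "terms ?x \<subseteq> Jset g" "terms ?y \<subseteq> Jset g'" by (rule terms_gen[OF x], rule terms_gen[OF y])
 next
  fix p q assume p: "p \<in> Jset g" and q: "q \<in> Jset g'"
  let ?d = "dyad (fst p) g (snd p) \<psi>" and ?d' = "dyad (fst q) g' (snd q) \<psi>'"
  have dh: "?d \<in> Hom C (\<gamma> (fst p)) g" "?d' \<in> Hom C (\<gamma> (fst q)) g'"
   using J(2,3)[OF p] J'(2,3)[OF q] by (intro dyad_hom; simp)+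
  note [simp] = HomD[OF dh(1)] HomD[OF dh(2)] J(2,3)[OF p] J'(2,3)[OF q]
  have b: "(\<rho><|?d')\<cdot>braid C (\<gamma> (fst q)) \<rho> = braid C g' \<rho>\<cdot>(?d'|>\<rho>)"
   by (rule braid_nat[symmetric]) simp_all
  let ?z = "(\<gamma> (fst p))<|(braid C (\<gamma> (fst q)) \<rho>|>\<rho>')"
  have e: "(T \<boxtimes> T')\<cdot>((?d|>\<rho>) \<boxtimes> (?d'|>\<rho>')) = (T\<cdot>(?d|>\<rho>)) \<boxtimes> (T'\<cdot>(?d'|>\<rho>'))"
   by (rule interch) simp_all
  have "?E p q = ((T \<boxtimes> T')\<cdot>((?d|>\<rho>) \<boxtimes> (?d'|>\<rho>')))\<cdot>?z" unfolding e ..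
  also have "\<dots> = (T \<boxtimes> T')\<cdot>((?d \<boxtimes> ((\<rho><|?d')|>\<rho>'))\<cdot>?z)" by simp
  also have "(?d \<boxtimes> ((\<rho><|?d')|>\<rho>'))\<cdot>((\<gamma> (fst p))<|(braid C (\<gamma> (fst q)) \<rho>|>\<rho>')) =
    ?d \<boxtimes> (((\<rho><|?d')\<cdot>braid C (\<gamma> (fst q)) \<rho>)|>\<rho>')"
   using interch[of ?d "idn C (\<gamma> (fst p))" "(\<rho><|?d')|>\<rho>'" "braid C (\<gamma> (fst q)) \<rho>|>\<rho>'"]
    interch[of "\<rho><|?d'" "braid C (\<gamma> (fst q)) \<rho>" "idn C \<rho>'" "idn C \<rho>'"] by simp
  also have "\<dots> = (g<|(braid C g' \<rho>|>\<rho>'))\<cdot>(?d \<boxtimes> (?d'|>(\<rho>\<boxdot>\<rho>')))"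
   unfolding b
   using interch[of "idn C g" ?d "braid C g' \<rho>|>\<rho>'" "(?d'|>\<rho>)|>\<rho>'"]
    interch[of "braid C g' \<rho>" "?d'|>\<rho>" "idn C \<rho>'" "idn C \<rho>'"] by simp
  finally show "?E p q = ?X\<cdot>((?d \<boxtimes> ?d')|>(\<rho>\<boxdot>\<rho>'))" by simp
  assume "p \<notin> terms ?x \<or> q \<notin> terms ?y"
  then show "?E p q = hzero C ((\<gamma> (fst p)\<boxdot>\<gamma> (fst q))\<boxdot>(\<rho>\<boxdot>\<rho>')) (\<sigma>\<boxdot>\<sigma>')"
  proof
   assume "p \<notin> terms ?x"
   then have 0: "T\<cdot>(?d|>\<rho>) = hzero C (\<gamma> (fst p)\<boxdot>\<rho>) \<sigma>" using terms_gen(2)[OF x, of p] p by simp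
   show ?thesis unfolding 0 by simp
  next
   assume "q \<notin> terms ?y"
   then have 0: "T'\<cdot>(?d'|>\<rho>') = hzero C (\<gamma> (fst q)\<boxdot>\<rho>') \<sigma>'" using terms_gen(2)[OF y, of q] q by simp
   show ?thesis unfolding 0 by simp
  qed
 next
  fix p q assume "p \<in> terms ?x" "q \<in> terms ?y"
  then have p: "p \<in> Jset g" and q: "q \<in> Jset g'" using terms_gen(1)[OF x] terms_gen(1)[OF y] by auto
  let ?d = "dyad (fst p) g (snd p) \<psi>" and ?d' = "dyad (fst q) g' (snd q) \<psi>'"
  have dh: "?d \<in> Hom C (\<gamma> (fst p)) g" "?d' \<in> Hom C (\<gamma> (fst q)) g'"
   using J(2,3)[OF p] J'(2,3)[OF q] by (intro dyad_hom; simp)+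
  note [simp] = HomD[OF dh(1)] HomD[OF dh(2)] J(2,3)[OF p] J'(2,3)[OF q]
  have "elem_tar \<rho> \<sigma> \<rho>' \<sigma>' (fst p) (T\<cdot>(?d|>\<rho>)) (snd p) (fst q) (T'\<cdot>(?d'|>\<rho>')) (snd q) =
    gen (\<rho>\<boxdot>\<rho>') (\<sigma>\<boxdot>\<sigma>') (\<gamma> (fst p)\<boxdot>\<gamma> (fst q)) (?E p q) (tv (\<gamma> (fst p)) (\<gamma> (fst q)) (snd p) (snd q))"
   unfolding elem_tar_def vec_tensor_def
  proof (rule gen_basis_sum)
   fix m v assume mv: "m \<in> Ghat" "v \<in> V (fst p) (fst q) m"
   note [simp] = mv(1) HomD[OF V_hom[OF J(2)[OF p] J'(2)[OF q] mv]]
   show "((T\<cdot>(?d|>\<rho>)) \<boxtimes> (T'\<cdot>(?d'|>\<rho>'))) \<cdot>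
     (((\<gamma> (fst p))<|(braid C (\<gamma> (fst q)) \<rho>|>\<rho>'))\<cdot>(v|>(\<rho>\<boxdot>\<rho>'))) =
     ?E p q\<cdot>(v|>(\<rho>\<boxdot>\<rho>'))" by simp
  qed (simp_all add: tv_mem)
  then show "(case (p, q) of (pa, q) => (case pa of (k, b) => %(l, c).
     elem_tar \<rho> \<sigma> \<rho>' \<sigma>' k (val ?x k b) b l (val ?y l c) c) q) =
    gen (\<rho>\<boxdot>\<rho>') (\<sigma>\<boxdot>\<sigma>') (\<gamma> (fst p)\<boxdot>\<gamma> (fst q)) (?E p q) (tv (\<gamma> (fst p)) (\<gamma> (fst q)) (snd p) (snd q))"
   by (simp only: split_beta prod.case fst_conv snd_conv val_gen J(2,3)[OF p] J'(2,3)[OF q])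
 qed simp_all
qed

subsection \<open>The conjugate vector and the star operation\<close>

definition cvec :: "'o => 'o => 'm => 'v => 'v" where
 "cvec g gb rb \<psi> = (THE \<xi>. \<xi> \<in> Vec gb \<and>
   (\<forall>a\<in>Vec gb. ip (Sp gb) a \<xi> = ip (Sp (g\<boxdot>gb)) (tv g gb \<psi> a) (Fa rb \<Omega>)))"

lemma conj_vec_eq: "conj_vec k \<psi> = cvec (\<gamma> k) (\<gamma> (conj_class C k)) (Rb k) \<psi>"
 by (simp add: conj_vec_def cvec_def H_Sp vec_tensor_def)

context
 fixes g gb r rb
 assumes g[simp]: "g \<in> S" and sol: "conjugate_solution C g gb r rb"
begin

lemma gb[simp]: "gb \<in> S"
 using sub.conj_mem[OF g sol] .

lemma sol_hom: "r \<in> Hom C (unt C) (gb\<boxdot>g)" "rb \<in> Hom C (unt C) (g\<boxdot>gb)"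
 using conjugateD[OF sol] by (simp_all add: in_Hom)

lemma Fr_mem[simp]: "Fa r \<Omega> \<in> Vec (gb\<boxdot>g)" "Fa rb \<Omega> \<in> Vec (g\<boxdot>gb)"
 using F_mem[OF sol_hom(1)] F_mem[OF sol_hom(2)] \<Omega>_mem by simp_all

lemma cvec_exists:
 assumes \<psi>: "\<psi> \<in> Vec g"
 shows "\<exists>!\<xi>. \<xi> \<in> Vec gb \<and> (\<forall>a\<in>Vec gb. ip (Sp (g\<boxdot>gb)) (tv g gb \<psi> a) (Fa rb \<Omega>) = ip (Sp gb) a \<xi>)"
proof -
 interpret gb: fd_hilbert "Sp gb" by (simp add: hilb)
 interpret ggb: fd_hilbert "Sp (g\<boxdot>gb)" by (simp add: hilb)
 show ?thesis
  by (rule gb.riesz) (use \<psi> in "simp_all add: tv_add_right tv_scale_right tv_mem ggb.ip_add_l ggb.ip_scale_l")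
qed

lemma cvec:
 assumes \<psi>: "\<psi> \<in> Vec g"
 shows "cvec g gb rb \<psi> \<in> Vec gb"
  and "a \<in> Vec gb ==> ip (Sp gb) a (cvec g gb rb \<psi>) = ip (Sp (g\<boxdot>gb)) (tv g gb \<psi> a) (Fa rb \<Omega>)"
proof -
 have "cvec g gb rb \<psi> = (THE \<xi>. \<xi> \<in> Vec gb \<and>
   (\<forall>a\<in>Vec gb. ip (Sp (g\<boxdot>gb)) (tv g gb \<psi> a) (Fa rb \<Omega>) = ip (Sp gb) a \<xi>))"
  unfolding cvec_def by (rule arg_cong[where f = The]) (auto simp: fun_eq_iff)
 with theI'[OF cvec_exists[OF \<psi>]] show "cvec g gb rb \<psi> \<in> Vec gb"
  "a \<in> Vec gb ==> ip (Sp gb) a (cvec g gb rb \<psi>) = ip (Sp (g\<boxdot>gb)) (tv g gb \<psi> a) (Fa rb \<Omega>)"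
  by auto
qed

lemma cvec_eqI:
 assumes "\<psi> \<in> Vec g" "\<xi> \<in> Vec gb"
  "!!a. a \<in> Vec gb ==> ip (Sp gb) a \<xi> = ip (Sp (g\<boxdot>gb)) (tv g gb \<psi> a) (Fa rb \<Omega>)"
 shows "cvec g gb rb \<psi> = \<xi>"
proof -
 interpret gb: fd_hilbert "Sp gb" by (simp add: hilb)
 show ?thesis by (rule gb.ip_eqI) (use assms cvec in auto)
qed

lemma cvec_add:
 assumes "\<psi> \<in> Vec g" "\<psi>' \<in> Vec g"
 shows "cvec g gb rb (\<psi> \<oplus>\<^bsub>Sp g\<^esub> \<psi>') = cvec g gb rb \<psi> \<oplus>\<^bsub>Sp gb\<^esub> cvec g gb rb \<psi>'"
proof -
 interpret g: fd_hilbert "Sp g" by (simp add: hilb)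
 interpret gb: fd_hilbert "Sp gb" by (simp add: hilb)
 interpret ggb: fd_hilbert "Sp (g\<boxdot>gb)" by (simp add: hilb)
 show ?thesis
  by (rule cvec_eqI) (use assms cvec in "simp_all add: gb.ip_add tv_add_left tv_mem ggb.ip_add_l")
qed

lemma cvec_finsum:
 assumes "finite A" "f \<in> A \<rightarrow> Vec g"
 shows "cvec g gb rb (finsum (Sp g) f A) = finsum (Sp gb) (%i. cvec g gb rb (f i)) A"
proof -
 interpret g: fd_hilbert "Sp g" by (simp add: hilb)
 interpret gb: fd_hilbert "Sp gb" by (simp add: hilb)
 interpret ggb: fd_hilbert "Sp (g\<boxdot>gb)" by (simp add: hilb)
 from assms show ?thesis
 proof induct
  case empty
  have "tv g gb \<zero>\<^bsub>Sp g\<^esub> a = \<zero>\<^bsub>Sp (g\<boxdot>gb)\<^esub>" if "a \<in> Vec gb" for a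
   using tv_scale_left[of g gb "\<zero>\<^bsub>Sp g\<^esub>" a 0] that tv_mem[of g gb "\<zero>\<^bsub>Sp g\<^esub>" a] by simp
  then show ?case by (simp, intro cvec_eqI) simp_all
 next
  case (insert i A)
  then have c: "f i \<in> Vec g" "f \<in> A \<rightarrow> Vec g" by auto
  then show ?case
   using insert cvec_add[of "f i" "finsum (Sp g) f A"] cvec(1) g.M.finsum_closed[of f A]
   by (simp add: Pi_iff)
 qed
qed

text \<open>By the conjugate equations the conjugate vector also represents the pairing with \<open>F(r)\<Omega>\<close>.\<close>

lemma cvec_dual:
 assumes \<psi>: "\<psi> \<in> Vec g" and \<phi>: "\<phi> \<in> Vec g"
 shows "ip (Sp (gb\<boxdot>g)) (Fa r \<Omega>) (tv gb g (cvec g gb rb \<psi>) \<phi>) = ip (Sp g) \<psi> \<phi>"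
proof -
 interpret g: fd_hilbert "Sp g" by (simp add: hilb)
 interpret gb: fd_hilbert "Sp gb" by (simp add: hilb)
 interpret u: fd_hilbert "Sp (unt C)" by (simp add: hilb)
 interpret gbg: fd_hilbert "Sp (gb\<boxdot>g)" by (simp add: hilb)
 note s = conjugateD[OF sol]
 note [simp] = s(1-8)
 have rbd: "rb\<dagger> \<in> Hom C (g\<boxdot>gb) (unt C)" by (simp add: in_Hom)
 have idg: "idn C g \<in> Hom C g g" by (simp add: in_Hom)
 have m1: "rb\<dagger>|>g \<in> Hom C (g\<boxdot>(gb\<boxdot>g)) g" by (simp add: in_Hom)
 have m2: "g<|r \<in> Hom C g (g\<boxdot>(gb\<boxdot>g))" by (simp add: in_Hom)
 have key: "ip (Sp (gb\<boxdot>g)) t (tv gb g (cvec g gb rb \<psi>) \<phi>) = ip (Sp g) (Fa (rb\<dagger>|>g) (tv g (gb\<boxdot>g) \<psi> t)) \<phi>"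
  if t: "t \<in> Vec (gb\<boxdot>g)" for t
  using gb g t
 proof (induct rule: tv_induct)
  case (tv a b)
  let ?c = "ip (Sp (unt C)) \<Omega> (Fa (rb\<dagger>) (tv g gb \<psi> a))"
  have ta: "tv g gb \<psi> a \<in> Vec (g\<boxdot>gb)" using \<psi> tv by (simp add: tv_mem)
  have Fm: "Fa (rb\<dagger>) (tv g gb \<psi> a) \<in> Vec (unt C)" by (rule F_mem[OF rbd]) (use ta in simp_all)
  have "ip (Sp (g\<boxdot>gb)) (Fa rb \<Omega>) (tv g gb \<psi> a) = ?c"
   by (rule F_adjoint[OF sol_hom(2)]) (use ta \<Omega>_mem in simp_all)
  then have c: "cnj ?c = ip (Sp gb) a (cvec g gb rb \<psi>)"
   using cvec(2)[OF \<psi> tv(1)] fd_hilbert.ip_cnj[OF hilb Fr_mem(2) ta] by simp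
  have "Fa (rb\<dagger>|>g) (tv g (gb\<boxdot>g) \<psi> (tv gb g a b)) = Fa (rb\<dagger>|>g) (tv (g\<boxdot>gb) g (tv g gb \<psi> a) b)"
   using tv_assoc[of g gb g \<psi> a b] \<psi> tv by simp
  also have "\<dots> = tv (unt C) g (Fa (rb\<dagger>) (tv g gb \<psi> a)) (Fa (idn C g) b)"
   by (rule F_tv[OF rbd idg]) (use ta tv in simp_all)
  also have "\<dots> = tv (unt C) g (?c \<odot>\<^bsub>Sp (unt C)\<^esub> \<Omega>) b"
   using \<Omega>_span[OF Fm] tv by (simp add: F.Fa_idn)
  also have "\<dots> = ?c \<odot>\<^bsub>Sp g\<^esub> b"
   using tv_scale_left[of "unt C" g \<Omega> b ?c] \<Omega>_mem tv tv_unt(1)[of g b] by simp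
  finally have "ip (Sp g) (Fa (rb\<dagger>|>g) (tv g (gb\<boxdot>g) \<psi> (tv gb g a b))) \<phi> = cnj ?c * ip (Sp g) b \<phi>"
   using tv \<phi> by (simp add: g.ip_scale_l)
  then show ?case using tv \<phi> cvec(1)[OF \<psi>] c by (simp add: tv_ip)
 next
  case (add t t')
  have "tv g (gb\<boxdot>g) \<psi> t \<in> Vec (g\<boxdot>(gb\<boxdot>g))" "tv g (gb\<boxdot>g) \<psi> t' \<in> Vec (g\<boxdot>(gb\<boxdot>g))"
   using add \<psi> by (simp_all add: tv_mem)
  then show ?case
   using add \<psi> \<phi> cvec(1)[OF \<psi>] F_mem[OF m1]
   by (simp add: gbg.ip_add_l tv_mem tv_add_right F_add[OF m1] g.ip_add_l)
 next
  case (smult c t)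
  have "tv g (gb\<boxdot>g) \<psi> t \<in> Vec (g\<boxdot>(gb\<boxdot>g))"
   using smult \<psi> by (simp_all add: tv_mem)
  then show ?case
   using smult \<psi> \<phi> cvec(1)[OF \<psi>] F_mem[OF m1]
   by (simp add: gbg.ip_scale_l tv_mem tv_scale_right F_scale[OF m1] g.ip_scale_l)
 qed
 have "tv g (gb\<boxdot>g) \<psi> (Fa r \<Omega>) = Fa (g<|r) (tv g (unt C) \<psi> \<Omega>)"
  using F_tv[OF idg sol_hom(1), of \<psi> \<Omega>] \<psi> \<Omega>_mem by (simp add: F.Fa_idn)
 then have "tv g (gb\<boxdot>g) \<psi> (Fa r \<Omega>) = Fa (g<|r) \<psi>" using \<psi> tv_unt(2)[of g \<psi>] by simp
 then have "Fa (rb\<dagger>|>g) (tv g (gb\<boxdot>g) \<psi> (Fa r \<Omega>)) = Fa ((rb\<dagger>|>g)\<cdot>(g<|r)) \<psi>"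
  using F.Fa_cmp[OF _ _ _ m1 m2, of \<psi>] \<psi> by simp
 also have "\<dots> = \<psi>" using \<psi> by (simp only: s(9)) (simp add: F.Fa_idn)
 finally show ?thesis using key[OF Fr_mem(1)] by simp
qed

end

definition gstar :: "'o => 'o => 'o => 'o => 'm => 'm => 'm => 'v => ('o, 'o set => 'v => 'm) arrow" where
 "gstar \<rho> \<sigma> g gb r rb T \<psi> = gen \<sigma> \<rho> gb ((r\<dagger>|>\<rho>)\<cdot>(gb<|T\<dagger>)) (cvec g gb rb \<psi>)"

lemma gstar_ok:
 assumes ok: "gen_ok \<rho> \<sigma> g T \<psi>" and s: "conjugate_solution C g gb r rb"
 shows "gen_ok \<sigma> \<rho> gb ((r\<dagger>|>\<rho>)\<cdot>(gb<|T\<dagger>)) (cvec g gb rb \<psi>)"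
proof -
 note [simp] = gen_okD[OF ok] conjugateD(1-8)[OF s]
 have "gb \<in> S" by (rule gb[OF _ s]) simp
 then show ?thesis using cvec(1)[OF _ s, of \<psi>] by (simp add: gen_ok_def)
qed

text \<open>The star of a tensor does not depend on the object over which it is written, nor on the
 solution of the conjugate equations: an arrow \<open>w: g1 \<rightarrow> g2\<close> has a transpose \<open>u\<close> between the conjugate
 objects, along which both components of the star are transported.\<close>

lemma gstar_natural:
 assumes ok: "gen_ok \<rho> \<sigma> g2 T (Fa w \<psi>)" and g1[simp]: "g1 \<in> S" and w: "w \<in> Hom C g1 g2"
  and \<psi>[simp]: "\<psi> \<in> Vec g1"
  and s1: "conjugate_solution C g1 gb1 r1 rb1" and s2: "conjugate_solution C g2 gb2 r2 rb2"
 shows "gstar \<rho> \<sigma> g1 gb1 r1 rb1 (T\<cdot>(w|>\<rho>)) \<psi> = gstar \<rho> \<sigma> g2 gb2 r2 rb2 T (Fa w \<psi>)"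
proof -
 note [simp] = gen_okD[OF ok] conjugateD(1-8)[OF s1] conjugateD(1-8)[OF s2] HomD[OF w]
 have g2[simp]: "g2 \<in> S" by simp
 have gbS[simp]: "gb1 \<in> S" "gb2 \<in> S" using gb[OF g1 s1] gb[OF g2 s2] by simp_all
 define y where "y = (w\<dagger>|>gb2)\<cdot>rb2"
 have [simp]: "y \<in> Arr C" "Dom C y = unt C" "Cod C y = g1\<boxdot>gb2" by (simp_all add: y_def)
 define u where "u = (r1\<dagger>|>gb2)\<cdot>(gb1<|y)"
 have [simp]: "u \<in> Arr C" "Dom C u = gb1" "Cod C u = gb2" by (simp_all add: u_def)
 have uh: "u \<in> Hom C gb1 gb2" by (simp add: in_Hom)
 have b: "(g1<|u)\<cdot>rb1 = y"
  unfolding u_def by (rule frobenius_right[OF conjugate_solution_sym[OF s1]]) simp_all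
 have a: "r2\<dagger>\<cdot>(u|>g2) = r1\<dagger>\<cdot>(gb1<|w\<dagger>)"
 proof -
  have 1: "r2\<dagger>\<cdot>(r1\<dagger>|>(gb2\<boxdot>g2)) = r1\<dagger>\<cdot>((gb1\<boxdot>g1)<|r2\<dagger>)"
   using slide[of "r1\<dagger>" "r2\<dagger>" "gb1\<boxdot>g1" "unt C" "gb2\<boxdot>g2" "unt C"] by simp
  have 2: "(g1<|r2\<dagger>)\<cdot>(w\<dagger>|>(gb2\<boxdot>g2)) = w\<dagger>\<cdot>(g2<|r2\<dagger>)"
   using slide[of "w\<dagger>" "r2\<dagger>" g2 g1 "gb2\<boxdot>g2" "unt C"] by simp
  have 3: "(g1<|r2\<dagger>)\<cdot>(y|>g2) = w\<dagger>"
  proof -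
   have "(g1<|r2\<dagger>)\<cdot>(y|>g2) = ((g1<|r2\<dagger>)\<cdot>(w\<dagger>|>(gb2\<boxdot>g2)))\<cdot>(rb2|>g2)"
    by (simp add: y_def whisker_cmp)
   also have "\<dots> = w\<dagger>\<cdot>((g2<|r2\<dagger>)\<cdot>(rb2|>g2))" unfolding 2 by simp
   also have "\<dots> = w\<dagger>" unfolding conjugateD(11)[OF s2] by simp
   finally show ?thesis .
  qed
  have "r2\<dagger>\<cdot>(u|>g2) = (r2\<dagger>\<cdot>(r1\<dagger>|>(gb2\<boxdot>g2)))\<cdot>(gb1<|(y|>g2))"
   by (simp add: u_def whisker_cmp)
  also have "\<dots> = r1\<dagger>\<cdot>(gb1<|((g1<|r2\<dagger>)\<cdot>(y|>g2)))"
   unfolding 1 by (simp add: whisker_cmp)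
  finally show ?thesis unfolding 3 .
 qed
 have c: "Fa u (cvec g1 gb1 rb1 \<psi>) = cvec g2 gb2 rb2 (Fa w \<psi>)"
 proof (rule cvec_eqI[OF g2 s2, symmetric])
  show Fw: "Fa w \<psi> \<in> Vec g2" by simp
  show "Fa u (cvec g1 gb1 rb1 \<psi>) \<in> Vec gb2" by (rule F_mem[OF uh]) (simp_all add: cvec(1)[OF g1 s1])
  fix a assume a: "a \<in> Vec gb2"
  have ud: "u\<dagger> \<in> Hom C gb2 gb1" by (simp add: in_Hom)
  have Fa': "Fa (u\<dagger>) a \<in> Vec gb1" by (rule F_mem[OF ud]) (simp_all add: a)
  have i1: "idn C g1 \<in> Hom C g1 g1" and i2: "idn C gb2 \<in> Hom C gb2 gb2" by (simp_all add: in_Hom)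
  have h1: "g1<|u\<dagger> \<in> Hom C (g1\<boxdot>gb2) (g1\<boxdot>gb1)" "g1<|u \<in> Hom C (g1\<boxdot>gb1) (g1\<boxdot>gb2)"
   "w|>gb2 \<in> Hom C (g1\<boxdot>gb2) (g2\<boxdot>gb2)" "w\<dagger>|>gb2 \<in> Hom C (g2\<boxdot>gb2) (g1\<boxdot>gb2)" by (simp_all add: in_Hom)
  have ta: "tv g1 gb2 \<psi> a \<in> Vec (g1\<boxdot>gb2)" using a by (simp add: tv_mem)
  have "ip (Sp gb2) a (Fa u (cvec g1 gb1 rb1 \<psi>)) = ip (Sp gb1) (Fa (u\<dagger>) a) (cvec g1 gb1 rb1 \<psi>)"
   using F_adjoint[OF ud _ _ a cvec(1)[OF g1 s1 \<psi>]] by simp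
  also have "\<dots> = ip (Sp (g1\<boxdot>gb1)) (tv g1 gb1 \<psi> (Fa (u\<dagger>) a)) (Fa rb1 \<Omega>)"
   by (rule cvec(2)[OF g1 s1 \<psi> Fa'])
  also have "tv g1 gb1 \<psi> (Fa (u\<dagger>) a) = Fa (g1<|u\<dagger>) (tv g1 gb2 \<psi> a)"
   using F_tv[OF i1 ud, of \<psi> a] a by (simp add: F.Fa_idn)
  also have "ip (Sp (g1\<boxdot>gb1)) (Fa (g1<|u\<dagger>) (tv g1 gb2 \<psi> a)) (Fa rb1 \<Omega>) =
    ip (Sp (g1\<boxdot>gb2)) (tv g1 gb2 \<psi> a) (Fa (g1<|u) (Fa rb1 \<Omega>))"
   using F_adjoint[OF h1(1) _ _ ta Fr_mem(2)[OF g1 s1]] by simp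
  also have "Fa (g1<|u) (Fa rb1 \<Omega>) = Fa y \<Omega>"
   using F.Fa_cmp[OF _ _ _ h1(2) sol_hom(2)[OF g1 s1], of \<Omega>] \<Omega>_mem by (simp add: b)
  also have "Fa y \<Omega> = Fa (w\<dagger>|>gb2) (Fa rb2 \<Omega>)"
   unfolding y_def by (rule F.Fa_cmp[OF _ _ _ h1(4) sol_hom(2)[OF g2 s2]]) (simp_all add: \<Omega>_mem)
  also have "ip (Sp (g1\<boxdot>gb2)) (tv g1 gb2 \<psi> a) (Fa (w\<dagger>|>gb2) (Fa rb2 \<Omega>)) =
    ip (Sp (g2\<boxdot>gb2)) (Fa (w|>gb2) (tv g1 gb2 \<psi> a)) (Fa rb2 \<Omega>)"
   using F_adjoint[OF h1(3) _ _ ta Fr_mem(2)[OF g2 s2]] by simp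
  also have "Fa (w|>gb2) (tv g1 gb2 \<psi> a) = tv g2 gb2 (Fa w \<psi>) a"
   using F_tv[OF w i2, of \<psi> a] a by (simp add: F.Fa_idn)
  finally show "ip (Sp gb2) a (Fa u (cvec g1 gb1 rb1 \<psi>)) = ip (Sp (g2\<boxdot>gb2)) (tv g2 gb2 (Fa w \<psi>) a) (Fa rb2 \<Omega>)" .
 qed
 define X where "X = (r2\<dagger>|>\<rho>)\<cdot>(gb2<|T\<dagger>)"
 have okX: "gen_ok \<sigma> \<rho> gb2 X (Fa u (cvec g1 gb1 rb1 \<psi>))"
  unfolding X_def c by (rule gstar_ok[OF ok s2])
 have "(u|>(g2\<boxdot>\<rho>))\<cdot>(gb1<|T\<dagger>) = (gb2<|T\<dagger>)\<cdot>(u|>\<sigma>)"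
  by (rule slide) simp_all
 then have "X\<cdot>(u|>\<sigma>) = (r2\<dagger>|>\<rho>)\<cdot>((u|>(g2\<boxdot>\<rho>))\<cdot>(gb1<|T\<dagger>))"
  by (simp add: X_def)
 also have "\<dots> = ((r2\<dagger>\<cdot>(u|>g2))|>\<rho>)\<cdot>(gb1<|T\<dagger>)" by (simp add: whisker_cmp)
 also have "\<dots> = (r1\<dagger>|>\<rho>)\<cdot>(gb1<|(T\<cdot>(w|>\<rho>))\<dagger>)" unfolding a by (simp add: whisker_cmp)
 finally have "gstar \<rho> \<sigma> g1 gb1 r1 rb1 (T\<cdot>(w|>\<rho>)) \<psi> = gen \<sigma> \<rho> gb1 (X\<cdot>(u|>\<sigma>)) (cvec g1 gb1 rb1 \<psi>)"
  by (simp add: gstar_def)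
 also have "\<dots> = gen \<sigma> \<rho> gb2 X (Fa u (cvec g1 gb1 rb1 \<psi>))"
  by (rule gen_natural[OF okX _ uh]) (simp_all add: cvec(1)[OF g1 s1])
 finally show ?thesis unfolding c X_def gstar_def .
qed

text \<open>The class of \<open>\<gamma> k\<close>'s conjugate consists of the conjugates of all members of \<open>k\<close>, because conjugates are
 unique up to isomorphism and can be transported along isomorphisms.\<close>

lemma conj_class:
 assumes k[simp]: "k \<in> Ghat"
 shows "conjugate_solution C (\<gamma> k) (\<gamma> (conj_class C k)) (R k) (Rb k)" "conj_class C k \<in> Ghat"
proof -
 define g where "g = \<gamma> (conj_class C k)"
 show "conjugate_solution C (\<gamma> k) (\<gamma> (conj_class C k)) (R k) (Rb k)"
  using ch.solution[OF k] by (simp add: normalized_solution_def)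
 then have s: "conjugate_solution C (\<gamma> k) g (R k) (Rb k)" unfolding g_def .
 have g: "g \<in> S" "irreducible_obj C g"
  using sub.conj_mem[OF _ s] conjugate_irreducible[OF s Ghat(2)[OF k]] by simp_all
 have "conj_class C k = iso_class C g"
 proof (intro equalityI subsetI)
  fix \<sigma> assume "\<sigma> \<in> conj_class C k"
  then obtain \<rho> r rb where \<rho>: "\<rho> \<in> k" and r: "conjugate_solution C \<rho> \<sigma> r rb" by (auto simp: conj_class_def)
  have "\<rho> \<in> iso_class C (\<gamma> k)" using \<rho> Ghat(3)[OF k] by simp
  then have "isomorphic C \<rho> (\<gamma> k)" using isomorphic_sym by (auto simp: iso_class_def)
  from conjugate_transport[OF conjugate_solution_sym[OF r] this] obtain r' rb' where
   "conjugate_solution C \<sigma> (\<gamma> k) r' rb'" by blast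
  from conjugate_unique[OF s conjugate_solution_sym[OF this]] show "\<sigma> \<in> iso_class C g"
   using conjugateD(2)[OF r] by (simp add: iso_class_def)
 next
  fix \<sigma> assume "\<sigma> \<in> iso_class C g"
  then have "isomorphic C g \<sigma>" by (simp add: iso_class_def)
  from conjugate_transport[OF s this] ch.rep_mem[OF k] show "\<sigma> \<in> conj_class C k"
   unfolding conj_class_def by blast
 qed
 then show "conj_class C k \<in> Ghat" using iso_class_mem_Ghat[OF g] by simp
qed

text \<open>The definition sums over dyads; \<open>gstar_natural\<close> rewrites every summand over \<open>g\<close>, where the vectors add up to \<open>\<psi>\<close>.\<close>

theorem cr_star_gen:
 assumes ok: "gen_ok \<rho> \<sigma> g T \<psi>" and s: "conjugate_solution C g gb r rb"
 shows "cr_star (gen \<rho> \<sigma> g T \<psi>) = gstar \<rho> \<sigma> g gb r rb T \<psi>"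
proof -
 note [simp] = gen_okD[OF ok] conjugateD(1-8)[OF s]
 have gS: "g \<in> S" by simp
 interpret cr: cvs "cr_space \<sigma> \<rho>" by (simp add: cr_cvs)
 note J = Jset[OF gS]
 let ?x = "gen \<rho> \<sigma> g T \<psi>" and ?X = "(r\<dagger>|>\<rho>)\<cdot>(gb<|T\<dagger>)"
 let ?v = "%p. Fa (dyad (fst p) g (snd p) \<psi>) (snd p)"
 have vm: "?v p \<in> Vec g" if "p \<in> Jset g" for p using dyad_sum(2)[OF gS _ that] by simp
 have okv: "gen_ok \<rho> \<sigma> g T (?v p)" if "p \<in> Jset g" for p using vm[OF that] by (simp add: gen_ok_def)
 have okX: "gen_ok \<sigma> \<rho> gb ?X (cvec g gb rb \<psi>)" by (rule gstar_ok[OF ok s])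
 have okk: "gen_ok \<rho> \<sigma> (\<gamma> (fst p)) (T\<cdot>(dyad (fst p) g (snd p) \<psi>|>\<rho>)) (snd p)" if "p \<in> Jset g" for p
  using J(2,3)[OF that] by (simp add: gen_ok_def)
 have gs: "gstar \<rho> \<sigma> (\<gamma> (fst p)) (\<gamma> (conj_class C (fst p))) (R (fst p)) (Rb (fst p)) (T\<cdot>(dyad (fst p) g (snd p) \<psi>|>\<rho>)) (snd p)
   = gen \<sigma> \<rho> gb ?X (cvec g gb rb (?v p))" if p: "p \<in> Jset g" for p
 proof -
  have dh: "dyad (fst p) g (snd p) \<psi> \<in> Hom C (\<gamma> (fst p)) g" using J(2,3)[OF p] by (intro dyad_hom; simp)
  have "gstar \<rho> \<sigma> (\<gamma> (fst p)) (\<gamma> (conj_class C (fst p))) (R (fst p)) (Rb (fst p)) (T\<cdot>(dyad (fst p) g (snd p) \<psi>|>\<rho>)) (snd p)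
   = gstar \<rho> \<sigma> g gb r rb T (?v p)"
   by (rule gstar_natural[OF okv[OF p] _ dh _ conj_class(1)[OF J(2)[OF p]] s]) (use J(2,3)[OF p] in simp_all)
  then show ?thesis unfolding gstar_def .
 qed
 have gh: "gen \<sigma> \<rho> gb ?X (cvec g gb rb (?v p)) \<in> cr_hom \<sigma> \<rho>" if "p \<in> Jset g" for p
  by (rule gen_hom[OF gstar_ok[OF okv[OF that] s]])
 have "cr_star ?x = finsum (cr_space \<sigma> \<rho>) (%p. gen \<sigma> \<rho> gb ?X (cvec g gb rb (?v p))) (terms ?x)"
  unfolding cr_star_def src_gen trg_gen
 proof (rule cr.M.finsum_cong')
  show "(%p. gen \<sigma> \<rho> gb ?X (cvec g gb rb (?v p))) \<in> terms ?x \<rightarrow> carrier (cr_space \<sigma> \<rho>)"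
   using gh terms_gen(1)[OF ok] by auto
  fix p assume "p \<in> terms ?x"
  then have p: "p \<in> Jset g" using terms_gen(1)[OF ok] by blast
  have "elem_star \<rho> \<sigma> (fst p) (T\<cdot>(dyad (fst p) g (snd p) \<psi>|>\<rho>)) (snd p) =
    gstar \<rho> \<sigma> (\<gamma> (fst p)) (\<gamma> (conj_class C (fst p))) (R (fst p)) (Rb (fst p)) (T\<cdot>(dyad (fst p) g (snd p) \<psi>|>\<rho>)) (snd p)"
   unfolding elem_star_def gstar_def conj_vec_eq
   by (rule elem_gen[OF conj_class(2)[OF J(2)[OF p]] gstar_ok[OF okk[OF p] conj_class(1)[OF J(2)[OF p]]]])
  then have "elem_star \<rho> \<sigma> (fst p) (val ?x (fst p) (snd p)) (snd p) = gen \<sigma> \<rho> gb ?X (cvec g gb rb (?v p))"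
   unfolding gs[OF p] by (simp only: val_gen[OF J(2,3)[OF p]])
  then show "(case p of (k, b) => elem_star \<rho> \<sigma> k (val ?x k b) b) = gen \<sigma> \<rho> gb ?X (cvec g gb rb (?v p))"
   by (simp only: split_beta)
 qed simp
 also have "\<dots> = finsum (cr_space \<sigma> \<rho>) (%p. gen \<sigma> \<rho> gb ?X (cvec g gb rb (?v p))) (Jset g)"
 proof (rule cr.finsum_subset[OF J(1) terms_gen(1)[OF ok]])
  show "(%p. gen \<sigma> \<rho> gb ?X (cvec g gb rb (?v p))) \<in> Jset g \<rightarrow> carrier (cr_space \<sigma> \<rho>)"
   using gh by (simp only: cr_space_simps Pi_iff) blast
  fix p assume pt: "p \<in> Jset g - terms ?x"
  then have p: "p \<in> Jset g" by blast
  note [simp] = J(2)[OF p] conjugateD(1-8)[OF conj_class(1)[OF J(2)[OF p]]]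
  have 0: "T\<cdot>(dyad (fst p) g (snd p) \<psi>|>\<rho>) = hzero C (\<gamma> (fst p)\<boxdot>\<rho>) \<sigma>" by (rule terms_gen(2)[OF ok pt])
  have ok0: "gen_ok \<sigma> \<rho> (\<gamma> (conj_class C (fst p))) (hzero C (\<gamma> (conj_class C (fst p))\<boxdot>\<sigma>) \<rho>)
    (cvec (\<gamma> (fst p)) (\<gamma> (conj_class C (fst p))) (Rb (fst p)) (snd p))"
   using gstar_ok[OF okk[OF p] conj_class(1)[OF J(2)[OF p]]] by (simp add: gen_ok_def)
  have "gen \<sigma> \<rho> gb ?X (cvec g gb rb (?v p)) =
    gen \<sigma> \<rho> (\<gamma> (conj_class C (fst p))) (hzero C (\<gamma> (conj_class C (fst p))\<boxdot>\<sigma>) \<rho>)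
     (cvec (\<gamma> (fst p)) (\<gamma> (conj_class C (fst p))) (Rb (fst p)) (snd p))"
   unfolding gs[OF p, symmetric] 0 gstar_def by simp
  also have "\<dots> = cr_zero \<sigma> \<rho>" by (rule gen_zero_arrow[OF ok0])
  finally show "gen \<sigma> \<rho> gb ?X (cvec g gb rb (?v p)) = \<zero>\<^bsub>cr_space \<sigma> \<rho>\<^esub>" by simp
 qed
 also have "\<dots> = gen \<sigma> \<rho> gb ?X (finsum (Sp gb) (%p. cvec g gb rb (?v p)) (Jset g))"
  by (rule gen_finsum_vec[OF okX J(1)]) (use vm cvec(1)[OF gS s] in "simp only: Pi_iff; blast")
 also have "finsum (Sp gb) (%p. cvec g gb rb (?v p)) (Jset g) = cvec g gb rb (finsum (Sp g) ?v (Jset g))"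
  by (rule cvec_finsum[OF gS s J(1), symmetric]) (use vm in "simp only: Pi_iff; blast")
 also have "finsum (Sp g) ?v (Jset g) = \<psi>" by (rule dyad_sum(1)[OF gS]) simp
 finally show ?thesis unfolding gstar_def .
qed

end

section \<open>The crossed product is a tensor category\<close>

context crossed_product_setting
begin

abbreviation "CR \<equiv> crossed0"

lemma CR_simps [simp]:
 "Obj CR = Obj C" "Dom CR = src" "Cod CR = trg" "idn CR \<rho> = incl (idn C \<rho>)" "cmp CR = cr_cmp"
 "unt CR = unt C" "tob CR = tob C" "tar CR = cr_tar" "star CR = cr_star" "hadd CR = cr_add"
 "hzero CR = cr_zero" "hscale CR = cr_scale" "braid CR \<rho> \<sigma> = incl (braid C \<rho> \<sigma>)"
 by (simp_all add: crossed0_def)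

lemma Hom_CR: "f \<in> Hom CR \<rho> \<sigma> \<longleftrightarrow> \<rho> \<in> Obj C \<and> \<sigma> \<in> Obj C \<and> f \<in> cr_hom \<rho> \<sigma>"
 using cr_homD(1,2) by (auto simp: Hom_def crossed0_def)

lemma CR_gen: "f \<in> Hom CR \<rho> \<sigma> ==> \<exists>g T \<psi>. gen_ok \<rho> \<sigma> g T \<psi> \<and> f = gen \<rho> \<sigma> g T \<psi>"
 using cr_hom_gen by (simp add: Hom_CR)

lemma gen_CR: "gen_ok \<rho> \<sigma> g T \<psi> ==> gen \<rho> \<sigma> g T \<psi> \<in> Hom CR \<rho> \<sigma>"
 using gen_hom[of \<rho> \<sigma> g T \<psi>] by (simp add: Hom_CR gen_ok_def)

lemma CR_gen2: "[|x \<in> Hom CR \<rho> \<sigma>; y \<in> Hom CR \<rho> \<sigma>|] ==>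
  \<exists>g T T' \<psi>. gen_ok \<rho> \<sigma> g T \<psi> \<and> gen_ok \<rho> \<sigma> g T' \<psi> \<and> gen_ok \<rho> \<sigma> g (hadd C T T') \<psi> \<and>
  x = gen \<rho> \<sigma> g T \<psi> \<and> y = gen \<rho> \<sigma> g T' \<psi> \<and> cr_add x y = gen \<rho> \<sigma> g (hadd C T T') \<psi>"
 using cr_hom_gen2 by (simp add: Hom_CR)

lemma Arr_CR: "f \<in> Arr CR \<longleftrightarrow> f \<in> Hom CR (src f) (trg f)"
 by (simp add: Hom_def)

lemma incl_gen:
 assumes "T \<in> Hom C \<rho> \<sigma>"
 shows "gen_ok \<rho> \<sigma> (unt C) T \<Omega>" "incl T = gen \<rho> \<sigma> (unt C) T \<Omega>"
proof -
 have o: "\<rho> \<in> Obj C" "\<sigma> \<in> Obj C" using Hom_obj[OF assms] by auto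
 note [simp] = HomD[OF assms] o
 show ok: "gen_ok \<rho> \<sigma> (unt C) T \<Omega>" by (simp add: gen_ok_def \<Omega>_mem)
 then show "incl T = gen \<rho> \<sigma> (unt C) T \<Omega>"
  unfolding incl_def using elem_gen[OF unt_Ghat, of \<rho> \<sigma> T \<Omega>] by (simp add: ch.rep_unt)
qed

lemma incl_hom: "T \<in> Hom C \<rho> \<sigma> ==> incl T \<in> Hom CR \<rho> \<sigma>"
 using gen_CR[OF incl_gen(1)] incl_gen(2) by simp

text \<open>The braiding with the unit is an idempotent isomorphism, hence trivial.\<close>

lemma braid_unt [simp]:
 assumes [simp]: "\<rho> \<in> Obj C"
 shows "braid C (unt C) \<rho> = idn C \<rho>" "braid C \<rho> (unt C) = idn C \<rho>"
proof -
 have id: "b = idn C \<rho>" if b: "b\<cdot>b = b" "b\<dagger>\<cdot>b = idn C \<rho>" and [simp]: "b \<in> Arr C" "Dom C b = \<rho>" "Cod C b = \<rho>" for b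
  using cmp_eq_cmp[OF b(2), of b] b by simp
 show "braid C (unt C) \<rho> = idn C \<rho>"
  by (rule id) (use braid_tob_left[of "unt C" "unt C" \<rho>] braid_unitary[of "unt C" \<rho>] in simp_all)
 show "braid C \<rho> (unt C) = idn C \<rho>"
  by (rule id) (use braid_tob_right[of \<rho> "unt C" "unt C"] braid_unitary[of \<rho> "unt C"] in simp_all)
qed

lemma incl_cmp_gen:
 assumes ok: "gen_ok \<rho> \<sigma> g T \<psi>" and a: "a \<in> Hom C \<sigma> \<tau>"
 shows "cr_cmp (incl a) (gen \<rho> \<sigma> g T \<psi>) = gen \<rho> \<tau> g (a\<cdot>T) \<psi>"
proof -
 note [simp] = gen_okD[OF ok] HomD[OF a]
 show ?thesis unfolding incl_gen(2)[OF a] cr_cmp_gen(1)[OF incl_gen(1)[OF a] ok] by (simp add: tv_unt)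
qed

lemma gen_cmp_incl:
 assumes ok: "gen_ok \<sigma> \<tau> g T \<psi>" and a: "a \<in> Hom C \<rho> \<sigma>"
 shows "cr_cmp (gen \<sigma> \<tau> g T \<psi>) (incl a) = gen \<rho> \<tau> g (T\<cdot>(g<|a)) \<psi>"
proof -
 note [simp] = gen_okD[OF ok] HomD[OF a]
 show ?thesis unfolding incl_gen(2)[OF a] cr_cmp_gen(1)[OF ok incl_gen(1)[OF a]] by (simp add: tv_unt)
qed

lemma incl_cmp: "[|a \<in> Hom C \<sigma> \<tau>; b \<in> Hom C \<rho> \<sigma>|] ==> cr_cmp (incl a) (incl b) = incl (a\<cdot>b)"
 using incl_cmp_gen[OF incl_gen(1), of b \<rho> \<sigma> a \<tau>] incl_gen(2)[of b \<rho> \<sigma>]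
  incl_gen(2)[OF cmp_hom[of a \<sigma> \<tau> b \<rho>]] by simp

lemma incl_tar:
 assumes a: "a \<in> Hom C \<rho> \<sigma>" and b: "b \<in> Hom C \<rho>' \<sigma>'"
 shows "cr_tar (incl a) (incl b) = incl (a \<boxtimes> b)"
proof -
 have o: "\<rho> \<in> Obj C" "\<rho>' \<in> Obj C" using Hom_obj[OF a] Hom_obj[OF b] by auto
 note [simp] = HomD[OF a] HomD[OF b] o
 have ab: "a \<boxtimes> b \<in> Hom C (\<rho>\<boxdot>\<rho>') (\<sigma>\<boxdot>\<sigma>')" by (simp add: in_Hom)
 show ?thesis
  unfolding incl_gen(2)[OF a] incl_gen(2)[OF b] incl_gen(2)[OF ab] cr_tar_gen(1)[OF incl_gen(1)[OF a] incl_gen(1)[OF b]]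
  by (simp add: tv_unt \<Omega>_mem)
qed

text \<open>Naturality of the braiding with \<open>k\<close> produces the braiding of \<open>k\<close> with \<open>l\<close>, whose composite with that of
 \<open>l\<close> with \<open>k\<close> is trivial because both lie in the symmetric subcategory.\<close>

lemma braid_past:
 assumes [simp]: "\<rho> \<in> Obj C" "k \<in> S" "l \<in> S" and T[simp]: "T \<in> Arr C" "Dom C T = l\<boxdot>\<rho>" "Cod C T = \<sigma>"
 shows "(braid C k \<sigma>\<cdot>(k<|T))\<cdot>(braid C l k|>\<rho>) = (T|>k)\<cdot>(l<|braid C k \<rho>)"
proof -
 have [simp]: "\<sigma> \<in> Obj C" using Cod_obj[OF T(1)] by simp
 have "braid C k \<sigma>\<cdot>(k<|T) = (T|>k)\<cdot>braid C k (l\<boxdot>\<rho>)" by (rule braid_nat) simp_all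
 also have "braid C k (l\<boxdot>\<rho>) = (l<|braid C k \<rho>)\<cdot>(braid C k l|>\<rho>)" by (rule braid_tob_right) simp_all
 finally have "(braid C k \<sigma>\<cdot>(k<|T))\<cdot>(braid C l k|>\<rho>) =
   (T|>k)\<cdot>((l<|braid C k \<rho>)\<cdot>((braid C k l|>\<rho>)\<cdot>(braid C l k|>\<rho>)))" by simp
 also have "(braid C k l|>\<rho>)\<cdot>(braid C l k|>\<rho>) = idn C (l\<boxdot>(k\<boxdot>\<rho>))"
  using sub.symmetric[of l k] by (simp add: interch)
 finally show ?thesis by simp
qed

text \<open>Both sides are tensors over the four objects \<open>k, l, k', l'\<close> in an order that differs by the braiding of \<open>l\<close>
 with \<open>k'\<close>. This braiding carries the vector of one side to that of the other, since \<open>F\<close> maps it to the flip,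
 and it carries the arrows to each other by naturality and symmetry.\<close>

lemma cr_interchange:
 assumes "g \<in> Hom CR \<sigma> \<tau>" "f \<in> Hom CR \<rho> \<sigma>" "g' \<in> Hom CR \<sigma>' \<tau>'" "f' \<in> Hom CR \<rho>' \<sigma>'"
 shows "cr_tar (cr_cmp g f) (cr_cmp g' f') = cr_cmp (cr_tar g g') (cr_tar f f')"
proof -
 obtain k T \<psi> where g: "gen_ok \<sigma> \<tau> k T \<psi>" "g = gen \<sigma> \<tau> k T \<psi>" using CR_gen[OF assms(1)] by blast
 obtain l T1 \<psi>1 where f: "gen_ok \<rho> \<sigma> l T1 \<psi>1" "f = gen \<rho> \<sigma> l T1 \<psi>1" using CR_gen[OF assms(2)] by blast
 obtain k' T' \<psi>' where g': "gen_ok \<sigma>' \<tau>' k' T' \<psi>'" "g' = gen \<sigma>' \<tau>' k' T' \<psi>'" using CR_gen[OF assms(3)] by blast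
 obtain l' T1' \<psi>1' where f': "gen_ok \<rho>' \<sigma>' l' T1' \<psi>1'" "f' = gen \<rho>' \<sigma>' l' T1' \<psi>1'" using CR_gen[OF assms(4)] by blast
 note [simp] = gen_okD[OF g(1)] gen_okD[OF f(1)] gen_okD[OF g'(1)] gen_okD[OF f'(1)]
 let ?u = "tv k (l\<boxdot>(k'\<boxdot>l')) \<psi> (tv l (k'\<boxdot>l') \<psi>1 (tv k' l' \<psi>' \<psi>1'))"
 \<comment> \<open>exchanges the objects \<open>l\<close> and \<open>k'\<close>\<close>
 let ?v = "k<|(braid C l k'|>l')"
 let ?L = "((T\<cdot>(k<|T1)) \<boxtimes> (T'\<cdot>(k'<|T1')))\<cdot>((k\<boxdot>l)<|(braid C (k'\<boxdot>l') \<rho>|>\<rho>'))"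
 let ?R = "((T \<boxtimes> T')\<cdot>(k<|(braid C k' \<sigma>|>\<sigma>'))) \<cdot>
   ((k\<boxdot>k')<|((T1 \<boxtimes> T1')\<cdot>(l<|(braid C l' \<rho>|>\<rho>'))))"
 have lhs: "cr_tar (cr_cmp g f) (cr_cmp g' f') = gen (\<rho>\<boxdot>\<rho>') (\<tau>\<boxdot>\<tau>') (k\<boxdot>(l\<boxdot>(k'\<boxdot>l'))) ?L ?u"
  unfolding g(2) f(2) g'(2) f'(2) cr_cmp_gen(1)[OF g(1) f(1)] cr_cmp_gen(1)[OF g'(1) f'(1)]
   cr_tar_gen(1)[OF cr_cmp_gen(2)[OF g(1) f(1)] cr_cmp_gen(2)[OF g'(1) f'(1)]]
  by (simp add: tv_assoc tv_mem)
 note okR = cr_cmp_gen(2)[OF cr_tar_gen(2)[OF g(1) g'(1)] cr_tar_gen(2)[OF f(1) f'(1)]]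
 have vh: "?v \<in> Hom C (k\<boxdot>(l\<boxdot>(k'\<boxdot>l'))) ((k\<boxdot>k')\<boxdot>(l\<boxdot>l'))" by (simp add: in_Hom)
 have h: "idn C k \<in> Hom C k k" "idn C l' \<in> Hom C l' l'" "braid C l k' \<in> Hom C (l\<boxdot>k') (k'\<boxdot>l)"
  "braid C l k'|>l' \<in> Hom C (l\<boxdot>(k'\<boxdot>l')) (k'\<boxdot>(l\<boxdot>l'))" by (simp_all add: in_Hom)
 have "Fa (braid C l k'|>l') (tv l (k'\<boxdot>l') \<psi>1 (tv k' l' \<psi>' \<psi>1')) = tv k' (l\<boxdot>l') \<psi>' (tv l l' \<psi>1 \<psi>1')"
  using F_tv[OF h(3) h(2), of "tv l k' \<psi>1 \<psi>'" \<psi>1'] F.Fa_braid[of l k' \<psi>1 \<psi>'] by (simp add: tv_mem tv_assoc F.Fa_idn)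
 then have Fv: "Fa ?v ?u = tv (k\<boxdot>k') (l\<boxdot>l') (tv k k' \<psi> \<psi>') (tv l l' \<psi>1 \<psi>1')"
  using F_tv[OF h(1) h(4), of \<psi>] by (simp add: tv_mem tv_assoc F.Fa_idn)
 have "cr_cmp (cr_tar g g') (cr_tar f f') = gen (\<rho>\<boxdot>\<rho>') (\<tau>\<boxdot>\<tau>') ((k\<boxdot>k')\<boxdot>(l\<boxdot>l')) ?R (Fa ?v ?u)"
  unfolding g(2) f(2) g'(2) f'(2) cr_tar_gen(1)[OF g(1) g'(1)] cr_tar_gen(1)[OF f(1) f'(1)]
   cr_cmp_gen(1)[OF cr_tar_gen(2)[OF g(1) g'(1)] cr_tar_gen(2)[OF f(1) f'(1)]] Fv ..
 also have "\<dots> = gen (\<rho>\<boxdot>\<rho>') (\<tau>\<boxdot>\<tau>') (k\<boxdot>(l\<boxdot>(k'\<boxdot>l'))) (?R\<cdot>(?v|>(\<rho>\<boxdot>\<rho>'))) ?u"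
  by (rule gen_natural[symmetric, OF _ _ vh]) (use okR in "simp_all add: Fv tv_mem")
 also have "?R\<cdot>(?v|>(\<rho>\<boxdot>\<rho>')) = ?L"
 proof -
  let ?m = "(k\<boxdot>(l\<boxdot>k'))<|(braid C l' \<rho>|>\<rho>')"
  have c: "((k\<boxdot>(k'\<boxdot>l))<|(braid C l' \<rho>|>\<rho>'))\<cdot>(?v|>(\<rho>\<boxdot>\<rho>')) =
    (k<|(braid C l k'|>(\<rho>\<boxdot>(l'\<boxdot>\<rho>'))))\<cdot>?m"
   using slide[of "k<|braid C l k'" "braid C l' \<rho>|>\<rho>'" "k\<boxdot>(l\<boxdot>k')" "k\<boxdot>(k'\<boxdot>l)"
     "l'\<boxdot>(\<rho>\<boxdot>\<rho>')" "\<rho>\<boxdot>(l'\<boxdot>\<rho>')"] by simp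
  have a: "?R\<cdot>(?v|>(\<rho>\<boxdot>\<rho>')) = (T \<boxtimes> T') \<cdot>
    ((k<|(((braid C k' \<sigma>\<cdot>(k'<|T1))\<cdot>(braid C l k'|>\<rho>)) \<boxtimes> T1'))\<cdot>?m)"
  proof -
   have 1: "(k\<boxdot>k')<|((T1 \<boxtimes> T1')\<cdot>(l<|(braid C l' \<rho>|>\<rho>'))) =
     ((k\<boxdot>k')<|(T1 \<boxtimes> T1'))\<cdot>((k\<boxdot>(k'\<boxdot>l))<|(braid C l' \<rho>|>\<rho>'))"
    by (simp add: whisker_cmp)
   have 2: "(k<|(braid C k' \<sigma>|>\<sigma>'))\<cdot>(((k\<boxdot>k')<|(T1 \<boxtimes> T1')) \<cdot>
     (k<|(braid C l k'|>(\<rho>\<boxdot>(l'\<boxdot>\<rho>'))))) =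
     k<|(((braid C k' \<sigma>\<cdot>(k'<|T1))\<cdot>(braid C l k'|>\<rho>)) \<boxtimes> T1')"
   proof -
    have "(k\<boxdot>k')<|(T1 \<boxtimes> T1') = k<|((k'<|T1) \<boxtimes> T1')" by simp
    moreover have "braid C l k'|>(\<rho>\<boxdot>(l'\<boxdot>\<rho>')) = (braid C l k'|>\<rho>)|>(l'\<boxdot>\<rho>')" by simp
    ultimately show ?thesis by (simp add: interch del: tar_assoc tar_idn_idn)
   qed
   show ?thesis unfolding 1 2[symmetric] using c by simp
  qed
  have b: "?L = (T \<boxtimes> T')\<cdot>((k<|(((T1|>k')\<cdot>(l<|braid C k' \<rho>)) \<boxtimes> T1'))\<cdot>?m)"
  proof -
   have 1: "(T\<cdot>(k<|T1)) \<boxtimes> (T'\<cdot>(k'<|T1')) = (T \<boxtimes> T')\<cdot>((k<|T1) \<boxtimes> (k'<|T1'))"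
    by (rule interch[symmetric]) simp_all
   have 2: "(k\<boxdot>l)<|(braid C (k'\<boxdot>l') \<rho>|>\<rho>') =
     ((k\<boxdot>l)<|(braid C k' \<rho>|>(l'\<boxdot>\<rho>')))\<cdot>?m"
    by (simp add: braid_tob_left whisker_cmp)
   have 3: "((k<|T1) \<boxtimes> (k'<|T1'))\<cdot>((k\<boxdot>l)<|(braid C k' \<rho>|>(l'\<boxdot>\<rho>'))) =
     k<|(((T1|>k')\<cdot>(l<|braid C k' \<rho>)) \<boxtimes> T1')"
   proof -
    have "(k<|T1) \<boxtimes> (k'<|T1') = k<|((T1|>k') \<boxtimes> T1')" by simp
    moreover have "(k\<boxdot>l)<|(braid C k' \<rho>|>(l'\<boxdot>\<rho>')) = k<|((l<|braid C k' \<rho>)|>(l'\<boxdot>\<rho>'))" by simp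
    ultimately show ?thesis by (simp add: interch del: tar_assoc tar_idn_idn)
   qed
   show ?thesis unfolding 1 2 3[symmetric] by simp
  qed
  have "(braid C k' \<sigma>\<cdot>(k'<|T1))\<cdot>(braid C l k'|>\<rho>) = (T1|>k')\<cdot>(l<|braid C k' \<rho>)"
   by (rule braid_past) simp_all
  then show ?thesis unfolding a b by simp
 qed
 finally show ?thesis unfolding lhs by simp
qed

text \<open>By the hexagon equations both sides involve the braidings of \<open>g2\<close> with \<open>\<rho>1\<close>, of \<open>g3\<close> with \<open>\<rho>2\<close> and of \<open>g3\<close> with \<open>\<rho>1\<close>.\<close>

lemma cr_tar_assoc:
 assumes "f1 \<in> Hom CR \<rho>1 \<sigma>1" "f2 \<in> Hom CR \<rho>2 \<sigma>2" "f3 \<in> Hom CR \<rho>3 \<sigma>3"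
 shows "cr_tar (cr_tar f1 f2) f3 = cr_tar f1 (cr_tar f2 f3)"
proof -
 obtain g1 T1 \<psi>1 where 1: "gen_ok \<rho>1 \<sigma>1 g1 T1 \<psi>1" "f1 = gen \<rho>1 \<sigma>1 g1 T1 \<psi>1" using CR_gen[OF assms(1)] by blast
 obtain g2 T2 \<psi>2 where 2: "gen_ok \<rho>2 \<sigma>2 g2 T2 \<psi>2" "f2 = gen \<rho>2 \<sigma>2 g2 T2 \<psi>2" using CR_gen[OF assms(2)] by blast
 obtain g3 T3 \<psi>3 where 3: "gen_ok \<rho>3 \<sigma>3 g3 T3 \<psi>3" "f3 = gen \<rho>3 \<sigma>3 g3 T3 \<psi>3" using CR_gen[OF assms(3)] by blast
 note [simp] = gen_okD[OF 1(1)] gen_okD[OF 2(1)] gen_okD[OF 3(1)]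
 let ?e = "(g1\<boxdot>g2)<|(braid C g3 \<rho>1|>(\<rho>2\<boxdot>\<rho>3))"
 let ?N = "(T1 \<boxtimes> (T2 \<boxtimes> T3))\<cdot>((g1<|(braid C g2 \<rho>1 \<boxtimes> (braid C g3 \<rho>2|>\<rho>3)))\<cdot>?e)"
 have l: "((((T1 \<boxtimes> T2)\<cdot>(g1<|(braid C g2 \<rho>1|>\<rho>2))) \<boxtimes> T3)\<cdot>((g1\<boxdot>g2)<|(braid C g3 (\<rho>1\<boxdot>\<rho>2)|>\<rho>3))) = ?N"
 proof -
  have A: "((T1 \<boxtimes> T2)\<cdot>(g1<|(braid C g2 \<rho>1|>\<rho>2))) \<boxtimes> T3 = (T1 \<boxtimes> (T2 \<boxtimes> T3))\<cdot>(g1<|(braid C g2 \<rho>1|>(\<rho>2\<boxdot>(g3\<boxdot>\<rho>3))))"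
   using interch[of "T1 \<boxtimes> T2" "g1<|(braid C g2 \<rho>1|>\<rho>2)" T3 "idn C (g3\<boxdot>\<rho>3)"] by simp
  have B: "(g1\<boxdot>g2)<|(braid C g3 (\<rho>1\<boxdot>\<rho>2)|>\<rho>3) = ((g1\<boxdot>(g2\<boxdot>\<rho>1))<|(braid C g3 \<rho>2|>\<rho>3))\<cdot>?e"
   by (simp add: braid_tob_right whisker_cmp)
  have C: "(g1<|(braid C g2 \<rho>1|>(\<rho>2\<boxdot>(g3\<boxdot>\<rho>3))))\<cdot>((g1\<boxdot>(g2\<boxdot>\<rho>1))<|(braid C g3 \<rho>2|>\<rho>3)) = g1<|(braid C g2 \<rho>1 \<boxtimes> (braid C g3 \<rho>2|>\<rho>3))"
   using interch[of "g1<|braid C g2 \<rho>1" "idn C (g1\<boxdot>(g2\<boxdot>\<rho>1))" "idn C (\<rho>2\<boxdot>(g3\<boxdot>\<rho>3))" "braid C g3 \<rho>2|>\<rho>3"] by simp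
  show ?thesis unfolding A B using cmp_eq_cmp[OF C, of ?e] by simp
 qed
 have r: "((T1 \<boxtimes> ((T2 \<boxtimes> T3)\<cdot>(g2<|(braid C g3 \<rho>2|>\<rho>3))))\<cdot>(g1<|(braid C (g2\<boxdot>g3) \<rho>1|>(\<rho>2\<boxdot>\<rho>3)))) = ?N"
 proof -
  have A: "T1 \<boxtimes> ((T2 \<boxtimes> T3)\<cdot>(g2<|(braid C g3 \<rho>2|>\<rho>3))) = (T1 \<boxtimes> (T2 \<boxtimes> T3))\<cdot>((g1\<boxdot>(\<rho>1\<boxdot>g2))<|(braid C g3 \<rho>2|>\<rho>3))"
   using interch[of T1 "idn C (g1\<boxdot>\<rho>1)" "T2 \<boxtimes> T3" "g2<|(braid C g3 \<rho>2|>\<rho>3)"] by simp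
  have B: "g1<|(braid C (g2\<boxdot>g3) \<rho>1|>(\<rho>2\<boxdot>\<rho>3)) = (g1<|(braid C g2 \<rho>1|>(g3\<boxdot>(\<rho>2\<boxdot>\<rho>3))))\<cdot>?e"
   by (simp add: braid_tob_left whisker_cmp)
  have C: "((g1\<boxdot>(\<rho>1\<boxdot>g2))<|(braid C g3 \<rho>2|>\<rho>3))\<cdot>(g1<|(braid C g2 \<rho>1|>(g3\<boxdot>(\<rho>2\<boxdot>\<rho>3)))) = g1<|(braid C g2 \<rho>1 \<boxtimes> (braid C g3 \<rho>2|>\<rho>3))"
   using interch[of "idn C (g1\<boxdot>(\<rho>1\<boxdot>g2))" "g1<|braid C g2 \<rho>1" "braid C g3 \<rho>2|>\<rho>3" "idn C (g3\<boxdot>(\<rho>2\<boxdot>\<rho>3))"] by simp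
  show ?thesis unfolding A B using cmp_eq_cmp[OF C, of ?e] by simp
 qed
 show ?thesis
  unfolding 1(2) 2(2) 3(2) cr_tar_gen(1)[OF 1(1) 2(1)] cr_tar_gen(1)[OF 2(1) 3(1)]
   cr_tar_gen(1)[OF cr_tar_gen(2)[OF 1(1) 2(1)] 3(1)] cr_tar_gen(1)[OF 1(1) cr_tar_gen(2)[OF 2(1) 3(1)]] l r
  by (simp add: tv_assoc)
qed

lemma complex_tensor_category_CR: "complex_tensor_category CR"
proof (rule complex_tensor_category.intro)
 fix f assume "f \<in> Arr CR"
 then show "Dom CR f \<in> Obj CR \<and> Cod CR f \<in> Obj CR" by (simp add: Arr_CR Hom_CR)
next
 fix \<rho> assume "\<rho> \<in> Obj CR"
 then show "idn CR \<rho> \<in> Hom CR \<rho> \<rho>" using incl_hom[OF idn_hom] by simp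
next
 fix g f \<rho> \<sigma> \<tau> assume a: "g \<in> Hom CR \<sigma> \<tau>" "f \<in> Hom CR \<rho> \<sigma>"
 obtain k T \<psi> where g: "gen_ok \<sigma> \<tau> k T \<psi>" "g = gen \<sigma> \<tau> k T \<psi>" using CR_gen[OF a(1)] by blast
 obtain l T1 \<psi>1 where f: "gen_ok \<rho> \<sigma> l T1 \<psi>1" "f = gen \<rho> \<sigma> l T1 \<psi>1" using CR_gen[OF a(2)] by blast
 note [simp] = gen_okD[OF g(1)] gen_okD[OF f(1)]
 show "g \<cdot>\<^bsub>CR\<^esub> f \<in> Hom CR \<rho> \<tau>"
  using gen_CR[OF cr_cmp_gen(2)[OF g(1) f(1)]] cr_cmp_gen(1)[OF g(1) f(1)] by (simp add: g(2) f(2))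
 fix c
 have okc: "gen_ok \<sigma> \<tau> k (hscale C c T) \<psi>" "gen_ok \<rho> \<sigma> l (hscale C c T1) \<psi>1" by (simp_all add: gen_ok_def)
 show "hscale CR c g \<cdot>\<^bsub>CR\<^esub> f = hscale CR c (g \<cdot>\<^bsub>CR\<^esub> f) \<and> g \<cdot>\<^bsub>CR\<^esub> hscale CR c f = hscale CR c (g \<cdot>\<^bsub>CR\<^esub> f)"
  unfolding g(2) f(2) CR_simps gen_scale(1)[OF g(1)] gen_scale(1)[OF f(1)] cr_cmp_gen(1)[OF g(1) f(1)]
   gen_scale(1)[OF cr_cmp_gen(2)[OF g(1) f(1)]] cr_cmp_gen(1)[OF okc(1) f(1)] cr_cmp_gen(1)[OF g(1) okc(2)]
  by simp
next
 fix h g f \<rho> \<sigma> \<tau> \<upsilon> assume a: "h \<in> Hom CR \<tau> \<upsilon>" "g \<in> Hom CR \<sigma> \<tau>" "f \<in> Hom CR \<rho> \<sigma>"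
 obtain m T2 \<psi>2 where h: "gen_ok \<tau> \<upsilon> m T2 \<psi>2" "h = gen \<tau> \<upsilon> m T2 \<psi>2" using CR_gen[OF a(1)] by blast
 obtain k T \<psi> where g: "gen_ok \<sigma> \<tau> k T \<psi>" "g = gen \<sigma> \<tau> k T \<psi>" using CR_gen[OF a(2)] by blast
 obtain l T1 \<psi>1 where f: "gen_ok \<rho> \<sigma> l T1 \<psi>1" "f = gen \<rho> \<sigma> l T1 \<psi>1" using CR_gen[OF a(3)] by blast
 note [simp] = gen_okD[OF g(1)] gen_okD[OF f(1)] gen_okD[OF h(1)]
 show "(h \<cdot>\<^bsub>CR\<^esub> g) \<cdot>\<^bsub>CR\<^esub> f = h \<cdot>\<^bsub>CR\<^esub> (g \<cdot>\<^bsub>CR\<^esub> f)"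
  unfolding h(2) g(2) f(2) CR_simps cr_cmp_gen(1)[OF g(1) f(1)] cr_cmp_gen(1)[OF h(1) g(1)]
   cr_cmp_gen(1)[OF cr_cmp_gen(2)[OF h(1) g(1)] f(1)] cr_cmp_gen(1)[OF h(1) cr_cmp_gen(2)[OF g(1) f(1)]]
  by (simp add: tv_assoc whisker_cmp)
next
 fix f \<rho> \<sigma> assume a: "f \<in> Hom CR \<rho> \<sigma>"
 obtain l T1 \<psi>1 where f: "gen_ok \<rho> \<sigma> l T1 \<psi>1" "f = gen \<rho> \<sigma> l T1 \<psi>1" using CR_gen[OF a] by blast
 note [simp] = gen_okD[OF f(1)]
 show "idn CR \<sigma> \<cdot>\<^bsub>CR\<^esub> f = f \<and> f \<cdot>\<^bsub>CR\<^esub> idn CR \<rho> = f"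
  using incl_cmp_gen[OF f(1) idn_hom] gen_cmp_incl[OF f(1) idn_hom] by (simp add: f(2))
next
 fix \<rho> \<sigma> assume "\<rho> \<in> Obj CR" "\<sigma> \<in> Obj CR"
 then have o: "\<rho> \<in> Obj C" "\<sigma> \<in> Obj C" by simp_all
 have "hom_space CR \<rho> \<sigma> = cr_space \<rho> \<sigma>" using o by (auto simp: hom_space_def cr_space_def Hom_CR)
 then show "Module.module complex_field (hom_space CR \<rho> \<sigma>)" using cr_module[OF o] by simp
next
 fix g g' f \<rho> \<sigma> \<tau> assume a: "g \<in> Hom CR \<sigma> \<tau>" "g' \<in> Hom CR \<sigma> \<tau>" "f \<in> Hom CR \<rho> \<sigma>"
 obtain k T T' \<psi> where g: "gen_ok \<sigma> \<tau> k T \<psi>" "gen_ok \<sigma> \<tau> k T' \<psi>" "gen_ok \<sigma> \<tau> k (hadd C T T') \<psi>"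
  "g = gen \<sigma> \<tau> k T \<psi>" "g' = gen \<sigma> \<tau> k T' \<psi>" "cr_add g g' = gen \<sigma> \<tau> k (hadd C T T') \<psi>" using CR_gen2[OF a(1,2)] by blast
 obtain l T1 \<psi>1 where f: "gen_ok \<rho> \<sigma> l T1 \<psi>1" "f = gen \<rho> \<sigma> l T1 \<psi>1" using CR_gen[OF a(3)] by blast
 note [simp] = gen_okD[OF g(1)] gen_okD[OF g(2)] gen_okD[OF f(1)]
 show "hadd CR g g' \<cdot>\<^bsub>CR\<^esub> f = hadd CR (g \<cdot>\<^bsub>CR\<^esub> f) (g' \<cdot>\<^bsub>CR\<^esub> f)"
  unfolding CR_simps g(6) unfolding g(4,5) f(2) cr_cmp_gen(1)[OF g(1) f(1)] cr_cmp_gen(1)[OF g(2) f(1)] cr_cmp_gen(1)[OF g(3) f(1)]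
   gen_add_arrow[OF cr_cmp_gen(2)[OF g(1) f(1)] cr_cmp_gen(2)[OF g(2) f(1)]] by (simp add: cmp_hadd)
next
 fix g f f' \<rho> \<sigma> \<tau> assume a: "g \<in> Hom CR \<sigma> \<tau>" "f \<in> Hom CR \<rho> \<sigma>" "f' \<in> Hom CR \<rho> \<sigma>"
 obtain k T T' \<psi> where g: "gen_ok \<rho> \<sigma> k T \<psi>" "gen_ok \<rho> \<sigma> k T' \<psi>" "gen_ok \<rho> \<sigma> k (hadd C T T') \<psi>"
  "f = gen \<rho> \<sigma> k T \<psi>" "f' = gen \<rho> \<sigma> k T' \<psi>" "cr_add f f' = gen \<rho> \<sigma> k (hadd C T T') \<psi>" using CR_gen2[OF a(2,3)] by blast
 obtain l T1 \<psi>1 where f: "gen_ok \<sigma> \<tau> l T1 \<psi>1" "g = gen \<sigma> \<tau> l T1 \<psi>1" using CR_gen[OF a(1)] by blast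
 note [simp] = gen_okD[OF g(1)] gen_okD[OF g(2)] gen_okD[OF f(1)]
 show "g \<cdot>\<^bsub>CR\<^esub> hadd CR f f' = hadd CR (g \<cdot>\<^bsub>CR\<^esub> f) (g \<cdot>\<^bsub>CR\<^esub> f')"
  unfolding CR_simps g(6) unfolding g(4,5) f(2) cr_cmp_gen(1)[OF f(1) g(1)] cr_cmp_gen(1)[OF f(1) g(2)] cr_cmp_gen(1)[OF f(1) g(3)]
   gen_add_arrow[OF cr_cmp_gen(2)[OF f(1) g(1)] cr_cmp_gen(2)[OF f(1) g(2)]] by (simp add: cmp_hadd tar_hadd)
next
 fix f f' \<rho> \<sigma> \<rho>' \<sigma>' assume a: "f \<in> Hom CR \<rho> \<sigma>" "f' \<in> Hom CR \<rho>' \<sigma>'"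
 obtain k T \<psi> where g: "gen_ok \<rho> \<sigma> k T \<psi>" "f = gen \<rho> \<sigma> k T \<psi>" using CR_gen[OF a(1)] by blast
 obtain l T1 \<psi>1 where f: "gen_ok \<rho>' \<sigma>' l T1 \<psi>1" "f' = gen \<rho>' \<sigma>' l T1 \<psi>1" using CR_gen[OF a(2)] by blast
 show "f \<boxtimes>\<^bsub>CR\<^esub> f' \<in> Hom CR (\<rho> \<boxdot>\<^bsub>CR\<^esub> \<rho>') (\<sigma> \<boxdot>\<^bsub>CR\<^esub> \<sigma>')"
  using gen_CR[OF cr_tar_gen(2)[OF g(1) f(1)]] cr_tar_gen(1)[OF g(1) f(1)] by (simp add: g(2) f(2))
next
 fix \<rho> \<sigma> assume "\<rho> \<in> Obj CR" "\<sigma> \<in> Obj CR"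
 then show "idn CR \<rho> \<boxtimes>\<^bsub>CR\<^esub> idn CR \<sigma> = idn CR (\<rho> \<boxdot>\<^bsub>CR\<^esub> \<sigma>)" using incl_tar[OF idn_hom idn_hom, of \<rho> \<sigma>] by simp
next
 fix g \<sigma> \<tau> f \<rho> g' \<sigma>' \<tau>' f' \<rho>'
 assume "g \<in> Hom CR \<sigma> \<tau>" "f \<in> Hom CR \<rho> \<sigma>" "g' \<in> Hom CR \<sigma>' \<tau>'" "f' \<in> Hom CR \<rho>' \<sigma>'"
 then show "(g \<cdot>\<^bsub>CR\<^esub> f) \<boxtimes>\<^bsub>CR\<^esub> (g' \<cdot>\<^bsub>CR\<^esub> f') = (g \<boxtimes>\<^bsub>CR\<^esub> g') \<cdot>\<^bsub>CR\<^esub> (f \<boxtimes>\<^bsub>CR\<^esub> f')"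
  using cr_interchange by simp
next
 fix f g h assume "f \<in> Arr CR" "g \<in> Arr CR" "h \<in> Arr CR"
 then show "(f \<boxtimes>\<^bsub>CR\<^esub> g) \<boxtimes>\<^bsub>CR\<^esub> h = f \<boxtimes>\<^bsub>CR\<^esub> (g \<boxtimes>\<^bsub>CR\<^esub> h)" unfolding Arr_CR using cr_tar_assoc by simp
next
 fix f assume "f \<in> Arr CR"
 then obtain l T1 \<psi>1 where f: "gen_ok (src f) (trg f) l T1 \<psi>1" "f = gen (src f) (trg f) l T1 \<psi>1" unfolding Arr_CR using CR_gen by blast
 note [simp] = gen_okD[OF f(1)]
 note u = incl_gen[OF idn_hom[OF unt_obj]]
 have "cr_tar (gen (unt C) (unt C) (unt C) (idn C (unt C)) \<Omega>) (gen (src f) (trg f) l T1 \<psi>1) = gen (src f) (trg f) l T1 \<psi>1"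
  "cr_tar (gen (src f) (trg f) l T1 \<psi>1) (gen (unt C) (unt C) (unt C) (idn C (unt C)) \<Omega>) = gen (src f) (trg f) l T1 \<psi>1"
  unfolding cr_tar_gen(1)[OF u(1) f(1)] cr_tar_gen(1)[OF f(1) u(1)] by (simp_all add: tv_unt)
 then show "idn CR (unt CR) \<boxtimes>\<^bsub>CR\<^esub> f = f \<and> f \<boxtimes>\<^bsub>CR\<^esub> idn CR (unt CR) = f"
  unfolding CR_simps u(2) f(2)[symmetric] by simp
next
 fix f f' g \<rho> \<sigma> assume a: "f \<in> Hom CR \<rho> \<sigma>" "f' \<in> Hom CR \<rho> \<sigma>" "g \<in> Arr CR"
 obtain k T T' \<psi> where g: "gen_ok \<rho> \<sigma> k T \<psi>" "gen_ok \<rho> \<sigma> k T' \<psi>" "gen_ok \<rho> \<sigma> k (hadd C T T') \<psi>"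
  "f = gen \<rho> \<sigma> k T \<psi>" "f' = gen \<rho> \<sigma> k T' \<psi>" "cr_add f f' = gen \<rho> \<sigma> k (hadd C T T') \<psi>" using CR_gen2[OF a(1,2)] by blast
 obtain \<rho>' \<sigma>' l T1 \<psi>1 where f: "gen_ok \<rho>' \<sigma>' l T1 \<psi>1" "g = gen \<rho>' \<sigma>' l T1 \<psi>1" using CR_gen a(3) unfolding Arr_CR by blast
 note [simp] = gen_okD[OF g(1)] gen_okD[OF g(2)] gen_okD[OF f(1)]
 show "hadd CR f f' \<boxtimes>\<^bsub>CR\<^esub> g = hadd CR (f \<boxtimes>\<^bsub>CR\<^esub> g) (f' \<boxtimes>\<^bsub>CR\<^esub> g)"
  unfolding CR_simps g(6) unfolding g(4,5) f(2) cr_tar_gen(1)[OF g(1) f(1)] cr_tar_gen(1)[OF g(2) f(1)] cr_tar_gen(1)[OF g(3) f(1)]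
   gen_add_arrow[OF cr_tar_gen(2)[OF g(1) f(1)] cr_tar_gen(2)[OF g(2) f(1)]] by (simp add: cmp_hadd tar_hadd)
 show "g \<boxtimes>\<^bsub>CR\<^esub> hadd CR f f' = hadd CR (g \<boxtimes>\<^bsub>CR\<^esub> f) (g \<boxtimes>\<^bsub>CR\<^esub> f')"
  unfolding CR_simps g(6) unfolding g(4,5) f(2) cr_tar_gen(1)[OF f(1) g(1)] cr_tar_gen(1)[OF f(1) g(2)] cr_tar_gen(1)[OF f(1) g(3)]
   gen_add_arrow[OF cr_tar_gen(2)[OF f(1) g(1)] cr_tar_gen(2)[OF f(1) g(2)]] by (simp add: cmp_hadd tar_hadd)
next
 fix f g c assume a: "f \<in> Arr CR" "g \<in> Arr CR"
 obtain \<rho> \<sigma> k T \<psi> where g: "gen_ok \<rho> \<sigma> k T \<psi>" "f = gen \<rho> \<sigma> k T \<psi>" using CR_gen a(1) unfolding Arr_CR by blast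
 obtain \<rho>' \<sigma>' l T1 \<psi>1 where f: "gen_ok \<rho>' \<sigma>' l T1 \<psi>1" "g = gen \<rho>' \<sigma>' l T1 \<psi>1" using CR_gen a(2) unfolding Arr_CR by blast
 note [simp] = gen_okD[OF g(1)] gen_okD[OF f(1)]
 have okc: "gen_ok \<rho> \<sigma> k (hscale C c T) \<psi>" "gen_ok \<rho>' \<sigma>' l (hscale C c T1) \<psi>1" by (simp_all add: gen_ok_def)
 show "hscale CR c f \<boxtimes>\<^bsub>CR\<^esub> g = hscale CR c (f \<boxtimes>\<^bsub>CR\<^esub> g) \<and> f \<boxtimes>\<^bsub>CR\<^esub> hscale CR c g = hscale CR c (f \<boxtimes>\<^bsub>CR\<^esub> g)"
  unfolding g(2) f(2) CR_simps gen_scale(1)[OF g(1)] gen_scale(1)[OF f(1)] cr_tar_gen(1)[OF g(1) f(1)]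
   gen_scale(1)[OF cr_tar_gen(2)[OF g(1) f(1)]] cr_tar_gen(1)[OF okc(1) f(1)] cr_tar_gen(1)[OF g(1) okc(2)]
  by simp
qed (simp_all add: tob_unt)

end

section \<open>The star operation of the crossed product\<close>

context tensor_category_with_star
begin

lemma conjugate_tensor_half:
 assumes s: "conjugate_solution C g gb r rb" and s': "conjugate_solution C g' gb' r' rb'"
 shows "(((g<|(rb'|>gb))\<cdot>rb)\<dagger>|>(g\<boxdot>g'))\<cdot>((g\<boxdot>g')<|((gb'<|(r|>g'))\<cdot>r')) = idn C (g\<boxdot>g')"
proof -
 note [simp] = conjugateD(1-8)[OF s] conjugateD(1-8)[OF s']
 let ?C = "g<|(r|>g')" and ?D = "g<|(rb'\<dagger>|>g')"
 have 1: "(g<|(rb'\<dagger>|>(gb\<boxdot>(g\<boxdot>g'))))\<cdot>((g\<boxdot>(g'\<boxdot>gb'))<|(r|>g')) = ?C\<cdot>?D"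
  using slide[of "g<|rb'\<dagger>" "r|>g'" "g\<boxdot>(g'\<boxdot>gb')" g g' "gb\<boxdot>(g\<boxdot>g')"] by simp
 have 2: "(rb\<dagger>|>(g\<boxdot>g'))\<cdot>?C = idn C (g\<boxdot>g')"
  using arg_cong[OF conjugateD(9)[OF s], of "%x. x|>g'"] by (simp add: whisker_cmp)
 have 3: "?D\<cdot>((g\<boxdot>g')<|r') = idn C (g\<boxdot>g')"
  using arg_cong[OF conjugateD(9)[OF s'], of "%x. g<|x"] by (simp add: whisker_cmp)
 have "(((g<|(rb'|>gb))\<cdot>rb)\<dagger>|>(g\<boxdot>g'))\<cdot>((g\<boxdot>g')<|((gb'<|(r|>g'))\<cdot>r'))
   = (rb\<dagger>|>(g\<boxdot>g'))\<cdot>(((g<|(rb'\<dagger>|>(gb\<boxdot>(g\<boxdot>g'))))\<cdot>((g\<boxdot>(g'\<boxdot>gb'))<|(r|>g')))\<cdot>((g\<boxdot>g')<|r'))"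
  by (simp add: whisker_cmp)
 also have "\<dots> = ((rb\<dagger>|>(g\<boxdot>g'))\<cdot>?C)\<cdot>(?D\<cdot>((g\<boxdot>g')<|r'))" unfolding 1 by simp
 also have "\<dots> = idn C (g\<boxdot>g')" unfolding 2 3 by simp
 finally show ?thesis .
qed

text \<open>Nested solutions: the inner zigzag is straightened within the outer one.\<close>

lemma conjugate_tensor:
 assumes s: "conjugate_solution C g gb r rb" and s': "conjugate_solution C g' gb' r' rb'"
 shows "conjugate_solution C (g\<boxdot>g') (gb'\<boxdot>gb) ((gb'<|(r|>g'))\<cdot>r') ((g<|(rb'|>gb))\<cdot>rb)"
proof -
 note [simp] = conjugateD(1-8)[OF s] conjugateD(1-8)[OF s']
 show ?thesis
  using conjugate_tensor_half[OF s s'] conjugate_tensor_half[OF conjugate_solution_sym[OF s'] conjugate_solution_sym[OF s]]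
  unfolding conjugate_solution_def by (simp add: in_Hom)
qed

end

context crossed_product_setting
begin

lemma solution_exists: "\<rho> \<in> Obj C ==> \<exists>\<rho>b r rb. conjugate_solution C \<rho> \<rho>b r rb"
 using conjugates unfolding has_conjugates_def by blast

lemma solution_unt: "conjugate_solution C (unt C) (unt C) (idn C (unt C)) (idn C (unt C))"
 by (simp add: conjugate_solution_def in_Hom)

text \<open>By the two formulas for the inner product with a conjugate vector, \<open>cvec\<close> is an involution.\<close>

lemma cvec_cvec:
 assumes g: "g \<in> S" and s: "conjugate_solution C g gb r rb" and \<psi>: "\<psi> \<in> Vec g"
 shows "cvec gb g r (cvec g gb rb \<psi>) = \<psi>"
proof (rule cvec_eqI[OF gb[OF g s] conjugate_solution_sym[OF s] cvec(1)[OF g s \<psi>] \<psi>])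
 have gbS: "gb \<in> S" by (rule gb[OF g s])
 interpret h: fd_hilbert "Sp g" by (rule hilb[OF g])
 interpret k: fd_hilbert "Sp (gb\<boxdot>g)" using g gbS by (intro hilb) simp
 fix a assume a: "a \<in> Vec g"
 have "ip (Sp (gb\<boxdot>g)) (tv gb g (cvec g gb rb \<psi>) a) (Fa r \<Omega>) = cnj (ip (Sp g) \<psi> a)"
  unfolding cvec_dual[OF g s \<psi> a, symmetric]
  by (rule k.ip_cnj[OF Fr_mem(1)[OF g s] tv_mem[OF gbS g cvec(1)[OF g s \<psi>] a]])
 then show "ip (Sp g) a \<psi> = ip (Sp (gb\<boxdot>g)) (tv gb g (cvec g gb rb \<psi>) a) (Fa r \<Omega>)"
  using h.ip_cnj[OF \<psi> a] by simp
qed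

text \<open>The solution for \<open>g g'\<close> is nested, so the pairing with its vector factors into the pairings for \<open>g'\<close> and \<open>g\<close>.\<close>

lemma cvec_tensor:
 assumes g[simp]: "g \<in> S" "g' \<in> S" and s: "conjugate_solution C g gb r rb" and s': "conjugate_solution C g' gb' r' rb'"
  and \<psi>[simp]: "\<psi> \<in> Vec g" "\<psi>' \<in> Vec g'"
 shows "cvec (g\<boxdot>g') (gb'\<boxdot>gb) ((g<|(rb'|>gb))\<cdot>rb) (tv g g' \<psi> \<psi>') =
  tv gb' gb (cvec g' gb' rb' \<psi>') (cvec g gb rb \<psi>)"
proof -
 note [simp] = conjugateD(1-8)[OF s] conjugateD(1-8)[OF s']
 have gbS[simp]: "gb \<in> S" "gb' \<in> S" using gb[OF g(1) s] gb[OF g(2) s'] by simp_all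
 let ?Rb = "(g<|(rb'|>gb))\<cdot>rb" and ?c = "cvec g gb rb \<psi>" and ?c' = "cvec g' gb' rb' \<psi>'"
 note c[simp] = cvec(1)[OF g(1) s \<psi>(1)] cvec(1)[OF g(2) s' \<psi>(2)]
 interpret t: fd_hilbert "Sp (gb'\<boxdot>gb)" by (rule hilb) simp
 interpret q: fd_hilbert "Sp ((g\<boxdot>g')\<boxdot>(gb'\<boxdot>gb))" by (rule hilb) simp
 interpret g: fd_hilbert "Sp (g\<boxdot>gb)" by (rule hilb) simp
 have gg: "g\<boxdot>g' \<in> S" by simp
 note st = conjugate_tensor[OF s s']
 have tm: "tv g g' \<psi> \<psi>' \<in> Vec (g\<boxdot>g')" by (simp add: tv_mem)
 note Fm = Fr_mem(2)[OF gg st]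
 show ?thesis
 proof (rule cvec_eqI[OF gg st tm])
  show "tv gb' gb ?c' ?c \<in> Vec (gb'\<boxdot>gb)" by (simp add: tv_mem)
  fix a assume "a \<in> Vec (gb'\<boxdot>gb)"
  with gbS(2,1) show "ip (Sp (gb'\<boxdot>gb)) a (tv gb' gb ?c' ?c) = ip (Sp ((g\<boxdot>g')\<boxdot>(gb'\<boxdot>gb))) (tv (g\<boxdot>g') (gb'\<boxdot>gb) (tv g g' \<psi> \<psi>') a) (Fa ?Rb \<Omega>)"
  proof (induct rule: tv_induct)
   case (tv x y)
   note [simp] = tv
   let ?t = "tv g' gb' \<psi>' x" let ?k = "ip (Sp (unt C)) \<Omega> (Fa (rb'\<dagger>) ?t)"
   have h: "rb'\<dagger> \<in> Hom C (g'\<boxdot>gb') (unt C)" "idn C gb \<in> Hom C gb gb" "idn C g \<in> Hom C g g"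
    "rb'\<dagger>|>gb \<in> Hom C (g'\<boxdot>(gb'\<boxdot>gb)) gb" "g<|(rb'|>gb) \<in> Hom C (g\<boxdot>gb) (g\<boxdot>(g'\<boxdot>(gb'\<boxdot>gb)))"
    "g<|(rb'\<dagger>|>gb) \<in> Hom C (g\<boxdot>(g'\<boxdot>(gb'\<boxdot>gb))) (g\<boxdot>gb)"
    by (simp_all add: in_Hom)
   have [simp]: "?t \<in> Vec (g'\<boxdot>gb')" by (simp add: tv_mem)
   have Ft: "Fa (rb'\<dagger>) ?t \<in> Vec (unt C)" by (rule F_mem[OF h(1)]) simp_all
   have k: "cnj ?k = ip (Sp gb') x ?c'"
   proof -
    have "ip (Sp (g'\<boxdot>gb')) (Fa rb' \<Omega>) ?t = ?k"
     by (rule F_adjoint[OF sol_hom(2)[OF g(2) s']]) (simp_all add: \<Omega>_mem)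
    then show ?thesis
     using cvec(2)[OF g(2) s' \<psi>(2) tv(1)] fd_hilbert.ip_cnj[OF hilb Fr_mem(2)[OF g(2) s'], of ?t] by simp
   qed
   have 1: "Fa (rb'\<dagger>|>gb) (tv (g'\<boxdot>gb') gb ?t y) = ?k \<odot>\<^bsub>Sp gb\<^esub> y"
    using F_tv[OF h(1,2), of ?t y] \<Omega>_span[OF Ft] tv_scale_left[of "unt C" gb \<Omega> y ?k]
    by (simp add: F.Fa_idn \<Omega>_mem tv_unt)
   have 2: "Fa (g<|(rb'\<dagger>|>gb)) (tv g (g'\<boxdot>(gb'\<boxdot>gb)) \<psi> (tv (g'\<boxdot>gb') gb ?t y)) = ?k \<odot>\<^bsub>Sp (g\<boxdot>gb)\<^esub> tv g gb \<psi> y"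
    using F_tv[OF h(3) h(4), of \<psi> "tv (g'\<boxdot>gb') gb ?t y"] tv_mem[of "g'\<boxdot>gb'" gb ?t y] 1 tv_scale_right[of g gb \<psi> y ?k]
    by (simp add: F.Fa_idn)
   have 3: "tv (g\<boxdot>g') (gb'\<boxdot>gb) (tv g g' \<psi> \<psi>') (tv gb' gb x y) = tv g (g'\<boxdot>(gb'\<boxdot>gb)) \<psi> (tv (g'\<boxdot>gb') gb ?t y)"
    by (simp add: tv_assoc tv_mem)
   have m: "tv g (g'\<boxdot>(gb'\<boxdot>gb)) \<psi> (tv (g'\<boxdot>gb') gb ?t y) \<in> Vec (g\<boxdot>(g'\<boxdot>(gb'\<boxdot>gb)))"
    using tv_mem[of "g'\<boxdot>gb'" gb ?t y] by (intro tv_mem) simp_all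
   have "Fa ?Rb \<Omega> = Fa (g<|(rb'|>gb)) (Fa rb \<Omega>)"
    by (rule F.Fa_cmp[OF _ _ _ h(5) sol_hom(2)[OF g(1) s]]) (simp_all add: \<Omega>_mem)
   then have "ip (Sp ((g\<boxdot>g')\<boxdot>(gb'\<boxdot>gb))) (tv (g\<boxdot>g') (gb'\<boxdot>gb) (tv g g' \<psi> \<psi>') (tv gb' gb x y)) (Fa ?Rb \<Omega>) =
     ip (Sp (g\<boxdot>gb)) (?k \<odot>\<^bsub>Sp (g\<boxdot>gb)\<^esub> tv g gb \<psi> y) (Fa rb \<Omega>)"
    using F_adjoint[OF h(6) _ _ m Fr_mem(2)[OF g(1) s]] by (simp add: 2 3)
   also have "\<dots> = cnj ?k * ip (Sp gb) y ?c"
    using cvec(2)[OF g(1) s \<psi>(1) tv(2)] Fr_mem(2)[OF g(1) s] by (simp add: g.ip_scale_l tv_mem)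
   finally show ?case by (simp add: k tv_ip)
  next
   case (add x y)
   have e: "tv (g\<boxdot>g') (gb'\<boxdot>gb) (tv g g' \<psi> \<psi>') (x \<oplus>\<^bsub>Sp (gb'\<boxdot>gb)\<^esub> y) =
    tv (g\<boxdot>g') (gb'\<boxdot>gb) (tv g g' \<psi> \<psi>') x \<oplus>\<^bsub>Sp ((g\<boxdot>g')\<boxdot>(gb'\<boxdot>gb))\<^esub> tv (g\<boxdot>g') (gb'\<boxdot>gb) (tv g g' \<psi> \<psi>') y"
    by (rule tv_add_right) (use add tm in simp_all)
   have m: "tv (g\<boxdot>g') (gb'\<boxdot>gb) (tv g g' \<psi> \<psi>') z \<in> Vec ((g\<boxdot>g')\<boxdot>(gb'\<boxdot>gb))" if "z \<in> Vec (gb'\<boxdot>gb)" for z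
    by (rule tv_mem) (use that tm in simp_all)
   show ?case unfolding e q.ip_add_l[OF Fm m[OF add(1)] m[OF add(2)]] add(3,4)[symmetric]
    by (rule t.ip_add_l) (use add in "simp_all add: tv_mem")
  next
   case (smult d x)
   have e: "tv (g\<boxdot>g') (gb'\<boxdot>gb) (tv g g' \<psi> \<psi>') (d \<odot>\<^bsub>Sp (gb'\<boxdot>gb)\<^esub> x) =
    d \<odot>\<^bsub>Sp ((g\<boxdot>g')\<boxdot>(gb'\<boxdot>gb))\<^esub> tv (g\<boxdot>g') (gb'\<boxdot>gb) (tv g g' \<psi> \<psi>') x"
    by (rule tv_scale_right) (use smult tm in simp_all)
   have m: "tv (g\<boxdot>g') (gb'\<boxdot>gb) (tv g g' \<psi> \<psi>') x \<in> Vec ((g\<boxdot>g')\<boxdot>(gb'\<boxdot>gb))"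
    by (rule tv_mem) (use smult tm in simp_all)
   show ?case unfolding e q.ip_scale_l[OF Fm m] smult(2)[symmetric]
    by (rule t.ip_scale_l) (use smult in "simp_all add: tv_mem")
  qed
 qed
qed

lemma cr_star_star:
 assumes "f \<in> Hom CR \<rho> \<sigma>"
 shows "cr_star (cr_star f) = f"
proof -
 obtain g T \<psi> where ok: "gen_ok \<rho> \<sigma> g T \<psi>" and f: "f = gen \<rho> \<sigma> g T \<psi>" using CR_gen[OF assms] by blast
 note [simp] = gen_okD[OF ok]
 have g: "g \<in> S" by simp
 obtain gb r rb where s: "conjugate_solution C g gb r rb" using solution_exists[of g] by auto
 note [simp] = conjugateD(1-8)[OF s]
 have 1: "(rb\<dagger>|>\<sigma>)\<cdot>((g\<boxdot>gb)<|T) = T\<cdot>(rb\<dagger>|>(g\<boxdot>\<rho>))"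
  using slide[of "rb\<dagger>" T "g\<boxdot>gb" "unt C" "g\<boxdot>\<rho>" \<sigma>] by simp
 have 2: "(rb\<dagger>|>(g\<boxdot>\<rho>))\<cdot>(g<|(r|>\<rho>)) = idn C (g\<boxdot>\<rho>)"
  using arg_cong[OF conjugateD(9)[OF s], of "%x. x|>\<rho>"] by (simp add: whisker_cmp)
 have "(rb\<dagger>|>\<sigma>)\<cdot>(g<|((r\<dagger>|>\<rho>)\<cdot>(gb<|T\<dagger>))\<dagger>) =
   ((rb\<dagger>|>\<sigma>)\<cdot>((g\<boxdot>gb)<|T))\<cdot>(g<|(r|>\<rho>))"
  by (simp add: whisker_cmp star_star)
 also have "\<dots> = T\<cdot>((rb\<dagger>|>(g\<boxdot>\<rho>))\<cdot>(g<|(r|>\<rho>)))" unfolding 1 by simp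
 also have "\<dots> = T" unfolding 2 by simp
 finally have a: "(rb\<dagger>|>\<sigma>)\<cdot>(g<|((r\<dagger>|>\<rho>)\<cdot>(gb<|T\<dagger>))\<dagger>) = T" .
 show ?thesis
  unfolding f cr_star_gen[OF ok s] gstar_def cr_star_gen[OF gstar_ok[OF ok s] conjugate_solution_sym[OF s]] a
  by (subst cvec_cvec[OF g s]) simp_all
qed

lemma cr_star_cmp:
 assumes "f \<in> Hom CR \<sigma> \<tau>" "f' \<in> Hom CR \<rho> \<sigma>"
 shows "cr_star (cr_cmp f f') = cr_cmp (cr_star f') (cr_star f)"
proof -
 obtain g T \<psi> where ok: "gen_ok \<sigma> \<tau> g T \<psi>" and f: "f = gen \<sigma> \<tau> g T \<psi>" using CR_gen[OF assms(1)] by blast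
 obtain g' T' \<psi>' where ok': "gen_ok \<rho> \<sigma> g' T' \<psi>'" and f': "f' = gen \<rho> \<sigma> g' T' \<psi>'" using CR_gen[OF assms(2)] by blast
 note [simp] = gen_okD[OF ok] gen_okD[OF ok']
 have gS: "g \<in> S" "g' \<in> S" and p: "\<psi> \<in> Vec g" "\<psi>' \<in> Vec g'" by simp_all
 obtain gb r rb where s: "conjugate_solution C g gb r rb" using solution_exists[of g] by auto
 obtain gb' r' rb' where s': "conjugate_solution C g' gb' r' rb'" using solution_exists[of g'] by auto
 note [simp] = conjugateD(1-8)[OF s] conjugateD(1-8)[OF s']
 have 1: "(r\<dagger>|>(g'\<boxdot>\<rho>))\<cdot>((gb\<boxdot>g)<|T'\<dagger>) = T'\<dagger>\<cdot>(r\<dagger>|>\<sigma>)"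
  using slide[of "r\<dagger>" "T'\<dagger>" "gb\<boxdot>g" "unt C" \<sigma> "g'\<boxdot>\<rho>"] by simp
 have 2: "(gb'<|(r\<dagger>|>(g'\<boxdot>\<rho>)))\<cdot>((gb'\<boxdot>(gb\<boxdot>g))<|T'\<dagger>) = (gb'<|T'\<dagger>)\<cdot>(gb'<|(r\<dagger>|>\<sigma>))"
  using arg_cong[OF 1, of "%x. gb'<|x"] by (simp add: whisker_cmp)
 have "((((gb'<|(r|>g'))\<cdot>r')\<dagger>|>\<rho>)\<cdot>((gb'\<boxdot>gb)<|(T\<cdot>(g<|T'))\<dagger>)) =
   (r'\<dagger>|>\<rho>)\<cdot>(((gb'<|(r\<dagger>|>(g'\<boxdot>\<rho>)))\<cdot>((gb'\<boxdot>(gb\<boxdot>g))<|T'\<dagger>))\<cdot>((gb'\<boxdot>gb)<|T\<dagger>))"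
  by (simp add: whisker_cmp)
 also have "\<dots> = ((r'\<dagger>|>\<rho>)\<cdot>(gb'<|T'\<dagger>))\<cdot>(gb'<|((r\<dagger>|>\<sigma>)\<cdot>(gb<|T\<dagger>)))"
  unfolding 2 by (simp add: whisker_cmp)
 finally have a: "((((gb'<|(r|>g'))\<cdot>r')\<dagger>|>\<rho>)\<cdot>((gb'\<boxdot>gb)<|(T\<cdot>(g<|T'))\<dagger>)) =
   ((r'\<dagger>|>\<rho>)\<cdot>(gb'<|T'\<dagger>))\<cdot>(gb'<|((r\<dagger>|>\<sigma>)\<cdot>(gb<|T\<dagger>)))" .
 show ?thesis
  unfolding f f' cr_cmp_gen(1)[OF ok ok'] cr_star_gen[OF ok s] cr_star_gen[OF ok' s']
   cr_star_gen[OF cr_cmp_gen(2)[OF ok ok'] conjugate_tensor[OF s s']] gstar_def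
   cr_cmp_gen(1)[OF gstar_ok[OF ok' s'] gstar_ok[OF ok s]] cvec_tensor[OF gS s s' p] a ..
qed

text \<open>With the nested solution for \<open>g g'\<close> the left side is a tensor over \<open>gb' gb\<close> and the right side one over \<open>gb gb'\<close>;
 the braiding of \<open>gb'\<close> with \<open>gb\<close> matches them, and \<open>b1\<close> moves \<open>r'\<close> past \<open>\<rho>\<close>.\<close>

lemma cr_star_tar:
 assumes "f \<in> Hom CR \<rho> \<sigma>" "f' \<in> Hom CR \<rho>' \<sigma>'"
 shows "cr_star (cr_tar f f') = cr_tar (cr_star f) (cr_star f')"
proof -
 obtain g T \<psi> where ok: "gen_ok \<rho> \<sigma> g T \<psi>" and f: "f = gen \<rho> \<sigma> g T \<psi>" using CR_gen[OF assms(1)] by blast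
 obtain g' T' \<psi>' where ok': "gen_ok \<rho>' \<sigma>' g' T' \<psi>'" and f': "f' = gen \<rho>' \<sigma>' g' T' \<psi>'" using CR_gen[OF assms(2)] by blast
 note [simp] = gen_okD[OF ok] gen_okD[OF ok']
 have gS: "g \<in> S" "g' \<in> S" and p: "\<psi> \<in> Vec g" "\<psi>' \<in> Vec g'" by simp_all
 obtain gb r rb where s: "conjugate_solution C g gb r rb" using solution_exists[of g] by auto
 obtain gb' r' rb' where s': "conjugate_solution C g' gb' r' rb'" using solution_exists[of g'] by auto
 note [simp] = conjugateD(1-8)[OF s] conjugateD(1-8)[OF s'] gb[OF gS(1) s] gb[OF gS(2) s']
 let ?c = "cvec g gb rb \<psi>" and ?c' = "cvec g' gb' rb' \<psi>'"
 note [simp] = cvec(1)[OF gS(1) s p(1)] cvec(1)[OF gS(2) s' p(2)]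
 \<comment> \<open>the arrow components of the stars of \<open>f\<close> and \<open>f'\<close>\<close>
 define X where "X = (r\<dagger>|>\<rho>)\<cdot>(gb<|T\<dagger>)"
 define Y where "Y = (r'\<dagger>|>\<rho>')\<cdot>(gb'<|T'\<dagger>)"
 have X[simp]: "X \<in> Arr C" "Dom C X = gb\<boxdot>\<sigma>" "Cod C X = \<rho>" by (simp_all add: X_def)
 have Y[simp]: "Y \<in> Arr C" "Dom C Y = gb'\<boxdot>\<sigma>'" "Cod C Y = \<rho>'" by (simp_all add: Y_def)
 let ?P = "(X \<boxtimes> Y)\<cdot>(gb<|(braid C gb' \<sigma>|>\<sigma>'))"
 let ?Q = "(((gb'<|(r|>g'))\<cdot>r')\<dagger>|>(\<rho>\<boxdot>\<rho>')) \<cdot>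
  ((gb'\<boxdot>gb)<|((T \<boxtimes> T')\<cdot>(g<|(braid C g' \<rho>|>\<rho>')))\<dagger>)"
 let ?M = "gb'<|(X \<boxtimes> T'\<dagger>)"
 have b1: "(\<rho><|r'\<dagger>)\<cdot>(braid C gb' \<rho>|>g') = (r'\<dagger>|>\<rho>)\<cdot>(gb'<|(braid C g' \<rho>)\<dagger>)"
 proof -
  have "(\<rho><|r'\<dagger>)\<cdot>braid C (gb'\<boxdot>g') \<rho> = r'\<dagger>|>\<rho>"
   using braid_nat[of "r'\<dagger>" "idn C \<rho>" "gb'\<boxdot>g'" "unt C" \<rho> \<rho>] by simp
  moreover have "braid C (gb'\<boxdot>g') \<rho> = (braid C gb' \<rho>|>g')\<cdot>(gb'<|braid C g' \<rho>)"
   by (rule braid_tob_left) simp_all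
  ultimately have "r'\<dagger>|>\<rho> = (\<rho><|r'\<dagger>)\<cdot>((braid C gb' \<rho>|>g')\<cdot>(gb'<|braid C g' \<rho>))" by simp
  then have "(r'\<dagger>|>\<rho>)\<cdot>(gb'<|(braid C g' \<rho>)\<dagger>) =
   (\<rho><|r'\<dagger>)\<cdot>((braid C gb' \<rho>|>g')\<cdot>((gb'<|braid C g' \<rho>)\<cdot>(gb'<|(braid C g' \<rho>)\<dagger>)))" by simp
  also have "(gb'<|braid C g' \<rho>)\<cdot>(gb'<|(braid C g' \<rho>)\<dagger>) = idn C (gb'\<boxdot>(\<rho>\<boxdot>g'))"
   using braid_unitary[of g' \<rho>] by (simp add: interch)
  finally show ?thesis by simp
 qed
 have a: "?P\<cdot>(braid C gb' gb|>(\<sigma>\<boxdot>\<sigma>')) = ?Q"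
 proof -
  have p1: "(X|>gb')\<cdot>((gb<|braid C gb' \<sigma>)\<cdot>(braid C gb' gb|>\<sigma>)) = braid C gb' \<rho>\<cdot>(gb'<|X)"
   using braid_tob_right[of gb' gb \<sigma>] braid_nat[of "idn C gb'" X gb' gb' "gb\<boxdot>\<sigma>" \<rho>] by simp
  have "?P\<cdot>(braid C gb' gb|>(\<sigma>\<boxdot>\<sigma>')) = (X \<boxtimes> Y)\<cdot>(((gb<|braid C gb' \<sigma>)\<cdot>(braid C gb' gb|>\<sigma>))|>\<sigma>')"
   by (simp add: whisker_cmp)
  also have "\<dots> = ((\<rho><|Y)\<cdot>(X|>(gb'\<boxdot>\<sigma>')))\<cdot>(((gb<|braid C gb' \<sigma>)\<cdot>(braid C gb' gb|>\<sigma>))|>\<sigma>')"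
   using tar_split'[of X Y] by simp
  also have "((\<rho><|Y)\<cdot>(X|>(gb'\<boxdot>\<sigma>')))\<cdot>(((gb<|braid C gb' \<sigma>)\<cdot>(braid C gb' gb|>\<sigma>))|>\<sigma>') =
    (\<rho><|Y)\<cdot>(((X|>gb')\<cdot>((gb<|braid C gb' \<sigma>)\<cdot>(braid C gb' gb|>\<sigma>)))|>\<sigma>')"
   by (simp add: whisker_cmp)
  also have "\<dots> = (\<rho><|(r'\<dagger>|>\<rho>'))\<cdot>(((\<rho>\<boxdot>gb')<|T'\<dagger>)\<cdot>((braid C gb' \<rho>|>\<sigma>')\<cdot>(gb'<|(X|>\<sigma>'))))"
   unfolding p1 Y_def by (simp add: whisker_cmp)
  also have "((\<rho>\<boxdot>gb')<|T'\<dagger>)\<cdot>((braid C gb' \<rho>|>\<sigma>')\<cdot>(gb'<|(X|>\<sigma>'))) =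
    (braid C gb' \<rho>|>(g'\<boxdot>\<rho>'))\<cdot>?M"
  proof -
   have 1: "((\<rho>\<boxdot>gb')<|T'\<dagger>)\<cdot>(braid C gb' \<rho>|>\<sigma>') = (braid C gb' \<rho>|>(g'\<boxdot>\<rho>'))\<cdot>((gb'\<boxdot>\<rho>)<|T'\<dagger>)"
    by (rule slide[symmetric]) simp_all
   have 2: "((gb'\<boxdot>\<rho>)<|T'\<dagger>)\<cdot>(gb'<|(X|>\<sigma>')) = ?M"
    using tar_split'[of "gb'<|X" "T'\<dagger>"] by simp
   show ?thesis using cmp_eq_cmp[OF 1, of "gb'<|(X|>\<sigma>')"] 2 by simp
  qed
  also have "(\<rho><|(r'\<dagger>|>\<rho>'))\<cdot>((braid C gb' \<rho>|>(g'\<boxdot>\<rho>'))\<cdot>?M) =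
    (((\<rho><|r'\<dagger>)\<cdot>(braid C gb' \<rho>|>g'))|>\<rho>')\<cdot>?M" by (simp add: whisker_cmp)
  also have "\<dots> = (r'\<dagger>|>(\<rho>\<boxdot>\<rho>'))\<cdot>((gb'<|((braid C g' \<rho>)\<dagger>|>\<rho>'))\<cdot>?M)"
   unfolding b1 by (simp add: whisker_cmp)
  also have "\<dots> = ?Q"
  proof -
   have 1: "(r\<dagger>|>(g'\<boxdot>(\<rho>\<boxdot>\<rho>')))\<cdot>((gb\<boxdot>g)<|((braid C g' \<rho>)\<dagger>|>\<rho>')) =
     ((braid C g' \<rho>)\<dagger>|>\<rho>')\<cdot>(r\<dagger>|>(\<rho>\<boxdot>(g'\<boxdot>\<rho>')))"
    using slide[of "r\<dagger>" "(braid C g' \<rho>)\<dagger>|>\<rho>'" "gb\<boxdot>g" "unt C" "\<rho>\<boxdot>(g'\<boxdot>\<rho>')" "g'\<boxdot>(\<rho>\<boxdot>\<rho>')"] by simp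
   have 2: "X \<boxtimes> T'\<dagger> = (r\<dagger>|>(\<rho>\<boxdot>(g'\<boxdot>\<rho>')))\<cdot>(gb<|(T\<dagger> \<boxtimes> T'\<dagger>))"
    unfolding X_def using interch[of "r\<dagger>|>\<rho>" "gb<|T\<dagger>" "idn C (g'\<boxdot>\<rho>')" "T'\<dagger>"] by simp
   have "?Q = (r'\<dagger>|>(\<rho>\<boxdot>\<rho>'))\<cdot>((gb'<|((r\<dagger>|>(g'\<boxdot>(\<rho>\<boxdot>\<rho>')))\<cdot>((gb\<boxdot>g)<|((braid C g' \<rho>)\<dagger>|>\<rho>')))) \<cdot>
     ((gb'\<boxdot>gb)<|(T\<dagger> \<boxtimes> T'\<dagger>)))"
    by (simp add: whisker_cmp star_tar)
   then show ?thesis unfolding 1 2 by (simp add: whisker_cmp)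
  qed
  finally show ?thesis .
 qed
 have bh: "braid C gb' gb \<in> Hom C (gb'\<boxdot>gb) (gb\<boxdot>gb')" by (simp add: in_Hom)
 have Fb: "Fa (braid C gb' gb) (tv gb' gb ?c' ?c) = tv gb gb' ?c ?c'" by (rule F.Fa_braid) simp_all
 note okP = cr_tar_gen(2)[OF gstar_ok[OF ok s] gstar_ok[OF ok' s'], folded X_def Y_def]
 have "cr_tar (cr_star f) (cr_star f') = gen (\<sigma>\<boxdot>\<sigma>') (\<rho>\<boxdot>\<rho>') (gb\<boxdot>gb') ?P (Fa (braid C gb' gb) (tv gb' gb ?c' ?c))"
  unfolding Fb f f' cr_star_gen[OF ok s] cr_star_gen[OF ok' s'] gstar_def cr_tar_gen(1)[OF gstar_ok[OF ok s] gstar_ok[OF ok' s']] X_def Y_def ..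
 also have "\<dots> = gen (\<sigma>\<boxdot>\<sigma>') (\<rho>\<boxdot>\<rho>') (gb'\<boxdot>gb) (?P\<cdot>(braid C gb' gb|>(\<sigma>\<boxdot>\<sigma>'))) (tv gb' gb ?c' ?c)"
  by (rule gen_natural[symmetric, OF _ _ bh]) (use okP in "simp_all add: Fb tv_mem")
 finally show ?thesis
  unfolding a f f' cr_tar_gen(1)[OF ok ok'] cr_star_gen[OF cr_tar_gen(2)[OF ok ok'] conjugate_tensor[OF s s']]
   gstar_def cvec_tensor[OF gS s s' p] by simp
qed

lemma tensor_category_with_star_CR: "tensor_category_with_star CR"
proof (intro tensor_category_with_star.intro[OF complex_tensor_category_CR] tensor_category_with_star_axioms.intro)
 fix f \<rho> \<sigma> assume a: "f \<in> Hom CR \<rho> \<sigma>"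
 obtain g T \<psi> where ok: "gen_ok \<rho> \<sigma> g T \<psi>" and f: "f = gen \<rho> \<sigma> g T \<psi>" using CR_gen[OF a] by blast
 obtain gb r rb where s: "conjugate_solution C g gb r rb" using solution_exists[of g] ok by (auto simp: gen_ok_def)
 show "f\<dagger>\<^bsub>CR\<^esub> \<in> Hom CR \<sigma> \<rho>" using gen_CR[OF gstar_ok[OF ok s]] cr_star_gen[OF ok s] by (simp add: f gstar_def)
next
 fix f assume "f \<in> Arr CR"
 then show "(f\<dagger>\<^bsub>CR\<^esub>)\<dagger>\<^bsub>CR\<^esub> = f" unfolding Arr_CR using cr_star_star by simp
next
 fix f f' \<rho> \<sigma> assume a: "f \<in> Hom CR \<rho> \<sigma>" "f' \<in> Hom CR \<rho> \<sigma>"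
 obtain k T T' \<psi> where g: "gen_ok \<rho> \<sigma> k T \<psi>" "gen_ok \<rho> \<sigma> k T' \<psi>" "gen_ok \<rho> \<sigma> k (hadd C T T') \<psi>"
  "f = gen \<rho> \<sigma> k T \<psi>" "f' = gen \<rho> \<sigma> k T' \<psi>" "cr_add f f' = gen \<rho> \<sigma> k (hadd C T T') \<psi>" using CR_gen2[OF a] by blast
 note [simp] = gen_okD[OF g(1)] gen_okD[OF g(2)]
 obtain gb r rb where s: "conjugate_solution C k gb r rb" using solution_exists[of k] by auto
 note [simp] = conjugateD(1-8)[OF s]
 show "(hadd CR f f')\<dagger>\<^bsub>CR\<^esub> = hadd CR (f\<dagger>\<^bsub>CR\<^esub>) (f'\<dagger>\<^bsub>CR\<^esub>)"
  unfolding CR_simps g(6) unfolding g(4,5) cr_star_gen[OF g(1) s] cr_star_gen[OF g(2) s] cr_star_gen[OF g(3) s] gstar_def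
   gen_add_arrow[OF gstar_ok[OF g(1) s] gstar_ok[OF g(2) s]] by (simp add: cmp_hadd tar_hadd)
next
 fix f c assume a: "f \<in> Arr CR"
 obtain \<rho> \<sigma> k T \<psi> where g: "gen_ok \<rho> \<sigma> k T \<psi>" "f = gen \<rho> \<sigma> k T \<psi>" using CR_gen a unfolding Arr_CR by blast
 note [simp] = gen_okD[OF g(1)]
 obtain gb r rb where s: "conjugate_solution C k gb r rb" using solution_exists[of k] by auto
 note [simp] = conjugateD(1-8)[OF s]
 have okc: "gen_ok \<rho> \<sigma> k (hscale C c T) \<psi>" by (simp add: gen_ok_def)
 show "(hscale CR c f)\<dagger>\<^bsub>CR\<^esub> = hscale CR (cnj c) (f\<dagger>\<^bsub>CR\<^esub>)"
  unfolding CR_simps g(2) gen_scale(1)[OF g(1)] cr_star_gen[OF g(1) s] cr_star_gen[OF okc s] gstar_def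
   gen_scale(1)[OF gstar_ok[OF g(1) s]] by (simp add: star_scale)
next
 fix g f \<rho> \<sigma> \<tau> assume "g \<in> Hom CR \<sigma> \<tau>" "f \<in> Hom CR \<rho> \<sigma>"
 then show "(g \<cdot>\<^bsub>CR\<^esub> f)\<dagger>\<^bsub>CR\<^esub> = f\<dagger>\<^bsub>CR\<^esub> \<cdot>\<^bsub>CR\<^esub> g\<dagger>\<^bsub>CR\<^esub>" using cr_star_cmp by simp
next
 fix f g assume "f \<in> Arr CR" "g \<in> Arr CR"
 then show "(f \<boxtimes>\<^bsub>CR\<^esub> g)\<dagger>\<^bsub>CR\<^esub> = f\<dagger>\<^bsub>CR\<^esub> \<boxtimes>\<^bsub>CR\<^esub> g\<dagger>\<^bsub>CR\<^esub>" unfolding Arr_CR using cr_star_tar by simp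
qed

lemma incl_star:
 assumes a: "a \<in> Hom C \<rho> \<sigma>"
 shows "cr_star (incl a) = incl (a\<dagger>)"
proof -
 note [simp] = HomD[OF a]
 have [simp]: "\<rho> \<in> Obj C" "\<sigma> \<in> Obj C" using Hom_obj[OF a] by auto
 have d: "a\<dagger> \<in> Hom C \<sigma> \<rho>" by (simp add: in_Hom)
 have "cvec (unt C) (unt C) (idn C (unt C)) \<Omega> = \<Omega>"
  by (rule cvec_eqI[OF _ solution_unt]) (simp_all add: \<Omega>_mem F.Fa_idn tv_unt)
 then show ?thesis
  unfolding incl_gen(2)[OF a] incl_gen(2)[OF d] cr_star_gen[OF incl_gen(1)[OF a] solution_unt] gstar_def by simp
qed

lemma incl_solution:
 assumes s: "conjugate_solution C \<rho> \<rho>b r rb"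
 shows "conjugate_solution CR \<rho> \<rho>b (incl r) (incl rb)"
proof -
 note D = conjugateD[OF s]
 note [simp] = D(1-8)
 have h: "r \<in> Hom C (unt C) (\<rho>b\<boxdot>\<rho>)" "rb \<in> Hom C (unt C) (\<rho>\<boxdot>\<rho>b)" "r\<dagger> \<in> Hom C (\<rho>b\<boxdot>\<rho>) (unt C)" "rb\<dagger> \<in> Hom C (\<rho>\<boxdot>\<rho>b) (unt C)"
  "idn C \<rho> \<in> Hom C \<rho> \<rho>" "idn C \<rho>b \<in> Hom C \<rho>b \<rho>b" by (simp_all add: in_Hom)
 have h': "rb\<dagger>|>\<rho> \<in> Hom C (\<rho>\<boxdot>(\<rho>b\<boxdot>\<rho>)) \<rho>" "\<rho><|r \<in> Hom C \<rho> (\<rho>\<boxdot>(\<rho>b\<boxdot>\<rho>))"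
  "r\<dagger>|>\<rho>b \<in> Hom C (\<rho>b\<boxdot>(\<rho>\<boxdot>\<rho>b)) \<rho>b" "\<rho>b<|rb \<in> Hom C \<rho>b (\<rho>b\<boxdot>(\<rho>\<boxdot>\<rho>b))" by (simp_all add: in_Hom)
 show ?thesis unfolding conjugate_solution_def CR_simps
  using incl_hom[OF h(1)] incl_hom[OF h(2)]
  by (simp only: incl_star[OF h(1)] incl_star[OF h(2)] incl_tar[OF h(4,5)] incl_tar[OF h(5,1)] incl_tar[OF h(3,6)] incl_tar[OF h(6,2)]
    incl_cmp[OF h'(1,2)] incl_cmp[OF h'(3,4)] D(1,2,9,10))
qed

end

section \<open>Positivity, finite dimension, direct sums and braiding of the crossed product\<close>

context tensor_category_with_star
begin

text \<open>Frobenius reciprocity reduces properties of all arrows to arrows out of the unit.\<close>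

lemma tensor_star_from_unit:
 assumes sol: "!!\<rho>. \<rho> \<in> Obj C ==> \<exists>\<rho>b r rb. conjugate_solution C \<rho> \<rho>b r rb"
  and pos: "!!\<tau> f. [|f \<in> Hom C (unt C) \<tau>; f\<dagger>\<cdot>f = hzero C (unt C) (unt C)|] ==> f = hzero C (unt C) \<tau>"
 shows "tensor_star_category C"
proof
 fix f \<rho> \<sigma> assume f: "f \<in> Hom C \<rho> \<sigma>" and z: "f\<dagger>\<cdot>f = hzero C \<rho> \<rho>"
 have o: "\<rho> \<in> Obj C" "\<sigma> \<in> Obj C" using Hom_obj[OF f] by auto
 note [simp] = HomD[OF f] o
 obtain \<rho>b r rb where s: "conjugate_solution C \<rho> \<rho>b r rb" using sol[OF o(1)] by blast
 note [simp] = conjugateD(1-8)[OF s]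
 \<comment> \<open>the transpose of \<open>f\<close>, an arrow out of the unit\<close>
 define h where "h = (\<rho>b<|f)\<cdot>r"
 have "h\<dagger>\<cdot>h = r\<dagger>\<cdot>((\<rho>b<|(f\<dagger>\<cdot>f))\<cdot>r)" by (simp add: h_def whisker_cmp)
 also have "\<dots> = hzero C (unt C) (unt C)" unfolding z by simp
 finally have "h = hzero C (unt C) (\<rho>b\<boxdot>\<sigma>)" by (rule pos[rotated]) (simp add: h_def in_Hom)
 then show "f = hzero C \<rho> \<sigma>" using frobenius_left[OF s, of f \<sigma>] by (simp add: h_def[symmetric])
qed

lemma finite_dimensional_from_unit:
 assumes s: "conjugate_solution C \<rho> \<rho>b r rb" and \<sigma>[simp]: "\<sigma> \<in> Obj C"
  and fd: "finite_dimensional (hom_space C (unt C) (\<rho>b\<boxdot>\<sigma>))"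
 shows "finite_dimensional (hom_space C \<rho> \<sigma>)"
proof -
 note [simp] = conjugateD(1-8)[OF s]
 show ?thesis
 proof (rule finite_dimensional_image[OF vector_space vector_space fd, where f = "%h. (rb\<dagger>|>\<sigma>)\<cdot>(\<rho><|h)"])
  fix y assume "y \<in> carrier (hom_space C \<rho> \<sigma>)"
  then have y: "y \<in> Arr C" "Dom C y = \<rho>" "Cod C y = \<sigma>" by (simp_all add: in_Hom)
  then show "\<exists>x\<in>carrier (hom_space C (unt C) (\<rho>b\<boxdot>\<sigma>)). y = (rb\<dagger>|>\<sigma>)\<cdot>(\<rho><|x)"
   by (intro bexI[of _ "(\<rho>b<|y)\<cdot>r"]) (simp_all add: frobenius_left[OF s y] in_Hom)
 qed (simp_all add: in_Hom cmp_hadd tar_hadd)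
qed

end

context crossed_product_setting
begin

text \<open>An arrow out of the unit is a sum over those irreducible components of its target which lie in the
 subcategory: an arrow from an object of the subcategory into any other irreducible object vanishes.\<close>

lemma arrow_through_S:
 assumes ok: "gen_ok (unt C) \<tau> g T \<psi>" and Q: "decomposition C \<tau> Q"
 shows "T = hsum C g \<tau> (%u. u\<cdot>(u\<dagger>\<cdot>T)) {u \<in> Q. Dom C u \<in> S}"
proof -
 note [simp] = gen_okD[OF ok]
 note d = decompositionD[OF Q]
 have gS: "g \<in> S" and gO: "g \<in> Obj C" by simp_all
 interpret h: cvs "hom_space C g \<tau>" by (simp add: hom_cvs)
 have z: "u\<dagger>\<cdot>T = hzero C g (Dom C u)" if u: "u \<in> Q" "Dom C u \<notin> S" for u
 proof (rule ccontr)
  note [simp] = d(4,5)[OF u(1)]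
  assume n: "u\<dagger>\<cdot>T ~= hzero C g (Dom C u)"
  have "T\<dagger>\<cdot>u ~= hzero C (Dom C u) g"
  proof
   assume "T\<dagger>\<cdot>u = hzero C (Dom C u) g"
   then have "(T\<dagger>\<cdot>u)\<dagger> = hzero C g (Dom C u)" by simp
   then show False using n by (simp add: star_star)
  qed
  then obtain e where "isometry C (Dom C u) g e"
   using normalize_isometry[OF d(2)[OF u(1)], of "T\<dagger>\<cdot>u"] by auto
  then have "Dom C u \<in> S" by (rule sub.subobject_mem[OF gS, rotated]) simp
  then show False using u by simp
 qed
 have "T = hsum C g \<tau> (%u. u\<cdot>(u\<dagger>\<cdot>T)) Q" using expand_cod[OF Q, of T] by simp
 also have "\<dots> = hsum C g \<tau> (%u. u\<cdot>(u\<dagger>\<cdot>T)) {u \<in> Q. Dom C u \<in> S}"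
 proof (rule h.finsum_subset[symmetric, OF d(1)])
  show "(%u. u\<cdot>(u\<dagger>\<cdot>T)) \<in> Q \<rightarrow> carrier (hom_space C g \<tau>)"
   by (intro Pi_I) (use d(4,5) in "simp add: in_Hom")
  fix u assume "u \<in> Q - {u \<in> Q. Dom C u \<in> S}"
  then show "u\<cdot>(u\<dagger>\<cdot>T) = \<zero>\<^bsub>hom_space C g \<tau>\<^esub>" using z[of u] d(4,5)[of u] by simp
 qed blast
 finally show ?thesis .
qed

lemma gen_unt_components:
 assumes ok: "gen_ok (unt C) \<tau> g T \<psi>" and Q: "decomposition C \<tau> Q" and u: "u \<in> Q" "Dom C u \<in> S"
 shows "Fa (u\<dagger>\<cdot>T) \<psi> \<in> Vec (Dom C u)"
  and "gen (unt C) \<tau> (Dom C u) u (Fa (u\<dagger>\<cdot>T) \<psi>) = gen (unt C) \<tau> g (u\<cdot>(u\<dagger>\<cdot>T)) \<psi>"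
proof -
 note [simp] = gen_okD[OF ok] decompositionD(4,5)[OF Q u(1)] u(2)
 have vh: "u\<dagger>\<cdot>T \<in> Hom C g (Dom C u)" by (simp add: in_Hom)
 show m: "Fa (u\<dagger>\<cdot>T) \<psi> \<in> Vec (Dom C u)" by (rule F_mem[OF vh]) simp_all
 show "gen (unt C) \<tau> (Dom C u) u (Fa (u\<dagger>\<cdot>T) \<psi>) = gen (unt C) \<tau> g (u\<cdot>(u\<dagger>\<cdot>T)) \<psi>"
  using gen_natural[where \<rho> = "unt C" and \<sigma> = \<tau> and T = u and \<psi> = \<psi>, OF _ _ vh] m by (simp add: gen_ok_def)
qed

lemma gen_unt_expansion:
 assumes ok: "gen_ok (unt C) \<tau> g T \<psi>" and Q: "decomposition C \<tau> Q"
 shows "gen (unt C) \<tau> g T \<psi> =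
  finsum (cr_space (unt C) \<tau>) (%u. gen (unt C) \<tau> (Dom C u) u (Fa (u\<dagger>\<cdot>T) \<psi>)) {u \<in> Q. Dom C u \<in> S}"
  (is "_ = finsum _ ?f ?Q")
proof -
 note [simp] = gen_okD[OF ok]
 note d = decompositionD[OF Q]
 interpret cr: cvs "cr_space (unt C) \<tau>" by (simp add: cr_cvs)
 have fin: "finite ?Q" using d(1) by simp
 have f: "?f u = gen (unt C) \<tau> g (u\<cdot>(u\<dagger>\<cdot>T)) \<psi>" "?f u \<in> cr_hom (unt C) \<tau>" if "u \<in> ?Q" for u
 proof -
  note [simp] = d(4,5)[of u]
  show "?f u = gen (unt C) \<tau> g (u\<cdot>(u\<dagger>\<cdot>T)) \<psi>" using gen_unt_components(2)[OF ok Q, of u] that by blast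
  then show "?f u \<in> cr_hom (unt C) \<tau>" using that by (simp add: gen_hom gen_ok_def)
 qed
 show ?thesis
 proof (rule cr_hom_eqI[OF gen_hom[OF ok]])
  show "finsum (cr_space (unt C) \<tau>) ?f ?Q \<in> cr_hom (unt C) \<tau>" using cr.M.finsum_closed[of ?f ?Q] f(2) by (simp add: Pi_iff)
  fix k \<phi> assume k[simp]: "k \<in> Ghat" "\<phi> \<in> Vec (\<gamma> k)"
  let ?d = "dyad k g \<phi> \<psi>"
  have "?d \<in> Hom C (\<gamma> k) g" by (rule dyad_hom) simp_all
  note dh = this and [simp] = HomD[OF this]
  have Ph: "(%u. u\<cdot>(u\<dagger>\<cdot>T)) \<in> ?Q \<rightarrow> Hom C g \<tau>" by (intro Pi_I) (use d(4,5) in "simp add: in_Hom")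
  have "val (gen (unt C) \<tau> g T \<psi>) k \<phi> = T\<cdot>?d" by simp
  also have "\<dots> = hsum C g \<tau> (%u. u\<cdot>(u\<dagger>\<cdot>T)) ?Q\<cdot>?d" using arrow_through_S[OF ok Q] by simp
  also have "\<dots> = hsum C (\<gamma> k) \<tau> (%u. (u\<cdot>(u\<dagger>\<cdot>T))\<cdot>?d) ?Q" by (rule hsum_cmp[OF fin Ph]) (simp_all add: dh)
  also have "\<dots> = hsum C (\<gamma> k) \<tau> (%u. val (?f u) k \<phi>) ?Q"
  proof (rule hsum_cong)
   fix u assume u: "u \<in> ?Q"
   note [simp] = d(4,5)[of u]
   show "(u\<cdot>(u\<dagger>\<cdot>T))\<cdot>?d = val (?f u) k \<phi>" unfolding f(1)[OF u] using u by simp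
  next
   show "(%u. val (?f u) k \<phi>) \<in> ?Q \<rightarrow> Hom C (\<gamma> k) \<tau>"
   proof
    fix u assume u: "u \<in> ?Q"
    show "val (?f u) k \<phi> \<in> Hom C (\<gamma> k) \<tau>" using cr_homD(4)[OF f(2)[OF u] k] by simp
   qed
  qed simp_all
  also have "\<dots> = val (finsum (cr_space (unt C) \<tau>) ?f ?Q) k \<phi>"
   using val_finsum[OF _ _ fin _ k, of "unt C" \<tau> ?f] f(2) by (simp add: Pi_iff)
  finally show "val (gen (unt C) \<tau> g T \<psi>) k \<phi> = val (finsum (cr_space (unt C) \<tau>) ?f ?Q) k \<phi>" .
 qed
qed

text \<open>\<open>T\<close> itself is an arrow of the subcategory into the unit, so naturality moves it into the vector, and \<open>F(\<iota>)\<close> is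
 spanned by \<open>\<Omega>\<close>.\<close>

lemma gen_unt_unt:
 assumes ok: "gen_ok (unt C) (unt C) g T \<psi>"
 shows "gen (unt C) (unt C) g T \<psi> = cr_scale (ip (Sp (unt C)) \<Omega> (Fa T \<psi>)) (incl (idn C (unt C)))"
proof -
 note [simp] = gen_okD[OF ok]
 have Th: "T \<in> Hom C g (unt C)" by (simp add: in_Hom)
 have m: "Fa T \<psi> \<in> Vec (unt C)" by (rule F_mem[OF Th]) simp_all
 note u = incl_gen[OF idn_hom[OF unt_obj]]
 have "gen (unt C) (unt C) g T \<psi> = gen (unt C) (unt C) (unt C) (idn C (unt C)) (Fa T \<psi>)"
  using gen_natural[where \<rho> = "unt C" and \<sigma> = "unt C" and T = "idn C (unt C)" and \<psi> = \<psi>, OF _ _ Th] m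
  by (simp add: gen_ok_def)
 then show ?thesis unfolding u(2) gen_scale(2)[OF u(1)] using \<Omega>_span[OF m] by simp
qed

lemma scale_idn_zero:
 assumes z: "cr_scale c (incl (idn C (unt C))) = cr_zero (unt C) (unt C)"
 shows "c = 0"
proof -
 let ?k = "iso_class C (unt C)"
 have k[simp]: "?k \<in> Ghat" "\<Omega> \<in> Vec (\<gamma> ?k)" using unt_Ghat by (simp_all add: ch.rep_unt \<Omega>_mem)
 have "val (incl (idn C (unt C))) ?k \<Omega> = idn C (unt C)"
  unfolding incl_def elem_def using unt_Ghat by (simp add: H_Sp ch.rep_unt \<Omega>_mem \<Omega>_ip)
 then have "hscale C c (idn C (unt C)) = val (cr_scale c (incl (idn C (unt C)))) ?k \<Omega>"
  unfolding val_cr_scale[OF k] by simp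
 also have "\<dots> = hzero C (unt C) (unt C)" unfolding z val_cr_zero[OF k] by (simp add: ch.rep_unt)
 finally have "hscale C c (idn C (unt C)) = hzero C (unt C) (unt C)" .
 then show ?thesis using hscale_eq_0D[of c "idn C (unt C)"] irreducible_objD[OF irreducible_unt] by (auto simp: in_Hom)
qed

text \<open>For \<open>f = T \<otimes> \<psi>\<close> out of the unit, \<open>f\<^sup>* \<circ> f\<close> is the scalar \<open>\<langle>\<psi>, F(T\<^sup>*T)\<psi>\<rangle>\<close>, by the dual formula for the
 conjugate vector; it is the sum of the squared norms of the components of \<open>f\<close>.\<close>

lemma positive_from_unt:
 assumes "f \<in> Hom CR (unt C) \<tau>" and z: "cr_cmp (cr_star f) f = cr_zero (unt C) (unt C)"
 shows "f = cr_zero (unt C) \<tau>"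
proof -
 obtain g T \<psi> where ok: "gen_ok (unt C) \<tau> g T \<psi>" and f: "f = gen (unt C) \<tau> g T \<psi>" using CR_gen[OF assms(1)] by blast
 note [simp] = gen_okD[OF ok]
 have g: "g \<in> S" and p: "\<psi> \<in> Vec g" and TD: "Dom C T = g" by simp_all
 note [simp] = TD
 obtain gb r rb where s: "conjugate_solution C g gb r rb" using solution_exists[of g] by auto
 note [simp] = conjugateD(1-8)[OF s] gb[OF g s]
 note c = cvec(1)[OF g s p]
 obtain Q where Q: "decomposition C \<tau> Q" using decomposition_exists[of \<tau>] by auto
 let ?Q = "{u \<in> Q. Dom C u \<in> S}"
 note d = decompositionD[OF Q]
 have fin: "finite ?Q" using d(1) by simp
 interpret g: fd_hilbert "Sp g" by (rule hilb[OF g])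
 let ?\<phi> = "Fa (T\<dagger>\<cdot>T) \<psi>"
 have TT: "T\<dagger>\<cdot>T \<in> Hom C g g" by (simp add: in_Hom)
 have fm: "?\<phi> \<in> Vec g" by (rule F_mem[OF TT]) simp_all
 have "ip (Sp g) \<psi> ?\<phi> = 0"
 proof -
  let ?c = "cvec g gb rb \<psi>" let ?K = "(r\<dagger>\<cdot>(gb<|T\<dagger>))\<cdot>(gb<|T)"
  have h: "idn C gb \<in> Hom C gb gb" "r\<dagger> \<in> Hom C (gb\<boxdot>g) (unt C)" "gb<|(T\<dagger>\<cdot>T) \<in> Hom C (gb\<boxdot>g) (gb\<boxdot>g)"
   by (simp_all add: in_Hom)
  have tm: "tv gb g ?c \<psi> \<in> Vec (gb\<boxdot>g)" using c by (simp add: tv_mem)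
  have e: "(r\<dagger>|>(unt C))\<cdot>(gb<|T\<dagger>) = r\<dagger>\<cdot>(gb<|T\<dagger>)" by simp
  have ff: "cr_cmp (cr_star f) f = gen (unt C) (unt C) (gb\<boxdot>g) ?K (tv gb g ?c \<psi>)"
   unfolding f cr_star_gen[OF ok s] gstar_def cr_cmp_gen(1)[OF gstar_ok[OF ok s] ok] unfolding e ..
  have ok2: "gen_ok (unt C) (unt C) (gb\<boxdot>g) ?K (tv gb g ?c \<psi>)" using tm by (simp add: gen_ok_def)
  have "ip (Sp (unt C)) \<Omega> (Fa ?K (tv gb g ?c \<psi>)) = 0"
   by (rule scale_idn_zero) (simp only: gen_unt_unt[OF ok2, symmetric] ff[symmetric] z)
  moreover have "?K = r\<dagger>\<cdot>(gb<|(T\<dagger>\<cdot>T))" by (simp add: whisker_cmp)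
  moreover have "Fa (r\<dagger>\<cdot>(gb<|(T\<dagger>\<cdot>T))) (tv gb g ?c \<psi>) = Fa (r\<dagger>) (Fa (gb<|(T\<dagger>\<cdot>T)) (tv gb g ?c \<psi>))"
   by (rule F.Fa_cmp[OF _ _ _ h(2,3)]) (use tm in simp_all)
  moreover have "Fa (gb<|(T\<dagger>\<cdot>T)) (tv gb g ?c \<psi>) = tv gb g ?c ?\<phi>"
   using F_tv[OF h(1) TT, of ?c \<psi>] c by (simp add: F.Fa_idn)
  moreover have "ip (Sp (gb\<boxdot>g)) (Fa r \<Omega>) (tv gb g ?c ?\<phi>) = ip (Sp (unt C)) \<Omega> (Fa (r\<dagger>) (tv gb g ?c ?\<phi>))"
   by (rule F_adjoint[OF sol_hom(1)[OF g s]]) (use c fm in \<open>simp_all add: \<Omega>_mem tv_mem\<close>)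
  ultimately show ?thesis using cvec_dual[OF g s p fm] by simp
 qed
 moreover have "ip (Sp g) \<psi> ?\<phi> = (\<Sum>u\<in>?Q. ip (Sp (Dom C u)) (Fa (u\<dagger>\<cdot>T) \<psi>) (Fa (u\<dagger>\<cdot>T) \<psi>))"
 proof -
  have Ph: "(%u. u\<cdot>(u\<dagger>\<cdot>T)) \<in> ?Q \<rightarrow> Hom C g \<tau>" by (intro Pi_I) (use d(4,5) in "simp add: in_Hom")
  have vh: "u\<dagger>\<cdot>T \<in> Hom C g (Dom C u)" "(u\<dagger>\<cdot>T)\<dagger> \<in> Hom C (Dom C u) g" if "u \<in> ?Q" for u
   using d(4,5)[of u] that by (simp_all add: in_Hom)
  have "T\<dagger>\<cdot>T = T\<dagger>\<cdot>hsum C g \<tau> (%u. u\<cdot>(u\<dagger>\<cdot>T)) ?Q" using arrow_through_S[OF ok Q] by simp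
  also have "\<dots> = hsum C g g (%u. T\<dagger>\<cdot>(u\<cdot>(u\<dagger>\<cdot>T))) ?Q" by (rule cmp_hsum[OF fin Ph]) (simp_all add: in_Hom)
  finally have TS: "T\<dagger>\<cdot>T = hsum C g g (%u. T\<dagger>\<cdot>(u\<cdot>(u\<dagger>\<cdot>T))) ?Q" .
  have hh: "T\<dagger>\<cdot>(u\<cdot>(u\<dagger>\<cdot>T)) \<in> Hom C g g" if "u \<in> ?Q" for u using d(4,5)[of u] that by (simp add: in_Hom)
  have "?\<phi> = finsum (Sp g) (%u. Fa (T\<dagger>\<cdot>(u\<cdot>(u\<dagger>\<cdot>T))) \<psi>) ?Q"
   unfolding TS by (rule F_hsum[OF g g fin _ p]) (use hh in blast)
  then have "ip (Sp g) \<psi> ?\<phi> = (\<Sum>u\<in>?Q. ip (Sp g) \<psi> (Fa (T\<dagger>\<cdot>(u\<cdot>(u\<dagger>\<cdot>T))) \<psi>))"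
   using g.ip_finsum[OF fin p, of "%u. Fa (T\<dagger>\<cdot>(u\<cdot>(u\<dagger>\<cdot>T))) \<psi>"] F_mem[OF hh g g p] by (simp add: Pi_iff)
  also have "\<dots> = (\<Sum>u\<in>?Q. ip (Sp (Dom C u)) (Fa (u\<dagger>\<cdot>T) \<psi>) (Fa (u\<dagger>\<cdot>T) \<psi>))"
  proof (rule sum.cong[OF refl])
   fix u assume u: "u \<in> ?Q"
   note [simp] = d(4,5)[of u]
   have uS: "Dom C u \<in> S" using u by simp
   have e: "T\<dagger>\<cdot>(u\<cdot>(u\<dagger>\<cdot>T)) = (u\<dagger>\<cdot>T)\<dagger>\<cdot>(u\<dagger>\<cdot>T)" using u by (simp add: star_star)
   have m: "Fa (u\<dagger>\<cdot>T) \<psi> \<in> Vec (Dom C u)" by (rule F_mem[OF vh(1)[OF u] g uS p])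
   show "ip (Sp g) \<psi> (Fa (T\<dagger>\<cdot>(u\<cdot>(u\<dagger>\<cdot>T))) \<psi>) = ip (Sp (Dom C u)) (Fa (u\<dagger>\<cdot>T) \<psi>) (Fa (u\<dagger>\<cdot>T) \<psi>)"
    unfolding e F_adjoint[OF vh(1)[OF u] g uS p m] F.Fa_cmp[OF g uS g vh(2)[OF u] vh(1)[OF u] p] ..
  qed
  finally show ?thesis .
 qed
 ultimately have sum0: "(\<Sum>u\<in>?Q. Re (ip (Sp (Dom C u)) (Fa (u\<dagger>\<cdot>T) \<psi>) (Fa (u\<dagger>\<cdot>T) \<psi>))) = 0"
  by (metis (no_types, lifting) Re_sum zero_complex.simps(1) sum.cong)
 have zero: "Fa (u\<dagger>\<cdot>T) \<psi> = \<zero>\<^bsub>Sp (Dom C u)\<^esub>" if u: "u \<in> ?Q" for u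
 proof -
  have nn: "Re (ip (Sp (Dom C v)) (Fa (v\<dagger>\<cdot>T) \<psi>) (Fa (v\<dagger>\<cdot>T) \<psi>)) \<ge> 0" if "v \<in> ?Q" for v
  proof -
   interpret v: fd_hilbert "Sp (Dom C v)" using that by (simp add: hilb)
   have m: "Fa (v\<dagger>\<cdot>T) \<psi> \<in> Vec (Dom C v)" using gen_unt_components(1)[OF ok Q, of v] that by blast
   show ?thesis using v.ip_pos[OF m] v.ip_0[OF m] by (cases "Fa (v\<dagger>\<cdot>T) \<psi> = \<zero>\<^bsub>Sp (Dom C v)\<^esub>") auto
  qed
  interpret u: fd_hilbert "Sp (Dom C u)" using u by (simp add: hilb)
  have "Re (ip (Sp (Dom C u)) (Fa (u\<dagger>\<cdot>T) \<psi>) (Fa (u\<dagger>\<cdot>T) \<psi>)) = 0"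
   using sum_nonneg_eq_0_iff[OF fin, of "%u. Re (ip (Sp (Dom C u)) (Fa (u\<dagger>\<cdot>T) \<psi>) (Fa (u\<dagger>\<cdot>T) \<psi>))"] nn sum0 u by blast
  then show ?thesis using u.ip_pos[of "Fa (u\<dagger>\<cdot>T) \<psi>"] gen_unt_components(1)[OF ok Q, of u] u by auto
 qed
 interpret cr: cvs "cr_space (unt C) \<tau>" by (simp add: cr_cvs)
 have "gen (unt C) \<tau> (Dom C u) u (Fa (u\<dagger>\<cdot>T) \<psi>) = cr_zero (unt C) \<tau>" if u: "u \<in> ?Q" for u
  unfolding zero[OF u]
 proof (rule gen_zero_vec)
  interpret u: fd_hilbert "Sp (Dom C u)" using u by (simp add: hilb)
  show "gen_ok (unt C) \<tau> (Dom C u) u \<zero>\<^bsub>Sp (Dom C u)\<^esub>" using u d(4,5)[of u] by (simp add: gen_ok_def)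
 qed
 then show ?thesis unfolding f gen_unt_expansion[OF ok Q] using cr.M.add.finprod_one_eqI[of ?Q] by simp
qed

theorem tensor_star_category_CR: "tensor_star_category CR"
 by (rule tensor_category_with_star.tensor_star_from_unit[OF tensor_category_with_star_CR])
  (use solution_exists incl_solution positive_from_unt in \<open>simp, blast\<close>, use positive_from_unt in simp)

text \<open>By Frobenius reciprocity only arrows out of the unit matter; by their expansion these are spanned by the
 tensors of finitely many components \<open>u\<close> with the vectors of a basis of \<open>F(Dom u)\<close>.\<close>

lemma finite_dimensional_CR:
 assumes o: "\<rho> \<in> Obj C" "\<sigma> \<in> Obj C"
 shows "finite_dimensional (hom_space CR \<rho> \<sigma>)"
proof -
 have fd: "finite_dimensional (hom_space CR (unt C) \<tau>)" if [simp]: "\<tau> \<in> Obj C" for \<tau>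
 proof -
  interpret CR: complex_tensor_category CR by (rule complex_tensor_category_CR)
  interpret h: cvs "hom_space CR (unt C) \<tau>" by (rule CR.hom_cvs) simp_all
  obtain Q where Q: "decomposition C \<tau> Q" using decomposition_exists[of \<tau>] by auto
  let ?Q = "{u \<in> Q. Dom C u \<in> S}"
  note d = decompositionD[OF Q]
  have "\<forall>u\<in>?Q. \<exists>B. spans (Sp (Dom C u)) B"
   using fd_hilbert.fin_dim[OF hilb] by (simp add: finite_dimensional_def)
  then obtain b where b: "!!u. u \<in> ?Q ==> spans (Sp (Dom C u)) (b u)" by (meson bchoice)
  let ?G = "%u. gen (unt C) \<tau> (Dom C u) u"
  have okG: "gen_ok (unt C) \<tau> (Dom C u) u \<xi>" if "u \<in> ?Q" "\<xi> \<in> Vec (Dom C u)" for u \<xi>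
   using that d(4,5)[of u] by (simp add: gen_ok_def)
  have "spans (hom_space CR (unt C) \<tau>) (\<Union>u\<in>?Q. ?G u ` b u)"
  proof (rule h.spansI)
   show "finite (\<Union>u\<in>?Q. ?G u ` b u)" using d(1) b by (intro finite_UN_I) (auto simp: spans_def)
   show "(\<Union>u\<in>?Q. ?G u ` b u) \<subseteq> carrier (hom_space CR (unt C) \<tau>)"
   proof
    fix y assume "y \<in> (\<Union>u\<in>?Q. ?G u ` b u)"
    then obtain u x where ux: "u \<in> ?Q" "x \<in> b u" "y = ?G u x" by blast
    then have "x \<in> Vec (Dom C u)" using b[OF ux(1)] by (auto simp: spans_def)
    then show "y \<in> carrier (hom_space CR (unt C) \<tau>)" using gen_CR[OF okG[OF ux(1)]] ux(3) by simp
   qed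
   fix x W assume x: "x \<in> carrier (hom_space CR (unt C) \<tau>)" and W: "\<zero>\<^bsub>hom_space CR (unt C) \<tau>\<^esub> \<in> W" "(\<Union>u\<in>?Q. ?G u ` b u) \<subseteq> W"
    "!!y z. [|y \<in> W; z \<in> W|] ==> y \<oplus>\<^bsub>hom_space CR (unt C) \<tau>\<^esub> z \<in> W" "!!c y. y \<in> W ==> c \<odot>\<^bsub>hom_space CR (unt C) \<tau>\<^esub> y \<in> W"
   have GW: "?G u \<xi> \<in> W" if u: "u \<in> ?Q" and \<xi>: "\<xi> \<in> Vec (Dom C u)" for u \<xi>
   proof -
    interpret u: fd_hilbert "Sp (Dom C u)" using u by (simp add: hilb)
    from b[OF u] \<xi> show ?thesis
    proof (induct rule: u.spans_induct)
     case zero show ?case using gen_zero_vec[OF okG[OF u u.M.zero_closed]] W(1) by simp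
    next
     case (base x) then show ?case using W(2) u by blast
    next
     case (add x y) then show ?case using gen_add_vec[OF okG[OF u add(1)] okG[OF u add(2)]] W(3)[of "?G u x" "?G u y"] by simp
    next
     case (smult c x) then show ?case using gen_scale(2)[OF okG[OF u smult(1)], of c] W(4)[of "?G u x" c] by simp
    qed
   qed
   obtain g T \<psi> where ok: "gen_ok (unt C) \<tau> g T \<psi>" and f: "x = gen (unt C) \<tau> g T \<psi>" using CR_gen x by fastforce
   interpret cr: cvs "cr_space (unt C) \<tau>" by (simp add: cr_cvs)
   let ?t = "%u. ?G u (Fa (u\<dagger>\<cdot>T) \<psi>)"
   have t: "?t u \<in> W" "?t u \<in> cr_hom (unt C) \<tau>" if u: "u \<in> ?Q" for u
   proof -
    have m: "Fa (u\<dagger>\<cdot>T) \<psi> \<in> Vec (Dom C u)" using gen_unt_components(1)[OF ok Q, of u] u by blast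
    show "?t u \<in> W" "?t u \<in> cr_hom (unt C) \<tau>" by (rule GW[OF u m], rule gen_hom[OF okG[OF u m]])
   qed
   have "finsum (cr_space (unt C) \<tau>) ?t A \<in> W" if "finite A" "A \<subseteq> ?Q" for A
    using that
   proof (induct rule: finite_induct)
    case empty then show ?case using W(1) by simp
   next
    case (insert u A)
    then have u: "u \<in> ?Q" and A: "?t \<in> A \<rightarrow> carrier (cr_space (unt C) \<tau>)" using t(2) by auto
    have "finsum (cr_space (unt C) \<tau>) ?t (insert u A) = cr_add (?t u) (finsum (cr_space (unt C) \<tau>) ?t A)"
     using cr.M.finsum_insert[OF insert(1,2) A] t(2)[OF u] by simp
    then show ?case using W(3)[OF t(1)[OF u], of "finsum (cr_space (unt C) \<tau>) ?t A"] insert(3,4) by simp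
   qed
   from this[of ?Q] d(1) show "x \<in> W" unfolding f gen_unt_expansion[OF ok Q] by simp
  qed
  then show ?thesis by (auto simp: finite_dimensional_def)
 qed
 obtain \<rho>b r rb where s: "conjugate_solution C \<rho> \<rho>b r rb" using solution_exists[OF o(1)] by blast
 from tensor_category_with_star.finite_dimensional_from_unit[OF tensor_category_with_star_CR incl_solution[OF s]] fd o conjugateD(2)[OF s]
 show ?thesis by simp
qed

lemma irreducible_unt_CR: "irreducible_obj CR (unt CR)"
proof -
 have "incl (idn C (unt C)) ~= cr_zero (unt C) (unt C)"
 proof
  assume z: "incl (idn C (unt C)) = cr_zero (unt C) (unt C)"
  have "cr_scale 1 (incl (idn C (unt C))) = incl (idn C (unt C))"
   using gen_scale(1)[OF incl_gen(1)[OF idn_hom[OF unt_obj]], of 1] incl_gen(2)[OF idn_hom[OF unt_obj]] by simp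
  then show False using scale_idn_zero[of 1] z by simp
 qed
 moreover have "f \<in> range (%c. cr_scale c (incl (idn C (unt C))))" if f: "f \<in> Hom CR (unt C) (unt C)" for f
  using CR_gen[OF f] gen_unt_unt by blast
 moreover have "cr_scale c (incl (idn C (unt C))) \<in> Hom CR (unt C) (unt C)" for c
  using cr_scale_hom[of "unt C" "unt C" "incl (idn C (unt C))" c] incl_hom[OF idn_hom[OF unt_obj]] by (simp add: Hom_CR)
 ultimately show ?thesis unfolding irreducible_obj_def by auto
qed

lemma incl_add:
 assumes "a \<in> Hom C \<rho> \<sigma>" "b \<in> Hom C \<rho> \<sigma>"
 shows "cr_add (incl a) (incl b) = incl (hadd C a b)"
proof -
 note [simp] = HomD[OF assms(1)] HomD[OF assms(2)]
 have "hadd C a b \<in> Hom C \<rho> \<sigma>" by (simp add: in_Hom)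
 then show ?thesis unfolding incl_gen(2)[OF assms(1)] incl_gen(2)[OF assms(2)]
  by (simp add: incl_gen(2) gen_add_arrow[OF incl_gen(1)[OF assms(1)] incl_gen(1)[OF assms(2)]])
qed

lemma has_direct_sums_CR: "has_direct_sums CR"
 unfolding has_direct_sums_def
proof (intro ballI)
 fix \<rho> \<sigma> assume o: "\<rho> \<in> Obj CR" "\<sigma> \<in> Obj CR"
 then obtain \<tau> V W where \<tau>: "\<tau> \<in> Obj C" and V: "isometry C \<rho> \<tau> V" and W: "isometry C \<sigma> \<tau> W"
  and e: "hadd C (V\<cdot>V\<dagger>) (W\<cdot>W\<dagger>) = idn C \<tau>"
  using direct_sums unfolding has_direct_sums_def direct_sum_def by (simp, metis)
 note [simp] = isometryD(1-6)[OF V] isometryD(1-6)[OF W]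
 have h: "V \<in> Hom C \<rho> \<tau>" "W \<in> Hom C \<sigma> \<tau>" "V\<dagger> \<in> Hom C \<tau> \<rho>" "W\<dagger> \<in> Hom C \<tau> \<sigma>" "V\<cdot>V\<dagger> \<in> Hom C \<tau> \<tau>" "W\<cdot>W\<dagger> \<in> Hom C \<tau> \<tau>"
  by (simp_all add: in_Hom)
 have "direct_sum CR \<rho> \<sigma> \<tau>"
  unfolding direct_sum_def isometry_def
  by (intro exI[of _ "incl V"] exI[of _ "incl W"])
   (simp add: incl_hom[OF h(1)] incl_hom[OF h(2)] incl_star[OF h(1)] incl_star[OF h(2)] incl_cmp[OF h(3,1)] incl_cmp[OF h(1,3)]
    incl_cmp[OF h(4,2)] incl_cmp[OF h(2,4)] incl_add[OF h(5,6)] e)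
 then show "\<exists>\<tau>\<in>Obj CR. direct_sum CR \<rho> \<sigma> \<tau>" using \<tau> by auto
qed

text \<open>Naturality of the braiding is where degeneracy enters: interchanging the tensor factors of
 \<open>(T \<otimes> \<psi>) \<times> (T' \<otimes> \<psi>')\<close> produces a monodromy of the source of \<open>T\<close> with an object of the subcategory.\<close>

lemma unitary_braiding_CR:
 assumes deg: "S \<subseteq> degenerate_objects C"
 shows "unitary_braiding CR"
proof
 fix \<rho> \<sigma> assume "\<rho> \<in> Obj CR" "\<sigma> \<in> Obj CR"
 then have o[simp]: "\<rho> \<in> Obj C" "\<sigma> \<in> Obj C" by simp_all
 have h: "braid C \<rho> \<sigma> \<in> Hom C (\<rho>\<boxdot>\<sigma>) (\<sigma>\<boxdot>\<rho>)" "(braid C \<rho> \<sigma>)\<dagger> \<in> Hom C (\<sigma>\<boxdot>\<rho>) (\<rho>\<boxdot>\<sigma>)" by (simp_all add: in_Hom)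
 show "braid CR \<rho> \<sigma> \<in> Hom CR (\<rho> \<boxdot>\<^bsub>CR\<^esub> \<sigma>) (\<sigma> \<boxdot>\<^bsub>CR\<^esub> \<rho>)" using incl_hom[OF h(1)] by simp
 show "(braid CR \<rho> \<sigma>)\<dagger>\<^bsub>CR\<^esub> \<cdot>\<^bsub>CR\<^esub> braid CR \<rho> \<sigma> = idn CR (\<rho> \<boxdot>\<^bsub>CR\<^esub> \<sigma>) \<and>
   braid CR \<rho> \<sigma> \<cdot>\<^bsub>CR\<^esub> (braid CR \<rho> \<sigma>)\<dagger>\<^bsub>CR\<^esub> = idn CR (\<sigma> \<boxdot>\<^bsub>CR\<^esub> \<rho>)"
  using braid_unitary[of \<rho> \<sigma>] by (simp add: incl_star[OF h(1)] incl_cmp[OF h] incl_cmp[OF h(2,1)])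
 fix \<tau> assume "\<tau> \<in> Obj CR"
 then have [simp]: "\<tau> \<in> Obj C" by simp
 have i: "idn C \<upsilon> \<in> Hom C \<upsilon> \<upsilon>" "braid C \<upsilon> \<upsilon>' \<in> Hom C (\<upsilon>\<boxdot>\<upsilon>') (\<upsilon>'\<boxdot>\<upsilon>)" if "\<upsilon> \<in> Obj C" "\<upsilon>' \<in> Obj C" for \<upsilon> \<upsilon>'
  using that by (simp_all add: in_Hom)
 have w: "\<sigma><|braid C \<rho> \<tau> \<in> Hom C (\<sigma>\<boxdot>(\<rho>\<boxdot>\<tau>)) (\<sigma>\<boxdot>(\<tau>\<boxdot>\<rho>))" "braid C \<rho> \<sigma>|>\<tau> \<in> Hom C (\<rho>\<boxdot>(\<sigma>\<boxdot>\<tau>)) (\<sigma>\<boxdot>(\<rho>\<boxdot>\<tau>))"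
  "braid C \<rho> \<tau>|>\<sigma> \<in> Hom C (\<rho>\<boxdot>(\<tau>\<boxdot>\<sigma>)) (\<tau>\<boxdot>(\<rho>\<boxdot>\<sigma>))" "\<rho><|braid C \<sigma> \<tau> \<in> Hom C (\<rho>\<boxdot>(\<sigma>\<boxdot>\<tau>)) (\<rho>\<boxdot>(\<tau>\<boxdot>\<sigma>))"
  by (simp_all add: in_Hom)
 show "braid CR \<rho> (\<sigma> \<boxdot>\<^bsub>CR\<^esub> \<tau>) = (idn CR \<sigma> \<boxtimes>\<^bsub>CR\<^esub> braid CR \<rho> \<tau>) \<cdot>\<^bsub>CR\<^esub> (braid CR \<rho> \<sigma> \<boxtimes>\<^bsub>CR\<^esub> idn CR \<tau>)"
  using incl_tar[OF i(1)[of \<sigma> \<sigma>] i(2)[of \<rho> \<tau>]] incl_tar[OF i(2)[of \<rho> \<sigma>] i(1)[of \<tau> \<tau>]] incl_cmp[OF w(1,2)] braid_tob_right[of \<rho> \<sigma> \<tau>] by simp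
 show "braid CR (\<rho> \<boxdot>\<^bsub>CR\<^esub> \<sigma>) \<tau> = (braid CR \<rho> \<tau> \<boxtimes>\<^bsub>CR\<^esub> idn CR \<sigma>) \<cdot>\<^bsub>CR\<^esub> (idn CR \<rho> \<boxtimes>\<^bsub>CR\<^esub> braid CR \<sigma> \<tau>)"
  using incl_tar[OF i(2)[of \<rho> \<tau>] i(1)[of \<sigma> \<sigma>]] incl_tar[OF i(1)[of \<rho> \<rho>] i(2)[of \<sigma> \<tau>]] incl_cmp[OF w(3,4)] braid_tob_left[of \<rho> \<sigma> \<tau>] by simp
next
 fix f g \<rho> \<rho>' \<sigma> \<sigma>' assume fg: "f \<in> Hom CR \<rho> \<rho>'" "g \<in> Hom CR \<sigma> \<sigma>'"
 obtain k T \<psi> where f: "gen_ok \<rho> \<rho>' k T \<psi>" "f = gen \<rho> \<rho>' k T \<psi>" using CR_gen[OF fg(1)] by blast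
 obtain l T' \<psi>' where g: "gen_ok \<sigma> \<sigma>' l T' \<psi>'" "g = gen \<sigma> \<sigma>' l T' \<psi>'" using CR_gen[OF fg(2)] by blast
 note [simp] = gen_okD[OF f(1)] gen_okD[OF g(1)]
 have b: "braid C \<rho> \<sigma> \<in> Hom C (\<rho>\<boxdot>\<sigma>) (\<sigma>\<boxdot>\<rho>)" "braid C \<rho>' \<sigma>' \<in> Hom C (\<rho>'\<boxdot>\<sigma>') (\<sigma>'\<boxdot>\<rho>')" "braid C k l \<in> Hom C (k\<boxdot>l) (l\<boxdot>k)"
  by (simp_all add: in_Hom)
 let ?X = "((T' \<boxtimes> T)\<cdot>(l<|(braid C k \<sigma>|>\<rho>)))\<cdot>((l\<boxdot>k)<|braid C \<rho> \<sigma>)"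
 have Fb: "Fa (braid C k l) (tv k l \<psi> \<psi>') = tv l k \<psi>' \<psi>" by (rule F.Fa_braid) simp_all
 have "l \<in> degenerate_objects C" using deg g(1) by (auto simp: gen_ok_def)
 then have mono: "braid C \<rho> l\<cdot>braid C l \<rho> = idn C (l\<boxdot>\<rho>)" unfolding degenerate_objects_def using f(1) by (simp add: gen_ok_def)
 have e1: "braid C \<rho>' \<sigma>'\<cdot>(T \<boxtimes> T') = (T' \<boxtimes> T)\<cdot>braid C (k\<boxdot>\<rho>) (l\<boxdot>\<sigma>)" by (rule braid_nat) simp_all
 have "braid C \<rho> (l\<boxdot>\<sigma>)\<cdot>(braid C l \<rho>|>\<sigma>) = (l<|braid C \<rho> \<sigma>)\<cdot>((braid C \<rho> l\<cdot>braid C l \<rho>)|>\<sigma>)"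
  by (simp add: braid_tob_right whisker_cmp)
 then have e2: "braid C \<rho> (l\<boxdot>\<sigma>)\<cdot>(braid C l \<rho>|>\<sigma>) = l<|braid C \<rho> \<sigma>" unfolding mono by simp
 have "braid C (k\<boxdot>\<rho>) (l\<boxdot>\<sigma>)\<cdot>(k<|(braid C l \<rho>|>\<sigma>)) =
   (braid C k (l\<boxdot>\<sigma>)|>\<rho>)\<cdot>(k<|(braid C \<rho> (l\<boxdot>\<sigma>)\<cdot>(braid C l \<rho>|>\<sigma>)))"
  by (simp only: braid_tob_left[of k \<rho> "l\<boxdot>\<sigma>"] S_obj gen_okD[OF f(1)] gen_okD[OF g(1)] tob_obj) (simp add: whisker_cmp)
 also have "\<dots> = (l<|(braid C k \<sigma>|>\<rho>))\<cdot>((braid C k l|>(\<sigma>\<boxdot>\<rho>))\<cdot>((k\<boxdot>l)<|braid C \<rho> \<sigma>))"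
  unfolding e2 by (simp add: braid_tob_right whisker_cmp)
 also have "(braid C k l|>(\<sigma>\<boxdot>\<rho>))\<cdot>((k\<boxdot>l)<|braid C \<rho> \<sigma>) = ((l\<boxdot>k)<|braid C \<rho> \<sigma>)\<cdot>(braid C k l|>(\<rho>\<boxdot>\<sigma>))"
  by (rule slide) simp_all
 finally have e3: "braid C (k\<boxdot>\<rho>) (l\<boxdot>\<sigma>)\<cdot>(k<|(braid C l \<rho>|>\<sigma>)) =
  (l<|(braid C k \<sigma>|>\<rho>))\<cdot>(((l\<boxdot>k)<|braid C \<rho> \<sigma>)\<cdot>(braid C k l|>(\<rho>\<boxdot>\<sigma>)))" .
 have "braid C \<rho>' \<sigma>'\<cdot>((T \<boxtimes> T')\<cdot>(k<|(braid C l \<rho>|>\<sigma>))) =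
   (T' \<boxtimes> T)\<cdot>(braid C (k\<boxdot>\<rho>) (l\<boxdot>\<sigma>)\<cdot>(k<|(braid C l \<rho>|>\<sigma>)))"
  using cmp_eq_cmp[OF e1, of "k<|(braid C l \<rho>|>\<sigma>)"] by simp
 then have a: "braid C \<rho>' \<sigma>'\<cdot>((T \<boxtimes> T')\<cdot>(k<|(braid C l \<rho>|>\<sigma>))) = ?X\<cdot>(braid C k l|>(\<rho>\<boxdot>\<sigma>))"
  unfolding e3 by simp
 note okX = cr_tar_gen(2)[OF g(1) f(1)]
 have okX': "gen_ok (\<rho>\<boxdot>\<sigma>) (\<sigma>'\<boxdot>\<rho>') (l\<boxdot>k) ?X (tv l k \<psi>' \<psi>)" by (simp add: gen_ok_def tv_mem)
 have "cr_cmp (cr_tar g f) (incl (braid C \<rho> \<sigma>)) = gen (\<rho>\<boxdot>\<sigma>) (\<sigma>'\<boxdot>\<rho>') (l\<boxdot>k) ?X (Fa (braid C k l) (tv k l \<psi> \<psi>'))"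
  unfolding f(2) g(2) cr_tar_gen(1)[OF g(1) f(1)] gen_cmp_incl[OF okX b(1)] Fb ..
 also have "\<dots> = gen (\<rho>\<boxdot>\<sigma>) (\<sigma>'\<boxdot>\<rho>') (k\<boxdot>l) (?X\<cdot>(braid C k l|>(\<rho>\<boxdot>\<sigma>))) (tv k l \<psi> \<psi>')"
  by (rule gen_natural[symmetric, OF okX' _ b(3)]) (simp_all add: tv_mem)
 also have "\<dots> = cr_cmp (incl (braid C \<rho>' \<sigma>')) (cr_tar f g)"
  unfolding a[symmetric] f(2) g(2) cr_tar_gen(1)[OF f(1) g(1)] incl_cmp_gen[OF cr_tar_gen(2)[OF f(1) g(1)] b(2)] ..
 finally show "braid CR \<rho>' \<sigma>' \<cdot>\<^bsub>CR\<^esub> (f \<boxtimes>\<^bsub>CR\<^esub> g) = (g \<boxtimes>\<^bsub>CR\<^esub> f) \<cdot>\<^bsub>CR\<^esub> braid CR \<rho> \<sigma>" by simp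
qed

end

section \<open>The crossed product\<close>

text \<open>\<open>(\<rho>, E)\<close> is a subobject of \<open>(\<rho>, id)\<close>, to which a solution for \<open>\<rho>\<close> carries over.\<close>

lemma (in closure_category) embedding_conjugate:
 assumes X: "X \<in> Obj B" and s: "conjugate_solution A (fst X) \<rho>b R Rb"
 shows "\<exists>Y w Yb R Rb. isometry B X Y w \<and> conjugate_solution B Y Yb R Rb"
proof -
 note [simp] = X[unfolded Obj_B] conjugateD(1-8)[OF s]
 have "isometry B X (fst X, idn A (fst X)) (Arrow X (fst X, idn A (fst X)) (snd X))"
  using X by (simp add: isometry_def Hom_B Obj_B arrow_eq_iff)
 moreover have "conjugate_solution B (fst X, idn A (fst X)) (\<rho>b, idn A \<rho>b) (J R) (J Rb)"
  using conjugateD(9,10)[OF s] J_hom[of R] J_hom[of Rb]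
  by (simp add: conjugate_solution_def Hom_B Obj_B J_def)
 ultimately show ?thesis by blast
qed

context crossed_product_setting
begin

lemma closure_category_CR: "closure_category CR"
 by (intro closure_category.intro tensor_star_category_CR)

lemma semisimple_CS: "semisimple_tensor_category (subobject_closure CR)"
 by (rule closure_category.semisimple_tensor_category_B[OF closure_category_CR has_direct_sums_CR irreducible_unt_CR])
  (simp add: finite_dimensional_CR)

lemma val_incl_cmp:
 assumes x: "x \<in> Hom CR \<rho> \<sigma>" and a: "a \<in> Hom C \<sigma> \<tau>" and k: "k \<in> Ghat" "\<phi> \<in> Vec (\<gamma> k)"
 shows "val (cr_cmp (incl a) x) k \<phi> = a\<cdot>val x k \<phi>"
proof -
 obtain g T \<psi> where ok: "gen_ok \<rho> \<sigma> g T \<psi>" and x: "x = gen \<rho> \<sigma> g T \<psi>" using CR_gen[OF x] by blast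
 note [simp] = gen_okD[OF ok] HomD[OF a]
 have "dyad k g \<phi> \<psi> \<in> Hom C (\<gamma> k) g" by (rule dyad_hom) (use k in simp_all)
 note [simp] = HomD[OF this]
 show ?thesis unfolding x incl_cmp_gen[OF ok a] using k by simp
qed

text \<open>An irreducible object \<open>(\<rho>, E)\<close> of the closure receives a nonzero arrow from \<open>E\<close> composed with some
 irreducible component of \<open>\<rho>\<close> in the original category, so it is isomorphic to one of the finitely many
 components of that component in the closure.\<close>

theorem rational_CS:
 assumes rat: "rational C"
 shows "rational (subobject_closure CR)"
proof -
 let ?B = "subobject_closure CR" and ?cl = "irr_classes C (Obj C)"
 interpret CR: tensor_star_category CR by (rule tensor_star_category_CR)
 interpret K: closure_category CR by (rule closure_category_CR)
 interpret B: semisimple_tensor_category ?B by (rule semisimple_CS)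
 have "\<forall>c\<in>?cl. \<exists>r. irreducible_obj C r \<and> iso_class C r = c" by (auto simp: irr_classes_def)
 then obtain r where r: "!!c. c \<in> ?cl ==> irreducible_obj C (r c) \<and> iso_class C (r c) = c" by (meson bchoice)
 have rO: "r c \<in> Obj C" if "c \<in> ?cl" for c using irreducible_objD r[OF that] by blast
 have "\<forall>c\<in>?cl. \<exists>Q. decomposition ?B (r c, idn CR (r c)) Q"
 proof
  fix c assume "c \<in> ?cl"
  then have "(r c, idn CR (r c)) \<in> Obj ?B" using K.Obj_J[of "r c"] rO by simp
  then show "\<exists>Q. decomposition ?B (r c, idn CR (r c)) Q" by (rule B.decomposition_exists)
 qed
 then obtain D where D: "!!c. c \<in> ?cl ==> decomposition ?B (r c, idn CR (r c)) (D c)" by (meson bchoice)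
 have "irr_classes ?B (Obj ?B) \<subseteq> (\<Union>c\<in>?cl. (%v. iso_class ?B (Dom ?B v)) ` D c)"
 proof
  fix y assume "y \<in> irr_classes ?B (Obj ?B)"
  then obtain X where X: "X \<in> Obj ?B" "irreducible_obj ?B X" and y: "y = iso_class ?B X" unfolding irr_classes_def by blast
  obtain \<rho> E where XE: "X = (\<rho>, E)" by (cases X)
  have \<rho>: "\<rho> \<in> Obj C" and E: "E \<in> Hom CR \<rho> \<rho>" and EE: "cr_cmp E E = E"
   using X(1) unfolding K.Obj_B XE in_Hom by simp_all
  have E0: "E ~= cr_zero \<rho> \<rho>" using B.irreducible_objD[OF X(2)] XE by auto
  obtain Q where Q: "decomposition C \<rho> Q" using decomposition_exists[OF \<rho>] by blast
  note d = decompositionD[OF Q]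
  have wd: "w\<dagger> \<in> Hom C \<rho> (Dom C w)" if "w \<in> Q" for w using d(4,5)[OF that] by (simp add: in_Hom)
  have "\<exists>w\<in>Q. cr_cmp (incl (w\<dagger>)) E ~= cr_zero \<rho> (Dom C w)"
  proof (rule ccontr)
   assume "\<not> ?thesis"
   then have n: "cr_cmp (incl (w\<dagger>)) E = cr_zero \<rho> (Dom C w)" if "w \<in> Q" for w using that by blast
   have Eh: "E \<in> cr_hom \<rho> \<rho>" using E by (simp add: Hom_CR)
   have "E = cr_zero \<rho> \<rho>"
   proof (rule cr_hom_eqI[OF Eh cr_zero_hom[OF \<rho> \<rho>]])
    fix k \<phi> assume k: "k \<in> Ghat" "\<phi> \<in> Vec (\<gamma> k)"
    note v = HomD[OF cr_homD(4)[OF Eh k]]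
    have "val E k \<phi> = hzero C (\<gamma> k\<boxdot>\<rho>) \<rho>"
    proof (rule zero_if_components_cod[OF Q v(1,3,2)])
     fix w assume w: "w \<in> Q"
     show "w\<dagger>\<cdot>val E k \<phi> = hzero C (\<gamma> k\<boxdot>\<rho>) (Dom C w)"
      unfolding val_incl_cmp[OF E wd[OF w] k, symmetric] n[OF w] val_cr_zero[OF k] ..
    qed
    then show "val E k \<phi> = val (cr_zero \<rho> \<rho>) k \<phi>" unfolding val_cr_zero[OF k] .
   qed
   then show False using E0 by simp
  qed
  then obtain w where w: "w \<in> Q" and w0: "cr_cmp (incl (w\<dagger>)) E ~= cr_zero \<rho> (Dom C w)" by blast
  note [simp] = d(4,5)[OF w]
  define c where "c = iso_class C (Dom C w)"
  have c: "c \<in> ?cl" unfolding c_def irr_classes_def using d(2)[OF w] by simp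
  let ?Y = "(r c, idn CR (r c))"
  have "isomorphic C (Dom C w) (r c)" using iso_class_eq_iff[of "Dom C w" "r c"] r[OF c] rO[OF c] by (simp add: c_def)
  then obtain f f' where f: "f \<in> Hom C (Dom C w) (r c)" and f': "f' \<in> Hom C (r c) (Dom C w)" and ff: "f'\<cdot>f = idn C (Dom C w)"
   unfolding isomorphic_def by blast
  note [simp] = HomD[OF f] HomD[OF f']
  have a: "f\<cdot>w\<dagger> \<in> Hom C \<rho> (r c)" by (simp add: in_Hom)
  have fa: "f'\<cdot>(f\<cdot>w\<dagger>) = w\<dagger>" using cmp_eq_cmp[OF ff, of "w\<dagger>"] by simp
  \<comment> \<open>the component of \<open>E\<close> found above, moved to the chosen representative\<close>
  define x where "x = cr_cmp (incl (f\<cdot>w\<dagger>)) E"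
  have x: "x \<in> Hom CR \<rho> (r c)" using CR.cmp_hom[OF incl_hom[OF a] E] by (simp add: x_def)
  have "cr_cmp (incl f') x = cr_cmp (incl (w\<dagger>)) E"
   using CR.cmp_assoc[OF incl_hom[OF f'] incl_hom[OF a] E] incl_cmp[OF f' a] by (simp add: x_def fa)
  then have x0: "x ~= cr_zero \<rho> (r c)"
   using w0 CR.cmp_hzero(1)[of \<rho> "incl f'" "r c"] HomD[OF incl_hom[OF f']] \<rho> by auto
  define h where "h = Arrow X ?Y x"
  have h: "h \<in> Hom ?B X ?Y"
  proof -
   have "cr_cmp x E = x" using CR.cmp_assoc[OF incl_hom[OF a] E E] EE by (simp add: x_def)
   moreover have "cr_cmp (incl (idn C (r c))) x = x" using CR.cmp_idn[OF x] by simp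
   moreover have "?Y \<in> Obj ?B" using K.Obj_J[of "r c"] rO[OF c] by simp
   ultimately show ?thesis using X(1) HomD[OF x] unfolding K.Hom_B by (simp add: h_def XE)
  qed
  note e = B.decompositionD[OF D[OF c]]
  have "\<exists>v\<in>D c. star ?B v \<cdot>\<^bsub>?B\<^esub> h ~= hzero ?B X (Dom ?B v)"
  proof (rule ccontr)
   assume "\<not> ?thesis"
   then have "h = hzero ?B X ?Y" by (intro B.zero_if_components_cod[OF D[OF c] HomD(1,3,2)[OF h]]) blast
   then show False using x0 by (simp add: h_def XE)
  qed
  then obtain v where v: "v \<in> D c" and v0: "star ?B v \<cdot>\<^bsub>?B\<^esub> h ~= hzero ?B X (Dom ?B v)" by blast
  have "v \<in> Hom ?B (Dom ?B v) ?Y" using e(4,5)[OF v] unfolding in_Hom by blast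
  from B.cmp_hom[OF B.star_hom[OF this] h] have "isomorphic ?B X (Dom ?B v)"
   by (rule B.irr_hom_isomorphic[OF X(2) e(2)[OF v] _ v0])
  then have "y = iso_class ?B (Dom ?B v)"
   unfolding y using B.iso_class_eq_iff[of X "Dom ?B v"] X(1) B.irreducible_objD e(2)[OF v] by blast
  then show "y \<in> (\<Union>c\<in>?cl. (%v. iso_class ?B (Dom ?B v)) ` D c)" using c v by blast
 qed
 moreover have "finite (\<Union>c\<in>?cl. (%v. iso_class ?B (Dom ?B v)) ` D c)"
  using rat B.decompositionD(1)[OF D] unfolding rational_def by blast
 ultimately show ?thesis unfolding rational_def by (rule finite_subset)
qed

end

theorem theorem3p13:
 fixes C :: "('o, 'm) braided_cat" and S :: "'o set"
  and G :: "'g top_group" and U :: "('u, 'g, 'v) rep_cat"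
  and Fo :: "'o \<Rightarrow> 'u" and Fa :: "'m \<Rightarrow> 'v \<Rightarrow> 'v"
  and \<gamma> :: "'o set \<Rightarrow> 'o" and V :: "'o set \<Rightarrow> 'o set \<Rightarrow> 'o set \<Rightarrow> 'm set"
  and R Rb :: "'o set \<Rightarrow> 'm"
 assumes "BTC_star C"
  and "even_symmetric_subcategory C S"
  and "compact_group G"
  and "rep_category G U"
  and "symmetric_tensor_isomorphism C S G U Fo Fa"
  and "crossed_product_choices C S \<gamma> V R Rb"
 shows "let CS = crossed_product_data.crossed_product C S U Fo Fa \<gamma> V R Rb in
   (\<exists>nrm. Cstar_tensor_category CS nrm) \<and>
   has_conjugates CS \<and> has_direct_sums CS \<and> has_subobjects CS \<and>
   (S \<subseteq> degenerate_objects C \<longrightarrow> unitary_braiding CS) \<and>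
   (rational C \<longrightarrow> rational CS)"
proof -
 interpret crossed_product_setting C S G U Fo Fa \<gamma> V R Rb
  by (intro crossed_product_setting.intro assms)
 interpret K: closure_category CR by (rule closure_category_CR)
 interpret B: semisimple_tensor_category "subobject_closure CR" by (rule semisimple_CS)
 have "has_conjugates (subobject_closure CR)"
 proof (rule B.conjugates_of_subobjects)
  fix X assume X: "X \<in> Obj (subobject_closure CR)"
  then have "fst X \<in> Obj C" by (simp add: K.Obj_B)
  from solution_exists[OF this] obtain \<rho>b r rb where "conjugate_solution C (fst X) \<rho>b r rb" by blast
  from K.embedding_conjugate[OF X incl_solution[OF this]]
  show "\<exists>\<rho> w \<rho>b R Rb. isometry (subobject_closure CR) X \<rho> w \<and> conjugate_solution (subobject_closure CR) \<rho> \<rho>b R Rb"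
   by blast
 qed
 then show ?thesis
  unfolding crossed_product_def Let_def
  using B.Cstar_norm K.has_direct_sums_B[OF has_direct_sums_CR] K.has_subobjects_B
   K.unitary_braiding_B[OF unitary_braiding_CR] rational_CS by blast
qed

end
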